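(* Let $\eta_-=\infty$, $\eta_+=n_1$, $s_-=0$, $s_+>0$, $$\kappa_0=-\frac{\mathrm i}{2s_+n_2}\ln\frac{n_2+n_1}{n_2-n_1}+\frac{\pi}{2s_+n_2},\qquad\gamma_0=\operatorname{Arg}_0\kappa_0,\qquad\alpha_0=\frac{\pi}{2s_+n_2},$$ $\rho_0=\rho_{\min}(\gamma_0)$, and $\rho_1:=\inf_{\gamma\in(\gamma_0,0)}\frac{\rho_{\min}(\gamma)\cos\gamma}{\cos\gamma_0}$. Then $$\lim_{\gamma\to\gamma_0-0}\rho_{\min}(\gamma)=\rho_0=|\kappa_0|<\rho_1,\qquad\rho_0<\lim_{\gamma\to\gamma_0+0}\rho_{\min}(\gamma),$$ and the following statements hold: (i) The number $\kappa_0$ is simultaneously the $(\eta_-,\eta_+)$-eigenvalue of minimal decay for the frequency $\alpha_0$ and the $(\eta_-,\eta_+)$-eigenvalue of minimal modulus for the complex argument $\gamma_0$. Moreover, the constant function $\varepsilon^{\min}_{\gamma_0}(s)=n_2^2$, $s\in(0,s_+)$, is the unique function in $\mathbb F_{0,s_+}$ that generates an $(\eta_-,\eta_+)$-eigenvalue at $\kappa_0$. (ii) Each of the numbers $\kappa=\rho e^{\mathrm i\gamma_0}$ with $\rho\in[\rho_0,\rho_1)$ is the $(\eta_-,\eta_+)$-eigenvalue of minimal decay for the frequency $\rho\cos\gamma_0$. One of the associated resonators of minimal decay $\tilde\varepsilon\in\mathbb F_{0,s_+}$ can be constructed by the rule $\tilde\varepsilon(s)=\varepsilon^{\min}(s)$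 for $s\in[0,T^{\min}_\kappa(\infty,n_1))$ and $\tilde\varepsilon(s)=n_1^2$ for $s\in(T^{\min}_\kappa(\infty,n_1),s_+]$, where $\varepsilon^{\min}$ is a minimum-time control (for spectral parameter $\kappa$) steering $x(0)=\infty$ to $x(T^{\min}_\kappa(\infty,n_1))=n_1$.
   Context: Fix constants $0<n_1<n_2$. $\hat{\mathbb C}=\mathbb C\cup\{\infty\}$; $\operatorname{Arg}_0$ is the principal argument in $(-\pi,\pi]$; $\inf\varnothing=+\infty$. $\mathbb F_{0,s_+}=\{\varepsilon\in L^\infty((0,s_+);\mathbb R):n_1^2\le\varepsilon\le n_2^2\text{ a.e.}\}$. For $\varepsilon\in\mathbb F_{0,s_+}$, the $(\infty,n_1)$-eigenvalues of $\varepsilon$ are the $k\in\mathbb C\setminus\{0\}$ such that $y''=-k^2\varepsilon y$ on $(0,s_+)$ has a nontrivial solution with $y(0)=0$ and $\frac{y'(s_+)}{\mathrm i k\,y(s_+)}=n_1$; then $\varepsilon$ is said to generate the eigenvalue $k$. Let $\Sigma[\mathbb F]$ be the set of all $(\infty,n_1)$-eigenvalues of all $\varepsilon\in\mathbb F_{0,s_+}$. $\rho_{\min}(\gamma)=\inf\{|k|:k\in\Sigma[\mathbb F],\ \operatorname{Arg}_0k=\gamma\}$; the number $e^{\mathrm i\gamma}\rho_{\min}(\gamma)$, if it belongs to $\Sigma[\mathbb F]$, is the $(\eta_-,\eta_+)$-eigenvalue of minimal modulus for $\gamma$. $\beta_{\min}(\alpha)=\inf\{\beta\in\mathbb R:\alpha-\mathrm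 i\beta\in\Sigma[\mathbb F]\}$; if $\beta_{\min}(\alpha)<+\infty$, then $\alpha-\mathrm i\beta_{\min}(\alpha)$ is the $(\eta_-,\eta_+)$-eigenvalue of minimal decay for the frequency $\alpha$, and any $\varepsilon\in\mathbb F_{0,s_+}$ generating it is a resonator of minimal decay for $\alpha$. Control system with spectral parameter $\kappa$: feasible controls are $\varepsilon\in L^\infty((0,\infty);\mathbb R)$ with $n_1^2\le\varepsilon\le n_2^2$ a.e.; the state $x(s)\in\hat{\mathbb C}$ evolves by $x'=\mathrm i\kappa(-x^2+\varepsilon)$ in the chart $\mathbb C$ and, near $\infty$, by $\tilde x'=\mathrm i\kappa(-1+\varepsilon\tilde x^2)$ for $\tilde x=-1/x$. $T^{\min}_\kappa(\eta_-,\eta_+)$ is the infimum of $t\ge0$ such that some feasible control steers $x(0)=\eta_-$ to $x(t)=\eta_+$; a control doing this in time $T^{\min}_\kappa(\eta_-,\eta_+)<\infty$ is a minimum-time control. *)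

theory Defs
  imports "HOL-Analysis.Analysis"
begin

(* On an interval I: f is locally absolutely continuous and f' = g almost everywhere,
   expressed as "f is an indefinite Lebesgue integral of g".  Differential equations with
   L^infinity coefficients are understood in this (Caratheodory) sense. *)
definition ac_deriv_on :: "(real \<Rightarrow> complex) \<Rightarrow> (real \<Rightarrow> complex) \<Rightarrow> real set \<Rightarrow> bool" where
  "ac_deriv_on f g I \<longleftrightarrow>
     (\<forall>a\<in>I. \<forall>b\<in>I. a \<le> b \<longrightarrow>
        g absolutely_integrable_on {a..b} \<and> (g has_integral (f b - f a)) {a..b})"

(* Elements of L^infinity(I) are represented by functions on the whole real line; nothing below
   depends on their values outside I or on a null set. *)
definition feasible_on :: "real \<Rightarrow> real \<Rightarrow> real set \<Rightarrow> (real \<Rightarrow> real) \<Rightarrow> bool" where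
  "feasible_on n1 n2 I \<epsilon> \<longleftrightarrow>
     \<epsilon> \<in> borel_measurable (lebesgue_on I) \<and>
     (AE s in lebesgue_on I. n1\<^sup>2 \<le> \<epsilon> s \<and> \<epsilon> s \<le> n2\<^sup>2)"

definition resonator_family :: "real \<Rightarrow> real \<Rightarrow> real \<Rightarrow> (real \<Rightarrow> real) set" where
  "resonator_family n1 n2 sp = {\<epsilon>. feasible_on n1 n2 {0<..<sp} \<epsilon>}"

(* y'' = - k^2 \<epsilon> y, with y' = v classically (also one-sidedly at the end points) and v
   absolutely continuous. *)
definition solves_wave_eq ::
  "real \<Rightarrow> (real \<Rightarrow> real) \<Rightarrow> complex \<Rightarrow> (real \<Rightarrow> complex) \<Rightarrow> (real \<Rightarrow> complex) \<Rightarrow> bool" where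
  "solves_wave_eq sp \<epsilon> k y v \<longleftrightarrow>
     (\<forall>s\<in>{0..sp}. (y has_vector_derivative v s) (at s within {0..sp})) \<and>
     ac_deriv_on v (\<lambda>s. - k\<^sup>2 * of_real (\<epsilon> s) * y s) {0..sp}"

(* The (\<infinity>, n1)-eigenvalues.  If y sp = 0, the boundary quotient is \<infinity>, hence not n1. *)
definition generates_eigenvalue :: "real \<Rightarrow> real \<Rightarrow> (real \<Rightarrow> real) \<Rightarrow> complex \<Rightarrow> bool" where
  "generates_eigenvalue n1 sp \<epsilon> k \<longleftrightarrow>
     k \<noteq> 0 \<and>
     (\<exists>y v. solves_wave_eq sp \<epsilon> k y v \<and> (\<exists>s\<in>{0..sp}. y s \<noteq> 0) \<and>
        y 0 = 0 \<and> y sp \<noteq> 0 \<and> v sp / (\<i> * k * y sp) = of_real n1)"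

definition eigenvalue_set :: "real \<Rightarrow> real \<Rightarrow> real \<Rightarrow> complex set" where
  "eigenvalue_set n1 n2 sp =
     {k. \<exists>\<epsilon>\<in>resonator_family n1 n2 sp. generates_eigenvalue n1 sp \<epsilon> k}"

definition rho_min :: "real \<Rightarrow> real \<Rightarrow> real \<Rightarrow> real \<Rightarrow> ereal" where
  "rho_min n1 n2 sp \<gamma> = (INF k\<in>{k \<in> eigenvalue_set n1 n2 sp. Arg k = \<gamma>}. ereal (cmod k))"

definition is_min_modulus_eigenvalue ::
  "real \<Rightarrow> real \<Rightarrow> real \<Rightarrow> real \<Rightarrow> complex \<Rightarrow> bool" where
  "is_min_modulus_eigenvalue n1 n2 sp \<gamma> k \<longleftrightarrow>
     k \<in> eigenvalue_set n1 n2 sp \<and>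
     (\<exists>\<rho>::real. rho_min n1 n2 sp \<gamma> = ereal \<rho> \<and> k = exp (\<i> * of_real \<gamma>) * of_real \<rho>)"

definition beta_min :: "real \<Rightarrow> real \<Rightarrow> real \<Rightarrow> real \<Rightarrow> ereal" where
  "beta_min n1 n2 sp \<alpha> =
     (INF \<beta>\<in>{\<beta>::real. of_real \<alpha> - \<i> * of_real \<beta> \<in> eigenvalue_set n1 n2 sp}. ereal \<beta>)"

definition is_min_decay_eigenvalue ::
  "real \<Rightarrow> real \<Rightarrow> real \<Rightarrow> real \<Rightarrow> complex \<Rightarrow> bool" where
  "is_min_decay_eigenvalue n1 n2 sp \<alpha> k \<longleftrightarrow>
     k \<in> eigenvalue_set n1 n2 sp \<and>
     (\<exists>\<beta>::real. beta_min n1 n2 sp \<alpha> = ereal \<beta> \<and> k = of_real \<alpha> - \<i> * of_real \<beta>)"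

definition is_min_decay_resonator ::
  "real \<Rightarrow> real \<Rightarrow> real \<Rightarrow> real \<Rightarrow> (real \<Rightarrow> real) \<Rightarrow> bool" where
  "is_min_decay_resonator n1 n2 sp \<alpha> \<epsilon> \<longleftrightarrow>
     \<epsilon> \<in> resonator_family n1 n2 sp \<and>
     (\<exists>k. is_min_decay_eigenvalue n1 n2 sp \<alpha> k \<and> generates_eigenvalue n1 sp \<epsilon> k)"

datatype riemann_sphere = Fin complex | Infty

(* The charts z on \<complex> and -1/z on the complement of 0; the values outside the chart domains
   (at Infty, resp. at Fin 0) are never used. *)
fun chart_zero :: "riemann_sphere \<Rightarrow> complex" where
  "chart_zero (Fin z) = z"
| "chart_zero Infty = 0"

fun chart_infty :: "riemann_sphere \<Rightarrow> complex" where
  "chart_infty (Fin z) = - 1 / z"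
| "chart_infty Infty = 0"

(* Every time has a neighbourhood J in the time interval I on which the state stays in the
   domain of one of the two charts and solves the corresponding Riccati equation. *)
definition trajectory_on ::
  "complex \<Rightarrow> (real \<Rightarrow> real) \<Rightarrow> real set \<Rightarrow> (real \<Rightarrow> riemann_sphere) \<Rightarrow> bool" where
  "trajectory_on \<kappa> \<epsilon> I x \<longleftrightarrow>
     (\<forall>s0\<in>I. \<exists>\<delta>>0. let J = I \<inter> {s0 - \<delta>..s0 + \<delta>} in
        ((\<forall>s\<in>J. x s \<noteq> Infty) \<and>
         ac_deriv_on (\<lambda>s. chart_zero (x s))
           (\<lambda>s. \<i> * \<kappa> * (- (chart_zero (x s))\<^sup>2 + of_real (\<epsilon> s))) J) \<or>
        ((\<forall>s\<in>J. x s \<noteq> Fin 0) \<and>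
         ac_deriv_on (\<lambda>s. chart_infty (x s))
           (\<lambda>s. \<i> * \<kappa> * (- 1 + of_real (\<epsilon> s) * (chart_infty (x s))\<^sup>2)) J))"

definition steers ::
  "complex \<Rightarrow> (real \<Rightarrow> real) \<Rightarrow> riemann_sphere \<Rightarrow> riemann_sphere \<Rightarrow> real \<Rightarrow> bool" where
  "steers \<kappa> \<epsilon> \<eta>m \<eta>p t \<longleftrightarrow>
     t \<ge> 0 \<and> (\<exists>x. trajectory_on \<kappa> \<epsilon> {0..t} x \<and> x 0 = \<eta>m \<and> x t = \<eta>p)"

definition T_min ::
  "real \<Rightarrow> real \<Rightarrow> complex \<Rightarrow> riemann_sphere \<Rightarrow> riemann_sphere \<Rightarrow> ereal" where
  "T_min n1 n2 \<kappa> \<eta>m \<eta>p =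
     (INF t\<in>{t. \<exists>\<epsilon>. feasible_on n1 n2 {0<..} \<epsilon> \<and> steers \<kappa> \<epsilon> \<eta>m \<eta>p t}. ereal t)"

definition is_min_time_control ::
  "real \<Rightarrow> real \<Rightarrow> complex \<Rightarrow> riemann_sphere \<Rightarrow> riemann_sphere \<Rightarrow> (real \<Rightarrow> real) \<Rightarrow> bool" where
  "is_min_time_control n1 n2 \<kappa> \<eta>m \<eta>p \<epsilon> \<longleftrightarrow>
     feasible_on n1 n2 {0<..} \<epsilon> \<and>
     (\<exists>t. T_min n1 n2 \<kappa> \<eta>m \<eta>p = ereal t \<and> steers \<kappa> \<epsilon> \<eta>m \<eta>p t)"

end

theory Submission
  imports Defs "HOL-Complex_Analysis.Great_Picard"
begin

text \<open>
  In terms of the impedance x = v / (i k y) an eigenvalue k = \<alpha> - i \<beta> is a spectral parameter for which some coefficient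
  steers the state on the sphere from infinity to n1 within the length of the resonator. Decay keeps x in the right
  half-plane, so the reflection coefficient (x - n) / (x + n) stays in the unit disc. It starts at 1, and a layer of index n
  multiplies it by exp (- 2 i k n s). In logarithmic coordinates - log r = p + i q relative to n2, the coefficient n2^2
  moves the state along a straight line of direction (\<beta>, \<alpha>), and any other coefficient can only increase \<beta> q - \<alpha> p
  as long as x is in the lower half-plane (below_axis_deflection). The target is the point (L, \<pi>) with
  L = ln ((n2 + n1) / (n2 - n1)).

  This gives an alternative for every eigenvalue (escape_time_dichotomy). If the trajectory first meets the real axis
  at or beyond n1, then \<alpha> L \<le> \<beta> \<pi>, and up to a correction the frequency is at least that of the quarter-wave layer
  n2^2. Otherwise it has overshot the target and has to travel twice from the real axis to the circle of radius n1; this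
  requires n2 \<alpha> sp \<ge> 2 arctan (n2 / n1), which exceeds the quarter wave \<pi> / 2. On the ray of \<kappa>0 the correction
  vanishes: \<kappa>0 has the least modulus, and equality forces the coefficient n2^2. Above that ray \<alpha> L > \<beta> \<pi>, so only the
  detour remains, which bounds \<rho>1 and the right limit away from the modulus of \<kappa>0. Below the ray the minimal modulus is
  squeezed between the alternative and quarter-wave layers of intermediate index, whence the left limit. For
  k = c * \<kappa>0 with c \<ge> 1 the quarter-wave layer of length sp / c is the unique fastest control; filling the rest with
  n1^2 keeps the state in the target. An eigenvalue of the same frequency and less decay would have its argument
  in (\<gamma>0, 0), against the definition of \<rho>1.

  The existence of the right limit needs a different argument. If some rays arbitrarily close to \<gamma>0 on the right carry
  eigenvalues of modulus below \<rho>, and K > \<rho>, then shrinking their structures gives eigenvalues of modulus K whose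
  structures end with a stretch of the medium n1. The first variations of the boundary condition are the integrals of
  (\<eta> - \<epsilon>) y^2. If they fill a disc of a radius common to all these structures, Brouwer's theorem restores the boundary
  condition on all neighbouring rays (boundary_condition_restored), so the upper limit is at most K, hence the two
  limits agree (pencil_filled). The common radius comes from compactness. A sequence of structures without one has a
  limit in which the coefficient is governed by the sign of Re (cnj N * y^2) for some N; following this switching function
  backwards from the target shows that the limit is the quarter-wave layer followed by a short stretch of n1
  (quarter_wave_limit). But the structures themselves have less decay than \<kappa>0, so they crossed the real axis between 0
  and n1, and returning from there to the target takes pushes outside the interior of a certain half-plane
  (cone_obstruction). After the quarter wave all pushes of the limit lie strictly inside it, a contradiction
  (no_degeneration).
\<close>

section \<open>Indefinite integrals of bounded functions\<close>

text \<open>Indefinite integration of bounded functions. The bound on the derivative makes every primitive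
  Lipschitz continuous, which is what makes products and compositions of primitives primitives again.\<close>
definition primitive :: "(real \<Rightarrow> 'a::euclidean_space) \<Rightarrow> (real \<Rightarrow> 'a) \<Rightarrow> real \<Rightarrow> real \<Rightarrow> bool" where
  "primitive f g a b \<longleftrightarrow> g \<in> borel_measurable (lebesgue_on {a..b}) \<and> bounded (g ` {a..b}) \<and>
     (\<forall>s t. a \<le> s \<longrightarrow> s \<le> t \<longrightarrow> t \<le> b \<longrightarrow> (g has_integral f t - f s) {s..t})"

lemma bounded_measurable_integrable:
  fixes g :: "real \<Rightarrow> 'a::euclidean_space"
  assumes "g \<in> borel_measurable (lebesgue_on {a..b})" "bounded (g ` {a..b})" "a \<le> s" "t \<le> b"
  shows "g absolutely_integrable_on {s..t}"
proof -
  obtain C where C: "\<And>r. r \<in> {a..b} \<Longrightarrow> norm (g r) \<le> C"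
    using assms(2) unfolding bounded_iff by blast
  have "g \<in> borel_measurable (lebesgue_on {s..t})"
    using assms by (auto intro: measurable_restrict_mono)
  then show ?thesis
    using assms C by (intro measurable_bounded_by_integrable_imp_absolutely_integrable[where g="\<lambda>_. C"]) auto
qed

lemma primitiveD:
  assumes "primitive f g a b" "a \<le> s" "s \<le> t" "t \<le> b"
  shows "(g has_integral f t - f s) {s..t}" "integral {s..t} g = f t - f s"
  using assms by (auto simp: primitive_def intro!: integral_unique)

lemma primitive_bounded:
  assumes "primitive f g a b"
  obtains C where "C > 0" "\<And>s. s \<in> {a..b} \<Longrightarrow> norm (g s) \<le> C"
  using assms unfolding primitive_def bounded_pos by auto

lemma has_integral_bound_Icc:
  fixes f :: "real \<Rightarrow> 'a::euclidean_space"
  assumes "0 \<le> B" "(f has_integral i) {a..b}" "a \<le> b" "\<And>x. x \<in> {a..b} \<Longrightarrow> norm (f x) \<le> B"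
  shows "norm i \<le> B * (b - a)"
  using has_integral_bound[of B f i a b] assms by auto

lemma primitive_lipschitz_le:
  assumes "primitive f g a b" "a \<le> s" "s \<le> t" "t \<le> b" "0 \<le> C" "\<And>r. r \<in> {s..t} \<Longrightarrow> norm (g r) \<le> C"
  shows "norm (f t - f s) \<le> C * (t - s)"
  using has_integral_bound[of C g "f t - f s" s t] primitiveD(1)[OF assms(1-4)] assms by auto

lemma primitive_lipschitz:
  assumes "primitive f g a b"
  obtains C where "C > 0" "\<And>s t. s \<in> {a..b} \<Longrightarrow> t \<in> {a..b} \<Longrightarrow> norm (f t - f s) \<le> C * \<bar>t - s\<bar>"
proof -
  obtain C where C: "C > 0" "\<And>s. s \<in> {a..b} \<Longrightarrow> norm (g s) \<le> C"
    using primitive_bounded[OF assms] by blast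
  have *: "norm (f t - f s) \<le> C * \<bar>t - s\<bar>" if "a \<le> s" "s \<le> t" "t \<le> b" for s t
    using primitive_lipschitz_le[OF assms that, of C] C that by auto
  show ?thesis
  proof (rule that[OF C(1)])
    fix s t assume "s \<in> {a..b}" "t \<in> {a..b}"
    then show "norm (f t - f s) \<le> C * \<bar>t - s\<bar>"
      using *[of s t] *[of t s] by (cases "s \<le> t") (auto simp: norm_minus_commute abs_minus_commute)
  qed
qed

lemma primitive_continuous:
  assumes "primitive f g a b" shows "continuous_on {a..b} f"
proof -
  obtain C where C: "C > 0" "\<And>s t. s \<in> {a..b} \<Longrightarrow> t \<in> {a..b} \<Longrightarrow> norm (f t - f s) \<le> C * \<bar>t - s\<bar>"
    using primitive_lipschitz[OF assms] by blast
  have "C-lipschitz_on {a..b} f"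
    using C by (intro lipschitz_onI) (auto simp: dist_norm norm_minus_commute abs_minus_commute)
  then show ?thesis by (rule lipschitz_on_continuous_on)
qed

lemma primitive_subset:
  assumes "primitive f g a b" "a \<le> c" "d \<le> b" shows "primitive f g c d"
  using assms unfolding primitive_def
  by (auto intro: measurable_restrict_mono bounded_subset image_mono elim!: bounded_subset[rotated])

lemma primitive_cong:
  assumes "primitive f g a b" "\<And>s. s \<in> {a..b} \<Longrightarrow> f s = f' s" "\<And>s. s \<in> {a..b} \<Longrightarrow> g s = g' s"
  shows "primitive f' g' a b"
proof -
  have "g' \<in> borel_measurable (lebesgue_on {a..b})"
    using assms(1) assms(3) unfolding primitive_def
    by (subst measurable_cong[of _ _ g]) (auto simp: space_restrict_space)
  moreover have "g' ` {a..b} = g ` {a..b}" using assms(3) by auto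
  moreover have "(g' has_integral f' t - f' s) {s..t}" if "a \<le> s" "s \<le> t" "t \<le> b" for s t
    using primitiveD(1)[OF assms(1) that] assms(2)[of s] assms(2)[of t] that assms(3)
    by (subst has_integral_cong[of _ _ g]) auto
  ultimately show ?thesis using assms(1) unfolding primitive_def by auto
qed

lemma primitive_linear:
  assumes "primitive f g a b" "bounded_linear h"
  shows "primitive (\<lambda>s. h (f s)) (\<lambda>s. h (g s)) a b"
proof -
  interpret bounded_linear h by fact
  have "h \<in> borel_measurable borel"
    by (intro borel_measurable_continuous_onI linear_continuous_on assms(2))
  then have "(\<lambda>s. h (g s)) \<in> borel_measurable (lebesgue_on {a..b})"
    using assms(1) unfolding primitive_def by (auto intro: measurable_compose)
  moreover have "bounded ((\<lambda>s. h (g s)) ` {a..b})"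
    using bounded_linear_image[OF _ assms(2), of "g ` {a..b}"] assms(1)
    unfolding primitive_def by (simp add: image_image)
  moreover have "((\<lambda>s. h (g s)) has_integral h (f t) - h (f s)) {s..t}" if "a \<le> s" "s \<le> t" "t \<le> b" for s t
    using has_integral_linear[OF primitiveD(1)[OF assms(1) that] assms(2)] by (simp add: o_def diff)
  ultimately show ?thesis unfolding primitive_def by auto
qed

lemma primitive_add:
  assumes "primitive f g a b" "primitive f' g' a b"
  shows "primitive (\<lambda>s. f s + f' s) (\<lambda>s. g s + g' s) a b"
  using assms unfolding primitive_def
  by (auto intro!: bounded_plus_comp simp: add_diff_add intro: has_integral_add)

lemma primitive_minus: "primitive f g a b \<Longrightarrow> primitive (\<lambda>s. - f s) (\<lambda>s. - g s) a b"
  by (rule primitive_linear[where h=uminus]) (auto intro: bounded_linear_minus bounded_linear_ident)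

lemma primitive_diff:
  assumes "primitive f g a b" "primitive f' g' a b"
  shows "primitive (\<lambda>s. f s - f' s) (\<lambda>s. g s - g' s) a b"
  using primitive_add[OF assms(1) primitive_minus[OF assms(2)]] by simp

lemma primitive_cmult:
  fixes f :: "real \<Rightarrow> 'a::{euclidean_space,real_normed_field}"
  shows "primitive f g a b \<Longrightarrow> primitive (\<lambda>s. c * f s) (\<lambda>s. c * g s) a b"
  by (rule primitive_linear[where h="\<lambda>x. c * x"]) (auto intro: bounded_linear_mult_right)

lemma primitive_const: "primitive (\<lambda>s. c) (\<lambda>s. 0) a b"
  unfolding primitive_def by (auto simp: bounded_iff)

text \<open>A function whose increments agree with the integral of h to first order at every point
  differs from the indefinite integral of h by a function with vanishing derivative.\<close>
lemma primitive_from_increments: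
  fixes F h :: "real \<Rightarrow> 'a::euclidean_space"
  assumes h: "h \<in> borel_measurable (lebesgue_on {a..b})" "bounded (h ` {a..b})"
    and loc: "\<And>s e. s \<in> {a..b} \<Longrightarrow> e > 0 \<Longrightarrow> \<exists>d>0. \<forall>u w. a \<le> u \<and> u \<le> w \<and> w \<le> b \<and> w - u < d \<and> (u = s \<or> w = s) \<longrightarrow>
       norm (F w - F u - integral {u..w} h) \<le> e * (w - u)"
  shows "primitive F h a b"
proof -
  define D where "D = (\<lambda>s. F s - integral {a..s} h)"
  have int: "h integrable_on {s..t}" if "a \<le> s" "t \<le> b" for s t
    using bounded_measurable_integrable[OF h that] by (simp add: absolutely_integrable_on_def)
  have split: "integral {a..t} h - integral {a..s} h = integral {s..t} h" if "a \<le> s" "s \<le> t" "t \<le> b" for s t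
    using Henstock_Kurzweil_Integration.integral_combine[of a s t h] that int by (auto simp: algebra_simps)
  have "(D has_derivative (\<lambda>_. 0)) (at s within {a..b})" if s: "s \<in> {a..b}" for s
    unfolding has_derivative_within_alt
  proof (intro conjI allI impI)
    fix e :: real assume "0 < e"
    then obtain d where d: "d > 0" "\<And>u w. a \<le> u \<Longrightarrow> u \<le> w \<Longrightarrow> w \<le> b \<Longrightarrow> w - u < d \<Longrightarrow> u = s \<or> w = s \<Longrightarrow>
       norm (F w - F u - integral {u..w} h) \<le> e * (w - u)"
      using loc[OF s, of e] by blast
    have "norm (D y - D s - 0) \<le> e * norm (y - s)" if y: "y \<in> {a..b}" "norm (y - s) < d" for y
    proof (cases "s \<le> y")
      case True
      then show ?thesis using d(2)[of s y] split[of s y] y s by (simp add: D_def algebra_simps)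
    next
      case False
      have "D y - D s = - (F s - F y - integral {y..s} h)"
        using False split[of y s] y s by (simp add: D_def algebra_simps)
      moreover have "norm (F s - F y - integral {y..s} h) \<le> e * (s - y)"
        using d(2)[of y s] False y s by auto
      ultimately show ?thesis using False by (metis abs_minus_commute abs_of_nonneg diff_ge_0_iff_ge diff_zero less_eq_real_def linorder_not_le norm_minus_cancel real_norm_def)
    qed
    then show "\<exists>d>0. \<forall>y\<in>{a..b}. norm (y - s) < d \<longrightarrow> norm (D y - D s - 0) \<le> e * norm (y - s)"
      using d(1) by blast
  qed simp
  then obtain c where c: "\<And>s. s \<in> {a..b} \<Longrightarrow> D s = c"
    using has_derivative_zero_constant[of "{a..b}" D] by auto
  have "(h has_integral F t - F s) {s..t}" if "a \<le> s" "s \<le> t" "t \<le> b" for s t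
  proof -
    have "F t - F s = integral {s..t} h"
      using c[of s] c[of t] split[OF that] that by (auto simp: D_def algebra_simps)
    then show ?thesis using int[of s t] that by (simp add: integrable_integral)
  qed
  then show ?thesis using h unfolding primitive_def by blast
qed

lemma continuous_bounded_measurable:
  fixes f :: "real \<Rightarrow> 'a::euclidean_space"
  assumes "continuous_on {a..b} f"
  shows "f \<in> borel_measurable (lebesgue_on {a..b})" "bounded (f ` {a..b})"
  using assms by (auto intro!: continuous_imp_measurable_on_sets_lebesgue compact_imp_bounded compact_continuous_image)

lemma bounded_mult_image:
  fixes f g :: "real \<Rightarrow> 'a::real_normed_field"
  assumes "bounded (f ` A)" "bounded (g ` A)"
  shows "bounded ((\<lambda>s. f s * g s) ` A)"
proof -
  obtain B C where "\<And>s. s \<in> A \<Longrightarrow> norm (f s) \<le> B" "\<And>s. s \<in> A \<Longrightarrow> norm (g s) \<le> C" 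
    using assms by (auto simp: bounded_iff)
  then have "norm (f s * g s) \<le> B * C" if "s \<in> A" for s
    using that norm_mult[of "f s" "g s"] mult_mono[of "norm (f s)" B "norm (g s)" C]
    by (metis norm_ge_zero order_trans)
  then show ?thesis by (auto simp: bounded_iff)
qed

text \<open>The increments of the composition agree to first order with the derivative times the increments of
  the inner function, uniformly enough for primitive_from_increments.\<close>
lemma primitive_compose:
  fixes f :: "real \<Rightarrow> 'a::{euclidean_space,real_normed_field}"
  assumes f: "primitive f g a b"
    and der: "\<And>s. s \<in> {a..b} \<Longrightarrow> (\<phi> has_field_derivative \<phi>' (f s)) (at (f s))"
    and cont: "continuous_on (f ` {a..b}) \<phi>'"
  shows "primitive (\<lambda>s. \<phi> (f s)) (\<lambda>s. \<phi>' (f s) * g s) a b"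
proof (rule primitive_from_increments)
  have c: "continuous_on {a..b} (\<lambda>s. \<phi>' (f s))"
    using continuous_on_compose2[OF cont primitive_continuous[OF f]] by auto
  note cm = continuous_bounded_measurable[OF c]
  have g: "g \<in> borel_measurable (lebesgue_on {a..b})" "bounded (g ` {a..b})"
    using f unfolding primitive_def by auto
  show meas: "(\<lambda>s. \<phi>' (f s) * g s) \<in> borel_measurable (lebesgue_on {a..b})"
    using cm(1) g(1) by measurable
  show bdd: "bounded ((\<lambda>s. \<phi>' (f s) * g s) ` {a..b})" by (rule bounded_mult_image[OF cm(2) g(2)])
  fix s e assume s: "s \<in> {a..b}" and e: "(e::real) > 0"
  obtain C where C: "C > 0" "\<And>s. s \<in> {a..b} \<Longrightarrow> norm (g s) \<le> C"
    using primitive_bounded[OF f] by blast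
  define e1 where "e1 = e / (2 * C)"
  have e1: "e1 > 0" using e C by (simp add: e1_def)
  obtain d1 where d1: "d1 > 0" "\<And>y. norm (y - f s) < d1 \<Longrightarrow> norm (\<phi> y - \<phi> (f s) - \<phi>' (f s) * (y - f s)) \<le> e1 * norm (y - f s)"
    using der[OF s] e1 unfolding has_field_derivative_def has_derivative_at_alt by blast
  obtain d2 where d2: "d2 > 0" "\<And>r. r \<in> {a..b} \<Longrightarrow> dist r s < d2 \<Longrightarrow> dist (\<phi>' (f r)) (\<phi>' (f s)) < e1"
    using c s e1 unfolding continuous_on_iff by metis
  show "\<exists>d>0. \<forall>u w. a \<le> u \<and> u \<le> w \<and> w \<le> b \<and> w - u < d \<and> (u = s \<or> w = s) \<longrightarrow>
       norm (\<phi> (f w) - \<phi> (f u) - integral {u..w} (\<lambda>s. \<phi>' (f s) * g s)) \<le> e * (w - u)"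
  proof (intro exI[of _ "min d2 (d1 / C)"] conjI allI impI)
    show "0 < min d2 (d1 / C)" using d1 d2 C by simp
    fix u w assume uw: "a \<le> u \<and> u \<le> w \<and> w \<le> b \<and> w - u < min d2 (d1 / C) \<and> (u = s \<or> w = s)"
    then have C2: "norm (f w - f u) \<le> C * (w - u)"
      using primitive_lipschitz_le[OF f, of u w C] C by auto
    also have "\<dots> < d1" using uw C by (simp add: field_simps)
    finally have lt: "norm (f w - f u) < d1" .
    have "norm (\<phi> (f w) - \<phi> (f u) - \<phi>' (f s) * (f w - f u)) \<le> e1 * norm (f w - f u)"
    proof (cases "u = s")
      case True then show ?thesis using d1(2)[of "f w"] lt by auto
    next
      case False
      then have "w = s" using uw by auto
      moreover have "\<phi> (f w) - \<phi> (f u) - \<phi>' (f s) * (f w - f u) = - (\<phi> (f u) - \<phi> (f s) - \<phi>' (f s) * (f u - f s))"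
        using \<open>w = s\<close> by (simp add: algebra_simps)
      ultimately show ?thesis using d1(2)[of "f u"] lt by (simp only: norm_minus_cancel norm_minus_commute)
    qed
    also have "\<dots> \<le> e1 * (C * (w - u))" using C2 e1 by simp
    finally have A: "norm (\<phi> (f w) - \<phi> (f u) - \<phi>' (f s) * (f w - f u)) \<le> e1 * (C * (w - u))" .
    have i1: "((\<lambda>r. \<phi>' (f r) * g r) has_integral integral {u..w} (\<lambda>r. \<phi>' (f r) * g r)) {u..w}"
      using bounded_measurable_integrable[OF meas bdd, of u w] uw
      by (simp add: absolutely_integrable_on_def integrable_integral)
    have i2: "((\<lambda>r. \<phi>' (f s) * g r) has_integral \<phi>' (f s) * (f w - f u)) {u..w}"
      using has_integral_mult_right[OF primitiveD(1)[OF f, of u w]] uw by auto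
    have i3: "((\<lambda>r. (\<phi>' (f r) - \<phi>' (f s)) * g r) has_integral
        integral {u..w} (\<lambda>r. \<phi>' (f r) * g r) - \<phi>' (f s) * (f w - f u)) {u..w}"
      using has_integral_diff[OF i1 i2] by (simp add: algebra_simps)
    have "norm (integral {u..w} (\<lambda>r. \<phi>' (f r) * g r) - \<phi>' (f s) * (f w - f u)) \<le> e1 * C * (w - u)"
    proof (rule has_integral_bound_Icc[where f="\<lambda>r. (\<phi>' (f r) - \<phi>' (f s)) * g r"])
      show "0 \<le> e1 * C" using e1 C by simp
      show "((\<lambda>r. (\<phi>' (f r) - \<phi>' (f s)) * g r) has_integral
        integral {u..w} (\<lambda>r. \<phi>' (f r) * g r) - \<phi>' (f s) * (f w - f u)) {u..w}" by (rule i3)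
      show "u \<le> w" using uw by simp
      fix r assume "r \<in> {u..w}"
      then have r: "r \<in> {a..b}" "dist r s < d2" using uw by (auto simp: dist_real_def)
      show "norm ((\<phi>' (f r) - \<phi>' (f s)) * g r) \<le> e1 * C"
        unfolding norm_mult using d2(2)[OF r] C(2)[OF r(1)] e1 by (intro mult_mono) (auto simp: dist_norm)
    qed
    then have B: "norm (integral {u..w} (\<lambda>r. \<phi>' (f r) * g r) - \<phi>' (f s) * (f w - f u)) \<le> e1 * (C * (w - u))"
      using uw by (simp add: mult.assoc)
    have "norm (\<phi> (f w) - \<phi> (f u) - integral {u..w} (\<lambda>r. \<phi>' (f r) * g r)) \<le> e1 * (C * (w - u)) + e1 * (C * (w - u))"
      using norm_triangle_mono[OF A B[unfolded norm_minus_commute[of "integral {u..w} (\<lambda>r. \<phi>' (f r) * g r)"]]]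
      by (simp add: algebra_simps)
    also have "\<dots> = e * (w - u)" using C by (simp add: e1_def field_simps)
    finally show "norm (\<phi> (f w) - \<phi> (f u) - integral {u..w} (\<lambda>s. \<phi>' (f s) * g s)) \<le> e * (w - u)" .
  qed
qed

text \<open>By polarization the product rule is the chain rule for the square.\<close>
lemma primitive_mult:
  fixes f :: "real \<Rightarrow> 'a::{euclidean_space,real_normed_field}"
  assumes f: "primitive f f' a b" and g: "primitive g g' a b"
  shows "primitive (\<lambda>s. f s * g s) (\<lambda>s. f' s * g s + f s * g' s) a b"
proof -
  have sq: "primitive (\<lambda>s. (h s)^2) (\<lambda>s. (2 * h s) * h' s) a b" if "primitive h h' a b" for h h' :: "real \<Rightarrow> 'a"
    by (rule primitive_compose[OF that, of "\<lambda>x. x^2" "\<lambda>x. 2 * x"])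
      (auto intro!: derivative_eq_intros continuous_intros)
  have "primitive (\<lambda>s. (1/4) * ((f s + g s)^2 - (f s - g s)^2)) 
     (\<lambda>s. (1/4) * ((2 * (f s + g s)) * (f' s + g' s) - (2 * (f s - g s)) * (f' s - g' s))) a b"
    by (intro primitive_cmult primitive_diff sq primitive_add f g)
  moreover have "(x + y)^2 - (x - y)^2 = 4 * (x * y)" for x y :: 'a
    by (simp add: power2_eq_square algebra_simps)
  moreover have "(2 * (x + y)) * (x' + y') - (2 * (x - y)) * (x' - y') = 4 * (x' * y + x * y')" for x y x' y' :: 'a
    by (simp add: algebra_simps)
  ultimately have "primitive (\<lambda>s. (1/4) * (4 * (f s * g s))) (\<lambda>s. (1/4) * (4 * (f' s * g s + f s * g' s))) a b"
    by (simp only:)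
  moreover have "(1/4) * (4 * x) = x" for x :: 'a by simp
  ultimately show ?thesis by (simp only:)
qed

lemma primitive_C1:
  fixes f :: "real \<Rightarrow> 'a::euclidean_space"
  assumes "\<And>s. s \<in> {a..b} \<Longrightarrow> (f has_vector_derivative g s) (at s within {a..b})" "continuous_on {a..b} g"
  shows "primitive f g a b"
proof -
  have "(g has_integral f t - f s) {s..t}" if "a \<le> s" "s \<le> t" "t \<le> b" for s t
  proof (rule fundamental_theorem_of_calculus[OF that(2)])
    fix x assume "x \<in> {s..t}"
    then show "(f has_vector_derivative g x) (at x within {s..t})"
      using that by (intro has_vector_derivative_within_subset[OF assms(1)]) auto
  qed
  then show ?thesis
    using continuous_bounded_measurable[OF assms(2)] unfolding primitive_def by blast
qed

lemma primitive_has_vector_derivative: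
  fixes f :: "real \<Rightarrow> 'a::euclidean_space"
  assumes "primitive f g a b" "continuous_on {a..b} g" "s \<in> {a..b}"
  shows "(f has_vector_derivative g s) (at s within {a..b})"
proof -
  have "((\<lambda>u. f a + integral {a..u} g) has_vector_derivative 0 + g s) (at s within {a..b})"
    using integral_has_vector_derivative[OF assms(2,3)] by (intro derivative_intros)
  then show ?thesis
    using primitiveD(2)[OF assms(1), of a] assms(3)
    by (intro has_vector_derivative_transform[OF assms(3), of f "\<lambda>u. f a + integral {a..u} g"]) auto
qed

lemma primitive_le:
  fixes f F :: "real \<Rightarrow> real"
  assumes "primitive f g a b" "primitive F G a b" "a \<le> b" "\<And>s. s \<in> {a..b} \<Longrightarrow> g s \<le> G s"
  shows "f b - f a \<le> F b - F a"
  by (rule has_integral_le[OF primitiveD(1)[OF assms(1)] primitiveD(1)[OF assms(2)]])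
    (use assms(3,4) in auto)

lemma primitive_ident: "primitive (\<lambda>s. c * s) (\<lambda>s. c) a (b::real)"
  by (rule primitive_C1) (auto intro!: derivative_eq_intros)

lemma primitive_mono:
  fixes f :: "real \<Rightarrow> real"
  assumes "primitive f g a b" "a \<le> b" "\<And>s. s \<in> {a..b} \<Longrightarrow> 0 \<le> g s"
  shows "f a \<le> f b"
  using primitive_le[OF primitive_const[of 0] assms(1,2)] assms(3) by simp

lemma primitive_bound:
  fixes f :: "real \<Rightarrow> real"
  assumes "primitive f g a b" "a \<le> b" "\<And>s. s \<in> {a..b} \<Longrightarrow> g s \<le> c"
  shows "f b - f a \<le> c * (b - a)"
  using primitive_le[OF assms(1) primitive_ident[of c] assms(2)] assms(3) by (simp add: algebra_simps)

text \<open>The source of all uniqueness statements: a quantity with nonnegative rate and no total increase has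
  zero rate almost everywhere.\<close>
lemma primitive_zero_negligible:
  fixes f :: "real \<Rightarrow> real"
  assumes f: "primitive f g a b" and nn: "\<And>s. s \<in> {a..b} \<Longrightarrow> 0 \<le> g s" and ab: "a \<le> b" "f b \<le> f a"
  shows "negligible {s\<in>{a..b}. g s \<noteq> 0}"
proof -
  have "f a = f b" using primitive_mono[OF f ab(1) nn] ab by simp
  then have i0: "(g has_integral 0) {a..b}" using primitiveD(1)[OF f, of a b] ab by simp
  have ai: "g absolutely_integrable_on {a..b}"
    by (rule bounded_measurable_integrable[of g a b]) (use f in \<open>auto simp: primitive_def\<close>)
  have "(LINT s:{a..b}|lebesgue. g s) = integral {a..b} g"
    by (rule set_lebesgue_integral_eq_integral(2)[OF ai])
  also have "\<dots> = 0" using i0 by (rule integral_unique)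
  finally have z: "(LINT s|lebesgue. indicat_real {a..b} s *\<^sub>R g s) = 0"
    unfolding set_lebesgue_integral_def .
  have nn': "AE s in lebesgue. 0 \<le> indicat_real {a..b} s *\<^sub>R g s"
    by (rule AE_I2) (use nn in \<open>simp add: indicator_def\<close>)
  have "AE s in lebesgue. indicat_real {a..b} s *\<^sub>R g s = 0"
    by (rule iffD1[OF integral_nonneg_eq_0_iff_AE[OF ai[unfolded set_integrable_def] nn'] z])
  then have "\<exists>N. negligible N \<and> {s. \<not> indicat_real {a..b} s *\<^sub>R g s = 0} \<subseteq> N"
    unfolding eventually_ae_filter_negligible .
  then obtain N where N: "negligible N" "{s. \<not> indicat_real {a..b} s *\<^sub>R g s = 0} \<subseteq> N"
    by (elim exE conjE)
  have "{s\<in>{a..b}. g s \<noteq> 0} \<subseteq> {s. \<not> indicat_real {a..b} s *\<^sub>R g s = 0}"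
    by (auto simp: indicator_def)
  then show ?thesis using N negligible_subset by blast
qed

lemma primitive_glue:
  fixes f :: "real \<Rightarrow> 'a::euclidean_space"
  assumes f: "primitive f g a b" and f': "primitive f g b c" and "a \<le> b" "b \<le> c"
  shows "primitive f g a c"
proof -
  have un: "{a..c} = {a..b} \<union> {b..c}" using assms by auto
  have "g \<in> borel_measurable (lebesgue_on ({a..b} \<union> {b..c}))"
  proof -
    have "(\<lambda>s. if s \<in> {a..b} then g s else 0) \<in> borel_measurable lebesgue"
         "(\<lambda>s. if s \<in> {b..c} then g s else 0) \<in> borel_measurable lebesgue"
      using borel_measurable_if_I[of g "{a..b}"] borel_measurable_if_I[of g "{b..c}"] f f'
      unfolding primitive_def by simp_all
    then have "(\<lambda>s. if s \<in> {a..b} then (if s \<in> {a..b} then g s else 0) else (if s \<in> {b..c} then g s else 0)) \<in> borel_measurable lebesgue"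
      by (rule measurable_If_set) auto
    also have "(\<lambda>s. if s \<in> {a..b} then (if s \<in> {a..b} then g s else 0) else (if s \<in> {b..c} then g s else 0))
       = (\<lambda>s. if s \<in> {a..b} \<union> {b..c} then g s else 0)" by auto
    finally show ?thesis by (subst borel_measurable_if[symmetric]) auto
  qed
  moreover have "bounded (g ` ({a..b} \<union> {b..c}))"
    using f f' unfolding primitive_def image_Un by (simp only: bounded_Un)
  moreover have "(g has_integral f t - f s) {s..t}" if st: "a \<le> s" "s \<le> t" "t \<le> c" for s t
  proof -
    consider "t \<le> b" | "b \<le> s" | "s \<le> b" "b \<le> t" by linarith
    then show ?thesis
    proof cases
      case 1 then show ?thesis using primitiveD(1)[OF f] st by blast
    next
      case 2 then show ?thesis using primitiveD(1)[OF f'] st by blast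
    next
      case 3
      have "(g has_integral (f b - f s) + (f t - f b)) {s..t}"
        by (rule has_integral_combine[OF 3 primitiveD(1)[OF f] primitiveD(1)[OF f']]) (use st 3 in auto)
      then show ?thesis by simp
    qed
  qed
  ultimately show ?thesis unfolding primitive_def un by blast
qed

lemma primitive_scale:
  fixes f :: "real \<Rightarrow> 'a::euclidean_space"
  assumes f: "primitive f g a b" and c: "c > 0"
  shows "primitive (\<lambda>s. f (c * s)) (\<lambda>s. c *\<^sub>R g (c * s)) (a / c) (b / c)"
proof -
  have im: "s \<in> {a/c..b/c} \<longleftrightarrow> c * s \<in> {a..b}" for s using c by (auto simp: field_simps)
  have "(\<lambda>s. if s \<in> {a..b} then g s else 0) \<in> borel_measurable lebesgue"
    using borel_measurable_if_I[of g "{a..b}"] f unfolding primitive_def by simp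
  from measurable_compose[OF lebesgue_measurable_scaling[of c] this]
  have "(\<lambda>s. c *\<^sub>R (if c * s \<in> {a..b} then g (c * s) else 0)) \<in> borel_measurable lebesgue"
    by (intro borel_measurable_scaleR) (simp_all only: real_scaleR_def borel_measurable_const)
  also have "(\<lambda>s. c *\<^sub>R (if c * s \<in> {a..b} then g (c * s) else 0)) = (\<lambda>s. if s \<in> {a/c..b/c} then c *\<^sub>R g (c * s) else 0)"
    unfolding im by auto
  finally have m: "(\<lambda>s. c *\<^sub>R g (c * s)) \<in> borel_measurable (lebesgue_on {a/c..b/c})"
    by (subst borel_measurable_if[symmetric]) auto
  obtain C where C: "C > 0" "\<And>s. s \<in> {a..b} \<Longrightarrow> norm (g s) \<le> C" using primitive_bounded[OF f] by blast
  have "bounded ((\<lambda>s. c *\<^sub>R g (c * s)) ` {a/c..b/c})"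
    unfolding bounded_iff using C c im by (intro exI[of _ "c * C"]) auto
  moreover have "((\<lambda>s. c *\<^sub>R g (c * s)) has_integral f (c * t) - f (c * s)) {s..t}"
    if "a / c \<le> s" "s \<le> t" "t \<le> b / c" for s t
  proof -
    have "(g has_integral f (c * t) - f (c * s)) {c * s..c * t}"
      using that c by (intro primitiveD(1)[OF f]) (auto simp: field_simps)
    from has_integral_affinity[OF this[folded cbox_interval], of c 0]
    have "((\<lambda>x. g (c * x)) has_integral (1 / c) *\<^sub>R (f (c * t) - f (c * s))) {s..t}"
      using c that by (simp add: image_affinity_atLeastAtMost field_simps)
    from has_integral_cmul[OF this, of c] show ?thesis using c by simp
  qed
  ultimately show ?thesis using m unfolding primitive_def by blast
qed

lemma primitive_ac_deriv_on:
  assumes "primitive f g a b" shows "ac_deriv_on f g {a..b}"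
  unfolding ac_deriv_on_def
proof (intro ballI impI conjI)
  fix s t assume st: "s \<in> {a..b}" "t \<in> {a..b}" "s \<le> t"
  show "(g has_integral f t - f s) {s..t}" using primitiveD(1)[OF assms] st by auto
  show "g absolutely_integrable_on {s..t}"
    by (rule bounded_measurable_integrable[of g a b]) (use assms st in \<open>auto simp: primitive_def\<close>)
qed

lemma ac_deriv_on_spike:
  assumes f: "ac_deriv_on f g {a..b}" and N: "negligible N" and eq: "\<And>s. s \<in> {a..b} - N \<Longrightarrow> g' s = g s"
  shows "ac_deriv_on f g' {a..b}"
  unfolding ac_deriv_on_def
proof (intro ballI impI conjI)
  fix s t assume st: "s \<in> {a..b}" "t \<in> {a..b}" "s \<le> t"
  have *: "g absolutely_integrable_on {s..t}" "(g has_integral f t - f s) {s..t}"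
    using f st unfolding ac_deriv_on_def by blast+
  show "(g' has_integral f t - f s) {s..t}"
    by (rule has_integral_spike[OF N _ *(2)]) (use eq st in auto)
  show "g' absolutely_integrable_on {s..t}"
    by (rule absolutely_integrable_spike[OF *(1) N]) (use eq st in auto)
qed

lemma primitive_of_ac_deriv_on:
  assumes f: "ac_deriv_on f g {a..b}" and bd: "bounded (g ` {a..b})" and ab: "a \<le> b"
  shows "primitive f g a b"
proof -
  have "g absolutely_integrable_on {a..b}" using f ab unfolding ac_deriv_on_def by auto
  then have "g \<in> borel_measurable (lebesgue_on {a..b})"
    by (rule absolutely_integrable_imp_borel_measurable) auto
  then show ?thesis using f bd unfolding primitive_def ac_deriv_on_def by auto
qed

lemma primitive_Re: "primitive f g a b \<Longrightarrow> primitive (\<lambda>s. Re (f s)) (\<lambda>s. Re (g s)) a b"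
  by (rule primitive_linear[OF _ bounded_linear_Re])

lemma primitive_Im: "primitive f g a b \<Longrightarrow> primitive (\<lambda>s. Im (f s)) (\<lambda>s. Im (g s)) a b"
  by (rule primitive_linear[OF _ bounded_linear_Im])

lemma primitive_cnj: "primitive f g a b \<Longrightarrow> primitive (\<lambda>s. cnj (f s)) (\<lambda>s. cnj (g s)) a b"
  by (rule primitive_linear[OF _ bounded_linear_cnj])

lemma primitive_exp:
  fixes f :: "real \<Rightarrow> complex"
  assumes "primitive f g a b" shows "primitive (\<lambda>s. exp (f s)) (\<lambda>s. exp (f s) * g s) a b"
  by (rule primitive_compose[OF assms, of exp exp]) (auto intro!: continuous_intros DERIV_exp)

lemma primitive_exp_linear:
  fixes c :: complex
  shows "primitive (\<lambda>s. exp (c * of_real s)) (\<lambda>s. c * exp (c * of_real s)) a b"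
proof (rule primitive_C1)
  fix s
  have "((\<lambda>z. exp (c * z)) has_field_derivative c * exp (c * of_real s)) (at (of_real s))"
    by (auto intro!: derivative_eq_intros)
  then show "((\<lambda>s. exp (c * of_real s)) has_vector_derivative c * exp (c * of_real s)) (at s within {a..b})"
    by (rule has_vector_derivative_real_field)
qed (intro continuous_intros)

section \<open>Impedance and reflection coefficient of a wave\<close>

text \<open>Borel functions bounded at every point instead of almost everywhere: no exceptional set has to be
  carried through the estimates. Every feasible coefficient has such a representative, see
  feasible_representative.\<close>
definition admissible :: "real \<Rightarrow> real \<Rightarrow> (real \<Rightarrow> real) \<Rightarrow> bool" where
  "admissible n1 n2 \<epsilon> \<longleftrightarrow> \<epsilon> \<in> borel_measurable borel \<and> (\<forall>s. n1\<^sup>2 \<le> \<epsilon> s \<and> \<epsilon> s \<le> n2\<^sup>2)"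

definition wave :: "complex \<Rightarrow> (real \<Rightarrow> real) \<Rightarrow> real \<Rightarrow> real \<Rightarrow> (real \<Rightarrow> complex) \<Rightarrow> (real \<Rightarrow> complex) \<Rightarrow> bool" where
  "wave k \<epsilon> a b y v \<longleftrightarrow>
     primitive y v a b \<and> primitive v (\<lambda>s. - k\<^sup>2 * of_real (\<epsilon> s) * y s) a b"

text \<open>A wave with y = 0 at the start: its impedance v / (i k y) starts at infinity. The spectral parameter
  has frequency \<alpha> and decay \<beta>.\<close>
locale mode =
  fixes n1 n2 \<alpha> \<beta> T :: real and k :: complex and \<epsilon> :: "real \<Rightarrow> real" and y v :: "real \<Rightarrow> complex"
  assumes n1: "0 < n1" and n12: "n1 < n2" and \<alpha>: "0 < \<alpha>" and \<beta>: "0 < \<beta>" and T: "0 < T"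
    and k: "k = Complex \<alpha> (- \<beta>)"
    and adm: "admissible n1 n2 \<epsilon>"
    and wave: "wave k \<epsilon> 0 T y v"
    and y0: "y 0 = 0" and v0: "v 0 \<noteq> 0"
begin

text \<open>The impedance multiplied by the square of the modulus of k y: it has the argument of the impedance,
  but no poles. The outgoing and incoming amplitudes relative to a medium of index n have as their
  quotient refl the image of the impedance x under (x - n) / (x + n); it is 1 at the start, and 0 when
  the impedance equals n.\<close>
definition flux :: "real \<Rightarrow> complex" where "flux s = v s * cnj (\<i> * k * y s)"
definition outgoing :: "real \<Rightarrow> real \<Rightarrow> complex" where "outgoing n s = v s - \<i> * k * of_real n * y s"
definition incoming :: "real \<Rightarrow> real \<Rightarrow> complex" where "incoming n s = v s + \<i> * k * of_real n * y s"
definition refl :: "real \<Rightarrow> real \<Rightarrow> complex" where "refl n s = outgoing n s / incoming n s"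

lemma n2: "0 < n2" using n1 n12 by simp

lemma eps: "n1\<^sup>2 \<le> \<epsilon> s" "\<epsilon> s \<le> n2\<^sup>2" "0 < \<epsilon> s"
proof -
  show "n1\<^sup>2 \<le> \<epsilon> s" "\<epsilon> s \<le> n2\<^sup>2" using adm by (auto simp: admissible_def)
  then show "0 < \<epsilon> s" using n1 by (meson less_le_trans zero_less_power)
qed

lemma prim_y: "primitive y v 0 T" and prim_v: "primitive v (\<lambda>s. - k\<^sup>2 * of_real (\<epsilon> s) * y s) 0 T"
  using wave by (auto simp: wave_def)

lemma k_nz: "k \<noteq> 0" using k \<alpha> by (auto simp: complex_eq_iff)
lemma Re_k: "Re k = \<alpha>" and Im_k: "Im k = - \<beta>" by (simp_all add: k)

lemma prim_flux: "primitive flux (\<lambda>s. (- k\<^sup>2 * of_real (\<epsilon> s) * y s) * cnj (\<i> * k * y s) + v s * cnj (\<i> * k * v s)) 0 T"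
  unfolding flux_def by (intro primitive_mult primitive_cnj primitive_cmult prim_v prim_y)

lemma flux_deriv:
  "(- k\<^sup>2 * of_real e * z) * cnj (\<i> * k * z) + w * cnj (\<i> * k * w)
   = Complex (\<beta> * ((cmod w)\<^sup>2 + (cmod k)\<^sup>2 * e * (cmod z)\<^sup>2)) (\<alpha> * ((cmod k)\<^sup>2 * e * (cmod z)\<^sup>2 - (cmod w)\<^sup>2))"
proof -
  have "(- k\<^sup>2 * of_real e * z) * cnj (\<i> * k * z) + w * cnj (\<i> * k * w)
     = \<i> * k * of_real ((cmod k)\<^sup>2 * e * (cmod z)\<^sup>2) - \<i> * cnj k * of_real ((cmod w)\<^sup>2)"
    unfolding of_real_mult complex_norm_square by (simp add: power2_eq_square algebra_simps)
  then show ?thesis by (simp add: complex_eq_iff Re_k Im_k algebra_simps)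
qed

lemma prim_Re_flux: "primitive (\<lambda>s. Re (flux s)) (\<lambda>s. \<beta> * ((cmod (v s))\<^sup>2 + (cmod k)\<^sup>2 * \<epsilon> s * (cmod (y s))\<^sup>2)) 0 T"
  using primitive_Re[OF prim_flux] unfolding flux_deriv by simp

lemma prim_Im_flux: "primitive (\<lambda>s. Im (flux s)) (\<lambda>s. \<alpha> * ((cmod k)\<^sup>2 * \<epsilon> s * (cmod (y s))\<^sup>2 - (cmod (v s))\<^sup>2)) 0 T"
  using primitive_Im[OF prim_flux] unfolding flux_deriv by simp

lemma cont_y: "continuous_on {0..T} y" and cont_v: "continuous_on {0..T} v"
  using prim_y prim_v by (auto intro: primitive_continuous)

lemma cont_flux: "continuous_on {0..T} flux"
  using prim_flux by (rule primitive_continuous)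

lemma flux_0: "flux 0 = 0" by (simp add: flux_def y0)

text \<open>Decay keeps the impedance in the right half-plane, hence the reflection coefficient in the unit
  disc.\<close>
lemma Re_flux_pos:
  assumes "0 < s" "s \<le> T" shows "0 < Re (flux s)"
proof -
  have nn: "0 \<le> \<beta> * ((cmod (v u))\<^sup>2 + (cmod k)\<^sup>2 * \<epsilon> u * (cmod (y u))\<^sup>2)" for u
    using \<beta> eps(3)[of u] by simp
  have mono: "Re (flux a) \<le> Re (flux b)" if "0 \<le> a" "a \<le> b" "b \<le> T" for a b
    by (rule primitive_mono[OF primitive_subset[OF prim_Re_flux that(1,3)] that(2) nn])
  obtain d where d: "d > 0" "\<And>s. s \<in> {0..T} \<Longrightarrow> dist s 0 < d \<Longrightarrow> dist (v s) (v 0) < cmod (v 0) / 2"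
    using cont_v[unfolded continuous_on_iff, rule_format, of 0 "cmod (v 0) / 2"] T v0 by auto
  define t where "t = min s (d / 2)"
  have t: "0 < t" "t \<le> s" "t < d" using d assms by (auto simp: t_def)
  have lower: "(cmod (v 0) / 2)\<^sup>2 \<le> (cmod (v u))\<^sup>2" if "u \<in> {0..t}" for u
  proof -
    have "dist (v u) (v 0) < cmod (v 0) / 2" using d(2)[of u] that t assms by (auto simp: dist_real_def)
    then have "cmod (v 0) / 2 \<le> cmod (v u)"
      using norm_triangle_ineq2[of "v 0" "v u"] by (simp add: dist_norm norm_minus_commute)
    then show ?thesis by (intro power_mono) auto
  qed
  have "\<beta> * (cmod (v 0) / 2)\<^sup>2 * t - \<beta> * (cmod (v 0) / 2)\<^sup>2 * 0 \<le> Re (flux t) - Re (flux 0)"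
  proof (rule primitive_le[OF primitive_ident primitive_subset[OF prim_Re_flux]])
    fix u assume "u \<in> {0..t}"
    then have "(cmod (v 0) / 2)\<^sup>2 \<le> (cmod (v u))\<^sup>2 + (cmod k)\<^sup>2 * \<epsilon> u * (cmod (y u))\<^sup>2"
      using lower[of u] eps(3)[of u] by (simp add: add_increasing2)
    then show "\<beta> * (cmod (v 0) / 2)\<^sup>2 \<le> \<beta> * ((cmod (v u))\<^sup>2 + (cmod k)\<^sup>2 * \<epsilon> u * (cmod (y u))\<^sup>2)"
      using \<beta> by simp
  qed (use t assms in auto)
  moreover have "0 < \<beta> * (cmod (v 0) / 2)\<^sup>2 * t" using \<beta> v0 t by simp
  ultimately have "0 < Re (flux t)" by (simp add: flux_0)
  also have "\<dots> \<le> Re (flux s)" using mono[of t s] t assms by simp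
  finally show ?thesis .
qed

lemma y_nz: "0 < s \<Longrightarrow> s \<le> T \<Longrightarrow> y s \<noteq> 0" and v_nz: "0 \<le> s \<Longrightarrow> s \<le> T \<Longrightarrow> v s \<noteq> 0"
proof -
  show "0 < s \<Longrightarrow> s \<le> T \<Longrightarrow> y s \<noteq> 0" using Re_flux_pos[of s] by (auto simp: flux_def)
  show "0 \<le> s \<Longrightarrow> s \<le> T \<Longrightarrow> v s \<noteq> 0"
    using Re_flux_pos[of s] v0 by (cases "s = 0") (auto simp: flux_def)
qed

lemma Re_flux_nonneg: "0 \<le> s \<Longrightarrow> s \<le> T \<Longrightarrow> 0 \<le> Re (flux s)"
  using Re_flux_pos[of s] flux_0 by (cases "s = 0") auto

lemma outgoing_alt: "outgoing n s = v s - of_real n * (\<i> * k * y s)"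
  and incoming_alt: "incoming n s = v s + of_real n * (\<i> * k * y s)"
  and cmod_iky: "(cmod k)\<^sup>2 * (cmod (y s))\<^sup>2 = (cmod (\<i> * k * y s))\<^sup>2"
  by (simp_all add: outgoing_def incoming_def norm_mult power_mult_distrib)

lemma outgoing_incoming: "outgoing n s * cnj (incoming n s) =
    Complex ((cmod (v s))\<^sup>2 - n\<^sup>2 * ((cmod k)\<^sup>2 * (cmod (y s))\<^sup>2)) (2 * n * Im (flux s))"
proof -
  have "(w - of_real n * A) * cnj (w + of_real n * A) = Complex ((cmod w)\<^sup>2 - n\<^sup>2 * (cmod A)\<^sup>2) (2 * n * Im (w * cnj A))"
    for w A :: complex
    unfolding complex_eq_iff cmod_power2 by (simp add: power2_eq_square) (simp add: algebra_simps)
  then show ?thesis unfolding outgoing_alt incoming_alt cmod_iky flux_def .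
qed

lemma cmod_incoming: "(cmod (incoming n s))\<^sup>2 = (cmod (v s))\<^sup>2 + n\<^sup>2 * ((cmod k)\<^sup>2 * (cmod (y s))\<^sup>2) + 2 * n * Re (flux s)"
  and cmod_outgoing: "(cmod (outgoing n s))\<^sup>2 = (cmod (v s))\<^sup>2 + n\<^sup>2 * ((cmod k)\<^sup>2 * (cmod (y s))\<^sup>2) - 2 * n * Re (flux s)"
proof -
  have "(cmod (w + of_real n * A))\<^sup>2 = (cmod w)\<^sup>2 + n\<^sup>2 * (cmod A)\<^sup>2 + 2 * n * Re (w * cnj A)"
       "(cmod (w - of_real n * A))\<^sup>2 = (cmod w)\<^sup>2 + n\<^sup>2 * (cmod A)\<^sup>2 - 2 * n * Re (w * cnj A)"
    for w A :: complex
    unfolding cmod_power2 by (simp_all add: power2_eq_square) (simp_all add: algebra_simps)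
  then show "(cmod (incoming n s))\<^sup>2 = (cmod (v s))\<^sup>2 + n\<^sup>2 * ((cmod k)\<^sup>2 * (cmod (y s))\<^sup>2) + 2 * n * Re (flux s)"
    "(cmod (outgoing n s))\<^sup>2 = (cmod (v s))\<^sup>2 + n\<^sup>2 * ((cmod k)\<^sup>2 * (cmod (y s))\<^sup>2) - 2 * n * Re (flux s)"
    unfolding outgoing_alt incoming_alt cmod_iky flux_def by blast+
qed

lemma incoming_nz:
  assumes "0 \<le> s" "s \<le> T" "0 < n" shows "incoming n s \<noteq> 0"
proof -
  have "0 < (cmod (v s))\<^sup>2" using v_nz[OF assms(1,2)] by simp
  moreover have "0 \<le> n\<^sup>2 * ((cmod k)\<^sup>2 * (cmod (y s))\<^sup>2)" by simp
  moreover have "0 \<le> 2 * n * Re (flux s)" using Re_flux_nonneg[OF assms(1,2)] assms(3) by simp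
  ultimately have "0 < (cmod (incoming n s))\<^sup>2" unfolding cmod_incoming by linarith
  then show ?thesis by auto
qed

lemma refl_eq: "refl n s = outgoing n s * cnj (incoming n s) / of_real ((cmod (incoming n s))\<^sup>2)"
  unfolding refl_def complex_norm_square by (cases "incoming n s = 0") auto

lemma Re_refl: "Re (refl n s) = ((cmod (v s))\<^sup>2 - n\<^sup>2 * ((cmod k)\<^sup>2 * (cmod (y s))\<^sup>2)) / (cmod (incoming n s))\<^sup>2"
  and Im_refl: "Im (refl n s) = 2 * n * Im (flux s) / (cmod (incoming n s))\<^sup>2"
  unfolding refl_eq outgoing_incoming by simp_all

lemma cmod_refl_less:
  assumes "0 < s" "s \<le> T" "0 < n" shows "cmod (refl n s) < 1"
proof -
  have "(cmod (outgoing n s))\<^sup>2 < (cmod (incoming n s))\<^sup>2"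
    unfolding cmod_incoming cmod_outgoing using Re_flux_pos[OF assms(1,2)] assms(3)
    by (smt (verit) mult_pos_pos)
  then have "cmod (outgoing n s) < cmod (incoming n s)" by (rule power2_less_imp_less) simp
  then show ?thesis using incoming_nz[of s n] assms by (simp add: refl_def norm_divide)
qed

lemma refl_0: "refl n 0 = 1" using v0 by (simp add: refl_def outgoing_def incoming_def y0)

lemma cmod_refl_le: "0 \<le> s \<Longrightarrow> s \<le> T \<Longrightarrow> 0 < n \<Longrightarrow> cmod (refl n s) \<le> 1"
  using cmod_refl_less[of s n] refl_0[of n] by (cases "s = 0") auto

text \<open>In the reflection coefficient a layer of constant index n is a rotation and contraction; the
  deviation of the coefficient from the square of n enters through the second term.\<close>
lemma prim_refl:
  assumes n: "0 < n"
  shows "primitive (refl n) (\<lambda>s. - 2 * \<i> * k * of_real n *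
      (refl n s + of_real ((n\<^sup>2 - \<epsilon> s) / (4 * n\<^sup>2)) * (1 - refl n s)\<^sup>2)) 0 T"
proof -
  let ?p = "\<lambda>s. - k\<^sup>2 * of_real (\<epsilon> s) * y s" and ?q = "\<lambda>s. (\<i> * k * of_real n) * v s"
  have W: "primitive (outgoing n) (\<lambda>s. ?p s - ?q s) 0 T"
    unfolding outgoing_def by (intro primitive_diff primitive_cmult prim_v prim_y)
  have V: "primitive (incoming n) (\<lambda>s. ?p s + ?q s) 0 T"
    unfolding incoming_def by (intro primitive_add primitive_cmult prim_v prim_y)
  have Vnz: "incoming n s \<noteq> 0" if "s \<in> {0..T}" for s using incoming_nz n that by auto
  have "primitive (\<lambda>s. inverse (incoming n s)) (\<lambda>s. - (inverse (incoming n s))\<^sup>2 * (?p s + ?q s)) 0 T"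
  proof (rule primitive_compose[OF V])
    show "(inverse has_field_derivative - (inverse (incoming n s))\<^sup>2) (at (incoming n s))" if "s \<in> {0..T}" for s
      using DERIV_inverse[OF Vnz[OF that]] by (simp add: numeral_2_eq_2)
    show "continuous_on (incoming n ` {0..T}) (\<lambda>w. - (inverse w)\<^sup>2)"
      using Vnz by (intro continuous_intros) auto
  qed
  from primitive_mult[OF W this]
  show ?thesis
  proof (rule primitive_cong)
    fix s assume s: "s \<in> {0..T}"
    show "outgoing n s * inverse (incoming n s) = refl n s" by (simp add: refl_def divide_inverse)
    define A where "A = \<i> * k * y s"
    define e where "e = complex_of_real (\<epsilon> s)"
    define m where "m = complex_of_real n"
    define V where "V = incoming n s"
    have Vnz': "V \<noteq> 0" and mnz: "m \<noteq> 0" using Vnz[OF s] n by (auto simp: V_def m_def)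
    have V: "V = v s + m * A" by (simp add: V_def incoming_def A_def m_def)
    have W: "outgoing n s = v s - m * A" by (simp add: outgoing_def A_def m_def)
    have "?p s = (\<i> * \<i>) * (k * k * e * y s)" by (simp add: e_def power2_eq_square)
    also have "\<dots> = \<i> * k * e * A" unfolding A_def by (simp only: mult_ac)
    finally have p: "?p s = \<i> * k * e * A" .
    have q: "?q s = \<i> * k * m * v s" by (simp add: m_def)
    have r: "refl n s = (v s - m * A) / V" by (simp add: refl_def W V_def)
    have 1: "1 - refl n s = 2 * m * A / V" unfolding r using Vnz' by (simp add: V field_simps)
    have "(?p s - ?q s) * inverse V + (v s - m * A) * (- (inverse V)\<^sup>2 * (?p s + ?q s))
        = ((?p s - ?q s) * V - (v s - m * A) * (?p s + ?q s)) / V\<^sup>2"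
      using Vnz' by (simp add: field_simps power2_eq_square)
    also have "(?p s - ?q s) * V - (v s - m * A) * (?p s + ?q s) = - 2 * \<i> * k * m * ((v s)\<^sup>2 - e * A\<^sup>2)"
      unfolding p q V by (simp add: algebra_simps power2_eq_square)
    also have "\<dots> / V\<^sup>2 = - 2 * \<i> * k * m * (((v s)\<^sup>2 - e * A\<^sup>2) / V\<^sup>2)" by simp
    also have "((v s)\<^sup>2 - e * A\<^sup>2) / V\<^sup>2 = refl n s + ((m\<^sup>2 - e) / (4 * m\<^sup>2)) * (1 - refl n s)\<^sup>2"
    proof -
      have "((m\<^sup>2 - e) / (4 * m\<^sup>2)) * (1 - refl n s)\<^sup>2 = (m\<^sup>2 - e) * A\<^sup>2 / V\<^sup>2"
        unfolding 1 using mnz Vnz' by (simp add: power_divide power_mult_distrib field_simps)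
      moreover have "refl n s = ((v s)\<^sup>2 - m\<^sup>2 * A\<^sup>2) / V\<^sup>2"
      proof -
        have "(v s)\<^sup>2 - m\<^sup>2 * A\<^sup>2 = (v s - m * A) * V" by (simp add: V power2_eq_square algebra_simps)
        then show ?thesis unfolding r using Vnz' by (simp add: power2_eq_square)
      qed
      ultimately show ?thesis by (simp add: add_divide_distrib[symmetric] algebra_simps)
    qed
    finally show "(?p s - ?q s) * inverse (incoming n s) + outgoing n s * (- (inverse (incoming n s))\<^sup>2 * (?p s + ?q s))
       = - 2 * \<i> * k * of_real n * (refl n s + of_real ((n\<^sup>2 - \<epsilon> s) / (4 * n\<^sup>2)) * (1 - refl n s)\<^sup>2)"
      by (simp add: W V_def m_def e_def)
  qed
qed

end

section \<open>The first crossing of the real axis\<close>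

lemma mult_cos_le_sin:
  fixes x :: real assumes "0 \<le> x" "x \<le> pi" shows "x * cos x \<le> sin x"
proof -
  have "sin 0 - 0 * cos 0 \<le> sin x - x * cos (x::real)"
  proof (rule DERIV_nonneg_imp_nondecreasing[OF assms(1)])
    fix t assume t: "0 \<le> t" "t \<le> x"
    have "((\<lambda>x. sin x - x * cos x) has_real_derivative t * sin t) (at t)"
      by (auto intro!: derivative_eq_intros)
    moreover have "0 \<le> t * sin t" using t assms sin_ge_zero[of t] by simp
    ultimately show "\<exists>y. ((\<lambda>x. sin x - x * cos x) has_real_derivative y) (at t) \<and> 0 \<le> y" by blast
  qed
  then show ?thesis by simp
qed

lemma sinh_le_mult_cosh:
  fixes x :: real assumes "0 \<le> x" shows "sinh x \<le> x * cosh x"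
proof -
  have "0 * cosh 0 - sinh 0 \<le> x * cosh x - sinh (x::real)"
  proof (rule DERIV_nonneg_imp_nondecreasing[OF assms(1)])
    fix t assume t: "0 \<le> t" "t \<le> x"
    have "((\<lambda>x. x * cosh x - sinh x) has_real_derivative t * sinh t) (at t)"
      by (auto intro!: derivative_eq_intros)
    moreover have "0 \<le> t * sinh t" using t by simp
    ultimately show "\<exists>y. ((\<lambda>x. x * cosh x - sinh x) has_real_derivative y) (at t) \<and> 0 \<le> y" by blast
  qed
  then show ?thesis by simp
qed

lemma cosh_minus_one_le:
  fixes x :: real assumes "0 \<le> x" shows "cosh x - 1 \<le> x / 2 * sinh x"
proof -
  have "0 / 2 * sinh 0 - (cosh 0 - 1) \<le> x / 2 * sinh x - (cosh (x::real) - 1)"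
  proof (rule DERIV_nonneg_imp_nondecreasing[OF assms(1)])
    fix t assume t: "0 \<le> t" "t \<le> x"
    have "((\<lambda>x. x / 2 * sinh x - (cosh x - 1)) has_real_derivative (t * cosh t - sinh t) / 2) (at t)"
      by (auto intro!: derivative_eq_intros simp: field_simps)
    moreover have "0 \<le> (t * cosh t - sinh t) / 2" using sinh_le_mult_cosh[OF t(1)] by simp
    ultimately show "\<exists>y. ((\<lambda>x. x / 2 * sinh x - (cosh x - 1)) has_real_derivative y) (at t) \<and> 0 \<le> y" by blast
  qed
  then show ?thesis by simp
qed

text \<open>The speed gained by lowering the coefficient is controlled by the deflection it causes.\<close>
lemma speed_gain_le_deflection:
  fixes p q a b :: real
  assumes "0 \<le> p" "0 \<le> q" "q \<le> pi" "0 < a" "0 < b" "a * p \<le> b * q"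
  shows "a * (cosh p * cos q - 1) \<le> b / 2 * (sinh p * sin q)"
proof (cases "0 \<le> cos q")
  case True
  have "cosh p * cos q - 1 \<le> cosh p * cos q - cos q" by simp
  also have "\<dots> = (cosh p - 1) * cos q" by (simp add: algebra_simps)
  also have "\<dots> \<le> (p / 2 * sinh p) * cos q"
    using cosh_minus_one_le[OF assms(1)] True by (intro mult_right_mono)
  finally have "a * (cosh p * cos q - 1) \<le> a * ((p / 2 * sinh p) * cos q)" using assms by simp
  also have "\<dots> = (a * p) * (sinh p * cos q / 2)" by simp
  also have "\<dots> \<le> (b * q) * (sinh p * cos q / 2)"
    using assms True by (intro mult_right_mono) auto
  also have "\<dots> = (b / 2 * sinh p) * (q * cos q)" by simp
  also have "\<dots> \<le> (b / 2 * sinh p) * sin q"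
    using mult_cos_le_sin[OF assms(2,3)] assms by (intro mult_left_mono) auto
  finally show ?thesis by simp
next
  case False
  have "cosh p * cos q \<le> 0" using False by (intro mult_nonneg_nonpos) auto
  then have "cosh p * cos q - 1 \<le> 0" by simp
  then have "a * (cosh p * cos q - 1) \<le> 0" using assms by (simp add: mult_nonneg_nonpos)
  also have "0 \<le> b / 2 * (sinh p * sin q)" using assms sin_ge_zero[of q] by simp
  finally show ?thesis .
qed

text \<open>The nonlinear term of the equation for the reflection coefficient in logarithmic coordinates.\<close>
lemma joukowski_exp:
  assumes r: "r = exp (- z)"
  shows "(1 - r)\<^sup>2 / r = 2 * Complex (cosh (Re z) * cos (Im z) - 1) (sinh (Re z) * sin (Im z))"
proof -
  have "(1 - r)\<^sup>2 / r = r + inverse r - 2"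
    using r by (simp add: power2_eq_square field_simps)
  also have "\<dots> = exp (- z) + exp z - 2" by (simp add: r exp_minus)
  also have "\<dots> = 2 * Complex (cosh (Re z) * cos (Im z) - 1) (sinh (Re z) * sin (Im z))"
    by (simp add: complex_eq_iff Re_exp Im_exp cosh_def sinh_def field_simps)
  finally show ?thesis .
qed

context mode begin

text \<open>In the logarithmic coordinates p and q of the reflection coefficient, along any branch, a layer of
  index n moves the state along a straight line of direction (\<beta>, \<alpha>), and D measures the
  deviation of the coefficient from the square of n.\<close>
lemma prim_log_refl:
  fixes L :: "complex \<Rightarrow> complex"
  assumes n: "0 < n" and ab: "0 \<le> a" "b \<le> T"
    and nz: "\<And>s. s \<in> {a..b} \<Longrightarrow> refl n s \<noteq> 0"
    and L: "\<And>s. s \<in> {a..b} \<Longrightarrow> (L has_field_derivative inverse (refl n s)) (at (refl n s))"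
    and eL: "\<And>s. s \<in> {a..b} \<Longrightarrow> exp (L (refl n s)) = refl n s"
  defines "p \<equiv> \<lambda>s. - Re (L (refl n s))" and "q \<equiv> \<lambda>s. - Im (L (refl n s))"
    and "D \<equiv> \<lambda>s. (n\<^sup>2 - \<epsilon> s) / (2 * n\<^sup>2)"
  shows "primitive p (\<lambda>s. 2 * n * (\<beta> * (1 + D s * (cosh (p s) * cos (q s) - 1)) - \<alpha> * (D s * (sinh (p s) * sin (q s))))) a b"
    "primitive q (\<lambda>s. 2 * n * (\<alpha> * (1 + D s * (cosh (p s) * cos (q s) - 1)) + \<beta> * (D s * (sinh (p s) * sin (q s))))) a b"
proof -
  let ?R = "\<lambda>s. - 2 * \<i> * k * of_real n * (refl n s + of_real ((n\<^sup>2 - \<epsilon> s) / (4 * n\<^sup>2)) * (1 - refl n s)\<^sup>2)"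
  have "primitive (\<lambda>s. L (refl n s)) (\<lambda>s. inverse (refl n s) * ?R s) a b"
  proof (rule primitive_compose[OF primitive_subset[OF prim_refl[OF n] ab]])
    show "(L has_field_derivative inverse (refl n s)) (at (refl n s))" if "s \<in> {a..b}" for s using L[OF that] .
    show "continuous_on (refl n ` {a..b}) inverse" using nz by (intro continuous_intros) auto
  qed
  from primitive_minus[OF this]
  have z: "primitive (\<lambda>s. - L (refl n s)) (\<lambda>s. 2 * of_real n * Complex (\<beta> * (1 + D s * (cosh (p s) * cos (q s) - 1)) - \<alpha> * (D s * (sinh (p s) * sin (q s))))
      (\<alpha> * (1 + D s * (cosh (p s) * cos (q s) - 1)) + \<beta> * (D s * (sinh (p s) * sin (q s))))) a b"
  proof (rule primitive_cong)
    fix s assume s: "s \<in> {a..b}"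
    have e: "refl n s = exp (- (- L (refl n s)))" using eL[OF s] by simp
    have J: "(1 - refl n s)\<^sup>2 / refl n s = 2 * Complex (cosh (p s) * cos (q s) - 1) (sinh (p s) * sin (q s))"
      using joukowski_exp[OF e] by (simp add: p_def q_def)
    have "- (inverse (refl n s) * ?R s) = 2 * of_real n * (\<i> * k) * (1 + of_real ((n\<^sup>2 - \<epsilon> s) / (4 * n\<^sup>2)) * ((1 - refl n s)\<^sup>2 / refl n s))"
    proof -
      have "- (inverse r * (- 2 * \<i> * k * m * (r + e * X))) = 2 * m * (\<i> * k) * (1 + e * (X / r))"
        if "r \<noteq> 0" for r e X m :: complex using that by (simp add: field_simps)
      then show ?thesis using nz[OF s] by blast
    qed
    also have "\<dots> = 2 * of_real n * (\<i> * k) * (1 + of_real (D s) * Complex (cosh (p s) * cos (q s) - 1) (sinh (p s) * sin (q s)))"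
      unfolding J D_def by simp
    also have "\<i> * k = Complex \<beta> \<alpha>" by (simp add: k complex_eq_iff)
    finally show "- (inverse (refl n s) * ?R s) = 2 * of_real n * Complex (\<beta> * (1 + D s * (cosh (p s) * cos (q s) - 1)) - \<alpha> * (D s * (sinh (p s) * sin (q s))))
      (\<alpha> * (1 + D s * (cosh (p s) * cos (q s) - 1)) + \<beta> * (D s * (sinh (p s) * sin (q s))))"
      by (simp add: complex_eq_iff algebra_simps)
  qed simp
  show "primitive p (\<lambda>s. 2 * n * (\<beta> * (1 + D s * (cosh (p s) * cos (q s) - 1)) - \<alpha> * (D s * (sinh (p s) * sin (q s))))) a b"
    using primitive_Re[OF z] by (simp add: p_def)
  show "primitive q (\<lambda>s. 2 * n * (\<alpha> * (1 + D s * (cosh (p s) * cos (q s) - 1)) + \<beta> * (D s * (sinh (p s) * sin (q s))))) a b"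
    using primitive_Im[OF z] by (simp add: q_def)
qed

end

text \<open>While the impedance is in the closed lower half-plane the reflection coefficient may reach the
  negative real axis, where the principal logarithm jumps. The branch used here has its cut on the
  positive imaginary axis.\<close>
lemma lower_branch_Ln:
  fixes r :: complex assumes "r \<noteq> 0" "Im r \<le> 0"
  shows "((\<lambda>w. Ln (\<i> * w) - \<i> * of_real pi / 2) has_field_derivative inverse r) (at r)"
    "exp (Ln (\<i> * r) - \<i> * of_real pi / 2) = r"
    "- pi \<le> Im (Ln (\<i> * r) - \<i> * of_real pi / 2)" "Im (Ln (\<i> * r) - \<i> * of_real pi / 2) \<le> 0"
proof -
  have re: "0 \<le> Re (\<i> * r)" "\<i> * r \<noteq> 0" using assms by auto
  then have nr: "\<i> * r \<notin> \<real>\<^sub>\<le>\<^sub>0" by (auto simp: complex_nonpos_Reals_iff complex_eq_iff)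
  show "((\<lambda>w. Ln (\<i> * w) - \<i> * of_real pi / 2) has_field_derivative inverse r) (at r)"
    using nr re by (auto intro!: derivative_eq_intros simp: field_simps)
  have "exp (\<i> * of_real pi / 2) = \<i>"
    using exp_Euler[of "of_real (pi/2)"] by (simp flip: cos_of_real sin_of_real)
  then show "exp (Ln (\<i> * r) - \<i> * of_real pi / 2) = r"
    using re by (simp add: exp_diff)
  have "\<bar>Im (Ln (\<i> * r))\<bar> \<le> pi / 2" using Re_Ln_pos_le[OF re(2)] re(1) by simp
  then show "- pi \<le> Im (Ln (\<i> * r) - \<i> * of_real pi / 2)" "Im (Ln (\<i> * r) - \<i> * of_real pi / 2) \<le> 0" by auto
qed

context mode begin

lemma cont_refl: "0 < n \<Longrightarrow> continuous_on {0..T} (refl n)"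
  by (rule primitive_continuous[OF prim_refl])

abbreviation "lower_log w \<equiv> Ln (\<i> * w) - \<i> * of_real pi / 2"

text \<open>As long as the impedance stays in the lower half-plane the trajectory can only be deflected to one
  side of the straight line that it follows for the constant coefficient n2^2, because \<beta> q -
  \<alpha> p grows at a rate proportional to n2^2 - \<epsilon>. The same rate controls the angular
  speed that can be gained by the deflection.\<close>
lemma below_axis_deflection:
  assumes t: "0 \<le> t" "t \<le> T"
    and nz_ball: "\<forall>s\<in>{0..t}. refl n2 s \<noteq> 0" and neg: "\<forall>s\<in>{0..t}. Im (flux s) \<le> 0"
  defines "p \<equiv> \<lambda>s. - Re (lower_log (refl n2 s))" and "q \<equiv> \<lambda>s. - Im (lower_log (refl n2 s))"
    and "G \<equiv> \<lambda>s. 2 * n2 * ((\<alpha>\<^sup>2 + \<beta>\<^sup>2) * ((n2\<^sup>2 - \<epsilon> s) / (2 * n2\<^sup>2) *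
        (sinh (- Re (lower_log (refl n2 s))) * sin (- Im (lower_log (refl n2 s))))))"
  shows "primitive (\<lambda>s. \<beta> * q s - \<alpha> * p s) G 0 t" and "\<And>s. s \<in> {0..t} \<Longrightarrow> 0 \<le> G s"
    and "p 0 = 0" "q 0 = 0" "\<And>s. s \<in> {0..t} \<Longrightarrow> \<alpha> * p s \<le> \<beta> * q s"
    and "q t \<le> 2 * n2 * \<alpha> * t + 3 / 2 * \<beta> * (\<beta> * q t - \<alpha> * p t) / (\<alpha>\<^sup>2 + \<beta>\<^sup>2)"
    and "\<And>s. s \<in> {0..t} \<Longrightarrow> 0 \<le> q s \<and> q s \<le> pi" "\<And>s. s \<in> {0..t} \<Longrightarrow> p s = - ln (cmod (refl n2 s))"
    and "\<And>s. s \<in> {0..t} \<Longrightarrow> refl n2 s = exp (- Complex (p s) (q s))"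
proof -
  define D where "D = (\<lambda>s. (n2\<^sup>2 - \<epsilon> s) / (2 * n2\<^sup>2))"
  define C where "C = (\<lambda>s. cosh (p s) * cos (q s) - 1)"
  define S where "S = (\<lambda>s. sinh (p s) * sin (q s))"
  have nz: "refl n2 s \<noteq> 0" if "s \<in> {0..t}" for s using nz_ball that by blast
  have Im: "Im (refl n2 s) \<le> 0" if "s \<in> {0..t}" for s
    unfolding Im_refl using neg[rule_format, OF that] n2 by (simp add: divide_nonpos_nonneg mult_nonneg_nonpos)
  note L = lower_branch_Ln[OF nz Im]
  note P = prim_log_refl[OF n2 order_refl t(2) nz L(1) L(2), folded p_def q_def, folded D_def C_def S_def]
  have Pp: "primitive p (\<lambda>s. 2 * n2 * (\<beta> * (1 + D s * C s) - \<alpha> * (D s * S s))) 0 t"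
    and Pq: "primitive q (\<lambda>s. 2 * n2 * (\<alpha> * (1 + D s * C s) + \<beta> * (D s * S s))) 0 t"
    using P unfolding p_def q_def D_def C_def S_def by blast+
  have D: "0 \<le> D s" for s using eps(2)[of s] n2 by (simp add: D_def)
  show q: "0 \<le> q s \<and> q s \<le> pi" if "s \<in> {0..t}" for s
    using L(3,4)[OF that that] unfolding q_def by linarith
  show pe: "p s = - ln (cmod (refl n2 s))" if "s \<in> {0..t}" for s
  proof -
    have "cmod (refl n2 s) = exp (Re (lower_log (refl n2 s)))" using L(2)[OF that that] by (metis norm_exp_eq_Re)
    then show ?thesis by (simp add: p_def)
  qed
  show "refl n2 s = exp (- Complex (p s) (q s))" if "s \<in> {0..t}" for s
  proof -
    have "- Complex (p s) (q s) = lower_log (refl n2 s)" by (simp add: complex_eq_iff p_def q_def)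
    then show ?thesis using L(2)[OF that that] by simp
  qed
  have p: "0 \<le> p s" if "s \<in> {0..t}" for s
    using pe[OF that] cmod_refl_le[of s n2] nz[OF that] that t n2 by simp
  have S: "0 \<le> S s" if "s \<in> {0..t}" for s
    using p[OF that] q[OF that] sin_ge_zero[of "q s"] by (simp add: S_def)
  have G: "G s = 2 * n2 * ((\<alpha>\<^sup>2 + \<beta>\<^sup>2) * (D s * S s))" for s
    by (simp add: G_def D_def S_def p_def q_def)
  show PG: "primitive (\<lambda>s. \<beta> * q s - \<alpha> * p s) G 0 t"
    by (rule primitive_cong[OF primitive_diff[OF primitive_cmult[OF Pq, of \<beta>] primitive_cmult[OF Pp, of \<alpha>]]])
       (simp_all add: G algebra_simps power2_eq_square)
  show Gn: "0 \<le> G s" if "s \<in> {0..t}" for s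
    unfolding G using n2 D[of s] S[OF that] by simp
  have i0: "Ln (\<i> * refl n2 0) - \<i> * of_real pi / 2 = 0" by (simp add: refl_0)
  show p0: "p 0 = 0" and q0: "q 0 = 0" unfolding p_def q_def i0 by simp_all
  show apq: "\<alpha> * p s \<le> \<beta> * q s" if "s \<in> {0..t}" for s
  proof -
    have "\<beta> * q 0 - \<alpha> * p 0 \<le> \<beta> * q s - \<alpha> * p s"
      by (rule primitive_mono[OF primitive_subset[OF PG]]) (use that Gn in auto)
    then show ?thesis by (simp add: p0 q0)
  qed
  define c where "c = 3 / 2 * \<beta> / (\<alpha>\<^sup>2 + \<beta>\<^sup>2)"
  have ab: "0 < \<alpha>\<^sup>2 + \<beta>\<^sup>2" using \<alpha> \<beta> by (simp add: add_pos_pos)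
  have "q t - q 0 \<le> (2 * n2 * \<alpha> * t + c * (\<beta> * q t - \<alpha> * p t)) - (2 * n2 * \<alpha> * 0 + c * (\<beta> * q 0 - \<alpha> * p 0))"
  proof (rule primitive_le[OF Pq primitive_add[OF primitive_ident primitive_cmult[OF PG]] t(1)])
    fix s assume s: "s \<in> {0..t}"
    have "\<alpha> * C s \<le> \<beta> / 2 * S s"
      unfolding C_def S_def using p[OF s] q[OF s] apq[OF s] \<alpha> \<beta> by (intro speed_gain_le_deflection) auto
    then have "D s * (\<alpha> * C s) \<le> D s * (\<beta> / 2 * S s)" using D by (rule mult_left_mono)
    then have "\<alpha> * (1 + D s * C s) + \<beta> * (D s * S s) \<le> \<alpha> + 3 / 2 * \<beta> * (D s * S s)"
      by (simp add: algebra_simps)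
    then have "2 * n2 * (\<alpha> * (1 + D s * C s) + \<beta> * (D s * S s)) \<le> 2 * n2 * (\<alpha> + 3 / 2 * \<beta> * (D s * S s))"
      using n2 by simp
    also have "\<dots> = 2 * n2 * \<alpha> + c * G s" unfolding G c_def using ab by (simp add: field_simps)
    finally show "2 * n2 * (\<alpha> * (1 + D s * C s) + \<beta> * (D s * S s)) \<le> 2 * n2 * \<alpha> + c * G s" .
  qed
  then show "q t \<le> 2 * n2 * \<alpha> * t + 3 / 2 * \<beta> * (\<beta> * q t - \<alpha> * p t) / (\<alpha>\<^sup>2 + \<beta>\<^sup>2)"
    by (simp add: p0 q0 c_def)
qed

lemma Im_flux_neg_imp_refl_nz: "0 \<le> s \<Longrightarrow> s \<le> T \<Longrightarrow> 0 < n \<Longrightarrow> Im (flux s) < 0 \<Longrightarrow> refl n s \<noteq> 0"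
  using Im_refl[of n s] incoming_nz[of s n] by auto

text \<open>At the crossing q = \<pi>, and the deflection estimate bounds p from above and the elapsed time from
  below. If p is as large as possible, the deflection vanishes, and with it the deviation of the
  coefficient from n2^2.\<close>
lemma first_crossing:
  assumes t1: "0 < t1" "t1 \<le> T" and neg: "\<And>s. 0 < s \<Longrightarrow> s < t1 \<Longrightarrow> Im (flux s) < 0"
    and zero: "Im (flux t1) = 0"
  obtains p where "0 < p" "refl n2 t1 = - of_real (exp (- p))" "\<alpha> * p \<le> \<beta> * pi"
    "pi \<le> 2 * n2 * \<alpha> * t1 + 3 / 2 * \<beta> * (\<beta> * pi - \<alpha> * p) / (\<alpha>\<^sup>2 + \<beta>\<^sup>2)"
    "\<alpha> * p = \<beta> * pi \<Longrightarrow> negligible {s \<in> {0..t1}. \<epsilon> s \<noteq> n2\<^sup>2}"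
proof -
  have nz: "refl n2 s \<noteq> 0" if "0 \<le> s" "s < t1" for s
    using that t1 neg[of s] Im_flux_neg_imp_refl_nz[of s n2] refl_0[of n2] n2 by (cases "s = 0") auto
  have le: "Im (flux s) \<le> 0" if "0 \<le> s" "s \<le> t1" for s
  proof -
    consider "s = 0" | "0 < s" "s < t1" | "s = t1" using \<open>0 \<le> s\<close> \<open>s \<le> t1\<close> by linarith
    then show ?thesis using neg[of s] zero flux_0 by cases auto
  qed
  have low: "exp (- (\<beta> * pi / \<alpha>)) \<le> cmod (refl n2 t)" if t: "0 \<le> t" "t < t1" for t
  proof -
    have t': "0 \<le> t" "t \<le> T" using t t1 by auto
    have h: "\<forall>s\<in>{0..t}. refl n2 s \<noteq> 0" "\<forall>s\<in>{0..t}. Im (flux s) \<le> 0" using nz le t by auto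
    note B = below_axis_deflection[OF t' h]
    have "\<alpha> * - ln (cmod (refl n2 t)) \<le> \<beta> * pi"
    proof -
      have a: "\<alpha> * - Re (lower_log (refl n2 t)) \<le> \<beta> * - Im (lower_log (refl n2 t))"
        using B(5)[of t] t t1 by auto
      have b: "- Im (lower_log (refl n2 t)) \<le> pi" using B(7)[of t] t t1 by auto
      have c: "- Re (lower_log (refl n2 t)) = - ln (cmod (refl n2 t))" using B(8)[of t] t t1 by auto
      have "\<beta> * - Im (lower_log (refl n2 t)) \<le> \<beta> * pi" using b \<beta> by (intro mult_left_mono) auto
      then show ?thesis using a unfolding c by linarith
    qed
    then have "- (\<beta> * pi / \<alpha>) \<le> ln (cmod (refl n2 t))" using \<alpha> by (simp add: field_simps)
    then show ?thesis using nz[OF t] by (metis exp_le_cancel_iff exp_ln zero_less_norm_iff)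
  qed
  have nz1: "refl n2 t1 \<noteq> 0"
  proof
    assume 0: "refl n2 t1 = 0"
    define c where "c = exp (- (\<beta> * pi / \<alpha>))"
    have "c > 0" by (simp add: c_def)
    then obtain d where d: "d > 0" "\<And>s. s \<in> {0..T} \<Longrightarrow> dist s t1 < d \<Longrightarrow> dist (refl n2 s) (refl n2 t1) < c"
      using cont_refl[OF n2, unfolded continuous_on_iff, rule_format, of t1 c] t1 by auto
    define s where "s = max (t1 / 2) (t1 - d / 2)"
    have s: "0 \<le> s" "s < t1" "dist s t1 < d" using d t1 by (auto simp: s_def dist_real_def max_def)
    have "dist (refl n2 s) 0 < c" using d(2)[of s] s t1 0 by auto
    then show False using low[OF s(1,2)] by (simp add: c_def)
  qed
  have nz': "refl n2 s \<noteq> 0" if "s \<in> {0..t1}" for s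
    using nz[of s] nz1 that by (cases "s = t1") auto
  have h: "\<forall>s\<in>{0..t1}. refl n2 s \<noteq> 0" "\<forall>s\<in>{0..t1}. Im (flux s) \<le> 0" using nz' le by auto
  have t1': "0 \<le> t1" using t1 by simp
  note B = below_axis_deflection[OF t1' t1(2) h]
  define p where "p = (\<lambda>s. - Re (lower_log (refl n2 s)))"
  define q where "q = (\<lambda>s. - Im (lower_log (refl n2 s)))"
  have pq: "\<And>s. - Re (lower_log (refl n2 s)) = p s" "\<And>s. - Im (lower_log (refl n2 s)) = q s"
    by (simp_all add: p_def q_def)
  note B = B[unfolded pq]
  have m1: "t1 \<in> {0..t1}" using t1 by simp
  have p1: "0 < p t1"
    using B(8)[OF m1] cmod_refl_less[OF t1 n2] nz1 by simp
  have re: "refl n2 s = of_real (exp (- p s)) * Complex (cos (q s)) (- sin (q s))" if "s \<in> {0..t1}" for s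
    using B(9)[OF that] by (simp add: complex_eq_iff Re_exp Im_exp)
  have "sin (q t1) = 0"
    using re[OF m1] Im_refl[of n2 t1] zero by simp
  moreover have "0 \<le> q t1" "q t1 \<le> pi" using B(7)[OF m1] by auto
  moreover have "q t1 \<noteq> 0" using B(5)[OF m1] p1 \<alpha> by (auto simp: mult_le_0_iff)
  ultimately have q1: "q t1 = pi"
    using sin_gt_zero[of "q t1"] by (cases "q t1 = pi") auto
  show ?thesis
  proof (rule that[of "p t1"])
    show "0 < p t1" by (rule p1)
    show "refl n2 t1 = - of_real (exp (- p t1))" using re[OF m1] by (simp add: q1 complex_eq_iff)
    show "\<alpha> * p t1 \<le> \<beta> * pi" using B(5)[OF m1] by (simp add: q1)
    show "pi \<le> 2 * n2 * \<alpha> * t1 + 3 / 2 * \<beta> * (\<beta> * pi - \<alpha> * p t1) / (\<alpha>\<^sup>2 + \<beta>\<^sup>2)"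
      using B(6) by (simp add: q1)
    assume eq: "\<alpha> * p t1 = \<beta> * pi"
    have "negligible {s \<in> {0..t1}. 2 * n2 * ((\<alpha>\<^sup>2 + \<beta>\<^sup>2) * ((n2\<^sup>2 - \<epsilon> s) / (2 * n2\<^sup>2) *
        (sinh (p s) * sin (q s)))) \<noteq> 0}"
      using primitive_zero_negligible[OF B(1) B(2) t1'] eq q1 B(3,4) by simp
    then have "negligible ({s \<in> {0..t1}. 2 * n2 * ((\<alpha>\<^sup>2 + \<beta>\<^sup>2) * ((n2\<^sup>2 - \<epsilon> s) / (2 * n2\<^sup>2) *
        (sinh (p s) * sin (q s)))) \<noteq> 0} \<union> {0, t1})"
      by (intro negligible_Un) auto
    then show "negligible {s \<in> {0..t1}. \<epsilon> s \<noteq> n2\<^sup>2}"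
    proof (rule negligible_subset, intro subsetI)
      fix s assume s: "s \<in> {s \<in> {0..t1}. \<epsilon> s \<noteq> n2\<^sup>2}"
      show "s \<in> {s \<in> {0..t1}. 2 * n2 * ((\<alpha>\<^sup>2 + \<beta>\<^sup>2) * ((n2\<^sup>2 - \<epsilon> s) / (2 * n2\<^sup>2) *
        (sinh (p s) * sin (q s)))) \<noteq> 0} \<union> {0, t1}"
      proof (cases "s = 0 \<or> s = t1")
        case False
        then have s': "0 < s" "s < t1" "s \<in> {0..t1}" using s by auto
        have "Im (refl n2 s) < 0" unfolding Im_refl
          using neg[OF s'(1,2)] n2 incoming_nz[of s n2] s' t1 by (simp add: divide_neg_pos mult_pos_neg)
        then have "sin (q s) \<noteq> 0" using re[OF s'(3)] by auto
        moreover have "p s > 0"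
          using B(8)[OF s'(3)] cmod_refl_less[of s n2] nz'[OF s'(3)] s' t1 n2 by simp
        moreover have "\<alpha>\<^sup>2 + \<beta>\<^sup>2 \<noteq> 0" using \<alpha> by (simp add: sum_power2_eq_zero_iff)
        ultimately show ?thesis using s n2 by simp
      qed auto
    qed
  qed
qed

end

section \<open>The detour of a trajectory that overshoots the target\<close>

context mode begin

text \<open>The reflection coefficient relative to n1 turns fastest for the coefficient n2^2 on the unit circle,
  where p = 0.\<close>
lemma quarter_wave_speed:
  fixes p q e :: real
  assumes "0 \<le> p" "0 \<le> q" "q \<le> pi / 2" "n1\<^sup>2 \<le> e" "e \<le> n2\<^sup>2"
  shows "2 * n1 * (\<alpha> * (1 + (n1\<^sup>2 - e) / (2 * n1\<^sup>2) * (cosh p * cos q - 1)) + \<beta> * ((n1\<^sup>2 - e) / (2 * n1\<^sup>2) * (sinh p * sin q)))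
    \<le> 2 * n1 * \<alpha> * ((cos (q / 2))\<^sup>2 + (n2 / n1)\<^sup>2 * (sin (q / 2))\<^sup>2)"
proof -
  define D where "D = (n1\<^sup>2 - e) / (2 * n1\<^sup>2)"
  have D: "D \<le> 0" using assms n1 by (simp add: D_def divide_nonpos_pos)
  have D2: "- D \<le> (n2\<^sup>2 - n1\<^sup>2) / (2 * n1\<^sup>2)"
    using assms n1 unfolding D_def minus_divide_left by (intro divide_right_mono) auto
  have "0 \<le> sinh p * sin q" using assms sin_ge_zero[of q] by simp
  then have 1: "\<beta> * (D * (sinh p * sin q)) \<le> 0" using D \<beta> by (simp add: mult_nonneg_nonpos mult_nonpos_nonneg)
  have "cos q \<le> cosh p * cos q" using cos_ge_zero[of q] assms by (simp add: mult_le_cancel_right1 cosh_real_ge_1)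
  then have "D * (cosh p * cos q - 1) \<le> D * (cos q - 1)" using D by (intro mult_left_mono_neg) auto
  also have "\<dots> = (- D) * (1 - cos q)" by (simp add: algebra_simps)
  also have "\<dots> \<le> (n2\<^sup>2 - n1\<^sup>2) / (2 * n1\<^sup>2) * (1 - cos q)" using D2 by (intro mult_right_mono) auto
  also have "1 - cos q = 2 * (sin (q / 2))\<^sup>2" using cos_double_sin[of "q / 2"] by simp
  also have "(n2\<^sup>2 - n1\<^sup>2) / (2 * n1\<^sup>2) * (2 * (sin (q / 2))\<^sup>2) = (n2 / n1)\<^sup>2 * (sin (q / 2))\<^sup>2 - (sin (q / 2))\<^sup>2"
    using n1 by (simp add: power_divide field_simps)
  finally have "1 + D * (cosh p * cos q - 1) \<le> (cos (q / 2))\<^sup>2 + (n2 / n1)\<^sup>2 * (sin (q / 2))\<^sup>2"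
    using sin_cos_squared_add[of "q / 2"] by linarith
  then have "\<alpha> * (1 + D * (cosh p * cos q - 1)) \<le> \<alpha> * ((cos (q / 2))\<^sup>2 + (n2 / n1)\<^sup>2 * (sin (q / 2))\<^sup>2)"
    using \<alpha> by simp
  then have "\<alpha> * (1 + D * (cosh p * cos q - 1)) + \<beta> * (D * (sinh p * sin q)) \<le> \<alpha> * ((cos (q / 2))\<^sup>2 + (n2 / n1)\<^sup>2 * (sin (q / 2))\<^sup>2)"
    using 1 by linarith
  from mult_left_mono[OF this, of "2 * n1"] n1 show ?thesis by (simp add: D_def mult.assoc)
qed

text \<open>A transit from the real axis to the circle of radius n1 in the lower half-plane, which is q = 0 to q
  = \<pi> / 2. The angle arctan (n2 / n1 * tan (q / 2)) has constant speed n2 \<alpha> under the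
  fastest motion and increases by arctan (n2 / n1).\<close>
lemma quarter_wave_transit:
  assumes ab: "0 \<le> a" "a \<le> b" "b \<le> T"
    and im: "\<And>s. s \<in> {a..b} \<Longrightarrow> Im (refl n1 s) \<le> 0" and re: "\<And>s. s \<in> {a..b} \<Longrightarrow> 0 \<le> Re (refl n1 s)"
    and nz: "\<And>s. s \<in> {a..b} \<Longrightarrow> refl n1 s \<noteq> 0"
    and start: "Im (refl n1 a) = 0" and stop: "Re (refl n1 b) = 0"
  shows "arctan (n2 / n1) \<le> n2 * \<alpha> * (b - a)"
proof -
  define p where "p = (\<lambda>s. - Re (Ln (refl n1 s)))"
  define q where "q = (\<lambda>s. - Im (Ln (refl n1 s)))"
  have nr: "refl n1 s \<notin> \<real>\<^sub>\<le>\<^sub>0" if "s \<in> {a..b}" for s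
    using re[OF that] nz[OF that] by (auto simp: complex_nonpos_Reals_iff complex_eq_iff)
  have der: "(Ln has_field_derivative inverse (refl n1 s)) (at (refl n1 s))" if "s \<in> {a..b}" for s
    by (rule has_field_derivative_Ln[OF nr[OF that]])
  have eL: "exp (Ln (refl n1 s)) = refl n1 s" if "s \<in> {a..b}" for s using nz[OF that] by simp
  have Pq: "primitive q (\<lambda>s. 2 * n1 * (\<alpha> * (1 + (n1\<^sup>2 - \<epsilon> s) / (2 * n1\<^sup>2) * (cosh (p s) * cos (q s) - 1)) +
     \<beta> * ((n1\<^sup>2 - \<epsilon> s) / (2 * n1\<^sup>2) * (sinh (p s) * sin (q s))))) a b"
    using prim_log_refl(2)[OF n1 ab(1,3) nz der eL] unfolding p_def q_def by simp
  have q: "0 \<le> q s" "q s \<le> pi / 2" if "s \<in> {a..b}" for s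
  proof -
    have "\<bar>Im (Ln (refl n1 s))\<bar> \<le> pi / 2" using Re_Ln_pos_le[OF nz[OF that]] re[OF that] by simp
    moreover have "Im (Ln (refl n1 s)) \<le> 0"
    proof (rule ccontr)
      assume "\<not> Im (Ln (refl n1 s)) \<le> 0"
      then have "0 < sin (Im (Ln (refl n1 s)))"
        using \<open>\<bar>Im (Ln (refl n1 s))\<bar> \<le> pi / 2\<close> pi_gt_zero by (intro sin_gt_zero) auto
      then have "0 < Im (exp (Ln (refl n1 s)))" by (simp add: Im_exp)
      then show False using im[OF that] nz[OF that] by simp
    qed
    ultimately show "0 \<le> q s" "q s \<le> pi / 2" by (auto simp: q_def)
  qed
  have p: "0 \<le> p s" if "s \<in> {a..b}" for s
    using cmod_refl_le[of s n1] n1 nz[OF that] that ab by (simp add: p_def)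
  define F where "F = (\<lambda>q. arctan (n2 / n1 * tan (q / 2)))"
  define F' where "F' = (\<lambda>q. n2 / (2 * n1) / ((cos (q / 2))\<^sup>2 + (n2 / n1)\<^sup>2 * (sin (q / 2))\<^sup>2))"
  have den: "0 < (cos (x / 2))\<^sup>2 + (n2 / n1)\<^sup>2 * (sin (x / 2))\<^sup>2" for x
  proof (cases "cos (x / 2) = 0")
    case True
    then have "sin (x / 2) \<noteq> 0" using sin_cos_squared_add[of "x / 2"] by auto
    then show ?thesis using n1 n2 by (simp add: True)
  qed (use n1 n2 in \<open>simp add: add_pos_nonneg\<close>)
  have F: "(F has_field_derivative F' x) (at x)" if x: "0 \<le> x" "x \<le> pi / 2" for x
  proof -
    have c: "cos (x / 2) \<noteq> 0" using cos_gt_zero_pi[of "x / 2"] x pi_gt_zero by auto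
    have "(F has_field_derivative (n2 / n1 * (inverse ((cos (x / 2))\<^sup>2) * (1 / 2))) * inverse (1 + (n2 / n1 * tan (x / 2))\<^sup>2)) (at x)"
      unfolding F_def using c n1 by (auto intro!: derivative_eq_intros simp: field_simps)
    also have "(n2 / n1 * (inverse ((cos (x / 2))\<^sup>2) * (1 / 2))) * inverse (1 + (n2 / n1 * tan (x / 2))\<^sup>2)
        = n2 / (2 * n1) * inverse ((cos (x / 2))\<^sup>2 * (1 + (n2 / n1 * tan (x / 2))\<^sup>2))"
      using n1 by (simp add: field_simps)
    also have "(cos (x / 2))\<^sup>2 * (1 + (n2 / n1 * tan (x / 2))\<^sup>2) = (cos (x / 2))\<^sup>2 + (n2 / n1)\<^sup>2 * (sin (x / 2))\<^sup>2"
    proof -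
      have t: "(n2 / n1 * tan (x / 2))\<^sup>2 = (n2 / n1)\<^sup>2 * ((sin (x / 2))\<^sup>2 / (cos (x / 2))\<^sup>2)"
        by (simp only: tan_def power_mult_distrib power_divide)
      have "C\<^sup>2 * (1 + A * (S\<^sup>2 / C\<^sup>2)) = C\<^sup>2 + A * S\<^sup>2" if "C \<noteq> 0" for A C S :: real
        using that by (simp add: field_simps)
      from this[OF c] show ?thesis unfolding t .
    qed
    finally show ?thesis by (simp only: F'_def divide_inverse)
  qed
  have PF: "primitive (\<lambda>s. F (q s)) (\<lambda>s. F' (q s) * (2 * n1 * (\<alpha> * (1 + (n1\<^sup>2 - \<epsilon> s) / (2 * n1\<^sup>2) * (cosh (p s) * cos (q s) - 1)) +
     \<beta> * ((n1\<^sup>2 - \<epsilon> s) / (2 * n1\<^sup>2) * (sinh (p s) * sin (q s)))))) a b"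
  proof (rule primitive_compose[OF Pq])
    show "(F has_field_derivative F' (q s)) (at (q s))" if "s \<in> {a..b}" for s using F q[OF that] by simp
    show "continuous_on (q ` {a..b}) F'"
      unfolding F'_def using den[THEN less_imp_neq, THEN not_sym] by (intro continuous_intros ballI) simp_all
  qed
  have "F (q b) - F (q a) \<le> n2 * \<alpha> * (b - a)"
  proof (rule primitive_bound[OF PF ab(2)])
    fix s assume s: "s \<in> {a..b}"
    have "0 \<le> F' (q s)" using den[of "q s"] n1 n2 by (simp add: F'_def)
    then have "F' (q s) * (2 * n1 * (\<alpha> * (1 + (n1\<^sup>2 - \<epsilon> s) / (2 * n1\<^sup>2) * (cosh (p s) * cos (q s) - 1)) +
     \<beta> * ((n1\<^sup>2 - \<epsilon> s) / (2 * n1\<^sup>2) * (sinh (p s) * sin (q s)))))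
      \<le> F' (q s) * (2 * n1 * \<alpha> * ((cos (q s / 2))\<^sup>2 + (n2 / n1)\<^sup>2 * (sin (q s / 2))\<^sup>2))"
      using quarter_wave_speed[OF p[OF s] q[OF s] eps(1,2)] by (intro mult_left_mono)
    also have "\<dots> = n2 * \<alpha>"
    proof -
      have "n2 / (2 * n1) / x * (2 * n1 * \<alpha> * x) = n2 * \<alpha>" if "0 < x" for x
        using that n1 by simp
      from this[OF den[of "q s"]] show ?thesis unfolding F'_def .
    qed
    finally show "F' (q s) * (2 * n1 * (\<alpha> * (1 + (n1\<^sup>2 - \<epsilon> s) / (2 * n1\<^sup>2) * (cosh (p s) * cos (q s) - 1)) +
     \<beta> * ((n1\<^sup>2 - \<epsilon> s) / (2 * n1\<^sup>2) * (sinh (p s) * sin (q s))))) \<le> n2 * \<alpha>" .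
  qed
  moreover have "q a = 0"
  proof -
    have m: "a \<in> {a..b}" using ab by simp
    have "sin (q a) = 0"
    proof -
      have "Im (exp (Ln (refl n1 a))) = 0" using start nz[OF m] by simp
      then show ?thesis by (simp add: Im_exp q_def)
    qed
    then show ?thesis using q[OF m] sin_gt_zero[of "q a"] pi_gt_zero by (cases "q a = 0") auto
  qed
  moreover have "q b = pi / 2"
  proof -
    have m: "b \<in> {a..b}" using ab by simp
    have "cos (q b) = 0"
    proof -
      have "Re (exp (Ln (refl n1 b))) = 0" using stop nz[OF m] by simp
      then show ?thesis by (simp add: Re_exp q_def)
    qed
    then show ?thesis using q[OF m] cos_gt_zero_pi[of "q b"] pi_gt_zero by (cases "q b = pi / 2") auto
  qed
  ultimately show ?thesis by (simp add: F_def tan_45)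
qed

text \<open>Variation of constants: the outgoing amplitude that is absorbed before the target is met is a
  superposition of pushes in directions given by the wave, with weights \<epsilon> - n1^2 \<ge> 0.\<close>
lemma outgoing_integral:
  assumes "0 \<le> s" "s \<le> e" "e \<le> T" "outgoing n1 e = 0"
  shows "((\<lambda>t. k\<^sup>2 * of_real (\<epsilon> t - n1\<^sup>2) * y t * exp (\<i> * k * of_real n1 * of_real (t - s))) has_integral outgoing n1 s) {s..e}"
proof -
  let ?c = "\<i> * k * of_real n1"
  have W: "primitive (outgoing n1) (\<lambda>s. (- k\<^sup>2 * of_real (\<epsilon> s) * y s) - ?c * v s) 0 T"
    unfolding outgoing_def by (intro primitive_diff primitive_cmult prim_v prim_y)
  have "primitive (\<lambda>t. exp (?c * of_real t) * outgoing n1 t)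
    (\<lambda>t. (?c * exp (?c * of_real t)) * outgoing n1 t + exp (?c * of_real t) * ((- k\<^sup>2 * of_real (\<epsilon> t) * y t) - ?c * v t)) 0 T"
    by (rule primitive_mult[OF primitive_exp_linear W])
  from primitiveD(1)[OF this assms(1-3)]
  have "((\<lambda>t. (?c * exp (?c * of_real t)) * outgoing n1 t + exp (?c * of_real t) * ((- k\<^sup>2 * of_real (\<epsilon> t) * y t) - ?c * v t))
     has_integral - exp (?c * of_real s) * outgoing n1 s) {s..e}" by (simp add: assms(4))
  from has_integral_mult_right[OF this, of "- exp (- (?c * of_real s))"]
  have "((\<lambda>t. - exp (- (?c * of_real s)) * ((?c * exp (?c * of_real t)) * outgoing n1 t + exp (?c * of_real t) * ((- k\<^sup>2 * of_real (\<epsilon> t) * y t) - ?c * v t)))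
     has_integral outgoing n1 s) {s..e}" by (simp add: exp_minus field_simps)
  then show ?thesis
  proof (rule has_integral_eq[rotated])
    fix t assume "t \<in> {s..e}"
    have 1: "?c * outgoing n1 t + ((- k\<^sup>2 * of_real (\<epsilon> t) * y t) - ?c * v t) = - (k\<^sup>2 * of_real (\<epsilon> t - n1\<^sup>2) * y t)"
      by (simp add: outgoing_def algebra_simps power2_eq_square)
    have 2: "exp (?c * of_real (t - s)) = exp (- (?c * of_real s)) * exp (?c * of_real t)"
      by (simp add: exp_add[symmetric] algebra_simps)
    have "- exp (- (?c * of_real s)) * ((?c * exp (?c * of_real t)) * outgoing n1 t + exp (?c * of_real t) * ((- k\<^sup>2 * of_real (\<epsilon> t) * y t) - ?c * v t))
      = - (exp (- (?c * of_real s)) * exp (?c * of_real t)) * (?c * outgoing n1 t + ((- k\<^sup>2 * of_real (\<epsilon> t) * y t) - ?c * v t))"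
      by (simp add: algebra_simps)
    also have "\<dots> = k\<^sup>2 * of_real (\<epsilon> t - n1\<^sup>2) * y t * exp (?c * of_real (t - s))"
      unfolding 1 2 by simp
    finally show "- exp (- (?c * of_real s)) * ((?c * exp (?c * of_real t)) * outgoing n1 t + exp (?c * of_real t) * ((- k\<^sup>2 * of_real (\<epsilon> t) * y t) - ?c * v t))
       = k\<^sup>2 * of_real (\<epsilon> t - n1\<^sup>2) * y t * exp (?c * of_real (t - s))" .
  qed
qed

end

lemma first_zero:
  fixes f :: "real \<Rightarrow> 'a::real_normed_vector"
  assumes "continuous_on {a..b} f" "a \<le> t" "t \<le> b" "f t = 0"
  obtains e where "a \<le> e" "e \<le> t" "f e = 0" "\<And>s. a \<le> s \<Longrightarrow> s < e \<Longrightarrow> f s \<noteq> 0"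
proof -
  let ?S = "{s \<in> {a..b}. f s = 0}"
  have "closed ?S" using assms(1) by (intro continuous_closed_preimage_constant) auto
  moreover have "bounded ?S" by (rule bounded_subset[of "{a..b}"]) auto
  ultimately have "compact ?S" by (simp add: compact_eq_bounded_closed)
  then obtain e where e: "e \<in> ?S" "\<And>s. s \<in> ?S \<Longrightarrow> e \<le> s"
    using compact_attains_inf[of ?S] assms by auto
  have "f s \<noteq> 0" if "a \<le> s" "s < e" for s
    using e(2)[of s] that e(1) by auto
  then show ?thesis using that[of e] e assms by auto
qed

lemma last_zero:
  fixes f :: "real \<Rightarrow> 'a::real_normed_vector"
  assumes "continuous_on {a..b} f" "a \<le> t" "t \<le> b" "f t = 0"
  obtains e where "t \<le> e" "e \<le> b" "f e = 0" "\<And>s. e < s \<Longrightarrow> s \<le> b \<Longrightarrow> f s \<noteq> 0"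
proof -
  let ?S = "{s \<in> {a..b}. f s = 0}"
  have "closed ?S" using assms(1) by (intro continuous_closed_preimage_constant) auto
  moreover have "bounded ?S" by (rule bounded_subset[of "{a..b}"]) auto
  ultimately have "compact ?S" by (simp add: compact_eq_bounded_closed)
  then obtain e where e: "e \<in> ?S" "\<And>s. s \<in> ?S \<Longrightarrow> s \<le> e"
    using compact_attains_sup[of ?S] assms by auto
  have "f s \<noteq> 0" if "e < s" "s \<le> b" for s
    using e(2)[of s] that e(1) by auto
  then show ?thesis using that[of e] e assms by auto
qed

lemma neg_persists:
  fixes f :: "real \<Rightarrow> real"
  assumes "continuous_on {a..b} f" "a \<le> b" "\<And>s. a \<le> s \<Longrightarrow> s \<le> b \<Longrightarrow> f s \<noteq> 0"
  shows "f a < 0 \<longleftrightarrow> f b < 0"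
proof -
  have "\<not> (f a < 0 \<and> 0 < f b)"
    using IVT'[of f a 0 b] assms by force
  moreover have "\<not> (0 < f a \<and> f b < 0)"
    using IVT2'[of f b 0 a] assms by force
  ultimately show ?thesis using assms(3)[of a] assms(3)[of b] assms(2) by force
qed

lemma primitive_integral:
  fixes g :: "real \<Rightarrow> 'a::euclidean_space"
  assumes g: "g \<in> borel_measurable (lebesgue_on {a..b})" "bounded (g ` {a..b})"
  shows "primitive (\<lambda>t. integral {a..t} g) g a b"
  unfolding primitive_def
proof (intro conjI allI impI g)
  fix s t assume st: "a \<le> s" "s \<le> t" "t \<le> b"
  have int: "g integrable_on {u..w}" if "a \<le> u" "w \<le> b" for u w
    using bounded_measurable_integrable[OF g that] by (simp add: absolutely_integrable_on_def)
  have "integral {a..t} g - integral {a..s} g = integral {s..t} g"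
    using Henstock_Kurzweil_Integration.integral_combine[of a s t g] st int by (auto simp: algebra_simps)
  then show "(g has_integral integral {a..t} g - integral {a..s} g) {s..t}"
    using int[of s t] st by (simp add: integrable_integral)
qed

lemma admissible_measurable:
  assumes "admissible n1 n2 \<epsilon>"
  shows "\<epsilon> \<in> borel_measurable (lebesgue_on S)" "bounded (\<epsilon> ` S)"
proof -
  have "\<epsilon> \<in> borel_measurable lebesgue" using assms by (simp add: admissible_def measurable_completion)
  then show "\<epsilon> \<in> borel_measurable (lebesgue_on S)" by (rule measurable_restrict_space1)
  have "\<bar>\<epsilon> s\<bar> \<le> n2\<^sup>2" for s
    using assms zero_le_power2[of n1] unfolding admissible_def by (smt (verit))
  then show "bounded (\<epsilon> ` S)" by (auto simp: bounded_iff)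
qed

context mode begin

lemma prim_contrast: "0 \<le> a \<Longrightarrow> primitive (\<lambda>t. integral {a..t} (\<lambda>s. \<epsilon> s - n1\<^sup>2)) (\<lambda>s. \<epsilon> s - n1\<^sup>2) a b"
proof (rule primitive_integral)
  show "(\<lambda>s. \<epsilon> s - n1\<^sup>2) \<in> borel_measurable (lebesgue_on {a..b})"
    using admissible_measurable(1)[OF adm] by simp
  have "norm (\<epsilon> s - n1\<^sup>2) \<le> n2\<^sup>2" for s using eps[of s] by (smt (verit) real_norm_def zero_le_power2)
  then show "bounded ((\<lambda>s. \<epsilon> s - n1\<^sup>2) ` {a..b})" by (auto simp: bounded_iff)
qed

lemma cont_outgoing: "continuous_on {0..T} (outgoing n)"
  unfolding outgoing_def by (intro continuous_intros cont_y cont_v)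

lemma cont_incoming: "continuous_on {0..T} (incoming n)"
  unfolding incoming_def by (intro continuous_intros cont_y cont_v)

lemma refl_zero_iff: "0 \<le> s \<Longrightarrow> s \<le> T \<Longrightarrow> 0 < n \<Longrightarrow> refl n s = 0 \<longleftrightarrow> outgoing n s = 0"
  using incoming_nz[of s n] by (simp add: refl_def)

lemma Im_flux_sign: "0 \<le> s \<Longrightarrow> s \<le> T \<Longrightarrow> 0 < n \<Longrightarrow> Im (refl n s) < 0 \<longleftrightarrow> Im (flux s) < 0"
  "0 \<le> s \<Longrightarrow> s \<le> T \<Longrightarrow> 0 < n \<Longrightarrow> Im (refl n s) = 0 \<longleftrightarrow> Im (flux s) = 0"
  using incoming_nz[of s n] unfolding Im_refl by (auto simp: divide_less_0_iff mult_less_0_iff)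

text \<open>Immediately before the target all pushes have nearly the same direction, so the target is approached
  from the lower half-plane and from inside the circle of radius n1.\<close>
lemma final_approach:
  assumes e: "0 < e" "e \<le> T" "outgoing n1 e = 0" and before: "\<And>s. 0 \<le> s \<Longrightarrow> s < e \<Longrightarrow> outgoing n1 s \<noteq> 0"
  obtains \<delta> where "0 < \<delta>" "\<delta> \<le> e" "\<And>s. e - \<delta> < s \<Longrightarrow> s < e \<Longrightarrow> Im (flux s) < 0 \<and> Re (refl n1 s) < 0"
proof -
  define K where "K = (\<lambda>p. k\<^sup>2 * y (snd p) * exp (\<i> * k * of_real n1 * of_real (snd p - fst p)) * cnj (incoming n1 (fst p)))"
  have cK: "continuous_on ({0..T} \<times> {0..T}) K"
    unfolding K_def
    by (intro continuous_intros continuous_on_compose2[OF cont_y] continuous_on_compose2[OF cont_incoming]) auto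
  define c where "c = n1 * (cmod k)\<^sup>2 * (cmod (y e))\<^sup>2 * min \<alpha> \<beta>"
  have ye: "y e \<noteq> 0" using y_nz e by simp
  have c: "c > 0" using n1 k_nz ye \<alpha> \<beta> by (simp add: c_def)
  have Kee: "K (e, e) = - of_real (2 * n1 * (cmod k)\<^sup>2 * (cmod (y e))\<^sup>2) * Complex \<beta> \<alpha>"
  proof -
    have ve: "v e = \<i> * k * of_real n1 * y e" using e(3) by (simp add: outgoing_def)
    have "incoming n1 e = 2 * \<i> * k * of_real n1 * y e" unfolding incoming_def ve by simp
    then have "K (e, e) = k\<^sup>2 * y e * cnj (2 * \<i> * k * of_real n1 * y e)" by (simp add: K_def)
    also have "\<dots> = - (2 * of_real n1 * (k * cnj k) * (y e * cnj (y e))) * (\<i> * k)"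
      by (simp add: power2_eq_square algebra_simps)
    also have "\<i> * k = Complex \<beta> \<alpha>" by (simp add: k complex_eq_iff)
    finally show ?thesis by (simp only: complex_norm_square of_real_mult of_real_numeral)
  qed
  have ReIm: "Re (K (e, e)) \<le> - 2 * c" "Im (K (e, e)) \<le> - 2 * c"
  proof -
    have "n1 * (cmod k)\<^sup>2 * (cmod (y e))\<^sup>2 * min \<alpha> \<beta> \<le> n1 * (cmod k)\<^sup>2 * (cmod (y e))\<^sup>2 * \<beta>"
         "n1 * (cmod k)\<^sup>2 * (cmod (y e))\<^sup>2 * min \<alpha> \<beta> \<le> n1 * (cmod k)\<^sup>2 * (cmod (y e))\<^sup>2 * \<alpha>"
      using n1 by (auto intro!: mult_left_mono)
    then show "Re (K (e, e)) \<le> - 2 * c" "Im (K (e, e)) \<le> - 2 * c"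
      unfolding Kee c_def by simp_all
  qed
  have "(e, e) \<in> {0..T} \<times> {0..T}" using e by auto
  then obtain d where d: "d > 0" "\<And>p. p \<in> {0..T} \<times> {0..T} \<Longrightarrow> dist p (e, e) < d \<Longrightarrow> dist (K p) (K (e, e)) < c"
    using cK c unfolding continuous_on_iff by metis
  define \<delta> where "\<delta> = min e (d / 2)"
  have \<delta>: "0 < \<delta>" "\<delta> \<le> e" "\<delta> \<le> d / 2" using d e by (auto simp: \<delta>_def)
  have K: "Re (K (s, t)) \<le> - c" "Im (K (s, t)) \<le> - c" if "e - \<delta> < s" "s \<le> t" "t \<le> e" for s t
  proof -
    have "dist (s, t) (e, e) \<le> dist s e + dist t e" by (simp add: dist_Pair_Pair sqrt_sum_squares_le_sum)
    also have "\<dots> < d" using that \<delta> by (simp add: dist_real_def)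
    finally have "dist (K (s, t)) (K (e, e)) < c" using d(2)[of "(s, t)"] that \<delta> e by auto
    then have "\<bar>Re (K (s, t) - K (e, e))\<bar> < c" "\<bar>Im (K (s, t) - K (e, e))\<bar> < c"
      unfolding dist_norm using abs_Re_le_cmod abs_Im_le_cmod by (meson le_less_trans)+
    then show "Re (K (s, t)) \<le> - c" "Im (K (s, t)) \<le> - c" using ReIm by auto
  qed
  show ?thesis
  proof (rule that[OF \<delta>(1,2)])
    fix s assume s: "e - \<delta> < s" "s < e"
    have s0: "0 \<le> s" "s \<le> e" "s \<le> T" using s \<delta> e by auto
    define I where "I = integral {s..e} (\<lambda>s. \<epsilon> s - n1\<^sup>2)"
    have hI: "((\<lambda>s. \<epsilon> s - n1\<^sup>2) has_integral I) {s..e}"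
      using primitiveD(1)[OF prim_contrast[OF s0(1), of e] order_refl s0(2)] by (simp add: I_def)
    have "I > 0"
    proof (rule ccontr)
      assume "\<not> I > 0"
      then have "negligible {t \<in> {s..e}. \<epsilon> t - n1\<^sup>2 \<noteq> 0}"
        using eps by (intro primitive_zero_negligible[OF prim_contrast[OF s0(1)]]) (auto simp: I_def s0)
      then have "((\<lambda>t. k\<^sup>2 * of_real (\<epsilon> t - n1\<^sup>2) * y t * exp (\<i> * k * of_real n1 * of_real (t - s))) has_integral 0) {s..e}"
        by (rule has_integral_spike[of _ _ _ "\<lambda>_. 0"]) auto
      then have "outgoing n1 s = 0"
        using outgoing_integral[OF s0(1,2) e(2,3)] has_integral_unique by blast
      then show False using before[OF s0(1) s(2)] by simp
    qed
    have h: "((\<lambda>t. of_real (\<epsilon> t - n1\<^sup>2) * K (s, t)) has_integral outgoing n1 s * cnj (incoming n1 s)) {s..e}"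
      using has_integral_mult_left[OF outgoing_integral[OF s0(1,2) e(2,3)], of "cnj (incoming n1 s)"]
      by (simp add: K_def mult_ac)
    have "Re (outgoing n1 s * cnj (incoming n1 s)) \<le> - c * I"
      using has_integral_le[OF has_integral_linear[OF h bounded_linear_Re, unfolded o_def] has_integral_mult_right[OF hI, of "- c"]]
        K(1)[OF s(1)] eps(1) mult_left_mono[of "Re (K (s, _))" "- c" "\<epsilon> _ - n1\<^sup>2"]
      by (auto simp: mult.commute)
    moreover have "Im (outgoing n1 s * cnj (incoming n1 s)) \<le> - c * I"
      using has_integral_le[OF has_integral_linear[OF h bounded_linear_Im, unfolded o_def] has_integral_mult_right[OF hI, of "- c"]]
        K(2)[OF s(1)] eps(1) mult_left_mono[of "Im (K (s, _))" "- c" "\<epsilon> _ - n1\<^sup>2"]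
      by (auto simp: mult.commute)
    moreover have "- c * I < 0" using c \<open>I > 0\<close> by simp
    ultimately have "Re (outgoing n1 s * cnj (incoming n1 s)) < 0" "Im (outgoing n1 s * cnj (incoming n1 s)) < 0" by linarith+
    moreover have "0 < (cmod (incoming n1 s))\<^sup>2" using incoming_nz[OF s0(1,3) n1] by simp
    ultimately show "Im (flux s) < 0 \<and> Re (refl n1 s) < 0"
      unfolding Re_refl outgoing_incoming using n1 by (simp add: divide_neg_pos mult_less_0_iff)
  qed
qed

text \<open>At the start y = 0, and v dominates the derivative of the imaginary part of the flux.\<close>
lemma Im_flux_initially_neg:
  obtains \<delta> where "0 < \<delta>" "\<delta> \<le> T" "\<And>s. 0 < s \<Longrightarrow> s \<le> \<delta> \<Longrightarrow> Im (flux s) < 0"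
proof -
  let ?g = "\<lambda>s. (cmod k)\<^sup>2 * n2\<^sup>2 * (cmod (y s))\<^sup>2 - (cmod (v s))\<^sup>2"
  have "continuous_on {0..T} ?g" by (intro continuous_intros cont_y cont_v)
  moreover have c: "0 < (cmod (v 0))\<^sup>2 / 2" using v0 by simp
  ultimately obtain d where d: "d > 0" "\<And>s. s \<in> {0..T} \<Longrightarrow> dist s 0 < d \<Longrightarrow> dist (?g s) (?g 0) < (cmod (v 0))\<^sup>2 / 2"
    using T unfolding continuous_on_iff by (metis atLeastAtMost_iff less_eq_real_def)
  define \<delta> where "\<delta> = min T (d / 2)"
  have \<delta>: "0 < \<delta>" "\<delta> \<le> T" "\<delta> < d" using d T by (auto simp: \<delta>_def)
  show ?thesis
  proof (rule that[OF \<delta>(1,2)])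
    fix s assume s: "0 < s" "s \<le> \<delta>"
    have "Im (flux s) - Im (flux 0) \<le> - \<alpha> * ((cmod (v 0))\<^sup>2 / 2) * (s - 0)"
    proof (rule primitive_bound[OF primitive_subset[OF prim_Im_flux order_refl]])
      fix u assume u: "u \<in> {0..s}"
      have "dist (?g u) (?g 0) < (cmod (v 0))\<^sup>2 / 2" using d(2)[of u] u s \<delta> by (auto simp: dist_real_def)
      then have "?g u - ?g 0 < (cmod (v 0))\<^sup>2 / 2" unfolding dist_real_def by linarith
      moreover have "?g 0 = - (cmod (v 0))\<^sup>2" by (simp add: y0)
      ultimately have "?g u \<le> - ((cmod (v 0))\<^sup>2 / 2)" by linarith
      moreover have "(cmod k)\<^sup>2 * \<epsilon> u * (cmod (y u))\<^sup>2 \<le> (cmod k)\<^sup>2 * n2\<^sup>2 * (cmod (y u))\<^sup>2"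
        using eps(2)[of u] by (intro mult_right_mono mult_left_mono) auto
      ultimately have "(cmod k)\<^sup>2 * \<epsilon> u * (cmod (y u))\<^sup>2 - (cmod (v u))\<^sup>2 \<le> - ((cmod (v 0))\<^sup>2 / 2)" by linarith
      from mult_left_mono[OF this, of \<alpha>] \<alpha>
      show "\<alpha> * ((cmod k)\<^sup>2 * \<epsilon> u * (cmod (y u))\<^sup>2 - (cmod (v u))\<^sup>2) \<le> - \<alpha> * ((cmod (v 0))\<^sup>2 / 2)" by simp
    qed (use s \<delta> in auto)
    moreover have "- \<alpha> * ((cmod (v 0))\<^sup>2 / 2) * (s - 0) < 0" using \<alpha> c s by (simp add: mult_pos_pos)
    ultimately show "Im (flux s) < 0" by (simp add: flux_0)
  qed
qed

lemma first_crossing_exists: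
  assumes "0 < e" "e \<le> T" "Im (flux e) = 0"
  obtains t1 where "0 < t1" "t1 \<le> e" "Im (flux t1) = 0" "\<And>s. 0 < s \<Longrightarrow> s < t1 \<Longrightarrow> Im (flux s) < 0"
proof -
  obtain \<delta> where \<delta>: "0 < \<delta>" "\<delta> \<le> T" "\<And>s. 0 < s \<Longrightarrow> s \<le> \<delta> \<Longrightarrow> Im (flux s) < 0"
    using Im_flux_initially_neg by blast
  have c: "continuous_on {0..T} (\<lambda>s. Im (flux s))" by (intro continuous_intros cont_flux)
  have "\<delta> < e" using \<delta>(3)[of e] assms by force
  then obtain t1 where t1: "\<delta> \<le> t1" "t1 \<le> e" "Im (flux t1) = 0" "\<And>s. \<delta> \<le> s \<Longrightarrow> s < t1 \<Longrightarrow> Im (flux s) \<noteq> 0"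
    using first_zero[OF continuous_on_subset[OF c, of "{\<delta>..T}"], of e] \<delta> assms by auto
  show ?thesis
  proof (rule that[of t1])
    fix s assume s: "0 < s" "s < t1"
    show "Im (flux s) < 0"
    proof (cases "s \<le> \<delta>")
      case False
      have "Im (flux \<delta>) < 0 \<longleftrightarrow> Im (flux s) < 0"
        by (rule neg_persists[OF continuous_on_subset[OF c]]) (use False s t1 \<delta> assms in auto)
      then show ?thesis using \<delta> by simp
    qed (use \<delta> s in auto)
  qed (use t1 \<delta> in auto)
qed

end

context mode begin

text \<open>On the real axis Re (refl n1 s) \<ge> 0 says that the impedance x is at least n1, and (n2 - x) / (n2
  + x), which is exp (- p), decreases in x.\<close>
lemma real_impedance_refl:
  assumes s: "0 < s" "s \<le> T" and im: "Im (flux s) = 0" and p: "refl n2 s = - of_real (exp (- p))"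
    and re: "0 \<le> Re (refl n1 s)"
  shows "ln ((n2 + n1) / (n2 - n1)) \<le> p"
proof -
  define V where "V = cmod (v s)"
  define A where "A = cmod k * cmod (y s)"
  have pos: "0 < V" "0 < A" using v_nz[of s] y_nz[of s] k_nz s by (auto simp: V_def A_def)
  have A2: "(cmod k)\<^sup>2 * (cmod (y s))\<^sup>2 = A\<^sup>2" by (simp add: A_def power_mult_distrib)
  have "cmod (flux s) = V * A" by (simp add: flux_def norm_mult V_def A_def)
  then have fl: "Re (flux s) = V * A"
    using Re_flux_pos[OF s] im by (simp add: cmod_eq_Re)
  have inc: "(cmod (incoming n s))\<^sup>2 = (V + n * A)\<^sup>2" for n
    unfolding cmod_incoming A2 fl V_def[symmetric] by (simp add: power2_eq_square algebra_simps)
  have Re: "Re (refl n s) = (V - n * A) / (V + n * A)" if "0 < n" for n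
  proof -
    have "V\<^sup>2 - n\<^sup>2 * A\<^sup>2 = (V - n * A) * (V + n * A)" by (simp add: power2_eq_square algebra_simps)
    moreover have "V + n * A \<noteq> 0" using pos that by (smt (verit) mult_pos_pos)
    ultimately show ?thesis unfolding Re_refl A2 inc V_def[symmetric] by (simp add: power2_eq_square)
  qed
  have d1: "0 < V + n1 * A" "0 < V + n2 * A" using pos n1 n2 by (auto intro!: add_pos_pos)
  have VA: "n1 * A \<le> V" using re d1 unfolding Re[OF n1] by (simp add: zero_le_divide_iff)
  have "exp (- p) = (n2 * A - V) / (V + n2 * A)" 
  proof -
    have "exp (- p) = - ((V - n2 * A) / (V + n2 * A))" using arg_cong[OF p, of Re] unfolding Re[OF n2] by simp
    then show ?thesis unfolding minus_divide_left by simp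
  qed
  also have "\<dots> \<le> (n2 - n1) / (n2 + n1)"
  proof -
    have "(n2 * A - V) * (n2 + n1) \<le> (n2 - n1) * (V + n2 * A)"
    proof -
      have "(n2 - n1) * (V + n2 * A) - (n2 * A - V) * (n2 + n1) = 2 * n2 * (V - n1 * A)"
        by (simp add: algebra_simps)
      moreover have "0 \<le> 2 * n2 * (V - n1 * A)" using VA n2 by simp
      ultimately show ?thesis by linarith
    qed
    then show ?thesis using d1 n1 n2 by (simp add: divide_le_eq pos_le_divide_eq)
  qed
  finally have "exp (- p) \<le> (n2 - n1) / (n2 + n1)" .
  then have "- p \<le> ln ((n2 - n1) / (n2 + n1))" using n1 n12 by (subst ln_ge_iff) auto
  also have "ln ((n2 - n1) / (n2 + n1)) = - ln ((n2 + n1) / (n2 - n1))"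
    using n1 n12 by (simp add: ln_div)
  finally show ?thesis by simp
qed

text \<open>If the real axis is first met at or beyond the target, the bounds of first_crossing apply. Otherwise
  the trajectory has overshot the target: it has entered the disc of radius n1 once before the
  crossing, and by final_approach it enters it again from the real axis outside the disc, through the
  lower half-plane. Each of the two transits takes at least the time of quarter_wave_transit.\<close>
lemma escape_time_dichotomy:
  assumes "outgoing n1 T = 0"
  shows "2 * arctan (n2 / n1) \<le> n2 * \<alpha> * T \<or>
    (\<exists>t1 p. 0 < t1 \<and> t1 \<le> T \<and> ln ((n2 + n1) / (n2 - n1)) \<le> p \<and> \<alpha> * p \<le> \<beta> * pi \<and>
       pi \<le> 2 * n2 * \<alpha> * t1 + 3 / 2 * \<beta> * (\<beta> * pi - \<alpha> * p) / (\<alpha>\<^sup>2 + \<beta>\<^sup>2) \<and>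
       (\<alpha> * p = \<beta> * pi \<longrightarrow> negligible {s \<in> {0..t1}. \<epsilon> s \<noteq> n2\<^sup>2}))"
proof -
  obtain e where e0: "0 \<le> e" "e \<le> T" "outgoing n1 e = 0" and ebef: "\<And>s. 0 \<le> s \<Longrightarrow> s < e \<Longrightarrow> outgoing n1 s \<noteq> 0"
    using first_zero[OF cont_outgoing _ order_refl assms] T by auto
  have "outgoing n1 0 \<noteq> 0" using v0 by (simp add: outgoing_def y0)
  then have e: "0 < e" using e0 by (cases "e = 0") auto
  have refl_e: "refl n1 e = 0" using e0 by (simp add: refl_def)
  then have "Im (flux e) = 0" using Im_flux_sign(2)[OF e0(1,2) n1] by simp
  then obtain t1 where t1: "0 < t1" "t1 \<le> e" "Im (flux t1) = 0" and tbef: "\<And>s. 0 < s \<Longrightarrow> s < t1 \<Longrightarrow> Im (flux s) < 0"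
    using first_crossing_exists[OF e e0(2)] by blast
  have t1T: "t1 \<le> T" using t1 e0 by simp
  show ?thesis
  proof (cases "0 \<le> Re (refl n1 t1)")
    case True
    obtain p where p: "0 < p" "refl n2 t1 = - of_real (exp (- p))" "\<alpha> * p \<le> \<beta> * pi"
      "pi \<le> 2 * n2 * \<alpha> * t1 + 3 / 2 * \<beta> * (\<beta> * pi - \<alpha> * p) / (\<alpha>\<^sup>2 + \<beta>\<^sup>2)"
      "\<alpha> * p = \<beta> * pi \<Longrightarrow> negligible {s \<in> {0..t1}. \<epsilon> s \<noteq> n2\<^sup>2}"
      using first_crossing[OF t1(1) t1T tbef t1(3)] by blast
    have "ln ((n2 + n1) / (n2 - n1)) \<le> p"
      by (rule real_impedance_refl[OF t1(1) t1T t1(3) p(2) True])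
    then show ?thesis using p t1 t1T by blast
  next
    case False
    have t1e: "t1 < e" using False refl_e t1(2) by (cases "t1 = e") auto
    have cR: "continuous_on {0..T} (\<lambda>s. Re (refl n1 s))" by (intro continuous_intros cont_refl n1)
    have cI: "continuous_on {0..T} (\<lambda>s. Im (flux s))" by (intro continuous_intros cont_flux)
    have nz: "refl n1 s \<noteq> 0" if "0 \<le> s" "s < e" for s
      using refl_zero_iff[of s n1] ebef[OF that] that e0 n1 by simp
    \<comment> \<open>a passage through the fourth quadrant, starting on the real axis outside the circle\<close>
    have transit: "\<exists>b. a < b \<and> b \<le> c \<and> arctan (n2 / n1) \<le> n2 * \<alpha> * (b - a)"
      if a: "0 \<le> a" "a < c" "c < e" "Im (flux a) = 0" "0 < Re (refl n1 a)" "Re (refl n1 c) < 0"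
        and neg: "\<And>s. a \<le> s \<Longrightarrow> s \<le> c \<Longrightarrow> Im (flux s) \<le> 0" for a c
    proof -
      have cR': "continuous_on {a..c} (\<lambda>s. Re (refl n1 s))" by (rule continuous_on_subset[OF cR]) (use a e0 in auto)
      obtain b0 where "a \<le> b0" "b0 \<le> c" "Re (refl n1 b0) = 0"
        using IVT2'[of "\<lambda>s. Re (refl n1 s)" c 0 a] cR' a by auto
      then obtain b where b: "a \<le> b" "b \<le> b0" "Re (refl n1 b) = 0" "\<And>s. a \<le> s \<Longrightarrow> s < b \<Longrightarrow> Re (refl n1 s) \<noteq> 0"
        using first_zero[OF cR', of b0] by auto
      have ab: "a < b" using b a(5) by (cases "a = b") auto
      have "0 \<le> Re (refl n1 s)" if s: "s \<in> {a..b}" for s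
      proof (cases "s = b")
        case False
        have "Re (refl n1 a) < 0 \<longleftrightarrow> Re (refl n1 s) < 0"
          by (rule neg_persists[OF continuous_on_subset[OF cR]]) (use False s b a e0 \<open>b0 \<le> c\<close> in auto)
        then show ?thesis using a by simp
      qed (use b in simp)
      moreover have "Im (refl n1 s) \<le> 0" if s: "s \<in> {a..b}" for s
      proof -
        have sr: "0 \<le> s" "s \<le> T" "a \<le> s" "s \<le> c" using s a b e0 \<open>b0 \<le> c\<close> by auto
        show ?thesis using neg[OF sr(3,4)] Im_flux_sign[OF sr(1,2) n1] by linarith
      qed
      moreover have "refl n1 s \<noteq> 0" if s: "s \<in> {a..b}" for s
        using nz[of s] s a b \<open>b0 \<le> c\<close> by auto
      moreover have "Im (refl n1 a) = 0" using Im_flux_sign(2)[of a n1] a e0 n1 by simp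
      ultimately have "arctan (n2 / n1) \<le> n2 * \<alpha> * (b - a)"
        by (intro quarter_wave_transit) (use a b e0 \<open>b0 \<le> c\<close> in auto)
      then show ?thesis using ab b \<open>b0 \<le> c\<close> by auto
    qed
    have le1: "Im (flux s) \<le> 0" if "0 \<le> s" "s \<le> t1" for s
    proof -
      consider "s = 0" | "0 < s" "s < t1" | "s = t1" using \<open>0 \<le> s\<close> \<open>s \<le> t1\<close> by linarith
      then show ?thesis using tbef[of s] t1 flux_0 by cases auto
    qed
    obtain b1 where b1: "0 < b1" "b1 \<le> t1" "arctan (n2 / n1) \<le> n2 * \<alpha> * (b1 - 0)"
      using transit[of 0 t1] t1 t1e flux_0 refl_0[of n1] False le1 by auto
    obtain \<delta> where \<delta>: "0 < \<delta>" "\<delta> \<le> e" "\<And>s. e - \<delta> < s \<Longrightarrow> s < e \<Longrightarrow> Im (flux s) < 0 \<and> Re (refl n1 s) < 0"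
      using final_approach[OF e e0(2,3) ebef] by blast
    define c where "c = (max (e - \<delta>) t1 + e) / 2"
    have c: "e - \<delta> < c" "t1 < c" "c < e" using \<delta> t1e by (auto simp: c_def)
    have cneg: "Im (flux c) < 0" "Re (refl n1 c) < 0" using \<delta>(3)[OF c(1,3)] by auto
    \<comment> \<open>the last visit to the real axis before the final approach starts the second transit\<close>
    obtain t4 where t4: "t1 \<le> t4" "t4 \<le> c" "Im (flux t4) = 0" "\<And>s. t4 < s \<Longrightarrow> s \<le> c \<Longrightarrow> Im (flux s) \<noteq> 0"
      using last_zero[OF continuous_on_subset[OF cI, of "{t1..c}"] order_refl, of thesis] t1 c e0 by auto
    have t4c: "t4 < c" using t4 cneg by (cases "t4 = c") auto
    have neg4: "Im (flux s) < 0" if "t4 < s" "s \<le> c" for s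
    proof -
      have "Im (flux s) < 0 \<longleftrightarrow> Im (flux c) < 0"
        by (rule neg_persists[OF continuous_on_subset[OF cI]]) (use that t4 t1 c e0 in auto)
      then show ?thesis using cneg by simp
    qed
    have le4: "Im (flux s) \<le> 0" if "t4 \<le> s" "s \<le> c" for s
      using neg4[of s] t4(3) that by (cases "s = t4") auto
    have t4r: "0 \<le> t4" "t4 \<le> T" "t4 < e" using t4 t4c c t1 e0 by auto
    \<comment> \<open>inside the circle the imaginary part of the flux would increase, so the axis would not be left downwards\<close>
    have R4: "0 < Re (refl n1 t4)"
    proof (rule ccontr)
      assume "\<not> 0 < Re (refl n1 t4)"
      moreover have "Re (refl n1 t4) \<noteq> 0"
        using nz[of t4] t4r Im_flux_sign(2)[of t4 n1] t4(3) n1 by (auto simp: complex_eq_iff)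
      ultimately have "Re (refl n1 t4) < 0" by simp
      then have g0: "(cmod (v t4))\<^sup>2 - n1\<^sup>2 * ((cmod k)\<^sup>2 * (cmod (y t4))\<^sup>2) < 0" (is "?g t4 < 0")
        using incoming_nz[OF t4r(1,2) n1] unfolding Re_refl by (simp add: divide_less_0_iff)
      have cg: "continuous_on {0..T} ?g" by (intro continuous_intros cont_y cont_v)
      then obtain d where d: "d > 0" "\<And>s. s \<in> {0..T} \<Longrightarrow> dist s t4 < d \<Longrightarrow> dist (?g s) (?g t4) < - ?g t4"
        using g0 t4r unfolding continuous_on_iff by (metis atLeastAtMost_iff neg_0_less_iff_less)
      define u where "u = min c (t4 + d / 2)"
      have u: "t4 < u" "u \<le> c" "u - t4 < d" using d t4c by (auto simp: u_def)
      have "Im (flux t4) \<le> Im (flux u)"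
      proof (rule primitive_mono[OF primitive_subset[OF prim_Im_flux]])
        fix s assume s: "s \<in> {t4..u}"
        have "dist (?g s) (?g t4) < - ?g t4" using d(2)[of s] s u t4r c e0 by (auto simp: dist_real_def)
        then have "?g s < 0" unfolding dist_real_def by linarith
        moreover have "n1\<^sup>2 * ((cmod k)\<^sup>2 * (cmod (y s))\<^sup>2) \<le> \<epsilon> s * ((cmod k)\<^sup>2 * (cmod (y s))\<^sup>2)"
          using eps(1)[of s] by (intro mult_right_mono) auto
        ultimately have "0 \<le> (cmod k)\<^sup>2 * \<epsilon> s * (cmod (y s))\<^sup>2 - (cmod (v s))\<^sup>2" by (simp add: mult_ac)
        then show "0 \<le> \<alpha> * ((cmod k)\<^sup>2 * \<epsilon> s * (cmod (y s))\<^sup>2 - (cmod (v s))\<^sup>2)" using \<alpha> by simp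
      qed (use u t4r c e0 in auto)
      then show False using neg4[OF u(1,2)] t4(3) by simp
    qed
    obtain b2 where b2: "t4 < b2" "b2 \<le> c" "arctan (n2 / n1) \<le> n2 * \<alpha> * (b2 - t4)"
      using transit[OF t4r(1) t4c c(3) t4(3) R4 cneg(2) le4] by blast
    have "2 * arctan (n2 / n1) \<le> n2 * \<alpha> * (b1 - 0) + n2 * \<alpha> * (b2 - t4)" using b1 b2 by simp
    also have "\<dots> = n2 * \<alpha> * (b1 + b2 - t4)" by (simp add: algebra_simps)
    also have "\<dots> \<le> n2 * \<alpha> * T" using n2 \<alpha> b1 b2 t4 c e0 by (intro mult_left_mono) auto
    finally show ?thesis by blast
  qed
qed

end

section \<open>Eigenvalues and normalized waves\<close>

text \<open>Clipping a Borel version at n1^2 and n2^2 turns bounds almost everywhere into bounds everywhere.\<close>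
lemma feasible_representative:
  assumes n: "0 < n1" "n1 < n2" and f: "feasible_on n1 n2 I \<epsilon>" and I: "I \<in> sets lebesgue"
  obtains \<epsilon>' N where "admissible n1 n2 \<epsilon>'" "negligible N" "\<And>s. s \<in> I - N \<Longrightarrow> \<epsilon> s = \<epsilon>' s"
proof -
  have "(\<lambda>s. if s \<in> I then \<epsilon> s else 0) \<in> borel_measurable lebesgue"
    using borel_measurable_if_I[of \<epsilon> I] f I by (simp add: feasible_on_def)
  then obtain g where g: "g \<in> borel_measurable lborel" "AE s in lborel. (if s \<in> I then \<epsilon> s else 0) = g s"
    using completion_ex_borel_measurable_real by blast
  define \<epsilon>' where "\<epsilon>' = (\<lambda>s. max (n1\<^sup>2) (min (n2\<^sup>2) (g s)))"
  have nn: "n1\<^sup>2 \<le> n2\<^sup>2" using n by (intro power_mono) auto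
  have "\<epsilon>' \<in> borel_measurable borel" using g(1) by (simp add: \<epsilon>'_def)
  then have adm: "admissible n1 n2 \<epsilon>'" using nn by (simp add: admissible_def \<epsilon>'_def)
  have "AE s in lebesgue. (if s \<in> I then \<epsilon> s else 0) = g s" using g(2) by (rule AE_completion)
  moreover have "AE s in lebesgue. s \<in> I \<longrightarrow> n1\<^sup>2 \<le> \<epsilon> s \<and> \<epsilon> s \<le> n2\<^sup>2"
    using f I unfolding feasible_on_def by (subst (asm) AE_restrict_space_iff) auto
  ultimately have "AE s in lebesgue. s \<in> I \<longrightarrow> \<epsilon> s = \<epsilon>' s"
    by eventually_elim (auto simp: \<epsilon>'_def)
  then have "\<exists>N. negligible N \<and> {s. \<not> (s \<in> I \<longrightarrow> \<epsilon> s = \<epsilon>' s)} \<subseteq> N"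
    unfolding eventually_ae_filter_negligible .
  then obtain N where "negligible N" "{s. \<not> (s \<in> I \<longrightarrow> \<epsilon> s = \<epsilon>' s)} \<subseteq> N" by (elim exE conjE)
  then show ?thesis using that[OF adm, of N] by blast
qed

lemma gronwall_primitive:
  fixes E :: "real \<Rightarrow> real"
  assumes E: "primitive E E' a b" and "a \<le> b" "0 \<le> C" "0 \<le> D"
    and le: "\<And>s. s \<in> {a..b} \<Longrightarrow> E' s \<le> C * E s + D"
  shows "E b \<le> (E a + D * (b - a)) * exp (C * (b - a))"
proof -
  have ex: "primitive (\<lambda>s. exp (- C * s)) (\<lambda>s. - C * exp (- C * s)) a b"
    by (rule primitive_C1) (auto intro!: derivative_eq_intros continuous_intros simp: has_vector_derivative_def field_simps)
  have "exp (- C * b) * E b - exp (- C * a) * E a \<le> D * exp (- C * a) * (b - a)"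
  proof (rule primitive_bound[OF primitive_mult[OF ex E] assms(2)])
    fix s assume s: "s \<in> {a..b}"
    have "- C * exp (- C * s) * E s + exp (- C * s) * E' s = exp (- C * s) * (E' s - C * E s)"
      by (simp add: algebra_simps)
    also have "\<dots> \<le> exp (- C * s) * D" using le[OF s] by (intro mult_left_mono) auto
    also have "\<dots> \<le> exp (- C * a) * D" using s assms by (intro mult_right_mono) (auto intro: mult_left_mono)
    finally show "- C * exp (- C * s) * E s + exp (- C * s) * E' s \<le> D * exp (- C * a)" by (simp add: mult.commute)
  qed
  then have "exp (- C * b) * E b \<le> (E a + D * (b - a)) * exp (- C * a)" by (simp add: algebra_simps)
  then have "exp (C * b) * (exp (- C * b) * E b) \<le> exp (C * b) * ((E a + D * (b - a)) * exp (- C * a))"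
    by (intro mult_left_mono) auto
  moreover have "exp (C * b) * (exp (- C * b) * E b) = E b" by (simp add: exp_minus)
  moreover have "exp (C * b) * ((E a + D * (b - a)) * exp (- C * a)) = (E a + D * (b - a)) * exp (C * (b - a))"
    by (simp add: exp_diff exp_minus field_simps)
  ultimately show ?thesis by linarith
qed

text \<open>The inhomogeneity f collects the effect of a change of the coefficient and of the spectral parameter
  when Y is the difference of two waves.\<close>
lemma energy_bound:
  assumes Y: "primitive Y V a b" and V: "primitive V (\<lambda>s. q s * Y s + f s) a b" and ab: "a \<le> b"
    and q: "\<And>s. s \<in> {a..b} \<Longrightarrow> cmod (q s) \<le> M" and f: "\<And>s. s \<in> {a..b} \<Longrightarrow> cmod (f s) \<le> d" and M: "0 \<le> M"
  shows "(cmod (Y b))\<^sup>2 + (cmod (V b))\<^sup>2 \<le> ((cmod (Y a))\<^sup>2 + (cmod (V a))\<^sup>2 + d\<^sup>2 * (b - a)) * exp ((2 + M) * (b - a))"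
proof -
  let ?E' = "\<lambda>s. Re ((V s * cnj (Y s) + Y s * cnj (V s)) + ((q s * Y s + f s) * cnj (V s) + V s * cnj (q s * Y s + f s)))"
  have "primitive (\<lambda>s. Re (Y s * cnj (Y s) + V s * cnj (V s))) ?E' a b"
    by (intro primitive_Re primitive_add primitive_mult primitive_cnj Y V)
  moreover have "Re (Y s * cnj (Y s) + V s * cnj (V s)) = (cmod (Y s))\<^sup>2 + (cmod (V s))\<^sup>2" for s
    unfolding cmod_power2 by (simp add: power2_eq_square)
  ultimately have E: "primitive (\<lambda>s. (cmod (Y s))\<^sup>2 + (cmod (V s))\<^sup>2) ?E' a b" by simp
  show ?thesis
  proof (rule gronwall_primitive[OF E ab])
    fix s assume s: "s \<in> {a..b}"
    have am: "2 * (x * y) \<le> x\<^sup>2 + y\<^sup>2" for x y :: real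
      using zero_le_power2[of "x - y"] by (simp add: power2_diff)
    have "?E' s = 2 * Re (V s * cnj (Y s)) + 2 * Re (q s * Y s * cnj (V s)) + 2 * Re (f s * cnj (V s))"
      by (simp add: algebra_simps)
    also have "\<dots> \<le> 2 * (cmod (Y s) * cmod (V s)) + M * (2 * (cmod (Y s) * cmod (V s))) + 2 * (d * cmod (V s))"
    proof -
      have "Re (V s * cnj (Y s)) \<le> cmod (Y s) * cmod (V s)"
        using complex_Re_le_cmod[of "V s * cnj (Y s)"] by (simp add: norm_mult mult.commute)
      moreover have "Re (q s * Y s * cnj (V s)) \<le> M * (cmod (Y s) * cmod (V s))"
      proof -
        have "Re (q s * Y s * cnj (V s)) \<le> cmod (q s) * (cmod (Y s) * cmod (V s))"
          using complex_Re_le_cmod[of "q s * Y s * cnj (V s)"] by (simp add: norm_mult mult.assoc)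
        also have "\<dots> \<le> M * (cmod (Y s) * cmod (V s))" using q[OF s] by (intro mult_right_mono) auto
        finally show ?thesis .
      qed
      moreover have "Re (f s * cnj (V s)) \<le> d * cmod (V s)"
      proof -
        have "Re (f s * cnj (V s)) \<le> cmod (f s) * cmod (V s)"
          using complex_Re_le_cmod[of "f s * cnj (V s)"] by (simp add: norm_mult)
        also have "\<dots> \<le> d * cmod (V s)" using f[OF s] by (intro mult_right_mono) auto
        finally show ?thesis .
      qed
      ultimately show ?thesis by linarith
    qed
    also have "\<dots> \<le> ((cmod (Y s))\<^sup>2 + (cmod (V s))\<^sup>2) + M * ((cmod (Y s))\<^sup>2 + (cmod (V s))\<^sup>2) + (d\<^sup>2 + (cmod (V s))\<^sup>2)"
      using am[of "cmod (Y s)" "cmod (V s)"] am[of d "cmod (V s)"] mult_left_mono[OF am[of "cmod (Y s)" "cmod (V s)"] M] by linarith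
    also have "\<dots> \<le> (2 + M) * ((cmod (Y s))\<^sup>2 + (cmod (V s))\<^sup>2) + d\<^sup>2"
      by (simp add: algebra_simps)
    finally show "?E' s \<le> (2 + M) * ((cmod (Y s))\<^sup>2 + (cmod (V s))\<^sup>2) + d\<^sup>2" .
  qed (use M in auto)
qed

lemma admissible_bound: "admissible n1 n2 \<epsilon> \<Longrightarrow> \<bar>\<epsilon> s\<bar> \<le> n2\<^sup>2"
  using zero_le_power2[of n1] unfolding admissible_def by (smt (verit))

lemma wave_cmult: "wave k \<epsilon> a b y v \<Longrightarrow> wave k \<epsilon> a b (\<lambda>s. c * y s) (\<lambda>s. c * v s)"
  unfolding wave_def
  using primitive_cmult[of y v a b c] primitive_cmult[of v "\<lambda>s. - k\<^sup>2 * of_real (\<epsilon> s) * y s" a b c]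
  by (simp add: mult.left_commute)

lemma wave_trivial:
  assumes w: "wave k \<epsilon> a b y v" and adm: "admissible n1 n2 \<epsilon>" and z: "y a = 0" "v a = 0" and s: "a \<le> s" "s \<le> b"
  shows "y s = 0" "v s = 0"
proof -
  have "(cmod (y s))\<^sup>2 + (cmod (v s))\<^sup>2 \<le> ((cmod (y a))\<^sup>2 + (cmod (v a))\<^sup>2 + 0\<^sup>2 * (s - a)) * exp ((2 + (cmod k)\<^sup>2 * n2\<^sup>2) * (s - a))"
  proof (rule energy_bound[where q="\<lambda>s. - k\<^sup>2 * of_real (\<epsilon> s)" and f="\<lambda>_. 0"])
    show "primitive y v a s" "primitive v (\<lambda>s. - k\<^sup>2 * of_real (\<epsilon> s) * y s + 0) a s"
      using w s by (auto simp: wave_def intro: primitive_subset)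
    show "cmod (- k\<^sup>2 * of_real (\<epsilon> t)) \<le> (cmod k)\<^sup>2 * n2\<^sup>2" for t
      using admissible_bound[OF adm, of t] by (simp add: norm_mult norm_power mult_left_mono)
  qed (use s in auto)
  then have "(cmod (y s))\<^sup>2 + (cmod (v s))\<^sup>2 \<le> 0" by (simp add: z)
  then show "y s = 0" "v s = 0" by (smt (verit) zero_le_power2 norm_eq_zero power_eq_0_iff)+
qed

lemma wave_coefficient_bounded:
  fixes y :: "real \<Rightarrow> complex"
  assumes "admissible n1 n2 \<epsilon>" "continuous_on {a..b} y"
  shows "bounded ((\<lambda>s. - k\<^sup>2 * of_real (\<epsilon> s) * y s) ` {a..b})"
proof -
  obtain B where B: "\<And>s. s \<in> {a..b} \<Longrightarrow> cmod (y s) \<le> B"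
    using continuous_bounded_measurable(2)[OF assms(2)] by (force simp: bounded_iff)
  have "cmod (- k\<^sup>2 * of_real (\<epsilon> s) * y s) \<le> (cmod k)\<^sup>2 * n2\<^sup>2 * B" if s: "s \<in> {a..b}" for s
  proof -
    have "\<bar>\<epsilon> s\<bar> * cmod (y s) \<le> n2\<^sup>2 * B"
      using admissible_bound[OF assms(1), of s] B[OF s] by (intro mult_mono) auto
    then show ?thesis by (simp add: norm_mult norm_power mult.assoc mult_left_mono)
  qed
  then show ?thesis unfolding bounded_iff by blast
qed

text \<open>A nontrivial solution with y 0 = 0 has v 0 \<noteq> 0 by uniqueness and can be normalized there.\<close>
lemma generated_wave:
  assumes n: "0 < n1" "n1 < n2" "0 < sp" and \<epsilon>: "\<epsilon> \<in> resonator_family n1 n2 sp" and g: "generates_eigenvalue n1 sp \<epsilon> k"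
  obtains \<epsilon>' N y v where "admissible n1 n2 \<epsilon>'" "negligible N" "\<And>s. s \<in> {0<..<sp} - N \<Longrightarrow> \<epsilon> s = \<epsilon>' s"
    "wave k \<epsilon>' 0 sp y v" "y 0 = 0" "v 0 = 1" "v sp = \<i> * k * of_real n1 * y sp" "y sp \<noteq> 0" "k \<noteq> 0"
proof -
  obtain \<epsilon>' N where e: "admissible n1 n2 \<epsilon>'" "negligible N" "\<And>s. s \<in> {0<..<sp} - N \<Longrightarrow> \<epsilon> s = \<epsilon>' s"
    using feasible_representative[OF n(1,2), of "{0<..<sp}" \<epsilon>] \<epsilon> by (auto simp: resonator_family_def)
  obtain y v s where y: "solves_wave_eq sp \<epsilon> k y v" "s \<in> {0..sp}" "y s \<noteq> 0" "y 0 = 0" "y sp \<noteq> 0"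
    "v sp / (\<i> * k * y sp) = of_real n1" and k: "k \<noteq> 0"
    using g unfolding generates_eigenvalue_def by blast
  have dy: "\<And>s. s \<in> {0..sp} \<Longrightarrow> (y has_vector_derivative v s) (at s within {0..sp})"
    and av: "ac_deriv_on v (\<lambda>s. - k\<^sup>2 * of_real (\<epsilon> s) * y s) {0..sp}"
    using y(1) unfolding solves_wave_eq_def by blast+
  have cy: "continuous_on {0..sp} y"
    unfolding continuous_on_eq_continuous_within by (intro ballI has_vector_derivative_continuous[OF dy])
  have av': "ac_deriv_on v (\<lambda>s. - k\<^sup>2 * of_real (\<epsilon>' s) * y s) {0..sp}"
  proof (rule ac_deriv_on_spike[OF av])
    show "negligible (N \<union> {0, sp})" using e by (intro negligible_Un) auto
    show "- k\<^sup>2 * of_real (\<epsilon>' s) * y s = - k\<^sup>2 * of_real (\<epsilon> s) * y s" if "s \<in> {0..sp} - (N \<union> {0, sp})" for s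
      using e(3)[of s] that by force
  qed
  have pv: "primitive v (\<lambda>s. - k\<^sup>2 * of_real (\<epsilon>' s) * y s) 0 sp"
    using primitive_of_ac_deriv_on[OF av' wave_coefficient_bounded[OF e(1) cy]] n by simp
  have "primitive y v 0 sp" by (rule primitive_C1[OF dy primitive_continuous[OF pv]])
  then have w: "wave k \<epsilon>' 0 sp y v" using pv by (simp add: wave_def)
  have v0: "v 0 \<noteq> 0" using wave_trivial(1)[OF w e(1) y(4), of s] y(2,3) by auto
  have bc: "v sp = \<i> * k * of_real n1 * y sp" using y(5,6) k by (simp add: field_simps)
  show ?thesis
  proof (rule that[OF e wave_cmult[OF w, of "inverse (v 0)"]])
    show "inverse (v 0) * v sp = \<i> * k * of_real n1 * (inverse (v 0) * y sp)" by (simp add: bc)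
  qed (use y v0 k in auto)
qed

lemma wave_generates:
  assumes sp: "0 < sp" and k: "k \<noteq> 0" and w: "wave k \<epsilon>' 0 sp y v" and bc: "y 0 = 0" "y sp \<noteq> 0" "v sp = \<i> * k * of_real n1 * y sp"
    and N: "negligible N" "\<And>s. s \<in> {0<..<sp} - N \<Longrightarrow> \<epsilon> s = \<epsilon>' s"
  shows "generates_eigenvalue n1 sp \<epsilon> k"
proof -
  have pv: "primitive v (\<lambda>s. - k\<^sup>2 * of_real (\<epsilon>' s) * y s) 0 sp" and py: "primitive y v 0 sp"
    using w by (auto simp: wave_def)
  have "ac_deriv_on v (\<lambda>s. - k\<^sup>2 * of_real (\<epsilon> s) * y s) {0..sp}"
  proof (rule ac_deriv_on_spike[OF primitive_ac_deriv_on[OF pv]])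
    show "negligible (N \<union> {0, sp})" using N by (intro negligible_Un) auto
    show "- k\<^sup>2 * of_real (\<epsilon> s) * y s = - k\<^sup>2 * of_real (\<epsilon>' s) * y s" if "s \<in> {0..sp} - (N \<union> {0, sp})" for s
      using N(2)[of s] that by force
  qed
  then have "solves_wave_eq sp \<epsilon> k y v"
    unfolding solves_wave_eq_def using primitive_has_vector_derivative[OF py primitive_continuous[OF pv]] by blast
  then show ?thesis unfolding generates_eigenvalue_def
    using k bc sp by (intro conjI exI[of _ y] exI[of _ v] bexI[of _ sp]) auto
qed

text \<open>Energy balance: for Im k \<ge> 0 the quantity - Im (v * cnj y) would not decrease from its initial
  value 0, but the boundary condition makes it negative at the open end.\<close>
lemma decay_positive:
  assumes w: "wave k \<epsilon> 0 sp y v" and adm: "admissible n1 n2 \<epsilon>" and n1: "0 < n1" and sp: "0 < sp" and bc: "y 0 = 0" "y sp \<noteq> 0" "v sp = \<i> * k * of_real n1 * y sp"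
    and re: "0 < Re k"
  shows "Im k < 0"
proof (rule ccontr)
  assume neg: "\<not> Im k < 0"
  have P: "primitive (\<lambda>s. - Im (v s * cnj (y s))) (\<lambda>s. - Im ((- k\<^sup>2 * of_real (\<epsilon> s) * y s) * cnj (y s) + v s * cnj (v s))) 0 sp"
    using w unfolding wave_def by (intro primitive_minus primitive_Im primitive_mult primitive_cnj) auto
  have "- Im (v 0 * cnj (y 0)) \<le> - Im (v sp * cnj (y sp))"
  proof (rule primitive_mono[OF P])
    fix s
    have "0 \<le> n1\<^sup>2" by simp
    then have "0 \<le> \<epsilon> s" using adm unfolding admissible_def by (meson order_trans)
    have "- Im ((- k\<^sup>2 * of_real (\<epsilon> s) * y s) * cnj (y s) + v s * cnj (v s)) = 2 * Re k * Im k * \<epsilon> s * (cmod (y s))\<^sup>2"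
      unfolding cmod_power2 by (simp add: power2_eq_square algebra_simps)
    also have "\<dots> \<ge> 0" using neg re \<open>0 \<le> \<epsilon> s\<close> by simp
    finally show "0 \<le> - Im ((- k\<^sup>2 * of_real (\<epsilon> s) * y s) * cnj (y s) + v s * cnj (v s))" .
  qed (use sp in auto)
  moreover have "Im (v sp * cnj (y sp)) = n1 * Re k * (cmod (y sp))\<^sup>2"
    unfolding bc(3) cmod_power2 by (simp add: power2_eq_square algebra_simps)
  moreover have "0 < n1 * Re k * (cmod (y sp))\<^sup>2" using n1 re bc(2) by simp
  ultimately show False by (simp add: bc(1))
qed

lemma mode_of_wave:
  assumes "0 < n1" "n1 < n2" "0 < Re k" "Im k < 0" "0 < sp" "admissible n1 n2 \<epsilon>" "wave k \<epsilon> 0 sp y v" "y 0 = 0" "v 0 \<noteq> 0"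
  shows "mode n1 n2 (Re k) (- Im k) sp k \<epsilon> y v"
  using assms by unfold_locales (auto simp: complex_eq_iff)

text \<open>The dichotomy of escape_time_dichotomy for the normalized wave of an eigenvalue.\<close>
theorem eigenvalue_alternative:
  assumes n: "0 < n1" "n1 < n2" "0 < sp" and \<epsilon>: "\<epsilon> \<in> resonator_family n1 n2 sp" and g: "generates_eigenvalue n1 sp \<epsilon> k" and re: "0 < Re k"
  shows "Im k < 0" and "2 * arctan (n2 / n1) \<le> n2 * Re k * sp \<or>
    (\<exists>t1 p. 0 < t1 \<and> t1 \<le> sp \<and> ln ((n2 + n1) / (n2 - n1)) \<le> p \<and> Re k * p \<le> - Im k * pi \<and>
       pi \<le> 2 * n2 * Re k * t1 + 3 / 2 * (- Im k) * (- Im k * pi - Re k * p) / ((Re k)\<^sup>2 + (Im k)\<^sup>2) \<and>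
       (Re k * p = - Im k * pi \<longrightarrow> (\<exists>N. negligible N \<and> (\<forall>s\<in>{0<..<t1} - N. \<epsilon> s = n2\<^sup>2))))"
proof -
  obtain \<epsilon>' N y v where e: "admissible n1 n2 \<epsilon>'" "negligible N" "\<And>s. s \<in> {0<..<sp} - N \<Longrightarrow> \<epsilon> s = \<epsilon>' s"
    and w: "wave k \<epsilon>' 0 sp y v" "y 0 = 0" "v 0 = 1" "v sp = \<i> * k * of_real n1 * y sp" "y sp \<noteq> 0" "k \<noteq> 0"
    using generated_wave[OF n \<epsilon> g] by blast
  show im: "Im k < 0" by (rule decay_positive[OF w(1) e(1) n(1,3) w(2,5,4) re])
  interpret mode n1 n2 "Re k" "- Im k" sp k \<epsilon>' y v
    by (rule mode_of_wave[OF n(1,2) re im n(3) e(1) w(1,2)]) (simp add: w)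
  have "outgoing n1 sp = 0" by (simp add: outgoing_def w(4))
  from escape_time_dichotomy[OF this]
  show "2 * arctan (n2 / n1) \<le> n2 * Re k * sp \<or>
    (\<exists>t1 p. 0 < t1 \<and> t1 \<le> sp \<and> ln ((n2 + n1) / (n2 - n1)) \<le> p \<and> Re k * p \<le> - Im k * pi \<and>
       pi \<le> 2 * n2 * Re k * t1 + 3 / 2 * (- Im k) * (- Im k * pi - Re k * p) / ((Re k)\<^sup>2 + (Im k)\<^sup>2) \<and>
       (Re k * p = - Im k * pi \<longrightarrow> (\<exists>N. negligible N \<and> (\<forall>s\<in>{0<..<t1} - N. \<epsilon> s = n2\<^sup>2))))"
  proof (elim disjE exE conjE)
    assume "2 * arctan (n2 / n1) \<le> n2 * Re k * sp" then show ?thesis by blast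
  next
    fix t1 p
    assume *: "0 < t1" "t1 \<le> sp" "ln ((n2 + n1) / (n2 - n1)) \<le> p" "Re k * p \<le> - Im k * pi"
      "pi \<le> 2 * n2 * Re k * t1 + 3 / 2 * - Im k * (- Im k * pi - Re k * p) / ((Re k)\<^sup>2 + (- Im k)\<^sup>2)"
      "Re k * p = - Im k * pi \<longrightarrow> negligible {s \<in> {0..t1}. \<epsilon>' s \<noteq> n2\<^sup>2}"
    have "\<exists>N. negligible N \<and> (\<forall>s\<in>{0<..<t1} - N. \<epsilon> s = n2\<^sup>2)" if "Re k * p = - Im k * pi"
    proof (intro exI conjI ballI)
      show "negligible (N \<union> {s \<in> {0..t1}. \<epsilon>' s \<noteq> n2\<^sup>2})" using * e(2) that by (intro negligible_Un) auto
      fix s assume "s \<in> {0<..<t1} - (N \<union> {s \<in> {0..t1}. \<epsilon>' s \<noteq> n2\<^sup>2})"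
      then show "\<epsilon> s = n2\<^sup>2" using e(3)[of s] *(2) by auto
    qed
    then show ?thesis using * by (intro disjI2 exI[of _ t1] exI[of _ p]) auto
  qed
qed

lemma primitive_spike:
  fixes f :: "real \<Rightarrow> complex"
  assumes f: "primitive f g a b" and N: "negligible N" and eq: "\<And>s. s \<in> {a..b} - N \<Longrightarrow> g' s = g s"
    and bd: "bounded (g' ` {a..b})" and ab: "a \<le> b"
  shows "primitive f g' a b"
  by (rule primitive_of_ac_deriv_on[OF ac_deriv_on_spike[OF primitive_ac_deriv_on[OF f] N eq] bd ab])

lemma wave_spike:
  assumes w: "wave k \<epsilon> a b y v" and adm: "admissible n1 n2 \<epsilon>'" and N: "negligible N"
    and eq: "\<And>s. s \<in> {a..b} - N \<Longrightarrow> \<epsilon>' s = \<epsilon> s" and ab: "a \<le> b"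
  shows "wave k \<epsilon>' a b y v"
proof -
  have y: "primitive y v a b" and v: "primitive v (\<lambda>s. - k\<^sup>2 * of_real (\<epsilon> s) * y s) a b"
    using w by (auto simp: wave_def)
  have "primitive v (\<lambda>s. - k\<^sup>2 * of_real (\<epsilon>' s) * y s) a b"
    by (rule primitive_spike[OF v N _ wave_coefficient_bounded[OF adm primitive_continuous[OF y]] ab]) (use eq in auto)
  then show ?thesis using y by (simp add: wave_def)
qed

lemma wave_cong:
  assumes "wave k \<epsilon> a b y v" "\<And>s. s \<in> {a..b} \<Longrightarrow> y s = y' s" "\<And>s. s \<in> {a..b} \<Longrightarrow> v s = v' s"
    "\<And>s. s \<in> {a..b} \<Longrightarrow> \<epsilon> s = \<epsilon>' s"
  shows "wave k \<epsilon>' a b y' v'"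
  using assms(1) unfolding wave_def
proof (elim conjE, intro conjI)
  assume "primitive y v a b" then show "primitive y' v' a b" by (rule primitive_cong) (use assms in auto)
next
  assume "primitive v (\<lambda>s. - k\<^sup>2 * of_real (\<epsilon> s) * y s) a b"
  then show "primitive v' (\<lambda>s. - k\<^sup>2 * of_real (\<epsilon>' s) * y' s) a b" by (rule primitive_cong) (use assms in auto)
qed

lemma wave_glue: "wave k \<epsilon> a b y v \<Longrightarrow> wave k \<epsilon> b c y v \<Longrightarrow> a \<le> b \<Longrightarrow> b \<le> c \<Longrightarrow> wave k \<epsilon> a c y v"
  unfolding wave_def using primitive_glue by blast

lemma wave_exp:
  assumes "k \<noteq> 0" "n \<noteq> 0"
  shows "wave k (\<lambda>_. n\<^sup>2) a b (\<lambda>s. C * exp (\<i> * k * of_real n * of_real s)) (\<lambda>s. \<i> * k * of_real n * C * exp (\<i> * k * of_real n * of_real s))"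
  unfolding wave_def
proof
  let ?c = "\<i> * k * of_real n"
  have P: "primitive (\<lambda>s. D * exp (?c * of_real s)) (\<lambda>s. D * (?c * exp (?c * of_real s))) a b" for D
    by (intro primitive_cmult primitive_exp_linear)
  show "primitive (\<lambda>s. C * exp (?c * of_real s)) (\<lambda>s. ?c * C * exp (?c * of_real s)) a b"
    using P[of C] by (simp add: mult_ac)
  have "(?c * C) * (?c * exp (?c * of_real s)) = - k\<^sup>2 * of_real (n\<^sup>2) * (C * exp (?c * of_real s))" for s
    by (simp add: power2_eq_square algebra_simps)
  then show "primitive (\<lambda>s. ?c * C * exp (?c * of_real s)) (\<lambda>s. - k\<^sup>2 * of_real (n\<^sup>2) * (C * exp (?c * of_real s))) a b"
    using P[of "?c * C"] by simp
qed

lemma wave_add: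
  assumes "wave k \<epsilon> a b y v" "wave k \<epsilon> a b y' v'"
  shows "wave k \<epsilon> a b (\<lambda>s. y s + y' s) (\<lambda>s. v s + v' s)"
  using assms primitive_add[of y v a b y' v']
    primitive_add[of v "\<lambda>s. - k\<^sup>2 * of_real (\<epsilon> s) * y s" a b v' "\<lambda>s. - k\<^sup>2 * of_real (\<epsilon> s) * y' s"]
  unfolding wave_def by (simp add: distrib_left)

lemma wave_shift:
  fixes y :: "real \<Rightarrow> complex"
  assumes "k \<noteq> 0" "n \<noteq> 0"
  shows "wave k (\<lambda>_. n\<^sup>2) a b (\<lambda>s. C * exp (\<i> * k * of_real n * of_real (s - c))) (\<lambda>s. \<i> * k * of_real n * C * exp (\<i> * k * of_real n * of_real (s - c)))"
proof (rule wave_cong[OF wave_exp[OF assms, of a b "C * exp (- \<i> * k * of_real n * of_real c)"]])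
  fix s
  have e: "exp (\<i> * k * of_real n * of_real (s - c)) = exp (- \<i> * k * of_real n * of_real c) * exp (\<i> * k * of_real n * of_real s)"
    by (simp add: exp_add[symmetric] algebra_simps)
  show "C * exp (- \<i> * k * of_real n * of_real c) * exp (\<i> * k * of_real n * of_real s) = C * exp (\<i> * k * of_real n * of_real (s - c))"
    "\<i> * k * of_real n * (C * exp (- \<i> * k * of_real n * of_real c)) * exp (\<i> * k * of_real n * of_real s) = \<i> * k * of_real n * C * exp (\<i> * k * of_real n * of_real (s - c))"
    unfolding e by (simp_all add: mult_ac)
qed simp

lemma wave_sin:
  assumes kn: "k \<noteq> 0" "n \<noteq> 0"
  shows "wave k (\<lambda>_. n\<^sup>2) a b (\<lambda>s. sin (k * of_real n * of_real s) / (k * of_real n)) (\<lambda>s. cos (k * of_real n * of_real s))"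
proof -
  let ?c = "\<i> * k * of_real n"
  have w: "wave k (\<lambda>_. n\<^sup>2) a b (\<lambda>s. (1 / (2 * ?c)) * exp (?c * of_real s) + (- (1 / (2 * ?c))) * exp (\<i> * (- k) * of_real n * of_real s))
     (\<lambda>s. ?c * (1 / (2 * ?c)) * exp (?c * of_real s) + \<i> * (- k) * of_real n * (- (1 / (2 * ?c))) * exp (\<i> * (- k) * of_real n * of_real s))"
  proof (rule wave_add[OF wave_exp[OF kn]])
    have neg: "wave (- k) e a b y v \<longleftrightarrow> wave k e a b y v" for e y v by (simp add: wave_def)
    have "- k \<noteq> 0" using kn by simp
    from wave_exp[OF this kn(2), of a b "- (1 / (2 * ?c))"]
    show "wave k (\<lambda>_. n\<^sup>2) a b (\<lambda>s. (- (1 / (2 * ?c))) * exp (\<i> * (- k) * of_real n * of_real s))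
      (\<lambda>s. \<i> * (- k) * of_real n * (- (1 / (2 * ?c))) * exp (\<i> * (- k) * of_real n * of_real s))"
      unfolding neg .
  qed
  then show ?thesis
  proof (rule wave_cong)
    fix s
    show "(1 / (2 * ?c)) * exp (?c * of_real s) + (- (1 / (2 * ?c))) * exp (\<i> * (- k) * of_real n * of_real s) = sin (k * of_real n * of_real s) / (k * of_real n)"
      using kn by (simp add: sin_exp_eq field_simps)
    show "?c * (1 / (2 * ?c)) * exp (?c * of_real s) + \<i> * (- k) * of_real n * (- (1 / (2 * ?c))) * exp (\<i> * (- k) * of_real n * of_real s) = cos (k * of_real n * of_real s)"
      using kn by (simp add: cos_exp_eq field_simps)
  qed simp
qed

lemma wave_scale:
  assumes w: "wave k \<epsilon> 0 T y v" and c: "0 < c"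
  shows "wave (of_real c * k) (\<lambda>s. \<epsilon> (c * s)) 0 (T / c) (\<lambda>s. y (c * s) / of_real c) (\<lambda>s. v (c * s))"
proof -
  have "primitive (\<lambda>s. y (c * s)) (\<lambda>s. c *\<^sub>R v (c * s)) 0 (T / c)"
    and v: "primitive (\<lambda>s. v (c * s)) (\<lambda>s. c *\<^sub>R (- k\<^sup>2 * of_real (\<epsilon> (c * s)) * y (c * s))) 0 (T / c)"
    using w primitive_scale[of _ _ 0 T c] c unfolding wave_def by force+
  from primitive_cmult[OF this(1), of "1 / of_real c"]
  have "primitive (\<lambda>s. y (c * s) / of_real c) (\<lambda>s. v (c * s)) 0 (T / c)"
    using c by (simp add: scaleR_conv_of_real)
  moreover have "primitive (\<lambda>s. v (c * s)) (\<lambda>s. - (of_real c * k)\<^sup>2 * of_real (\<epsilon> (c * s)) * (y (c * s) / of_real c)) 0 (T / c)"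
    using v c by (simp add: scaleR_conv_of_real power2_eq_square mult_ac)
  ultimately show ?thesis by (simp add: wave_def)
qed

text \<open>At the impedance n1 a medium of index n1 keeps the state at rest, so a structure that reached the
  target can be prolonged to any length.\<close>
lemma wave_extend:
  assumes w: "wave k \<epsilon> 0 T y v" and adm: "admissible n1 n2 \<epsilon>" and n: "0 < n1" "n1 < n2" and T: "0 < T" "T \<le> S" and k: "k \<noteq> 0"
    and bc: "v T = \<i> * k * of_real n1 * y T"
  obtains y' v' where "wave k (\<lambda>s. if s < T then \<epsilon> s else n1\<^sup>2) 0 S y' v'"
    "\<forall>s\<le>T. y' s = y s \<and> v' s = v s"
    "\<forall>s\<ge>T. y' s = y T * exp (\<i> * k * of_real n1 * of_real (s - T)) \<and> v' s = \<i> * k * of_real n1 * y' s" "admissible n1 n2 (\<lambda>s. if s < T then \<epsilon> s else n1\<^sup>2)"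
proof -
  define y' where "y' = (\<lambda>s. if s \<le> T then y s else y T * exp (\<i> * k * of_real n1 * of_real (s - T)))"
  define v' where "v' = (\<lambda>s. if s \<le> T then v s else \<i> * k * of_real n1 * y T * exp (\<i> * k * of_real n1 * of_real (s - T)))"
  define \<epsilon>' where "\<epsilon>' = (\<lambda>s. if s < T then \<epsilon> s else n1\<^sup>2)"
  have nn: "n1\<^sup>2 \<le> n2\<^sup>2" using n by (intro power_mono) auto
  have adm': "admissible n1 n2 \<epsilon>'"
    using adm nn unfolding admissible_def \<epsilon>'_def by auto
  have "wave k \<epsilon>' 0 T y v"
    by (rule wave_spike[OF w adm', of "{T}"]) (use T in \<open>auto simp: \<epsilon>'_def\<close>)
  then have 1: "wave k \<epsilon>' 0 T y' v'" by (rule wave_cong) (auto simp: y'_def v'_def)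
  have 2: "wave k \<epsilon>' T S y' v'"
    by (rule wave_cong[OF wave_shift[of k n1 T S "y T" T]]) (use n k bc in \<open>auto simp: y'_def v'_def \<epsilon>'_def\<close>)
  have "wave k \<epsilon>' 0 S y' v'" by (rule wave_glue[OF 1 2]) (use T in auto)
  then show ?thesis
    by (rule that[of y' v', folded \<epsilon>'_def]) (use bc adm' in \<open>auto simp: y'_def v'_def\<close>)
qed

text \<open>A quarter-wave layer of index n matches the exterior impedance n1 exactly at the complex frequency
  whose real part is fixed by the quarter wave and whose decay balances the reflection at the
  interface.\<close>
lemma quarter_wave_matching:
  assumes n: "0 < n1" "n1 < n" and k: "k = Complex \<alpha> (- \<beta>)" and q: "\<alpha> * n * T = pi / 2"
    and h: "2 * \<beta> * n * T = ln ((n + n1) / (n - n1))"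
  defines "\<theta> \<equiv> k * of_real n * of_real T"
  shows "cos \<theta> = \<i> * of_real (n1 / n) * sin \<theta>" "sin \<theta> \<noteq> 0"
proof -
  define w where "w = exp (\<i> * \<theta>)"
  have w: "w \<noteq> 0" by (simp add: w_def)
  have "w\<^sup>2 = exp (2 * (\<i> * \<theta>))" unfolding w_def by (simp add: exp_double)
  also have "2 * (\<i> * \<theta>) = Complex (2 * \<beta> * n * T) (2 * (\<alpha> * n * T))"
    by (simp add: \<theta>_def k complex_eq_iff)
  also have "exp \<dots> = - of_real ((n + n1) / (n - n1))"
    unfolding q h using n by (simp add: exp_eq_polar complex_eq_iff)
  finally have w2: "w\<^sup>2 = - of_real ((n + n1) / (n - n1))" .
  have c: "cos \<theta> = (w + inverse w) / 2" and s: "sin \<theta> = (w - inverse w) / (2 * \<i>)"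
    by (simp_all add: cos_exp_eq sin_exp_eq w_def exp_minus)
  have nn: "complex_of_real n - complex_of_real n1 \<noteq> 0" using n by (simp flip: of_real_diff)
  have key: "w\<^sup>2 * (of_real n - of_real n1) = - (of_real n + of_real n1)"
    unfolding w2 using nn by (simp add: of_real_diff of_real_add)
  have "of_real n * (w + inverse w) = of_real n1 * (w - inverse w)"
  proof -
    have "w * (of_real n * (w + inverse w) - of_real n1 * (w - inverse w)) = w\<^sup>2 * (of_real n - of_real n1) + (of_real n + of_real n1)"
      using w by (simp add: power2_eq_square field_simps)
    also have "\<dots> = 0" unfolding key by simp
    finally show ?thesis using w by simp
  qed
  then show "cos \<theta> = \<i> * of_real (n1 / n) * sin \<theta>"
  proof -
    assume e: "of_real n * (w + inverse w) = of_real n1 * (w - inverse w)"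
    have "X / 2 = \<i> * of_real (n1 / n) * Z" if "of_real n * X = of_real n1 * (2 * \<i> * Z)" for X Z :: complex
      using that n by (simp add: field_simps)
    moreover have "w - inverse w = 2 * \<i> * ((w - inverse w) / (2 * \<i>))" by simp
    ultimately show ?thesis using e unfolding c s by metis
  qed
  show "sin \<theta> \<noteq> 0"
  proof
    assume "sin \<theta> = 0"
    then have "w = inverse w" using s by simp
    then have "w\<^sup>2 = 1" using w by (metis power2_eq_square right_inverse)
    then have "Re (w\<^sup>2) = 1" by simp
    then have "- ((n + n1) / (n - n1)) = 1" unfolding w2 by simp
    moreover have "0 < (n + n1) / (n - n1)" using n by simp
    ultimately show False by linarith
  qed
qed

lemma quarter_wave_mode:
  assumes n: "0 < n1" "n1 < n" and k: "k = Complex \<alpha> (- \<beta>)" and q: "\<alpha> * n * T = pi / 2"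
    and h: "2 * \<beta> * n * T = ln ((n + n1) / (n - n1))"
  obtains y v where "wave k (\<lambda>_. n\<^sup>2) 0 T y v" "y 0 = 0" "v 0 = 1" "v T = \<i> * k * of_real n1 * y T" "y T \<noteq> 0" "k \<noteq> 0"
    "y = (\<lambda>s. sin (k * of_real n * of_real s) / (k * of_real n))" "v = (\<lambda>s. cos (k * of_real n * of_real s))"
proof -
  have knz: "k \<noteq> 0"
  proof
    assume "k = 0"
    then have "\<alpha> = 0" by (simp add: k complex_eq_iff)
    then show False using q pi_gt_zero by simp
  qed
  note m = quarter_wave_matching[OF n k q h]
  let ?y = "\<lambda>s. sin (k * of_real n * of_real s) / (k * of_real n)" and ?v = "\<lambda>s. cos (k * of_real n * of_real s)"
  show ?thesis
  proof (rule that[of ?y ?v])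
    show "wave k (\<lambda>_. n\<^sup>2) 0 T ?y ?v" using wave_sin[of k n 0 T] knz n by simp
    show "?v T = \<i> * k * of_real n1 * ?y T" unfolding m(1) using knz n by simp
    show "?y T \<noteq> 0" using m(2) knz n by simp
  qed (use knz in auto)
qed

section \<open>The extreme eigenvalue and its ray\<close>

lemma polar_Re_Im: "Re k = cmod k * cos (Arg k)" "Im k = cmod k * sin (Arg k)"
  using rcis_cmod_Arg[of k] by (metis Re_rcis, metis Im_rcis)

lemma arctan_gt_quarter_pi:
  assumes "0 < n1" "n1 < n2" shows "pi / 4 < arctan (n2 / n1)"
  using arctan_monotone[of 1 "n2 / n1"] assms by (simp add: arctan_one)

locale resonator =
  fixes n1 n2 sp :: real
  assumes n1: "0 < n1" and n12: "n1 < n2" and sp: "0 < sp"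
begin

definition L0 :: real where "L0 = ln ((n2 + n1) / (n2 - n1))"
definition \<alpha>0 :: real where "\<alpha>0 = pi / (2 * sp * n2)"
definition \<beta>0 :: real where "\<beta>0 = L0 / (2 * sp * n2)"
definition \<kappa>0 :: complex where "\<kappa>0 = Complex \<alpha>0 (- \<beta>0)"
definition \<gamma>0 :: real where "\<gamma>0 = Arg \<kappa>0"
text \<open>The least frequency of a trajectory that overshoots the target before it reaches it.\<close>
definition escape :: real where "escape = 2 * arctan (n2 / n1) / (n2 * sp)"

lemma n2: "0 < n2" using n1 n12 by simp

lemma L0_pos: "0 < L0" unfolding L0_def using n1 n12 by (intro ln_gt_zero) (simp add: field_simps)
lemma \<alpha>0_pos: "0 < \<alpha>0" and \<beta>0_pos: "0 < \<beta>0" using L0_pos sp n2 by (simp_all add: \<alpha>0_def \<beta>0_def)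
lemma ratio0: "\<beta>0 * pi = \<alpha>0 * L0" by (simp add: \<alpha>0_def \<beta>0_def)

lemma \<gamma>0_range: "- (pi / 2) < \<gamma>0" "\<gamma>0 < 0"
  using Arg_Re_pos[of \<kappa>0] Arg_neg_iff[of \<kappa>0] \<alpha>0_pos \<beta>0_pos by (auto simp: \<gamma>0_def \<kappa>0_def)

lemma cos_\<gamma>0: "0 < cos \<gamma>0" using \<gamma>0_range by (intro cos_gt_zero_pi) auto

lemma tan_\<gamma>0: "tan \<gamma>0 = - (L0 / pi)"
proof -
  have "\<gamma>0 = arctan (- \<beta>0 / \<alpha>0)" unfolding \<gamma>0_def using arg_conv_arctan[of \<kappa>0] \<alpha>0_pos by (simp add: \<kappa>0_def)
  moreover have "\<beta>0 / \<alpha>0 = L0 / pi" using ratio0 \<alpha>0_pos pi_gt_zero by (simp add: field_simps)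
  ultimately show ?thesis by (simp add: tan_arctan)
qed

lemma cmod_\<kappa>0: "cmod \<kappa>0 = \<alpha>0 / cos \<gamma>0"
  using polar_Re_Im(1)[of \<kappa>0] cos_\<gamma>0 by (simp add: \<kappa>0_def \<gamma>0_def field_simps)

lemma \<alpha>0_less_escape: "\<alpha>0 < escape"
  using arctan_gt_quarter_pi[OF n1 n12] sp n2 by (simp add: \<alpha>0_def escape_def field_simps)

lemma tan_Arg: "0 < Re k \<Longrightarrow> tan (Arg k) = Im k / Re k"
  using arg_conv_arctan[of k] by (simp add: tan_arctan)

lemma eigenvalue_lower_half:
  assumes "k \<in> eigenvalue_set n1 n2 sp" "0 < Re k" shows "Im k < 0"
  using assms eigenvalue_alternative(1)[OF n1 n12 sp] by (auto simp: eigenvalue_set_def)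

text \<open>Less decay per oscillation than that of the quarter-wave layer excludes a first crossing at or
  beyond the target and leaves only the detour.\<close>
lemma slow_decay_frequency:
  assumes k: "k \<in> eigenvalue_set n1 n2 sp" "0 < Re k" and flat: "- Im k * pi < Re k * L0"
  shows "escape \<le> Re k"
proof -
  obtain \<epsilon> where e: "\<epsilon> \<in> resonator_family n1 n2 sp" "generates_eigenvalue n1 sp \<epsilon> k"
    using k by (auto simp: eigenvalue_set_def)
  have no: False if "L0 \<le> p" "Re k * p \<le> - Im k * pi" for p
  proof -
    have "Re k * L0 \<le> Re k * p" using that(1) k by simp
    then show False using flat that(2) by linarith
  qed
  have "2 * arctan (n2 / n1) \<le> n2 * Re k * sp"
    using eigenvalue_alternative(2)[OF n1 n12 sp e k(2)] unfolding L0_def[symmetric]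
    by (elim disjE exE conjE) (assumption, drule no, assumption, erule FalseE)
  then show ?thesis unfolding escape_def using n2 sp by (simp add: field_simps)
qed

text \<open>For an arbitrary ratio b of decay and frequency both alternatives have to be taken into account. At
  the critical ratio b = L0 / \<pi> the correction term vanishes and the bound is that of the
  quarter-wave layer.\<close>
lemma frequency_lower_bound:
  assumes k: "k \<in> eigenvalue_set n1 n2 sp" "0 < Re k" and b: "b = - Im k / Re k"
  shows "min (2 * arctan (n2 / n1)) ((pi - 3 / 2 * b * (b * pi - L0) / (1 + b\<^sup>2)) / 2) \<le> n2 * Re k * sp"
proof -
  obtain \<epsilon> where e: "\<epsilon> \<in> resonator_family n1 n2 sp" "generates_eigenvalue n1 sp \<epsilon> k"
    using k by (auto simp: eigenvalue_set_def)
  have im: "Im k < 0" by (rule eigenvalue_lower_half[OF k])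
  have b0: "0 < b" using divide_neg_pos[OF im k(2)] by (simp add: b)
  have bk: "- Im k = b * Re k" using k by (simp add: b)
  from eigenvalue_alternative(2)[OF n1 n12 sp e k(2)] show ?thesis
  proof (elim disjE exE conjE)
    fix t1 p assume *: "0 < t1" "t1 \<le> sp" "ln ((n2 + n1) / (n2 - n1)) \<le> p"
      "pi \<le> 2 * n2 * Re k * t1 + 3 / 2 * - Im k * (- Im k * pi - Re k * p) / ((Re k)\<^sup>2 + (Im k)\<^sup>2)"
    have "Im k = - (b * Re k)" using bk by linarith
    then have d: "(Re k)\<^sup>2 + (Im k)\<^sup>2 = (Re k)\<^sup>2 * (1 + b\<^sup>2)"
      by (simp add: power_mult_distrib algebra_simps)
    have n: "3 / 2 * - Im k * (- Im k * pi - Re k * p) = (Re k)\<^sup>2 * (3 / 2 * b * (b * pi - p))"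
      unfolding bk by (simp only: power2_eq_square right_diff_distrib left_diff_distrib mult_ac)
    have "3 / 2 * - Im k * (- Im k * pi - Re k * p) / ((Re k)\<^sup>2 + (Im k)\<^sup>2) = 3 / 2 * b * (b * pi - p) / (1 + b\<^sup>2)"
      unfolding d n by (rule nonzero_mult_divide_mult_cancel_left) (use k(2) in simp)
    also have "\<dots> \<le> 3 / 2 * b * (b * pi - L0) / (1 + b\<^sup>2)"
    proof (rule divide_right_mono)
      show "3 / 2 * b * (b * pi - p) \<le> 3 / 2 * b * (b * pi - L0)"
        using b0 *(3) unfolding L0_def by (intro mult_left_mono) simp_all
      show "0 \<le> 1 + b\<^sup>2" by simp
    qed
    finally have le: "3 / 2 * - Im k * (- Im k * pi - Re k * p) / ((Re k)\<^sup>2 + (Im k)\<^sup>2) \<le> 3 / 2 * b * (b * pi - L0) / (1 + b\<^sup>2)" .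
    have "pi \<le> 2 * n2 * Re k * t1 + 3 / 2 * b * (b * pi - L0) / (1 + b\<^sup>2)"
      using order_trans[OF *(4) add_left_mono[OF le]] .
    moreover have "2 * n2 * Re k * t1 \<le> 2 * n2 * Re k * sp" using *(2) n2 k by simp
    moreover define X where "X = 3 / 2 * b * (b * pi - L0) / (1 + b\<^sup>2)"
    moreover define Y where "Y = n2 * Re k * sp"
    ultimately have "pi \<le> 2 * n2 * Re k * t1 + X" "2 * n2 * Re k * t1 \<le> 2 * Y" by (simp_all only: mult.assoc)
    then have "pi \<le> 2 * Y + X" by (meson add_right_mono order_trans)
    then have "(pi - X) / 2 \<le> Y" by simp
    then have "(pi - 3 / 2 * b * (b * pi - L0) / (1 + b\<^sup>2)) / 2 \<le> n2 * Re k * sp" by (simp only: X_def Y_def)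
    then show ?thesis by (rule min.coboundedI2)
  qed simp
qed

lemma quarter_wave_eigenvalue:
  assumes n: "n1 < n" "n \<le> n2" and k: "k = Complex (pi / (2 * sp * n)) (- (ln ((n + n1) / (n - n1)) / (2 * sp * n)))"
  shows "generates_eigenvalue n1 sp (\<lambda>_. n\<^sup>2) k" "(\<lambda>_. n\<^sup>2) \<in> resonator_family n1 n2 sp" "k \<in> eigenvalue_set n1 n2 sp"
proof -
  obtain y v where w: "wave k (\<lambda>_. n\<^sup>2) 0 sp y v" "y 0 = 0" "v 0 = 1" "v sp = \<i> * k * of_real n1 * y sp" "y sp \<noteq> 0" "k \<noteq> 0"
  proof -
    have "pi / (2 * sp * n) * n * sp = pi / 2"
      "2 * (ln ((n + n1) / (n - n1)) / (2 * sp * n)) * n * sp = ln ((n + n1) / (n - n1))"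
      using n n1 sp by (simp_all add: field_simps)
    from quarter_wave_mode[OF n1 n(1) k this] show ?thesis using that by blast
  qed
  show g: "generates_eigenvalue n1 sp (\<lambda>_. n\<^sup>2) k"
    by (rule wave_generates[OF sp w(6,1,2,5,4), of "{}"]) auto
  have "n1\<^sup>2 \<le> n\<^sup>2" "n\<^sup>2 \<le> n2\<^sup>2" using n n1 by (auto intro: power_mono)
  then show r: "(\<lambda>_. n\<^sup>2) \<in> resonator_family n1 n2 sp" by (simp add: resonator_family_def feasible_on_def)
  show "k \<in> eigenvalue_set n1 n2 sp" using g r by (auto simp: eigenvalue_set_def)
qed

lemma \<kappa>0_eigenvalue:
  "generates_eigenvalue n1 sp (\<lambda>_. n2\<^sup>2) \<kappa>0" "(\<lambda>_. n2\<^sup>2) \<in> resonator_family n1 n2 sp" "\<kappa>0 \<in> eigenvalue_set n1 n2 sp"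
  using quarter_wave_eigenvalue[of n2 \<kappa>0] n12 by (auto simp: \<kappa>0_def \<alpha>0_def \<beta>0_def L0_def)

lemma steeper_argument:
  assumes "0 < Re k" "\<gamma>0 < Arg k" shows "- Im k * pi < Re k * L0"
proof -
  have "\<bar>Arg k\<bar> < pi / 2" using assms Arg_Re_pos[of k] by auto
  then have "tan \<gamma>0 < tan (Arg k)" using \<gamma>0_range assms by (intro tan_monotone) auto
  then show ?thesis unfolding tan_\<gamma>0 tan_Arg[OF assms(1)] using assms(1) pi_gt_zero by (simp add: field_simps)
qed

lemma at_\<gamma>0_frequency:
  assumes "k \<in> eigenvalue_set n1 n2 sp" "Arg k = \<gamma>0" shows "\<alpha>0 \<le> Re k" "0 < Re k"
proof -
  have "k \<noteq> 0" using assms by (auto simp: eigenvalue_set_def generates_eigenvalue_def)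
  then show re: "0 < Re k" using Arg_Re_pos[of k] assms \<gamma>0_range by auto
  have b: "- Im k / Re k = L0 / pi" using tan_Arg[OF re] tan_\<gamma>0 assms(2) by simp
  have "min (2 * arctan (n2 / n1)) (pi / 2) \<le> n2 * Re k * sp"
    using frequency_lower_bound[OF assms(1) re refl] unfolding b by simp
  then have "pi / 2 \<le> n2 * Re k * sp" using arctan_gt_quarter_pi[OF n1 n12] by linarith
  then show "\<alpha>0 \<le> Re k" unfolding \<alpha>0_def using n2 sp by (simp add: field_simps)
qed

theorem rho_min_\<gamma>0: "rho_min n1 n2 sp \<gamma>0 = ereal (cmod \<kappa>0)"
  unfolding rho_min_def
proof (rule antisym)
  show "(INF k\<in>{k \<in> eigenvalue_set n1 n2 sp. Arg k = \<gamma>0}. ereal (cmod k)) \<le> ereal (cmod \<kappa>0)"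
    using \<kappa>0_eigenvalue(3) by (intro INF_lower) (auto simp: \<gamma>0_def)
  show "ereal (cmod \<kappa>0) \<le> (INF k\<in>{k \<in> eigenvalue_set n1 n2 sp. Arg k = \<gamma>0}. ereal (cmod k))"
  proof (rule INF_greatest)
    fix k assume "k \<in> {k \<in> eigenvalue_set n1 n2 sp. Arg k = \<gamma>0}"
    then have k: "k \<in> eigenvalue_set n1 n2 sp" "Arg k = \<gamma>0" by auto
    have "\<alpha>0 \<le> cmod k * cos \<gamma>0" using at_\<gamma>0_frequency(1)[OF k] polar_Re_Im(1)[of k] k(2) by simp
    then show "ereal (cmod \<kappa>0) \<le> ereal (cmod k)" unfolding cmod_\<kappa>0 using cos_\<gamma>0 by (simp add: field_simps)
  qed
qed

text \<open>At \<kappa>0 the first crossing uses up the whole length and the deflection vanishes, so the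
  coefficient is n2^2 almost everywhere.\<close>
theorem \<kappa>0_unique:
  assumes "\<epsilon> \<in> resonator_family n1 n2 sp" "generates_eigenvalue n1 sp \<epsilon> \<kappa>0"
  shows "AE s in lebesgue_on {0<..<sp}. \<epsilon> s = n2\<^sup>2"
proof -
  have re: "0 < Re \<kappa>0" using \<alpha>0_pos by (simp add: \<kappa>0_def)
  have c: "n2 * Re \<kappa>0 * sp = pi / 2" using n2 sp by (simp add: \<kappa>0_def \<alpha>0_def)
  obtain t1 p where *: "0 < t1" "t1 \<le> sp" "L0 \<le> p" "\<alpha>0 * p \<le> \<beta>0 * pi"
     "pi \<le> 2 * n2 * \<alpha>0 * t1 + 3 / 2 * \<beta>0 * (\<beta>0 * pi - \<alpha>0 * p) / (\<alpha>0\<^sup>2 + \<beta>0\<^sup>2)"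
     "\<alpha>0 * p = \<beta>0 * pi \<longrightarrow> (\<exists>N. negligible N \<and> (\<forall>s\<in>{0<..<t1} - N. \<epsilon> s = n2\<^sup>2))"
    using eigenvalue_alternative(2)[OF n1 n12 sp assms re] arctan_gt_quarter_pi[OF n1 n12] unfolding c L0_def[symmetric]
    by (auto simp: \<kappa>0_def)
  have "\<alpha>0 * L0 \<le> \<alpha>0 * p" using *(3) \<alpha>0_pos by simp
  then have eq: "\<alpha>0 * p = \<beta>0 * pi" using *(4) ratio0 by linarith
  have "pi \<le> 2 * n2 * \<alpha>0 * t1" using *(5) unfolding eq by simp
  then have "sp \<le> t1" unfolding \<alpha>0_def using n2 sp pi_gt_zero by (simp add: field_simps)
  then have t: "t1 = sp" using *(2) by simp
  obtain N where N: "negligible N" "\<forall>s\<in>{0<..<sp} - N. \<epsilon> s = n2\<^sup>2" using *(6) eq t by auto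
  then have "AE s in lebesgue. s \<in> {0<..<sp} \<longrightarrow> \<epsilon> s = n2\<^sup>2"
    unfolding eventually_ae_filter_negligible by (intro exI[of _ N]) auto
  then show ?thesis by (subst AE_restrict_space_iff) auto
qed

theorem \<kappa>0_min_modulus: "is_min_modulus_eigenvalue n1 n2 sp \<gamma>0 \<kappa>0"
  unfolding is_min_modulus_eigenvalue_def
proof (intro conjI exI)
  show "rho_min n1 n2 sp \<gamma>0 = ereal (cmod \<kappa>0)" by (rule rho_min_\<gamma>0)
  have "\<kappa>0 \<noteq> 0" using \<alpha>0_pos by (auto simp: \<kappa>0_def complex_eq_iff)
  from Arg_eq[OF this] show "\<kappa>0 = exp (\<i> * of_real \<gamma>0) * of_real (cmod \<kappa>0)" by (simp add: \<gamma>0_def mult.commute)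
qed (rule \<kappa>0_eigenvalue)

lemma min_decayI:
  assumes k: "k \<in> eigenvalue_set n1 n2 sp" "Re k = \<alpha>" and least: "\<And>k'. k' \<in> eigenvalue_set n1 n2 sp \<Longrightarrow> Re k' = \<alpha> \<Longrightarrow> Im k' \<le> Im k"
  shows "is_min_decay_eigenvalue n1 n2 sp \<alpha> k"
  unfolding is_min_decay_eigenvalue_def
proof (intro conjI exI)
  show ke: "k = of_real \<alpha> - \<i> * of_real (- Im k)" using k by (simp add: complex_eq_iff)
  show "beta_min n1 n2 sp \<alpha> = ereal (- Im k)"
    unfolding beta_min_def
  proof (rule antisym)
    show "(INF \<beta>\<in>{\<beta>. of_real \<alpha> - \<i> * of_real \<beta> \<in> eigenvalue_set n1 n2 sp}. ereal \<beta>) \<le> ereal (- Im k)"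
      by (rule INF_lower) (use k ke in simp)
    show "ereal (- Im k) \<le> (INF \<beta>\<in>{\<beta>. of_real \<alpha> - \<i> * of_real \<beta> \<in> eigenvalue_set n1 n2 sp}. ereal \<beta>)"
    proof (rule INF_greatest)
      fix \<beta> assume "\<beta> \<in> {\<beta>. of_real \<alpha> - \<i> * of_real \<beta> \<in> eigenvalue_set n1 n2 sp}"
      then show "ereal (- Im k) \<le> ereal \<beta>" using least[of "of_real \<alpha> - \<i> * of_real \<beta>"] by simp
    qed
  qed
qed (rule k)

text \<open>Less decay at the same frequency would force a frequency of at least escape, which exceeds
  \<alpha>0.\<close>
theorem \<kappa>0_min_decay: "is_min_decay_eigenvalue n1 n2 sp \<alpha>0 \<kappa>0"
proof (rule min_decayI[OF \<kappa>0_eigenvalue(3)])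
  fix k assume k: "k \<in> eigenvalue_set n1 n2 sp" "Re k = \<alpha>0"
  show "Im k \<le> Im \<kappa>0"
  proof (rule ccontr)
    assume "\<not> Im k \<le> Im \<kappa>0"
    then have "- Im k < \<beta>0" by (simp add: \<kappa>0_def)
    then have "- Im k * pi < Re k * L0" using ratio0 k(2) pi_gt_zero by (metis mult_strict_right_mono)
    then have "escape \<le> \<alpha>0" using slow_decay_frequency[OF k(1)] k(2) \<alpha>0_pos by simp
    then show False using \<alpha>0_less_escape by simp
  qed
qed (simp add: \<kappa>0_def)

text \<open>Arguments above \<gamma>0 have less decay per oscillation than \<kappa>0, so only the detour
  remains.\<close>
lemma rho_min_right:
  assumes "\<gamma>0 < \<gamma>" "\<gamma> < 0" shows "ereal (escape / cos \<gamma>) \<le> rho_min n1 n2 sp \<gamma>"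
  unfolding rho_min_def
proof (rule INF_greatest)
  fix k assume "k \<in> {k \<in> eigenvalue_set n1 n2 sp. Arg k = \<gamma>}"
  then have k: "k \<in> eigenvalue_set n1 n2 sp" "Arg k = \<gamma>" by auto
  have "k \<noteq> 0" using k by (auto simp: eigenvalue_set_def generates_eigenvalue_def)
  then have re: "0 < Re k" using Arg_Re_pos[of k] assms k \<gamma>0_range by auto
  have "escape \<le> Re k" by (rule slow_decay_frequency[OF k(1) re steeper_argument[OF re]]) (use k assms in simp)
  moreover have "0 < cos \<gamma>" using assms \<gamma>0_range by (intro cos_gt_zero_pi) auto
  ultimately show "ereal (escape / cos \<gamma>) \<le> ereal (cmod k)"
    using polar_Re_Im(1)[of k] k(2) by (simp add: field_simps)
qed

lemma rho1_bound:
  "ereal (escape / cos \<gamma>0) \<le> (INF \<gamma>\<in>{\<gamma>0<..<0}. rho_min n1 n2 sp \<gamma> * ereal (cos \<gamma>) / ereal (cos \<gamma>0))"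
proof (rule INF_greatest)
  fix \<gamma> assume g: "\<gamma> \<in> {\<gamma>0<..<0}"
  have c: "0 < cos \<gamma>" using g \<gamma>0_range by (intro cos_gt_zero_pi) auto
  have "ereal (escape / cos \<gamma>) * ereal (cos \<gamma>) \<le> rho_min n1 n2 sp \<gamma> * ereal (cos \<gamma>)"
    using rho_min_right[of \<gamma>] g c by (intro ereal_mult_right_mono) auto
  then have "ereal escape \<le> rho_min n1 n2 sp \<gamma> * ereal (cos \<gamma>)" using c by simp
  then have "ereal escape / ereal (cos \<gamma>0) \<le> rho_min n1 n2 sp \<gamma> * ereal (cos \<gamma>) / ereal (cos \<gamma>0)"
    using cos_\<gamma>0 by (intro ereal_divide_right_mono) auto
  then show "ereal (escape / cos \<gamma>0) \<le> rho_min n1 n2 sp \<gamma> * ereal (cos \<gamma>) / ereal (cos \<gamma>0)"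
    using cos_\<gamma>0 by simp
qed

lemma cmod_\<kappa>0_less: "cmod \<kappa>0 < escape / cos \<gamma>0"
  unfolding cmod_\<kappa>0 using \<alpha>0_less_escape cos_\<gamma>0 by (rule divide_strict_right_mono)

text \<open>An eigenvalue with the same frequency and less decay has its argument in (\<gamma>0, 0); its modulus
  times the ratio of the cosines equals the modulus of k, which is below the infimum.\<close>
lemma ray_min_decay:
  assumes k: "k \<in> eigenvalue_set n1 n2 sp" "Arg k = \<gamma>0"
    and lt: "ereal (cmod k) < (INF \<gamma>\<in>{\<gamma>0<..<0}. rho_min n1 n2 sp \<gamma> * ereal (cos \<gamma>) / ereal (cos \<gamma>0))"
  shows "is_min_decay_eigenvalue n1 n2 sp (cmod k * cos \<gamma>0) k"
proof (rule min_decayI[OF k(1)])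
  show rk: "Re k = cmod k * cos \<gamma>0" using polar_Re_Im(1)[of k] k(2) by simp
  fix k' assume k': "k' \<in> eigenvalue_set n1 n2 sp" "Re k' = cmod k * cos \<gamma>0"
  have re: "0 < Re k'" using at_\<gamma>0_frequency(2)[OF k] rk k' by simp
  have im: "Im k' < 0" by (rule eigenvalue_lower_half[OF k'(1) re])
  show "Im k' \<le> Im k"
  proof (rule ccontr)
    assume "\<not> Im k' \<le> Im k"
    then have "Im k / Re k < Im k' / Re k'" using re rk k'(2) by (simp add: divide_strict_right_mono)
    then have "tan (Arg k) < tan (Arg k')" using tan_Arg[of k] tan_Arg[of k'] re rk k'(2) by simp
    moreover have "\<bar>Arg k'\<bar> < pi / 2" using Arg_Re_pos[of k'] re by simp
    ultimately have g: "\<gamma>0 < Arg k'" using k(2) \<gamma>0_range tan_mono_lt_eq[of \<gamma>0 "Arg k'"] by auto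
    have g0: "Arg k' < 0" using im by (simp add: Arg_neg_iff)
    define \<gamma> where "\<gamma> = Arg k'"
    have c: "0 < cos \<gamma>" using g g0 \<gamma>0_range unfolding \<gamma>_def by (intro cos_gt_zero_pi) auto
    have "rho_min n1 n2 sp \<gamma> \<le> ereal (cmod k')" unfolding rho_min_def using k'(1) by (intro INF_lower) (simp add: \<gamma>_def)
    then have "rho_min n1 n2 sp \<gamma> * ereal (cos \<gamma>) / ereal (cos \<gamma>0) \<le> ereal (cmod k') * ereal (cos \<gamma>) / ereal (cos \<gamma>0)"
      using c cos_\<gamma>0 by (intro ereal_divide_right_mono ereal_mult_right_mono) auto
    also have "\<dots> = ereal (cmod k)"
      using polar_Re_Im(1)[of k'] k'(2) cos_\<gamma>0 by (simp add: \<gamma>_def field_simps)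
    finally have "rho_min n1 n2 sp \<gamma> * ereal (cos \<gamma>) / ereal (cos \<gamma>0) \<le> ereal (cmod k)" .
    moreover have "\<gamma> \<in> {\<gamma>0<..<0}" using g g0 by (simp add: \<gamma>_def)
    ultimately show False using lt INF_lower2 not_less by (metis (no_types, lifting))
  qed
qed

end

section \<open>The left limit of the minimal modulus\<close>

context resonator begin

text \<open>The index of the quarter-wave layer whose eigenvalue has the argument \<gamma>.\<close>
definition matched_index :: "real \<Rightarrow> real" where
  "matched_index \<gamma> = n1 * (exp (- (pi * tan \<gamma>)) + 1) / (exp (- (pi * tan \<gamma>)) - 1)"

lemma matched_index_eigenvalue:
  assumes g: "- (pi / 2) < \<gamma>" "\<gamma> \<le> \<gamma>0"
  shows "n1 < matched_index \<gamma>" "matched_index \<gamma> \<le> n2"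
    "rho_min n1 n2 sp \<gamma> \<le> ereal (pi / (2 * sp * matched_index \<gamma> * cos \<gamma>))"
proof -
  define x where "x = - (pi * tan \<gamma>)"
  define n where "n = matched_index \<gamma>"
  have "tan \<gamma> \<le> tan \<gamma>0" using g \<gamma>0_range by (intro tan_mono_le) auto
  then have xL: "L0 \<le> x" unfolding tan_\<gamma>0 x_def using pi_gt_zero by (simp add: field_simps)
  then have x: "0 < x" using L0_pos by simp
  have ex: "1 < exp x" using x by simp
  have n_eq: "n = n1 * (exp x + 1) / (exp x - 1)" by (simp add: n_def matched_index_def x_def)
  have nm: "n * (exp x - 1) = n1 * (exp x + 1)" unfolding n_eq using ex by simp
  show n1n: "n1 < matched_index \<gamma>"
  proof -
    have "n1 * (exp x - 1) < n1 * (exp x + 1)" using n1 by simp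
    then have "n1 * (exp x - 1) < n * (exp x - 1)" using nm by simp
    then show ?thesis using ex by (simp add: n_def)
  qed
  have eL: "exp L0 = (n2 + n1) / (n2 - n1)" unfolding L0_def using n1 n12 by simp
  show nn2: "matched_index \<gamma> \<le> n2"
  proof -
    have "(n2 + n1) / (n2 - n1) \<le> exp x" using xL unfolding eL[symmetric] by simp
    then have "n2 + n1 \<le> exp x * (n2 - n1)" using n12 by (simp add: field_simps)
    then have "n1 * (exp x + 1) \<le> n2 * (exp x - 1)" by (simp add: algebra_simps)
    then have "n * (exp x - 1) \<le> n2 * (exp x - 1)" using nm by simp
    then show ?thesis using ex by (simp add: n_def)
  qed
  have ln: "ln ((n + n1) / (n - n1)) = x"
  proof -
    have "n - n1 \<noteq> 0" using n1n by (simp add: n_def)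
    moreover have "n + n1 = exp x * (n - n1)" using nm by (simp add: algebra_simps)
    ultimately show ?thesis by simp
  qed
  define k where "k = Complex (pi / (2 * sp * n)) (- (ln ((n + n1) / (n - n1)) / (2 * sp * n)))"
  have nn: "n1 < n" "n \<le> n2" "0 < n" using n1n nn2 n1 by (auto simp: n_def)
  have kS: "k \<in> eigenvalue_set n1 n2 sp" by (rule quarter_wave_eigenvalue(3)[OF nn(1,2) k_def])
  have rk: "Re k = pi / (2 * sp * n)" "Im k = - (x / (2 * sp * n))" by (simp_all add: k_def ln)
  have re: "0 < Re k" unfolding rk using sp nn pi_gt_zero by simp
  have "Im k / Re k = tan \<gamma>" unfolding rk x_def using sp nn pi_gt_zero by simp
  then have "Arg k = arctan (tan \<gamma>)" using arg_conv_arctan[OF re] by simp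
  then have arg: "Arg k = \<gamma>" using g \<gamma>0_range by (simp add: arctan_tan)
  have c: "0 < cos \<gamma>" using g \<gamma>0_range by (intro cos_gt_zero_pi) auto
  have "cmod k = Re k / cos \<gamma>" using polar_Re_Im(1)[of k] c arg by (simp add: field_simps)
  also have "\<dots> = pi / (2 * sp * n * cos \<gamma>)" unfolding rk by simp
  finally have ck: "cmod k = pi / (2 * sp * n * cos \<gamma>)" .
  have "rho_min n1 n2 sp \<gamma> \<le> ereal (cmod k)"
    unfolding rho_min_def using kS arg by (intro INF_lower) auto
  then show "rho_min n1 n2 sp \<gamma> \<le> ereal (pi / (2 * sp * matched_index \<gamma> * cos \<gamma>))" by (simp only: ck n_def)
qed

definition frequency_floor :: "real \<Rightarrow> real" where
  "frequency_floor b = min (2 * arctan (n2 / n1)) ((pi - 3 / 2 * b * (b * pi - L0) / (1 + b\<^sup>2)) / 2)"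

lemma rho_min_floor:
  assumes g: "- (pi / 2) < \<gamma>" "\<gamma> < pi / 2"
  shows "ereal (frequency_floor (- tan \<gamma>) / (n2 * sp * cos \<gamma>)) \<le> rho_min n1 n2 sp \<gamma>"
  unfolding rho_min_def
proof (rule INF_greatest)
  fix k assume "k \<in> {k \<in> eigenvalue_set n1 n2 sp. Arg k = \<gamma>}"
  then have k: "k \<in> eigenvalue_set n1 n2 sp" "Arg k = \<gamma>" by auto
  have "k \<noteq> 0" using k by (auto simp: eigenvalue_set_def generates_eigenvalue_def)
  then have re: "0 < Re k" using Arg_Re_pos[of k] g k by auto
  have b: "- tan \<gamma> = - Im k / Re k" using tan_Arg[OF re] k(2) by simp
  have c: "0 < cos \<gamma>" using g by (intro cos_gt_zero_pi) auto
  have "frequency_floor (- tan \<gamma>) \<le> n2 * Re k * sp"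
    unfolding frequency_floor_def by (rule frequency_lower_bound[OF k(1) re b])
  also have "\<dots> = cmod k * (n2 * sp * cos \<gamma>)" using polar_Re_Im(1)[of k] k(2) by simp
  finally show "ereal (frequency_floor (- tan \<gamma>) / (n2 * sp * cos \<gamma>)) \<le> ereal (cmod k)"
    using c n2 sp by (simp add: pos_divide_le_eq)
qed

text \<open>The minimal modulus is squeezed between frequency_lower_bound and the quarter-wave layers of
  intermediate index; the two bounds agree at \<gamma>0.\<close>
theorem rho_min_left_limit: "(rho_min n1 n2 sp \<longlongrightarrow> ereal (cmod \<kappa>0)) (at_left \<gamma>0)"
proof (rule tendsto_sandwich)
  let ?U = "\<lambda>\<gamma>. pi / (2 * sp * matched_index \<gamma> * cos \<gamma>)"
  let ?F = "\<lambda>\<gamma>. frequency_floor (- tan \<gamma>) / (n2 * sp * cos \<gamma>)"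
  have ev: "eventually (\<lambda>\<gamma>. \<gamma> \<in> {- (pi / 2)<..<\<gamma>0}) (at_left \<gamma>0)"
    using \<gamma>0_range by (intro eventually_at_leftI[of "- (pi / 2)"]) auto
  show "eventually (\<lambda>\<gamma>. ereal (?F \<gamma>) \<le> rho_min n1 n2 sp \<gamma>) (at_left \<gamma>0)"
    using ev by eventually_elim (use \<gamma>0_range in \<open>auto intro!: rho_min_floor\<close>)
  show "eventually (\<lambda>\<gamma>. rho_min n1 n2 sp \<gamma> \<le> ereal (?U \<gamma>)) (at_left \<gamma>0)"
    using ev by eventually_elim (auto intro!: matched_index_eigenvalue(3))
  have c: "cos \<gamma>0 \<noteq> 0" using cos_\<gamma>0 by simp
  have cm: "cmod \<kappa>0 = pi / (2 * sp * n2 * cos \<gamma>0)" unfolding cmod_\<kappa>0 \<alpha>0_def by simp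
  have tn: "(tan \<longlongrightarrow> tan \<gamma>0) (at_left \<gamma>0)" by (intro tendsto_intros c)
  have eL: "exp (- (pi * tan \<gamma>0)) = (n2 + n1) / (n2 - n1)"
    unfolding tan_\<gamma>0 using n1 n12 by (simp add: L0_def)
  have e1: "exp (- (pi * tan \<gamma>0)) - 1 \<noteq> 0" unfolding tan_\<gamma>0 using L0_pos by simp
  have mi: "matched_index \<gamma>0 = n2" unfolding matched_index_def eL using n1 n12 by (simp add: field_simps)
  have "(matched_index \<longlongrightarrow> matched_index \<gamma>0) (at_left \<gamma>0)"
    unfolding matched_index_def by (intro tendsto_intros tn e1)
  then have "(?U \<longlongrightarrow> ?U \<gamma>0) (at_left \<gamma>0)"
    using c sp n2 by (intro tendsto_intros) (auto simp: mi)
  then show "((\<lambda>\<gamma>. ereal (?U \<gamma>)) \<longlongrightarrow> ereal (cmod \<kappa>0)) (at_left \<gamma>0)"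
    unfolding mi cm by (intro tendsto_ereal)
  have sq: "1 + (- tan \<gamma>0)\<^sup>2 \<noteq> 0" by (metis add_pos_nonneg less_irrefl zero_le_power2 zero_less_one)
  have "((\<lambda>\<gamma>. frequency_floor (- tan \<gamma>)) \<longlongrightarrow> frequency_floor (- tan \<gamma>0)) (at_left \<gamma>0)"
    unfolding frequency_floor_def by (intro tendsto_intros tendsto_min tn sq) auto
  then have "(?F \<longlongrightarrow> ?F \<gamma>0) (at_left \<gamma>0)"
    using c sp n2 by (intro tendsto_intros) auto
  moreover have "frequency_floor (- tan \<gamma>0) = pi / 2"
    unfolding frequency_floor_def tan_\<gamma>0 using arctan_gt_quarter_pi[OF n1 n12] by (simp add: min_def)
  ultimately show "((\<lambda>\<gamma>. ereal (?F \<gamma>)) \<longlongrightarrow> ereal (cmod \<kappa>0)) (at_left \<gamma>0)"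
    unfolding cm by (intro tendsto_ereal) (simp add: mult_ac)
qed

end

section \<open>Trajectories on the sphere\<close>

text \<open>The pair (i k Y, V) consists of homogeneous coordinates of the point x of the sphere.\<close>
definition represents :: "complex \<Rightarrow> riemann_sphere \<Rightarrow> complex \<Rightarrow> complex \<Rightarrow> bool" where
  "represents k x Y V \<longleftrightarrow> (case x of Fin z \<Rightarrow> Y \<noteq> 0 \<and> V = \<i> * k * z * Y | Infty \<Rightarrow> Y = 0 \<and> V \<noteq> 0)"

lemma represents_scale: "represents k x Y V \<Longrightarrow> c \<noteq> 0 \<Longrightarrow> represents k x (c * Y) (c * V)"
  by (auto simp: represents_def split: riemann_sphere.splits)

lemma represents_proportional:
  assumes "represents k x Y V" "represents k x Y' V'"
  obtains c where "c \<noteq> 0" "Y = c * Y'" "V = c * V'"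
proof (cases x)
  case (Fin z)
  then show ?thesis using assms that[of "Y / Y'"] by (auto simp: represents_def)
next
  case Infty
  then show ?thesis using assms that[of "V / V'"] by (auto simp: represents_def)
qed

lemma ac_deriv_on_continuous:
  assumes "ac_deriv_on f g {a..b}" "a \<le> b" shows "continuous_on {a..b} f"
proof -
  have g: "g integrable_on {a..b}" using assms unfolding ac_deriv_on_def absolutely_integrable_on_def by auto
  have "continuous_on {a..b} (\<lambda>s. f a + integral {a..s} g)"
    by (intro continuous_intros indefinite_integral_continuous_1 g)
  moreover have "f a + integral {a..s} g = f s" if "s \<in> {a..b}" for s
  proof -
    have "(g has_integral f s - f a) {a..s}" using assms that unfolding ac_deriv_on_def by auto
    then show ?thesis by (simp add: integral_unique)
  qed
  ultimately show ?thesis by (rule continuous_on_eq)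
qed

lemma ac_deriv_on_subset: "ac_deriv_on f g I \<Longrightarrow> J \<subseteq> I \<Longrightarrow> ac_deriv_on f g J"
  unfolding ac_deriv_on_def by blast

lemma primitive_integral_continuous:
  fixes g :: "real \<Rightarrow> 'a::euclidean_space"
  assumes "continuous_on {a..b} g" shows "primitive (\<lambda>t. integral {a..t} g) g a b"
  by (rule primitive_integral[OF continuous_bounded_measurable[OF assms]])

lemma riccati_bounded:
  fixes z :: "real \<Rightarrow> complex"
  assumes "admissible n1 n2 \<epsilon>" "continuous_on {a..b} z" "continuous_on {a..b} w"
  shows "bounded ((\<lambda>s. w s + of_real (\<epsilon> s) * z s) ` {a..b})"
proof -
  have b1: "bounded (w ` {a..b})" and b2: "bounded (z ` {a..b})"
    using assms by (auto intro: continuous_bounded_measurable(2))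
  have "bounded ((\<lambda>s. complex_of_real (\<epsilon> s)) ` {a..b})"
    unfolding bounded_iff using admissible_bound[OF assms(1)] by (intro exI[of _ "n2\<^sup>2"]) auto
  from bounded_plus_comp[OF b1 bounded_mult_image[OF this b2]] show ?thesis .
qed

lemma wave_from_chart_zero:
  assumes k: "k \<noteq> 0" and cd: "c \<le> d" and adm: "admissible n1 n2 \<epsilon>'" and N: "negligible N" and eq: "\<And>s. s \<in> {c..d} - N \<Longrightarrow> \<epsilon> s = \<epsilon>' s"
    and x: "\<forall>s\<in>{c..d}. x s \<noteq> Infty"
    and ac: "ac_deriv_on (\<lambda>s. chart_zero (x s)) (\<lambda>s. \<i> * k * (- (chart_zero (x s))\<^sup>2 + of_real (\<epsilon> s))) {c..d}"
  shows "\<exists>y v. wave k \<epsilon>' c d y v \<and> (\<forall>s\<in>{c..d}. represents k (x s) (y s) (v s))"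
proof -
  define z where "z = (\<lambda>s. chart_zero (x s))"
  have cz: "continuous_on {c..d} z" unfolding z_def by (rule ac_deriv_on_continuous[OF ac cd])
  have ac': "ac_deriv_on z (\<lambda>s. (- \<i> * k * (z s)\<^sup>2) + of_real (\<epsilon>' s) * (\<i> * k)) {c..d}"
    unfolding z_def by (rule ac_deriv_on_spike[OF ac N]) (simp add: eq algebra_simps)
  have Pz: "primitive z (\<lambda>s. (- \<i> * k * (z s)\<^sup>2) + of_real (\<epsilon>' s) * (\<i> * k)) c d"
    by (rule primitive_of_ac_deriv_on[OF ac' riccati_bounded[OF adm] cd]) (intro continuous_intros cz)+
  define y where "y = (\<lambda>s. exp (\<i> * k * integral {c..s} z))"
  define v where "v = (\<lambda>s. \<i> * k * z s * y s)"
  have Py: "primitive y (\<lambda>s. y s * (\<i> * k * z s)) c d"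
    unfolding y_def by (intro primitive_exp primitive_cmult primitive_integral_continuous cz)
  have "primitive v (\<lambda>s. (\<i> * k * ((- \<i> * k * (z s)\<^sup>2) + of_real (\<epsilon>' s) * (\<i> * k))) * y s + \<i> * k * z s * (y s * (\<i> * k * z s))) c d"
    unfolding v_def by (intro primitive_mult primitive_cmult Pz Py)
  then have Pv: "primitive v (\<lambda>s. - k\<^sup>2 * of_real (\<epsilon>' s) * y s) c d"
  proof (rule primitive_cong)
    fix s
    have "(\<i> * k * ((- \<i> * k * (z s)\<^sup>2) + of_real (\<epsilon>' s) * (\<i> * k))) * y s + \<i> * k * z s * (y s * (\<i> * k * z s))
      = (\<i> * \<i>) * (k * k * of_real (\<epsilon>' s) * y s)" by (simp add: power2_eq_square algebra_simps)
    then show "(\<i> * k * ((- \<i> * k * (z s)\<^sup>2) + of_real (\<epsilon>' s) * (\<i> * k))) * y s + \<i> * k * z s * (y s * (\<i> * k * z s))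
      = - k\<^sup>2 * of_real (\<epsilon>' s) * y s" by (simp add: power2_eq_square)
  qed simp
  have "wave k \<epsilon>' c d y v" unfolding wave_def using Pv primitive_cong[OF Py, of y v] by (simp add: v_def mult_ac)
  moreover have "represents k (x s) (y s) (v s)" if "s \<in> {c..d}" for s
    using x that by (cases "x s") (auto simp: represents_def v_def z_def y_def)
  ultimately show ?thesis by blast
qed

lemma wave_from_chart_infty:
  assumes k: "k \<noteq> 0" and cd: "c \<le> d" and adm: "admissible n1 n2 \<epsilon>'" and N: "negligible N" and eq: "\<And>s. s \<in> {c..d} - N \<Longrightarrow> \<epsilon> s = \<epsilon>' s"
    and x: "\<forall>s\<in>{c..d}. x s \<noteq> Fin 0"
    and ac: "ac_deriv_on (\<lambda>s. chart_infty (x s)) (\<lambda>s. \<i> * k * (- 1 + of_real (\<epsilon> s) * (chart_infty (x s))\<^sup>2)) {c..d}"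
  shows "\<exists>y v. wave k \<epsilon>' c d y v \<and> (\<forall>s\<in>{c..d}. represents k (x s) (y s) (v s))"
proof -
  define z where "z = (\<lambda>s. chart_infty (x s))"
  have cz: "continuous_on {c..d} z" unfolding z_def by (rule ac_deriv_on_continuous[OF ac cd])
  have ac': "ac_deriv_on z (\<lambda>s. - \<i> * k + of_real (\<epsilon>' s) * (\<i> * k * (z s)\<^sup>2)) {c..d}"
    unfolding z_def by (rule ac_deriv_on_spike[OF ac N]) (simp add: eq algebra_simps)
  have Pz: "primitive z (\<lambda>s. - \<i> * k + of_real (\<epsilon>' s) * (\<i> * k * (z s)\<^sup>2)) c d"
    by (rule primitive_of_ac_deriv_on[OF ac' riccati_bounded[OF adm] cd]) (intro continuous_intros cz)+
  have ez: "(\<lambda>s. of_real (\<epsilon>' s) * z s) \<in> borel_measurable (lebesgue_on {c..d})" "bounded ((\<lambda>s. of_real (\<epsilon>' s) * z s) ` {c..d})"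
  proof -
    show "(\<lambda>s. of_real (\<epsilon>' s) * z s) \<in> borel_measurable (lebesgue_on {c..d})"
      using admissible_measurable(1)[OF adm, of "{c..d}"] continuous_bounded_measurable(1)[OF cz] by measurable
    show "bounded ((\<lambda>s. of_real (\<epsilon>' s) * z s) ` {c..d})"
      using riccati_bounded[OF adm cz, of "\<lambda>_. 0"] by simp
  qed
  define v where "v = (\<lambda>s. exp (- \<i> * k * integral {c..s} (\<lambda>s. of_real (\<epsilon>' s) * z s)))"
  define y where "y = (\<lambda>s. \<i> / k * (z s * v s))"
  have Pv: "primitive v (\<lambda>s. v s * (- \<i> * k * (of_real (\<epsilon>' s) * z s))) c d"
    unfolding v_def by (intro primitive_exp primitive_cmult primitive_integral ez)
  have "primitive y (\<lambda>s. \<i> / k * ((- \<i> * k + of_real (\<epsilon>' s) * (\<i> * k * (z s)\<^sup>2)) * v s + z s * (v s * (- \<i> * k * (of_real (\<epsilon>' s) * z s))))) c d"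
    unfolding y_def by (intro primitive_mult primitive_cmult Pz Pv)
  then have Py: "primitive y v c d"
  proof (rule primitive_cong)
    fix s
    have "(- \<i> * k + of_real (\<epsilon>' s) * (\<i> * k * (z s)\<^sup>2)) * v s + z s * (v s * (- \<i> * k * (of_real (\<epsilon>' s) * z s))) = - \<i> * k * v s"
      by (simp add: power2_eq_square algebra_simps)
    then show "\<i> / k * ((- \<i> * k + of_real (\<epsilon>' s) * (\<i> * k * (z s)\<^sup>2)) * v s + z s * (v s * (- \<i> * k * (of_real (\<epsilon>' s) * z s)))) = v s"
      using k by simp
  qed simp
  have Pv': "primitive v (\<lambda>s. - k\<^sup>2 * of_real (\<epsilon>' s) * y s) c d"
    by (rule primitive_cong[OF Pv]) (use k in \<open>simp_all add: y_def power2_eq_square\<close>)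
  then have "wave k \<epsilon>' c d y v" using Py by (simp add: wave_def)
  moreover have "represents k (x s) (y s) (v s)" if "s \<in> {c..d}" for s
    using x that k by (cases "x s") (auto simp: represents_def v_def z_def y_def)
  ultimately show ?thesis by blast
qed

text \<open>In each chart the Riccati equation is linearized by an exponential; the local lifts agree up to
  constant factors and can therefore be glued.\<close>
lemma wave_from_trajectory:
  assumes k: "k \<noteq> 0" and t: "0 \<le> t" and tr: "trajectory_on k \<epsilon> {0..t} x"
    and adm: "admissible n1 n2 \<epsilon>'" and N: "negligible N" and eq: "\<And>s. s \<in> {0<..} - N \<Longrightarrow> \<epsilon> s = \<epsilon>' s"
  obtains y v where "wave k \<epsilon>' 0 t y v" "\<And>s. s \<in> {0..t} \<Longrightarrow> represents k (x s) (y s) (v s)"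
proof -
  let ?P = "\<lambda>c d. c \<le> d \<longrightarrow> 0 \<le> c \<longrightarrow> d \<le> t \<longrightarrow> (\<exists>y v. wave k \<epsilon>' c d y v \<and> (\<forall>s\<in>{c..d}. represents k (x s) (y s) (v s)))"
  have "?P 0 t"
  proof (rule Bolzano[where P="?P", OF t])
    fix a b c assume ab: "?P a b" and bc: "?P b c" and le: "a \<le> b" "b \<le> c"
    show "a \<le> c \<longrightarrow> 0 \<le> a \<longrightarrow> c \<le> t \<longrightarrow> (\<exists>y v. wave k \<epsilon>' a c y v \<and> (\<forall>s\<in>{a..c}. represents k (x s) (y s) (v s)))"
    proof (intro impI)
      assume "a \<le> c" "0 \<le> a" "c \<le> t"
      then obtain y v y' v' where w: "wave k \<epsilon>' a b y v" "\<forall>s\<in>{a..b}. represents k (x s) (y s) (v s)"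
        and w': "wave k \<epsilon>' b c y' v'" "\<forall>s\<in>{b..c}. represents k (x s) (y' s) (v' s)"
        using ab bc le by auto
      obtain m where m: "m \<noteq> 0" "y b = m * y' b" "v b = m * v' b"
        using represents_proportional[of k "x b" "y b" "v b" "y' b" "v' b"] w(2) w'(2) le by auto
      define Y where "Y = (\<lambda>s. if s \<le> b then y s else m * y' s)"
      define V where "V = (\<lambda>s. if s \<le> b then v s else m * v' s)"
      have "wave k \<epsilon>' a b Y V" by (rule wave_cong[OF w(1)]) (auto simp: Y_def V_def)
      moreover have "wave k \<epsilon>' b c Y V" by (rule wave_cong[OF wave_cmult[OF w'(1), of m]]) (auto simp: Y_def V_def m)
      ultimately have "wave k \<epsilon>' a c Y V" using le by (rule wave_glue)
      moreover have "represents k (x s) (Y s) (V s)" if "s \<in> {a..c}" for s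
        using that w(2) w'(2) represents_scale[OF _ m(1)] by (auto simp: Y_def V_def)
      ultimately show "\<exists>y v. wave k \<epsilon>' a c y v \<and> (\<forall>s\<in>{a..c}. represents k (x s) (y s) (v s))" by blast
    qed
  next
    fix s0 assume s0: "0 \<le> s0" "s0 \<le> t"
    then obtain \<delta> where d: "\<delta> > 0" and J: "let J = {0..t} \<inter> {s0 - \<delta>..s0 + \<delta>} in
        ((\<forall>s\<in>J. x s \<noteq> Infty) \<and>
         ac_deriv_on (\<lambda>s. chart_zero (x s)) (\<lambda>s. \<i> * k * (- (chart_zero (x s))\<^sup>2 + of_real (\<epsilon> s))) J) \<or>
        ((\<forall>s\<in>J. x s \<noteq> Fin 0) \<and>
         ac_deriv_on (\<lambda>s. chart_infty (x s)) (\<lambda>s. \<i> * k * (- 1 + of_real (\<epsilon> s) * (chart_infty (x s))\<^sup>2)) J)"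
      using tr unfolding trajectory_on_def by (meson atLeastAtMost_iff)
    have "?P a b" if ab: "a \<le> s0" "s0 \<le> b" "b - a < \<delta>" for a b
    proof (intro impI)
      assume le: "a \<le> b" "0 \<le> a" "b \<le> t"
      have sub: "{a..b} \<subseteq> {0..t} \<inter> {s0 - \<delta>..s0 + \<delta>}" using ab le by auto
      have N': "negligible (insert 0 N)" using N by simp
      have eq': "\<And>s. s \<in> {a..b} - insert 0 N \<Longrightarrow> \<epsilon> s = \<epsilon>' s" using eq le by auto
      from J show "\<exists>y v. wave k \<epsilon>' a b y v \<and> (\<forall>s\<in>{a..b}. represents k (x s) (y s) (v s))"
        unfolding Let_def
      proof (elim disjE conjE)
        assume "\<forall>s\<in>{0..t} \<inter> {s0 - \<delta>..s0 + \<delta>}. x s \<noteq> Infty"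
          and ac: "ac_deriv_on (\<lambda>s. chart_zero (x s)) (\<lambda>s. \<i> * k * (- (chart_zero (x s))\<^sup>2 + of_real (\<epsilon> s))) ({0..t} \<inter> {s0 - \<delta>..s0 + \<delta>})"
        then have "\<forall>s\<in>{a..b}. x s \<noteq> Infty" using sub by blast
        then show ?thesis
          by (intro wave_from_chart_zero[where N="insert 0 N", OF k le(1) adm N' _ _ ac_deriv_on_subset[OF ac sub]]) (use eq' in auto)
      next
        assume "\<forall>s\<in>{0..t} \<inter> {s0 - \<delta>..s0 + \<delta>}. x s \<noteq> Fin 0"
          and ac: "ac_deriv_on (\<lambda>s. chart_infty (x s)) (\<lambda>s. \<i> * k * (- 1 + of_real (\<epsilon> s) * (chart_infty (x s))\<^sup>2)) ({0..t} \<inter> {s0 - \<delta>..s0 + \<delta>})"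
        then have "\<forall>s\<in>{a..b}. x s \<noteq> Fin 0" using sub by blast
        then show ?thesis
          by (intro wave_from_chart_infty[where N="insert 0 N", OF k le(1) adm N' _ _ ac_deriv_on_subset[OF ac sub]]) (use eq' in auto)
      qed
    qed
    then show "\<exists>d>0. \<forall>a b. a \<le> s0 \<and> s0 \<le> b \<and> b - a < d \<longrightarrow> ?P a b" using d by blast
  qed
  then show ?thesis using that t by auto
qed

text \<open>Where y is nonzero the quotient v / (i k y) solves the Riccati equation in the chart of finite
  points, and where v is nonzero its negative reciprocal solves the one at infinity.\<close>
lemma trajectory_from_wave:
  assumes k: "k \<noteq> 0" and w: "wave k \<epsilon> 0 t y v" and nd: "\<And>s. s \<in> {0..t} \<Longrightarrow> y s \<noteq> 0 \<or> v s \<noteq> 0"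
  shows "trajectory_on k \<epsilon> {0..t} (\<lambda>s. if y s = 0 then Infty else Fin (v s / (\<i> * k * y s)))"
  unfolding trajectory_on_def
proof
  let ?x = "\<lambda>s. if y s = 0 then Infty else Fin (v s / (\<i> * k * y s))"
  fix s0 assume s0: "s0 \<in> {0..t}"
  have Py: "primitive y v 0 t" and Pv: "primitive v (\<lambda>s. - k\<^sup>2 * of_real (\<epsilon> s) * y s) 0 t"
    using w by (auto simp: wave_def)
  have nbhd: "\<exists>\<delta>>0. \<forall>s\<in>{0..t} \<inter> {s0 - \<delta>..s0 + \<delta>}. f s \<noteq> 0" if f: "continuous_on {0..t} f" "f s0 \<noteq> 0" for f :: "real \<Rightarrow> complex"
  proof -
    obtain d where d: "d > 0" "\<And>s. s \<in> {0..t} \<Longrightarrow> dist s s0 < d \<Longrightarrow> dist (f s) (f s0) < cmod (f s0)"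
      using f s0 unfolding continuous_on_iff by (metis zero_less_norm_iff)
    have "f s \<noteq> 0" if "s \<in> {0..t} \<inter> {s0 - d / 2..s0 + d / 2}" for s
      using d(2)[of s] d(1) that by (auto simp: dist_real_def abs_less_iff)
    then show ?thesis using d(1) by (intro exI[of _ "d / 2"]) auto
  qed
  have interval: "{0..t} \<inter> {s0 - \<delta>..s0 + \<delta>} = {max 0 (s0 - \<delta>)..min t (s0 + \<delta>)}" for \<delta> by auto
  have inv: "primitive (\<lambda>s. inverse (f s)) (\<lambda>s. - (inverse (f s))\<^sup>2 * g s) a b"
    if f: "primitive f g a b" "\<And>s. s \<in> {a..b} \<Longrightarrow> f s \<noteq> 0" for f g :: "real \<Rightarrow> complex" and a b
  proof (rule primitive_compose[OF f(1)])
    show "(inverse has_field_derivative - (inverse (f s))\<^sup>2) (at (f s))" if "s \<in> {a..b}" for s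
      using DERIV_inverse[OF f(2)[OF that]] by (simp add: numeral_2_eq_2)
    show "continuous_on (f ` {a..b}) (\<lambda>w. - (inverse w)\<^sup>2)" using f(2) by (intro continuous_intros) auto
  qed
  show "\<exists>\<delta>>0. let J = {0..t} \<inter> {s0 - \<delta>..s0 + \<delta>} in
        ((\<forall>s\<in>J. ?x s \<noteq> Infty) \<and>
         ac_deriv_on (\<lambda>s. chart_zero (?x s)) (\<lambda>s. \<i> * k * (- (chart_zero (?x s))\<^sup>2 + of_real (\<epsilon> s))) J) \<or>
        ((\<forall>s\<in>J. ?x s \<noteq> Fin 0) \<and>
         ac_deriv_on (\<lambda>s. chart_infty (?x s)) (\<lambda>s. \<i> * k * (- 1 + of_real (\<epsilon> s) * (chart_infty (?x s))\<^sup>2)) J)"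
  proof (cases "y s0 = 0")
    case False
    obtain \<delta> where d: "\<delta> > 0" "\<forall>s\<in>{0..t} \<inter> {s0 - \<delta>..s0 + \<delta>}. y s \<noteq> 0"
      using nbhd[OF primitive_continuous[OF Py] False] by blast
    define a where "a = max 0 (s0 - \<delta>)"
    define b where "b = min t (s0 + \<delta>)"
    have J: "{0..t} \<inter> {s0 - \<delta>..s0 + \<delta>} = {a..b}" unfolding interval a_def b_def ..
    have ab: "0 \<le> a" "b \<le> t" by (auto simp: a_def b_def)
    have ynz: "\<And>s. s \<in> {a..b} \<Longrightarrow> y s \<noteq> 0" using d(2) unfolding J by blast
    have "primitive (\<lambda>s. (1 / (\<i> * k)) * (v s * inverse (y s)))
       (\<lambda>s. (1 / (\<i> * k)) * ((- k\<^sup>2 * of_real (\<epsilon> s) * y s) * inverse (y s) + v s * (- (inverse (y s))\<^sup>2 * v s))) a b"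
      by (intro primitive_cmult primitive_mult primitive_subset[OF Pv ab] inv primitive_subset[OF Py ab] ynz)
    then have "primitive (\<lambda>s. chart_zero (?x s)) (\<lambda>s. \<i> * k * (- (chart_zero (?x s))\<^sup>2 + of_real (\<epsilon> s))) a b"
    proof (rule primitive_cong)
      fix s assume s: "s \<in> {a..b}"
      show "(1 / (\<i> * k)) * (v s * inverse (y s)) = chart_zero (?x s)" using ynz[OF s] by (simp add: divide_inverse)
      have "(1 / (\<i> * k)) * ((- k\<^sup>2 * e * Y) * inverse Y + V * (- (inverse Y)\<^sup>2 * V)) = \<i> * k * (- (V / (\<i> * k * Y))\<^sup>2 + e)"
        if "Y \<noteq> 0" for e Y V :: complex
        using that k by (simp add: field_simps power2_eq_square)
      from this[OF ynz[OF s]]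
      show "(1 / (\<i> * k)) * ((- k\<^sup>2 * of_real (\<epsilon> s) * y s) * inverse (y s) + v s * (- (inverse (y s))\<^sup>2 * v s)) = \<i> * k * (- (chart_zero (?x s))\<^sup>2 + of_real (\<epsilon> s))"
        using ynz[OF s] by simp
    qed
    from primitive_ac_deriv_on[OF this] show ?thesis
      using d(1) ynz by (intro exI[of _ \<delta>]) (simp only: Let_def J, simp)
  next
    case True
    then have "v s0 \<noteq> 0" using nd[OF s0] by simp
    then obtain \<delta> where d: "\<delta> > 0" "\<forall>s\<in>{0..t} \<inter> {s0 - \<delta>..s0 + \<delta>}. v s \<noteq> 0"
      using nbhd[OF primitive_continuous[OF Pv]] by blast
    define a where "a = max 0 (s0 - \<delta>)"
    define b where "b = min t (s0 + \<delta>)"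
    have J: "{0..t} \<inter> {s0 - \<delta>..s0 + \<delta>} = {a..b}" unfolding interval a_def b_def ..
    have ab: "0 \<le> a" "b \<le> t" by (auto simp: a_def b_def)
    have vnz: "\<And>s. s \<in> {a..b} \<Longrightarrow> v s \<noteq> 0" using d(2) unfolding J by blast
    have ci: "chart_infty (?x s) = - \<i> * k * (y s * inverse (v s))" if "s \<in> {a..b}" for s
      using vnz[OF that] by (simp add: divide_inverse)
    have "primitive (\<lambda>s. (- \<i> * k) * (y s * inverse (v s)))
       (\<lambda>s. (- \<i> * k) * (v s * inverse (v s) + y s * (- (inverse (v s))\<^sup>2 * (- k\<^sup>2 * of_real (\<epsilon> s) * y s)))) a b"
      by (intro primitive_cmult primitive_mult primitive_subset[OF Py ab] inv primitive_subset[OF Pv ab] vnz)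
    then have "primitive (\<lambda>s. chart_infty (?x s)) (\<lambda>s. \<i> * k * (- 1 + of_real (\<epsilon> s) * (chart_infty (?x s))\<^sup>2)) a b"
    proof (rule primitive_cong)
      fix s assume s: "s \<in> {a..b}"
      show "(- \<i> * k) * (y s * inverse (v s)) = chart_infty (?x s)" using ci[OF s] by simp
      have "(- \<i> * k) * (V * inverse V + Y * (- (inverse V)\<^sup>2 * (- k\<^sup>2 * e * Y))) = \<i> * k * (- 1 + e * (- \<i> * k * (Y * inverse V))\<^sup>2)"
        if "V \<noteq> 0" for e Y V :: complex
        using that by (simp add: field_simps power2_eq_square)
      from this[OF vnz[OF s]]
      show "(- \<i> * k) * (v s * inverse (v s) + y s * (- (inverse (v s))\<^sup>2 * (- k\<^sup>2 * of_real (\<epsilon> s) * y s))) = \<i> * k * (- 1 + of_real (\<epsilon> s) * (chart_infty (?x s))\<^sup>2)"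
        unfolding ci[OF s] .
    qed
    from primitive_ac_deriv_on[OF this] show ?thesis
      using d(1) vnz k by (intro exI[of _ \<delta>]) (simp only: Let_def J, simp)
  qed
qed

section \<open>Minimal time on the critical ray\<close>

context resonator begin

text \<open>On the ray of \<kappa>0 the ratio of decay and frequency is critical, so a first crossing at or
  beyond the target takes at least the time sp / c of the quarter-wave layer, and a detour takes
  longer.\<close>
lemma steering_time:
  assumes ray: "k = of_real c * \<kappa>0" "0 < c" and f: "feasible_on n1 n2 {0<..} \<epsilon>" and st: "steers k \<epsilon> Infty (Fin (of_real n1)) t"
  shows "sp / c \<le> t" and "t = sp / c \<Longrightarrow> \<exists>N. negligible N \<and> (\<forall>s\<in>{0<..<t} - N. \<epsilon> s = n2\<^sup>2)"
proof -
  obtain x where t0: "0 \<le> t" and x: "trajectory_on k \<epsilon> {0..t} x" "x 0 = Infty" "x t = Fin (of_real n1)"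
    using st unfolding steers_def by blast
  have t: "0 < t" using t0 x by (cases "t = 0") auto
  obtain \<epsilon>' N where e: "admissible n1 n2 \<epsilon>'" "negligible N" "\<And>s. s \<in> {0<..} - N \<Longrightarrow> \<epsilon> s = \<epsilon>' s"
    using feasible_representative[OF n1 n12 f] by auto
  have \<kappa>nz: "\<kappa>0 \<noteq> 0" using \<alpha>0_pos by (auto simp: \<kappa>0_def complex_eq_iff)
  then have knz: "k \<noteq> 0" using ray by simp
  obtain y v where w: "wave k \<epsilon>' 0 t y v" and r: "\<And>s. s \<in> {0..t} \<Longrightarrow> represents k (x s) (y s) (v s)"
    using wave_from_trajectory[OF knz t0 x(1) e] by blast
  have y0: "y 0 = 0" "v 0 \<noteq> 0" using r[of 0] x(2) t by (auto simp: represents_def)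
  have yt: "v t = \<i> * k * of_real n1 * y t" using r[of t] x(3) t by (auto simp: represents_def)
  have re: "Re k = c * \<alpha>0" "Im k = - (c * \<beta>0)" using ray by (simp_all add: \<kappa>0_def)
  interpret mode n1 n2 "Re k" "- Im k" t k \<epsilon>' y v
    by (rule mode_of_wave[OF n1 n12 _ _ t e(1) w y0]) (use re ray \<alpha>0_pos \<beta>0_pos in auto)
  have "outgoing n1 t = 0" by (simp add: outgoing_def yt)
  note D = escape_time_dichotomy[OF this, folded L0_def]
  have c0: "n2 * Re k * (sp / c) = pi / 2" unfolding re \<alpha>0_def using ray(2) n2 sp by simp
  have pos: "0 < n2 * Re k" using n2 ray(2) \<alpha>0_pos re by simp
  have A: "pi / 2 < 2 * arctan (n2 / n1)" using arctan_gt_quarter_pi[OF n1 n12] by simp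
  have second: "sp / c \<le> t1 \<and> t1 \<le> t \<and> negligible {s \<in> {0..t1}. \<epsilon>' s \<noteq> n2\<^sup>2}"
    if "t1 \<le> t" "L0 \<le> p" "Re k * p \<le> - Im k * pi"
       "pi \<le> 2 * n2 * Re k * t1 + 3 / 2 * - Im k * (- Im k * pi - Re k * p) / ((Re k)\<^sup>2 + (- Im k)\<^sup>2)"
       "Re k * p = - Im k * pi \<longrightarrow> negligible {s \<in> {0..t1}. \<epsilon>' s \<noteq> n2\<^sup>2}" for t1 p
  proof -
    have "Re k * L0 \<le> Re k * p" using that(2) \<alpha>0_pos ray(2) re by simp
    moreover have "Re k * L0 = - Im k * pi" unfolding re using ratio0 by (simp add: mult.assoc)
    ultimately have eq: "Re k * p = - Im k * pi" using that(3) by linarith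
    then have "pi \<le> 2 * n2 * Re k * t1" using that(4) by simp
    then have "n2 * Re k * (sp / c) \<le> n2 * Re k * t1" unfolding c0 by simp
    then have "sp / c \<le> t1" using pos by (simp only: mult_le_cancel_left_pos)
    then show ?thesis using that eq by blast
  qed
  show "sp / c \<le> t"
    using D
  proof (elim disjE exE conjE)
    assume "2 * arctan (n2 / n1) \<le> n2 * Re k * t"
    then have "n2 * Re k * (sp / c) \<le> n2 * Re k * t" unfolding c0 using A by linarith
    then show ?thesis using pos by (simp only: mult_le_cancel_left_pos)
  qed (use second order_trans in blast)
  assume tc: "t = sp / c"
  have "negligible {s \<in> {0..t}. \<epsilon>' s \<noteq> n2\<^sup>2}"
    using D
  proof (elim disjE exE conjE)
    assume "2 * arctan (n2 / n1) \<le> n2 * Re k * t"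
    then show ?thesis using A c0 unfolding tc by linarith
  next
    fix t1 p
    assume *: "t1 \<le> t" "L0 \<le> p" "Re k * p \<le> - Im k * pi"
       "pi \<le> 2 * n2 * Re k * t1 + 3 / 2 * - Im k * (- Im k * pi - Re k * p) / ((Re k)\<^sup>2 + (- Im k)\<^sup>2)"
       "Re k * p = - Im k * pi \<longrightarrow> negligible {s \<in> {0..t1}. \<epsilon>' s \<noteq> n2\<^sup>2}"
    from second[OF this] tc have "t1 = t" by simp
    then show ?thesis using second[OF *] by simp
  qed
  then have "negligible (N \<union> {s \<in> {0..t}. \<epsilon>' s \<noteq> n2\<^sup>2})" using e(2) by (intro negligible_Un)
  moreover have "\<forall>s\<in>{0<..<t} - (N \<union> {s \<in> {0..t}. \<epsilon>' s \<noteq> n2\<^sup>2}). \<epsilon> s = n2\<^sup>2" using e(3) by auto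
  ultimately show "\<exists>N. negligible N \<and> (\<forall>s\<in>{0<..<t} - N. \<epsilon> s = n2\<^sup>2)" by blast
qed

lemma ray_quarter_wave:
  assumes k: "k = of_real c * \<kappa>0" "0 < c"
  obtains y v where "wave k (\<lambda>_. n2\<^sup>2) 0 (sp / c) y v" "y 0 = 0" "v 0 = 1" "v (sp / c) = \<i> * k * of_real n1 * y (sp / c)" "y (sp / c) \<noteq> 0" "k \<noteq> 0"
    "y = (\<lambda>s. sin (k * of_real n2 * of_real s) / (k * of_real n2))" "v = (\<lambda>s. cos (k * of_real n2 * of_real s))"
proof -
  have k': "k = Complex (c * \<alpha>0) (- (c * \<beta>0))" using k by (simp add: \<kappa>0_def complex_eq_iff)
  have "c * \<alpha>0 * n2 * (sp / c) = pi / 2" "2 * (c * \<beta>0) * n2 * (sp / c) = ln ((n2 + n1) / (n2 - n1))"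
    using k(2) n2 sp by (simp_all add: \<alpha>0_def \<beta>0_def L0_def)
  from quarter_wave_mode[OF n1 n12 k' this] show ?thesis using that by blast
qed

lemma quarter_wave_steers:
  assumes k: "k = of_real c * \<kappa>0" "0 < c"
  shows "steers k (\<lambda>_. n2\<^sup>2) Infty (Fin (of_real n1)) (sp / c)"
proof -
  obtain y v where w: "wave k (\<lambda>_. n2\<^sup>2) 0 (sp / c) y v" "y 0 = 0" "v 0 = 1" "v (sp / c) = \<i> * k * of_real n1 * y (sp / c)" "y (sp / c) \<noteq> 0" "k \<noteq> 0"
    and ex: "y = (\<lambda>s. sin (k * of_real n2 * of_real s) / (k * of_real n2))" "v = (\<lambda>s. cos (k * of_real n2 * of_real s))"
    by (rule ray_quarter_wave[OF k])
  have "sin z \<noteq> 0 \<or> cos z \<noteq> 0" for z :: complex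
  proof (rule ccontr)
    assume "\<not> ?thesis"
    then have z: "sin z = 0" "cos z = 0" by auto
    have "(1::complex) = (sin z)\<^sup>2 + (cos z)\<^sup>2" by simp
    also have "\<dots> = 0" unfolding z by simp
    finally show False by simp
  qed
  then have nd: "y s \<noteq> 0 \<or> v s \<noteq> 0" for s
    using w(6) n2 unfolding ex by auto
  let ?x = "\<lambda>s. if y s = 0 then Infty else Fin (v s / (\<i> * k * y s))"
  show ?thesis
    unfolding steers_def
  proof (intro conjI exI[of _ ?x])
    show "trajectory_on k (\<lambda>_. n2\<^sup>2) {0..sp / c} ?x" by (rule trajectory_from_wave[OF w(6,1) nd])
  qed (use w k sp in auto)
qed

lemma feasible_const: "feasible_on n1 n2 I (\<lambda>_. n2\<^sup>2)"
proof -
  have "n1\<^sup>2 \<le> n2\<^sup>2" using n1 n12 by (intro power_mono) auto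
  then show ?thesis by (simp add: feasible_on_def)
qed

theorem ray_T_min:
  assumes k: "k = of_real c * \<kappa>0" "0 < c"
  shows "T_min n1 n2 k Infty (Fin (of_real n1)) = ereal (sp / c)"
  unfolding T_min_def
proof (rule antisym)
  show "(INF t\<in>{t. \<exists>\<epsilon>. feasible_on n1 n2 {0<..} \<epsilon> \<and> steers k \<epsilon> Infty (Fin (of_real n1)) t}. ereal t) \<le> ereal (sp / c)"
    by (rule INF_lower) (use quarter_wave_steers[OF k] feasible_const in blast)
  show "ereal (sp / c) \<le> (INF t\<in>{t. \<exists>\<epsilon>. feasible_on n1 n2 {0<..} \<epsilon> \<and> steers k \<epsilon> Infty (Fin (of_real n1)) t}. ereal t)"
    by (rule INF_greatest) (use steering_time(1)[OF k] in auto)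
qed

lemma layered_generates:
  assumes k: "k = of_real c * \<kappa>0" "1 \<le> c" and N: "negligible N" "\<And>s. s \<in> {0<..<sp / c} - N \<Longrightarrow> \<epsilon> s = n2\<^sup>2"
  shows "generates_eigenvalue n1 sp (\<lambda>s. if s < sp / c then \<epsilon> s else n1\<^sup>2) k"
proof -
  have c: "0 < c" using k by simp
  obtain y v where w: "wave k (\<lambda>_. n2\<^sup>2) 0 (sp / c) y v" "y 0 = 0" "v 0 = 1" "v (sp / c) = \<i> * k * of_real n1 * y (sp / c)" "y (sp / c) \<noteq> 0" "k \<noteq> 0"
    and "y = (\<lambda>s. sin (k * of_real n2 * of_real s) / (k * of_real n2))" "v = (\<lambda>s. cos (k * of_real n2 * of_real s))"
    by (rule ray_quarter_wave[OF k(1) c])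
  have T: "0 < sp / c" "sp / c \<le> sp" using sp k c by (simp_all add: divide_le_eq)
  have "n1\<^sup>2 \<le> n2\<^sup>2" using n1 n12 by (intro power_mono) auto
  then have adm: "admissible n1 n2 (\<lambda>_. n2\<^sup>2)" by (simp add: admissible_def)
  obtain y' v' where w': "wave k (\<lambda>s. if s < sp / c then n2\<^sup>2 else n1\<^sup>2) 0 sp y' v'"
    "\<forall>s\<le>sp / c. y' s = y s \<and> v' s = v s"
    "\<forall>s\<ge>sp / c. y' s = y (sp / c) * exp (\<i> * k * of_real n1 * of_real (s - sp / c)) \<and> v' s = \<i> * k * of_real n1 * y' s" "admissible n1 n2 (\<lambda>s. if s < sp / c then n2\<^sup>2 else n1\<^sup>2)"
    by (rule wave_extend[OF w(1) adm n1 n12 T w(6,4)])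
  show ?thesis
  proof (rule wave_generates[OF sp w(6) w'(1) _ _ _ N(1)])
    show "y' 0 = 0" using w'(2) w(2) T by simp
    show "y' sp \<noteq> 0" using w'(3) T(2) w(5) by simp
    show "v' sp = \<i> * k * of_real n1 * y' sp" using w'(3) T(2) by blast
    show "(if s < sp / c then \<epsilon> s else n1\<^sup>2) = (if s < sp / c then n2\<^sup>2 else n1\<^sup>2)" if "s \<in> {0<..<sp} - N" for s
      using N(2)[of s] that by simp
  qed
qed

lemma layered_feasible:
  assumes f: "feasible_on n1 n2 {0<..} \<epsilon>"
  shows "(\<lambda>s. if s < T then \<epsilon> s else n1\<^sup>2) \<in> resonator_family n1 n2 sp"
proof -
  have "\<epsilon> \<in> borel_measurable (lebesgue_on {0<..<sp})"
    using f unfolding feasible_on_def by (auto intro: measurable_restrict_mono)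
  moreover have "{s \<in> space (lebesgue_on {0<..<sp}). s < T} \<in> sets (lebesgue_on {0<..<sp})"
  proof -
    have eq: "{s \<in> space (lebesgue_on {0<..<sp}). s < T} = {0<..<min sp T}" by (auto simp: space_restrict_space)
    have "{0<..<min sp T} \<subseteq> {0<..<sp}" by (rule subsetI) simp
    then show ?thesis unfolding eq by (subst sets_restrict_space_iff) simp_all
  qed
  ultimately have m: "(\<lambda>s. if s < T then \<epsilon> s else n1\<^sup>2) \<in> borel_measurable (lebesgue_on {0<..<sp})"
    by (intro measurable_If borel_measurable_const)
  have "AE s in lebesgue. s \<in> {0<..} \<longrightarrow> n1\<^sup>2 \<le> \<epsilon> s \<and> \<epsilon> s \<le> n2\<^sup>2"
    using f unfolding feasible_on_def by (subst (asm) AE_restrict_space_iff) auto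
  moreover have "n1\<^sup>2 \<le> n2\<^sup>2" using n1 n12 by (intro power_mono) auto
  ultimately have "AE s in lebesgue. s \<in> {0<..<sp} \<longrightarrow> n1\<^sup>2 \<le> (if s < T then \<epsilon> s else n1\<^sup>2) \<and> (if s < T then \<epsilon> s else n1\<^sup>2) \<le> n2\<^sup>2"
    by (auto elim!: eventually_mono)
  then have "AE s in lebesgue_on {0<..<sp}. n1\<^sup>2 \<le> (if s < T then \<epsilon> s else n1\<^sup>2) \<and> (if s < T then \<epsilon> s else n1\<^sup>2) \<le> n2\<^sup>2"
    by (subst AE_restrict_space_iff) auto
  then show ?thesis using m unfolding resonator_family_def feasible_on_def by blast
qed

text \<open>By steering_time a minimum-time control agrees with n2^2 up to the time sp / c. The medium n1 keeps
  the state in the target on the remaining length, so k is an eigenvalue, and ray_min_decay applies to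
  it.\<close>
theorem ray_resonators:
  assumes \<rho>: "ereal (cmod \<kappa>0) \<le> ereal \<rho>" and \<rho>1: "ereal \<rho> < (INF \<gamma>\<in>{\<gamma>0<..<0}. rho_min n1 n2 sp \<gamma> * ereal (cos \<gamma>) / ereal (cos \<gamma>0))"
    and k: "k = of_real \<rho> * exp (\<i> * of_real \<gamma>0)"
  shows "is_min_decay_eigenvalue n1 n2 sp (\<rho> * cos \<gamma>0) k \<and>
     (\<exists>T. T_min n1 n2 k Infty (Fin (of_real n1)) = ereal T \<and> T \<le> sp \<and>
        (\<exists>\<epsilon>. is_min_time_control n1 n2 k Infty (Fin (of_real n1)) \<epsilon>) \<and>
        (\<forall>\<epsilon>. is_min_time_control n1 n2 k Infty (Fin (of_real n1)) \<epsilon> \<longrightarrow>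
           is_min_decay_resonator n1 n2 sp (\<rho> * cos \<gamma>0) (\<lambda>s. if s < T then \<epsilon> s else n1\<^sup>2)))"
proof -
  have \<kappa>nz: "\<kappa>0 \<noteq> 0" using \<alpha>0_pos by (auto simp: \<kappa>0_def complex_eq_iff)
  define c where "c = \<rho> / cmod \<kappa>0"
  have c1: "1 \<le> c" using \<rho> \<kappa>nz by (simp add: c_def)
  then have c: "0 < c" by simp
  have "\<kappa>0 = of_real (cmod \<kappa>0) * exp (\<i> * of_real \<gamma>0)" using Arg_eq[OF \<kappa>nz] by (simp add: \<gamma>0_def)
  then have "of_real c * \<kappa>0 = of_real c * of_real (cmod \<kappa>0) * exp (\<i> * of_real \<gamma>0)" by (metis mult.assoc)
  also have "of_real c * of_real (cmod \<kappa>0) = (of_real \<rho> :: complex)" using \<kappa>nz by (simp add: c_def)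
  finally have kc: "k = of_real c * \<kappa>0" using k by simp
  have "cmod k = c * cmod \<kappa>0" unfolding kc using c by (simp add: norm_mult)
  also have "\<dots> = \<rho>" using \<kappa>nz by (simp add: c_def)
  finally have ck: "cmod k = \<rho>" .
  have ak: "Arg k = \<gamma>0" unfolding kc \<gamma>0_def using c by simp
  have T: "T_min n1 n2 k Infty (Fin (of_real n1)) = ereal (sp / c)" by (rule ray_T_min[OF kc c])
  have gen: "generates_eigenvalue n1 sp (\<lambda>s. if s < sp / c then \<epsilon> s else n1\<^sup>2) k"
    if "is_min_time_control n1 n2 k Infty (Fin (of_real n1)) \<epsilon>" for \<epsilon>
  proof -
    have f: "feasible_on n1 n2 {0<..} \<epsilon>" and st: "steers k \<epsilon> Infty (Fin (of_real n1)) (sp / c)"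
      using that unfolding is_min_time_control_def T by auto
    obtain N where "negligible N" "\<forall>s\<in>{0<..<sp / c} - N. \<epsilon> s = n2\<^sup>2"
      using steering_time(2)[OF kc c f st refl] by blast
    then show ?thesis using layered_generates[OF kc c1] by blast
  qed
  have mt: "is_min_time_control n1 n2 k Infty (Fin (of_real n1)) (\<lambda>_. n2\<^sup>2)"
    unfolding is_min_time_control_def using feasible_const quarter_wave_steers[OF kc c] T by blast
  have kS: "k \<in> eigenvalue_set n1 n2 sp"
    using gen[OF mt] layered_feasible[OF feasible_const] unfolding eigenvalue_set_def by blast
  have md: "is_min_decay_eigenvalue n1 n2 sp (\<rho> * cos \<gamma>0) k"
    using ray_min_decay[OF kS ak] \<rho>1 unfolding ck by simp
  have "is_min_decay_resonator n1 n2 sp (\<rho> * cos \<gamma>0) (\<lambda>s. if s < sp / c then \<epsilon> s else n1\<^sup>2)"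
    if m: "is_min_time_control n1 n2 k Infty (Fin (of_real n1)) \<epsilon>" for \<epsilon>
  proof -
    have "feasible_on n1 n2 {0<..} \<epsilon>" using m unfolding is_min_time_control_def by blast
    then show ?thesis unfolding is_min_decay_resonator_def using layered_feasible gen[OF m] md by blast
  qed
  moreover have "sp / c \<le> sp" using sp c1 by (simp add: divide_le_eq)
  ultimately show ?thesis using md T mt by blast
qed

end

section \<open>Perturbing an eigenvalue with open variations\<close>

lemma primitive_uniform_limit:
  fixes f g :: "nat \<Rightarrow> real \<Rightarrow> 'a::euclidean_space"
  assumes P: "\<And>n. primitive (f n) (g n) a b" and f: "\<And>s. s \<in> {a..b} \<Longrightarrow> (\<lambda>n. f n s) \<longlonglongrightarrow> F s"
    and g: "uniform_limit {a..b} g G sequentially"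
  shows "primitive F G a b"
  unfolding primitive_def
proof (intro conjI allI impI)
  have gm: "g n \<in> borel_measurable (lebesgue_on {a..b})" "bounded (g n ` {a..b})" for n
    using P[of n] unfolding primitive_def by auto
  show Gm: "G \<in> borel_measurable (lebesgue_on {a..b})"
  proof (rule borel_measurable_LIMSEQ_metric[OF gm(1)])
    show "(\<lambda>n. g n s) \<longlonglongrightarrow> G s" if "s \<in> space (lebesgue_on {a..b})" for s
      using tendsto_uniform_limitI[OF g] that by (simp add: space_restrict_space)
  qed
  show Gb: "bounded (G ` {a..b})"
  proof -
    obtain N where N: "\<And>s. s \<in> {a..b} \<Longrightarrow> dist (g N s) (G s) < 1"
      using uniform_limitD[OF g, of 1] unfolding eventually_sequentially by (meson order_refl zero_less_one)
    obtain B where B: "\<And>s. s \<in> {a..b} \<Longrightarrow> norm (g N s) \<le> B" using gm(2)[of N] unfolding bounded_iff by blast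
    have "norm (G s) \<le> B + 1" if s: "s \<in> {a..b}" for s
    proof -
      have "norm (G s) \<le> norm (g N s) + dist (g N s) (G s)"
        using norm_triangle_ineq2[of "G s" "g N s"] by (simp add: dist_norm norm_minus_commute)
      then show ?thesis using N[OF s] B[OF s] by linarith
    qed
    then show ?thesis unfolding bounded_iff by blast
  qed
  fix s t assume st: "a \<le> s" "s \<le> t" "t \<le> b"
  have Gi: "(G has_integral integral {s..t} G) {s..t}"
    using bounded_measurable_integrable[OF Gm Gb st(1,3)] by (simp add: absolutely_integrable_on_def integrable_integral)
  have "(\<lambda>n. f n t - f n s) \<longlonglongrightarrow> integral {s..t} G"
  proof (rule LIMSEQ_I)
    fix e :: real assume e: "0 < e"
    define e' where "e' = e / (2 * (t - s + 1))"
    have "e * (t - s) < e * (2 * (t - s + 1))" using e st by (intro mult_strict_left_mono) auto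
    then have e': "0 < e'" "e' * (t - s) < e" using e st by (auto simp: e'_def divide_less_eq)
    obtain N where N: "\<And>n r. n \<ge> N \<Longrightarrow> r \<in> {a..b} \<Longrightarrow> dist (g n r) (G r) < e'"
      using uniform_limitD[OF g e'(1)] unfolding eventually_sequentially by blast
    have "norm (f n t - f n s - integral {s..t} G) < e" if n: "n \<ge> N" for n
    proof -
      have "norm (f n t - f n s - integral {s..t} G) \<le> e' * (t - s)"
      proof (rule has_integral_bound_Icc[OF _ has_integral_diff[OF primitiveD(1)[OF P st] Gi] st(2)])
        fix r assume "r \<in> {s..t}"
        then show "norm (g n r - G r) \<le> e'" using N[OF n, of r] st by (auto simp: dist_norm)
      qed (use e' in simp)
      then show ?thesis using e' by simp
    qed
    then show "\<exists>no. \<forall>n\<ge>no. norm (f n t - f n s - integral {s..t} G) < e" by blast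
  qed
  moreover have "(\<lambda>n. f n t - f n s) \<longlonglongrightarrow> F t - F s" using st by (intro tendsto_diff f) auto
  ultimately have "integral {s..t} G = F t - F s" using LIMSEQ_unique by blast
  then show "(G has_integral F t - F s) {s..t}" using Gi by simp
qed

lemma wave_coefficient_measurable:
  fixes y :: "real \<Rightarrow> complex"
  assumes "admissible n1 n2 \<epsilon>" "continuous_on {a..b} y"
  shows "(\<lambda>s. - k\<^sup>2 * of_real (\<epsilon> s) * y s) \<in> borel_measurable (lebesgue_on {a..b})"
  using admissible_measurable(1)[OF assms(1), of "{a..b}"] continuous_bounded_measurable(1)[OF assms(2)] by measurable

text \<open>The terms of the Picard series of the wave equation; the n-th term is bounded by the n-th term of an
  exponential series.\<close>
primrec picard :: "complex \<Rightarrow> (real \<Rightarrow> real) \<Rightarrow> nat \<Rightarrow> (real \<Rightarrow> complex) \<times> (real \<Rightarrow> complex)" where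
  "picard k \<epsilon> 0 = (\<lambda>s. of_real s, \<lambda>_. 1)"
| "picard k \<epsilon> (Suc j) = (let V = (\<lambda>t. integral {0..t} (\<lambda>s. - k\<^sup>2 * of_real (\<epsilon> s) * fst (picard k \<epsilon> j) s))
     in (\<lambda>t. integral {0..t} V, V))"

lemma power_integral: 
  fixes s :: real assumes "0 \<le> s"
  shows "((\<lambda>t. c * (c * t) ^ j / fact j) has_integral (c * s) ^ Suc j / fact (Suc j)) {0..s}"
proof -
  have "((\<lambda>t. c * (c * t) ^ j / fact j) has_integral (c * s) ^ Suc j / fact (Suc j) - (c * 0) ^ Suc j / fact (Suc j)) {0..s}"
  proof (rule fundamental_theorem_of_calculus[OF assms])
    fix t
    have "((\<lambda>t. (c * t) ^ Suc j / fact (Suc j)) has_real_derivative (of_nat (Suc j) * ((c * t) ^ j * c)) / fact (Suc j)) (at t within {0..s})"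
      by (rule derivative_eq_intros refl | simp)+
    also have "(of_nat (Suc j) * ((c * t) ^ j * c)) / fact (Suc j) = c * (c * t) ^ j / (fact j :: real)"
    proof -
      have "(of_nat (Suc j) * X) / fact (Suc j) = X / (fact j :: real)" for X :: real
        unfolding fact_Suc by (rule nonzero_mult_divide_mult_cancel_left) simp
      then show ?thesis by (simp add: mult.commute)
    qed
    finally show "((\<lambda>t. (c * t) ^ Suc j / fact (Suc j)) has_vector_derivative c * (c * t) ^ j / fact j) (at t within {0..s})"
      by (simp add: has_real_derivative_iff_has_vector_derivative)
  qed
  then show ?thesis by simp
qed

theorem wave_exists:
  assumes adm: "admissible n1 n2 \<epsilon>" and T: "0 \<le> T"
  obtains y v where "wave k \<epsilon> 0 T y v" "y 0 = 0" "v 0 = 1"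
proof -
  define Y where "Y = (\<lambda>j. fst (picard k \<epsilon> j))"
  define V where "V = (\<lambda>j. snd (picard k \<epsilon> j))"
  let ?g = "\<lambda>y s. - k\<^sup>2 * of_real (\<epsilon> s) * y s"
  have V_Suc: "V (Suc j) = (\<lambda>t. integral {0..t} (?g (Y j)))" for j by (simp add: V_def Y_def Let_def)
  have Y_Suc: "Y (Suc j) = (\<lambda>t. integral {0..t} (V (Suc j)))" for j by (simp add: V_def Y_def Let_def)
  have Y0: "Y 0 = (\<lambda>s. of_real s)" and V0: "V 0 = (\<lambda>_. 1)" by (simp_all add: Y_def V_def)
  have PY: "primitive (Y j) (V j) 0 T \<and> continuous_on {0..T} (Y j)" for j
  proof (induction j)
    case 0
    have "primitive (\<lambda>s. complex_of_real s) (\<lambda>_. 1) 0 T"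
      by (rule primitive_C1) (auto intro!: derivative_eq_intros simp: has_vector_derivative_of_real)
    then show ?case by (auto simp: Y0 V0 intro: primitive_continuous)
  next
    case (Suc j)
    have "primitive (V (Suc j)) (?g (Y j)) 0 T"
      unfolding V_Suc using Suc by (intro primitive_integral wave_coefficient_measurable[OF adm] wave_coefficient_bounded[OF adm]) auto
    then have "primitive (Y (Suc j)) (V (Suc j)) 0 T"
      unfolding Y_Suc by (intro primitive_integral_continuous primitive_continuous)
    then show ?case by (auto intro: primitive_continuous)
  qed
  have PV: "primitive (V (Suc j)) (?g (Y j)) 0 T" for j
    unfolding V_Suc using PY[of j] by (intro primitive_integral wave_coefficient_measurable[OF adm] wave_coefficient_bounded[OF adm]) auto
  define c where "c = (cmod k)\<^sup>2 * n2\<^sup>2 * T"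
  have c: "0 \<le> c" using T by (simp add: c_def)
  have bd: "cmod (V j s) \<le> (c * s) ^ j / fact j \<and> cmod (Y j s) \<le> T * ((c * s) ^ j / fact j)" if "s \<in> {0..T}" for j s
    using that
  proof (induction j arbitrary: s)
    case 0 then show ?case by (simp add: Y0 V0)
  next
    case (Suc j)
    have V1: "cmod (V (Suc j) s) \<le> (c * s) ^ Suc j / fact (Suc j)" if s: "s \<in> {0..T}" for s
    proof -
      have "((?g (Y j)) has_integral V (Suc j) s) {0..s}"
        using primitiveD(1)[OF PV, of 0 s j] s by (simp add: V_Suc)
      then have "norm (integral {0..s} (?g (Y j))) \<le> integral {0..s} (\<lambda>t. c * (c * t) ^ j / fact j)"
      proof (intro integral_norm_bound_integral)
        show "(\<lambda>t. c * (c * t) ^ j / fact j) integrable_on {0..s}"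
          using power_integral[of s c j] s by (auto simp: integrable_on_def)
        fix t assume t: "t \<in> {0..s}"
        have "cmod (?g (Y j) t) = (cmod k)\<^sup>2 * (\<bar>\<epsilon> t\<bar> * cmod (Y j t))" by (simp add: norm_mult norm_power)
        also have "\<dots> \<le> (cmod k)\<^sup>2 * (n2\<^sup>2 * (T * ((c * t) ^ j / fact j)))"
          using admissible_bound[OF adm, of t] Suc.IH[of t] t s by (intro mult_left_mono mult_mono) auto
        also have "\<dots> = c * (c * t) ^ j / fact j" by (simp add: c_def)
        finally show "cmod (?g (Y j) t) \<le> c * (c * t) ^ j / fact j" .
      qed (auto simp: integrable_on_def)
      also have "\<dots> = (c * s) ^ Suc j / fact (Suc j)" using power_integral[of s c j] s by (intro integral_unique) auto
      finally show ?thesis by (simp add: V_Suc)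
    qed
    have mono: "(c * t) ^ Suc j / fact (Suc j) \<le> (c * s) ^ Suc j / fact (Suc j)" if "0 \<le> t" "t \<le> s" for t
      using that c by (intro divide_right_mono power_mono mult_left_mono) auto
    have "norm (Y (Suc j) s - Y (Suc j) 0) \<le> (c * s) ^ Suc j / fact (Suc j) * (s - 0)"
    proof (rule primitive_lipschitz_le[OF conjunct1[OF PY]])
      fix t assume t: "t \<in> {0..s}"
      show "cmod (V (Suc j) t) \<le> (c * s) ^ Suc j / fact (Suc j)"
        using order_trans[OF V1[of t] mono[of t]] t Suc.prems by auto
    qed (use Suc.prems c in auto)
    then have "cmod (Y (Suc j) s) \<le> (c * s) ^ Suc j / fact (Suc j) * s" by (simp add: Y_Suc)
    also have "\<dots> \<le> (c * s) ^ Suc j / fact (Suc j) * T" using Suc.prems c by (intro mult_left_mono) auto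
    finally show ?case using V1[OF Suc.prems] by (simp only: mult.commute)
  qed
  have bT: "(c * s) ^ j / fact j \<le> (c * T) ^ j / fact j" if "s \<in> {0..T}" for s j
    using that c by (intro divide_right_mono power_mono mult_left_mono) auto
  have sm: "summable (\<lambda>j. (c * T) ^ j / fact j)"
    using summable_exp[of "c * T"] by (simp add: divide_inverse mult.commute)
  define y where "y = (\<lambda>s. suminf (\<lambda>j. Y j s))"
  define v where "v = (\<lambda>s. suminf (\<lambda>j. V j s))"
  have uV: "uniform_limit {0..T} (\<lambda>n s. \<Sum>j<n. V j s) v sequentially"
    unfolding v_def by (rule Weierstrass_m_test[OF _ sm]) (use bd bT order_trans in blast)
  have uY: "uniform_limit {0..T} (\<lambda>n s. \<Sum>j<n. Y j s) y sequentially"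
    unfolding y_def
  proof (rule Weierstrass_m_test[OF _ summable_mult[OF sm, of T]])
    fix j s assume s: "s \<in> {0..T}"
    show "cmod (Y j s) \<le> T * ((c * T) ^ j / fact j)"
      using order_trans[OF conjunct2[OF bd[OF s, of j]] mult_left_mono[OF bT[OF s, of j] T]] .
  qed
  have sumP: "primitive (\<lambda>s. \<Sum>j<n. f j s) (\<lambda>s. \<Sum>j<n. g j s) 0 T" if "\<And>j. primitive (f j) (g j) 0 T" for f g :: "nat \<Rightarrow> real \<Rightarrow> complex" and n
  proof (induction n)
    case 0 then show ?case using primitive_const[of 0] by simp
  next
    case (Suc n) show ?case using primitive_add[OF Suc that[of n]] by simp
  qed
  have py: "primitive y v 0 T"
    by (rule primitive_uniform_limit[OF sumP[OF conjunct1[OF PY]] tendsto_uniform_limitI[OF uY] uV])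
  have pv: "primitive v (?g y) 0 T"
  proof (rule primitive_uniform_limit)
    have "primitive (\<lambda>s. (\<Sum>j<n. V (Suc j) s) + 1) (\<lambda>s. (\<Sum>j<n. ?g (Y j) s) + 0) 0 T" for n
      by (intro primitive_add primitive_const sumP PV)
    moreover have "(\<Sum>j<Suc n. V j s) = (\<Sum>j<n. V (Suc j) s) + 1" for n s
      by (simp only: sum.lessThan_Suc_shift V0 add.commute)
    moreover have "(\<Sum>j<n. ?g (Y j) s) + 0 = ?g (\<lambda>s. \<Sum>j<n. Y j s) s" for n s
      by (simp add: sum_distrib_left)
    ultimately show "primitive (\<lambda>s. \<Sum>j<Suc n. V j s) (?g (\<lambda>s. \<Sum>j<n. Y j s)) 0 T" for n by simp
    show "(\<lambda>n. \<Sum>j<Suc n. V j s) \<longlonglongrightarrow> v s" if "s \<in> {0..T}" for s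
      using LIMSEQ_Suc[OF tendsto_uniform_limitI[OF uV that]] .
    show "uniform_limit {0..T} (\<lambda>n. ?g (\<lambda>s. \<Sum>j<n. Y j s)) (?g y) sequentially"
    proof (rule uniform_limitI)
      fix e :: real assume e: "e > 0"
      define M where "M = (cmod k)\<^sup>2 * n2\<^sup>2 + 1"
      have M: "0 < M" by (simp add: M_def add_nonneg_pos)
      have "\<forall>\<^sub>F n in sequentially. \<forall>s\<in>{0..T}. dist (\<Sum>j<n. Y j s) (y s) < e / M"
        using uniform_limitD[OF uY, of "e / M"] e M by simp
      then show "\<forall>\<^sub>F n in sequentially. \<forall>s\<in>{0..T}. dist (?g (\<lambda>s. \<Sum>j<n. Y j s) s) (?g y s) < e"
      proof eventually_elim
        case (elim n)
        show ?case
        proof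
          fix s assume s: "s \<in> {0..T}"
          have "dist (?g (\<lambda>s. \<Sum>j<n. Y j s) s) (?g y s) = (cmod k)\<^sup>2 * \<bar>\<epsilon> s\<bar> * dist (\<Sum>j<n. Y j s) (y s)"
            unfolding dist_norm by (simp add: norm_mult norm_power flip: right_diff_distrib) (simp add: norm_minus_commute)
          also have "\<dots> \<le> M * dist (\<Sum>j<n. Y j s) (y s)"
          proof (rule mult_right_mono)
            have "(cmod k)\<^sup>2 * \<bar>\<epsilon> s\<bar> \<le> (cmod k)\<^sup>2 * n2\<^sup>2" using admissible_bound[OF adm, of s] by (intro mult_left_mono) auto
            then show "(cmod k)\<^sup>2 * \<bar>\<epsilon> s\<bar> \<le> M" by (simp add: M_def)
          qed simp
          also have "\<dots> < M * (e / M)" using elim s M by (intro mult_strict_left_mono) auto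
          finally show "dist (?g (\<lambda>s. \<Sum>j<n. Y j s) s) (?g y s) < e" using M by simp
        qed
      qed
    qed
  qed
  have "Y j 0 = 0" for j by (cases j) (simp_all add: Y0 Y_Suc)
  then have y0: "y 0 = 0" by (simp add: y_def)
  have "V j 0 = (if j = 0 then 1 else 0)" for j by (cases j) (simp_all add: V0 V_Suc)
  then have "(\<lambda>j. V j 0) = (\<lambda>j. if j = 0 then 1 else 0)" by (rule ext)
  then have v0: "v 0 = 1" unfolding v_def using sums_single[of 0 "\<lambda>_. 1 :: complex"] by (simp add: sums_iff)
  show ?thesis using that[of y v] py pv y0 v0 by (simp add: wave_def)
qed

text \<open>Brouwer's fixed point theorem for the map t - R t / c of the disc.\<close>
lemma zero_of_near_similarity:
  fixes R :: "complex \<Rightarrow> complex" and c \<rho> :: real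
  assumes c: "0 < c" and \<rho>: "0 < \<rho>" and cont: "continuous_on (cball 0 \<rho>) R"
    and near: "\<And>t. cmod t \<le> \<rho> \<Longrightarrow> cmod (R t - of_real c * t) \<le> c * \<rho>"
  obtains t where "cmod t \<le> \<rho>" "R t = 0"
proof -
  define f where "f = (\<lambda>t. t - R t / of_real c)"
  have "f t \<in> cball 0 \<rho>" if "t \<in> cball 0 \<rho>" for t
  proof -
    have "f t = - (R t - of_real c * t) / of_real c" using c by (simp add: f_def field_simps)
    then have "cmod (f t) = cmod (R t - of_real c * t) / c"
      using c by (simp only: norm_divide norm_minus_cancel norm_of_real abs_of_pos)
    also have "\<dots> \<le> \<rho>" using near[of t] that c by (simp add: divide_le_eq mult.commute)
    finally show ?thesis by simp
  qed
  moreover have "continuous_on (cball 0 \<rho>) f" unfolding f_def using c by (intro continuous_intros cont) auto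
  ultimately obtain t where "t \<in> cball 0 \<rho>" "f t = t" using brouwer_ball[OF \<rho>, of 0 f] by blast
  then show ?thesis using that[of t] c by (simp add: f_def)
qed

lemma wave_bound:
  assumes w: "wave k \<epsilon> 0 T y v" and adm: "admissible n1 n2 \<epsilon>" and z: "y 0 = 0" "v 0 = 1" and K: "cmod k \<le> K"
    and s: "0 \<le> s" "s \<le> T"
  shows "cmod (y s) \<le> exp ((1 + K\<^sup>2 * n2\<^sup>2) * T)" "cmod (v s) \<le> exp ((1 + K\<^sup>2 * n2\<^sup>2) * T)"
proof -
  let ?M = "K\<^sup>2 * n2\<^sup>2"
  have "(cmod (y s))\<^sup>2 + (cmod (v s))\<^sup>2 \<le> ((cmod (y 0))\<^sup>2 + (cmod (v 0))\<^sup>2 + 0\<^sup>2 * (s - 0)) * exp ((2 + ?M) * (s - 0))"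
  proof (rule energy_bound[where q="\<lambda>s. - k\<^sup>2 * of_real (\<epsilon> s)" and f="\<lambda>_. 0"])
    show "primitive y v 0 s" "primitive v (\<lambda>s. - k\<^sup>2 * of_real (\<epsilon> s) * y s + 0) 0 s"
      using w s by (auto simp: wave_def intro: primitive_subset)
    fix t
    have "(cmod k)\<^sup>2 * \<bar>\<epsilon> t\<bar> \<le> K\<^sup>2 * n2\<^sup>2"
      using admissible_bound[OF adm, of t] K by (intro mult_mono power_mono) auto
    then show "cmod (- k\<^sup>2 * of_real (\<epsilon> t)) \<le> ?M" by (simp add: norm_mult norm_power)
  qed (use s in auto)
  also have "\<dots> = exp ((2 + ?M) * s)" by (simp add: z)
  also have "\<dots> \<le> exp (2 * ((1 + ?M) * T))"
  proof -
    have "(2 + ?M) * s \<le> (2 + 2 * ?M) * T" using s by (intro mult_mono) auto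
    then show ?thesis by (simp add: algebra_simps)
  qed
  also have "\<dots> = (exp ((1 + ?M) * T))\<^sup>2" by (simp add: exp_double)
  finally have le: "(cmod (y s))\<^sup>2 + (cmod (v s))\<^sup>2 \<le> (exp ((1 + ?M) * T))\<^sup>2" .
  then have "(cmod (y s))\<^sup>2 \<le> (exp ((1 + ?M) * T))\<^sup>2" "(cmod (v s))\<^sup>2 \<le> (exp ((1 + ?M) * T))\<^sup>2"
    using zero_le_power2[of "cmod (y s)"] zero_le_power2[of "cmod (v s)"] by linarith+
  then show "cmod (y s) \<le> exp ((1 + ?M) * T)" "cmod (v s) \<le> exp ((1 + ?M) * T)"
    by (auto intro: power2_le_imp_le)
qed

lemma wave_continuous_dependence:
  assumes w: "wave k \<epsilon> 0 T y v" "wave k' \<epsilon>' 0 T y' v'" and adm: "admissible n1 n2 \<epsilon>" "admissible n1 n2 \<epsilon>'"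
    and z: "y 0 = 0" "v 0 = 1" "y' 0 = 0" "v' 0 = 1" and K: "cmod k \<le> K" "cmod k' \<le> K"
    and d: "\<And>s. s \<in> {0..T} \<Longrightarrow> cmod (k'\<^sup>2 * of_real (\<epsilon>' s) - k\<^sup>2 * of_real (\<epsilon> s)) \<le> d" and s: "0 \<le> s" "s \<le> T"
  shows "cmod (y' s - y s) \<le> d * ((1 + T) * exp (2 * ((1 + K\<^sup>2 * n2\<^sup>2) * T)))"
    "cmod (v' s - v s) \<le> d * ((1 + T) * exp (2 * ((1 + K\<^sup>2 * n2\<^sup>2) * T)))"
proof -
  let ?M = "K\<^sup>2 * n2\<^sup>2" and ?B = "exp ((1 + K\<^sup>2 * n2\<^sup>2) * T)"
  have T: "0 \<le> T" using s by simp
  have d0: "0 \<le> d" using d[of 0] norm_ge_zero T by (meson atLeastAtMost_iff order_refl order_trans)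
  have Y: "primitive (\<lambda>s. y' s - y s) (\<lambda>s. v' s - v s) 0 s"
    using w s by (intro primitive_diff) (auto simp: wave_def intro: primitive_subset)
  have "primitive (\<lambda>s. v' s - v s) (\<lambda>s. - k'\<^sup>2 * of_real (\<epsilon>' s) * y' s - (- k\<^sup>2 * of_real (\<epsilon> s) * y s)) 0 s"
    using w s by (intro primitive_diff) (auto simp: wave_def intro: primitive_subset)
  then have V: "primitive (\<lambda>s. v' s - v s) (\<lambda>s. (- k'\<^sup>2 * of_real (\<epsilon>' s)) * (y' s - y s) + (- (k'\<^sup>2 * of_real (\<epsilon>' s) - k\<^sup>2 * of_real (\<epsilon> s)) * y s)) 0 s"
    by (rule primitive_cong) (auto simp: algebra_simps)
  have "(cmod (y' s - y s))\<^sup>2 + (cmod (v' s - v s))\<^sup>2 \<le> ((cmod (y' 0 - y 0))\<^sup>2 + (cmod (v' 0 - v 0))\<^sup>2 + (d * ?B)\<^sup>2 * (s - 0)) * exp ((2 + ?M) * (s - 0))"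
  proof (rule energy_bound[OF Y V s(1)])
    fix t assume t: "t \<in> {0..s}"
    have "(cmod k')\<^sup>2 * \<bar>\<epsilon>' t\<bar> \<le> K\<^sup>2 * n2\<^sup>2"
      using admissible_bound[OF adm(2), of t] K by (intro mult_mono power_mono) auto
    then show "cmod (- k'\<^sup>2 * of_real (\<epsilon>' t)) \<le> ?M" by (simp add: norm_mult norm_power)
    have "cmod (k'\<^sup>2 * of_real (\<epsilon>' t) - k\<^sup>2 * of_real (\<epsilon> t)) * cmod (y t) \<le> d * ?B"
      using d[of t] wave_bound(1)[OF w(1) adm(1) z(1,2) K(1), of t] t s d0 by (intro mult_mono) auto
    then show "cmod (- (k'\<^sup>2 * of_real (\<epsilon>' t) - k\<^sup>2 * of_real (\<epsilon> t)) * y t) \<le> d * ?B"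
      by (simp only: norm_mult norm_minus_cancel)
  qed simp
  also have "\<dots> = (d * ?B)\<^sup>2 * (s * exp ((2 + ?M) * s))" by (simp add: z)
  also have "\<dots> \<le> (d * ?B)\<^sup>2 * ((1 + T)\<^sup>2 * ?B\<^sup>2)"
  proof (intro mult_left_mono mult_mono)
    have "(2 + ?M) * s \<le> (2 + 2 * ?M) * T" using s by (intro mult_mono) auto
    then have "(2 + ?M) * s \<le> 2 * ((1 + ?M) * T)" by (simp add: algebra_simps)
    then show "exp ((2 + ?M) * s) \<le> ?B\<^sup>2" by (simp flip: exp_double)
    have "T \<le> (1 + T)\<^sup>2" using T by (simp add: power2_sum)
    then show "s \<le> (1 + T)\<^sup>2" using s by simp
  qed auto
  also have "\<dots> = (d * ((1 + T) * ?B\<^sup>2))\<^sup>2" by (simp add: power_mult_distrib power2_eq_square mult_ac)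
  also have "?B\<^sup>2 = exp (2 * ((1 + ?M) * T))" by (simp add: exp_double)
  finally have le: "(cmod (y' s - y s))\<^sup>2 + (cmod (v' s - v s))\<^sup>2 \<le> (d * ((1 + T) * exp (2 * ((1 + ?M) * T))))\<^sup>2" .
  then have "(cmod (y' s - y s))\<^sup>2 \<le> (d * ((1 + T) * exp (2 * ((1 + ?M) * T))))\<^sup>2" "(cmod (v' s - v s))\<^sup>2 \<le> (d * ((1 + T) * exp (2 * ((1 + ?M) * T))))\<^sup>2"
    using zero_le_power2[of "cmod (y' s - y s)"] zero_le_power2[of "cmod (v' s - v s)"] by linarith+
  moreover have "0 \<le> d * ((1 + T) * exp (2 * ((1 + ?M) * T)))" using d0 T by simp
  ultimately show "cmod (y' s - y s) \<le> d * ((1 + T) * exp (2 * ((1 + ?M) * T)))" "cmod (v' s - v s) \<le> d * ((1 + T) * exp (2 * ((1 + ?M) * T)))"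
    by (auto intro: power2_le_imp_le)
qed

text \<open>Green's formula: the Wronskian at the open end is the total effect of the change of the coefficient
  and of the spectral parameter, weighted by the product of the two waves.\<close>
lemma wronskian_identity:
  assumes w: "wave k \<epsilon> 0 T y v" "wave k' \<epsilon>' 0 T y' v'" and z: "y 0 = 0" "y' 0 = 0" and T: "0 \<le> T"
  shows "((\<lambda>s. (k'\<^sup>2 * of_real (\<epsilon>' s) - k\<^sup>2 * of_real (\<epsilon> s)) * (y s * y' s)) has_integral y' T * v T - y T * v' T) {0..T}"
proof -
  have "primitive (\<lambda>s. y' s * v s - y s * v' s)
    (\<lambda>s. (v' s * v s + y' s * (- k\<^sup>2 * of_real (\<epsilon> s) * y s)) - (v s * v' s + y s * (- k'\<^sup>2 * of_real (\<epsilon>' s) * y' s))) 0 T"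
    using w unfolding wave_def by (intro primitive_diff primitive_mult) auto
  from primitiveD(1)[OF this order_refl T order_refl]
  show ?thesis by (rule has_integral_eq_rhs[OF has_integral_eq[rotated]]) (auto simp: z algebra_simps)
qed

text \<open>The first variations of the boundary condition at the open end, up to a constant factor, under all
  changes of the coefficient inside the admissible set.\<close>
definition reachable_variations :: "real \<Rightarrow> real \<Rightarrow> real \<Rightarrow> (real \<Rightarrow> real) \<Rightarrow> (real \<Rightarrow> complex) \<Rightarrow> complex set" where
  "reachable_variations n1 n2 sp \<epsilon> y = {integral {0..sp} (\<lambda>s. of_real (\<eta> s - \<epsilon> s) * (y s)\<^sup>2) |\<eta>. admissible n1 n2 \<eta>}"

lemma variation_integrable:
  fixes y :: "real \<Rightarrow> complex"
  assumes "admissible n1 n2 \<epsilon>" "admissible n1 n2 \<eta>" "continuous_on {a..b} y"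
  shows "(\<lambda>s. of_real (\<eta> s - \<epsilon> s) * (y s)) integrable_on {a..b}"
proof -
  have m: "(\<lambda>s. complex_of_real (\<eta> s - \<epsilon> s) * (y s)) \<in> borel_measurable (lebesgue_on {a..b})"
    using admissible_measurable(1)[OF assms(1), of "{a..b}"] admissible_measurable(1)[OF assms(2), of "{a..b}"]
      continuous_bounded_measurable(1)[OF assms(3)] by measurable
  have "\<bar>\<eta> s - \<epsilon> s\<bar> \<le> 2 * n2\<^sup>2" for s
    using admissible_bound[OF assms(1), of s] admissible_bound[OF assms(2), of s] by linarith
  then have "bounded ((\<lambda>s. complex_of_real (\<eta> s - \<epsilon> s)) ` {a..b})"
    unfolding bounded_iff by (intro exI[of _ "2 * n2\<^sup>2"]) (simp flip: of_real_diff)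
  from bounded_mult_image[OF this continuous_bounded_measurable(2)[OF assms(3)]]
  show ?thesis using bounded_measurable_integrable[OF m _ order_refl order_refl] by (simp add: absolutely_integrable_on_def)
qed

text \<open>A family of coefficients through \<epsilon> with parameters in the plane. Positive and negative
  parts of the coordinates pull towards different coefficients, which keeps all weights nonnegative
  and the family admissible.\<close>
definition mixture :: "(real \<Rightarrow> real) \<Rightarrow> (real \<Rightarrow> real) \<Rightarrow> (real \<Rightarrow> real) \<Rightarrow> (real \<Rightarrow> real) \<Rightarrow> (real \<Rightarrow> real) \<Rightarrow> complex \<Rightarrow> real \<Rightarrow> real" where
  "mixture \<epsilon> e w n s t x = \<epsilon> x + max (Re t) 0 * (e x - \<epsilon> x) + max (- Re t) 0 * (w x - \<epsilon> x)
     + max (Im t) 0 * (n x - \<epsilon> x) + max (- Im t) 0 * (s x - \<epsilon> x)"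

lemma mixture_admissible:
  assumes adm: "admissible n1 n2 \<epsilon>" "admissible n1 n2 e" "admissible n1 n2 w" "admissible n1 n2 n" "admissible n1 n2 s"
    and t: "cmod t \<le> 1 / 2"
  shows "admissible n1 n2 (mixture \<epsilon> e w n s t)"
  unfolding admissible_def
proof (intro conjI allI)
  show "mixture \<epsilon> e w n s t \<in> borel_measurable borel"
  proof -
    have [measurable]: "\<epsilon> \<in> borel_measurable borel" "e \<in> borel_measurable borel" "w \<in> borel_measurable borel"
      "n \<in> borel_measurable borel" "s \<in> borel_measurable borel"
      using adm by (auto simp: admissible_def)
    show ?thesis unfolding mixture_def by measurable
  qed
  fix x
  define a where "a = max (Re t) 0" define b where "b = max (- Re t) 0"
  define c where "c = max (Im t) 0" define d where "d = max (- Im t) 0"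
  have nn: "0 \<le> a" "0 \<le> b" "0 \<le> c" "0 \<le> d" by (auto simp: a_def b_def c_def d_def)
  have "a + b + c + d = \<bar>Re t\<bar> + \<bar>Im t\<bar>" by (auto simp: a_def b_def c_def d_def max_def)
  then have sum: "0 \<le> 1 - (a + b + c + d)" using abs_Re_le_cmod[of t] abs_Im_le_cmod[of t] t by linarith
  have bd: "n1\<^sup>2 \<le> f x" "f x \<le> n2\<^sup>2" if "admissible n1 n2 f" for f using that by (auto simp: admissible_def)
  have "mixture \<epsilon> e w n s t x - n1\<^sup>2 = (1 - (a + b + c + d)) * (\<epsilon> x - n1\<^sup>2) + a * (e x - n1\<^sup>2) + b * (w x - n1\<^sup>2) + c * (n x - n1\<^sup>2) + d * (s x - n1\<^sup>2)"
    unfolding mixture_def a_def[symmetric] b_def[symmetric] c_def[symmetric] d_def[symmetric] by (simp add: algebra_simps)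
  also have "0 \<le> \<dots>" using bd(1)[OF adm(1)] bd(1)[OF adm(2)] bd(1)[OF adm(3)] bd(1)[OF adm(4)] bd(1)[OF adm(5)] nn sum
    by (intro add_nonneg_nonneg mult_nonneg_nonneg) auto
  finally show "n1\<^sup>2 \<le> mixture \<epsilon> e w n s t x" by simp
  have "n2\<^sup>2 - mixture \<epsilon> e w n s t x = (1 - (a + b + c + d)) * (n2\<^sup>2 - \<epsilon> x) + a * (n2\<^sup>2 - e x) + b * (n2\<^sup>2 - w x) + c * (n2\<^sup>2 - n x) + d * (n2\<^sup>2 - s x)"
    unfolding mixture_def a_def[symmetric] b_def[symmetric] c_def[symmetric] d_def[symmetric] by (simp add: algebra_simps)
  also have "0 \<le> \<dots>" using bd(2)[OF adm(1)] bd(2)[OF adm(2)] bd(2)[OF adm(3)] bd(2)[OF adm(4)] bd(2)[OF adm(5)] nn sum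
    by (intro add_nonneg_nonneg mult_nonneg_nonneg) auto
  finally show "mixture \<epsilon> e w n s t x \<le> n2\<^sup>2" by simp
qed

lemma mixture_lipschitz:
  assumes adm: "admissible n1 n2 \<epsilon>" "admissible n1 n2 e" "admissible n1 n2 w" "admissible n1 n2 n" "admissible n1 n2 s"
  shows "\<bar>mixture \<epsilon> e w n s t x - mixture \<epsilon> e w n s t' x\<bar> \<le> 4 * n2\<^sup>2 * cmod (t - t')"
proof -
  have d: "\<bar>f x - \<epsilon> x\<bar> \<le> n2\<^sup>2" if "admissible n1 n2 f" for f
  proof -
    have "n1\<^sup>2 \<le> f x" "f x \<le> n2\<^sup>2" "n1\<^sup>2 \<le> \<epsilon> x" "\<epsilon> x \<le> n2\<^sup>2" "0 \<le> n1\<^sup>2" using that adm(1) by (auto simp: admissible_def)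
    then show ?thesis by linarith
  qed
  have m: "\<bar>(p - p') * (f x - \<epsilon> x)\<bar> \<le> cmod (t - t') * n2\<^sup>2" if "\<bar>p - p'\<bar> \<le> cmod (t - t')" "admissible n1 n2 f" for p p' f
    unfolding abs_mult using that(1) d[OF that(2)] by (intro mult_mono) auto
  have R: "\<bar>Re t - Re t'\<bar> \<le> cmod (t - t')" "\<bar>Im t - Im t'\<bar> \<le> cmod (t - t')"
    using abs_Re_le_cmod[of "t - t'"] abs_Im_le_cmod[of "t - t'"] by auto
  have 1: "\<bar>max (Re t) 0 - max (Re t') 0\<bar> \<le> cmod (t - t')" "\<bar>max (- Re t) 0 - max (- Re t') 0\<bar> \<le> cmod (t - t')"
    "\<bar>max (Im t) 0 - max (Im t') 0\<bar> \<le> cmod (t - t')" "\<bar>max (- Im t) 0 - max (- Im t') 0\<bar> \<le> cmod (t - t')"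
    using R by (auto simp: max_def)
  have "mixture \<epsilon> e w n s t x - mixture \<epsilon> e w n s t' x = (max (Re t) 0 - max (Re t') 0) * (e x - \<epsilon> x) + (max (- Re t) 0 - max (- Re t') 0) * (w x - \<epsilon> x)
     + (max (Im t) 0 - max (Im t') 0) * (n x - \<epsilon> x) + (max (- Im t) 0 - max (- Im t') 0) * (s x - \<epsilon> x)"
    unfolding mixture_def by (simp add: algebra_simps)
  moreover have "\<bar>P + Q + R + S\<bar> \<le> 4 * M" if "\<bar>P\<bar> \<le> M" "\<bar>Q\<bar> \<le> M" "\<bar>R\<bar> \<le> M" "\<bar>S\<bar> \<le> M" for P Q R S M :: real
    using that by linarith
  from this[OF m[OF 1(1) adm(2)] m[OF 1(2) adm(3)] m[OF 1(3) adm(4)] m[OF 1(4) adm(5)]]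
  have "\<bar>(max (Re t) 0 - max (Re t') 0) * (e x - \<epsilon> x) + (max (- Re t) 0 - max (- Re t') 0) * (w x - \<epsilon> x)
     + (max (Im t) 0 - max (Im t') 0) * (n x - \<epsilon> x) + (max (- Im t) 0 - max (- Im t') 0) * (s x - \<epsilon> x)\<bar> \<le> 4 * n2\<^sup>2 * cmod (t - t')"
    by (simp only: mult_ac)
  ultimately show ?thesis by (simp only:)
qed

lemma mixture_variation:
  assumes adm: "admissible n1 n2 \<epsilon>" "admissible n1 n2 e" "admissible n1 n2 w" "admissible n1 n2 n" "admissible n1 n2 s"
    and y: "continuous_on {0..T} y"
    and I: "integral {0..T} (\<lambda>x. of_real (e x - \<epsilon> x) * (y x)\<^sup>2) = of_real r" "integral {0..T} (\<lambda>x. of_real (w x - \<epsilon> x) * (y x)\<^sup>2) = - of_real r"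
      "integral {0..T} (\<lambda>x. of_real (n x - \<epsilon> x) * (y x)\<^sup>2) = \<i> * of_real r" "integral {0..T} (\<lambda>x. of_real (s x - \<epsilon> x) * (y x)\<^sup>2) = - \<i> * of_real r"
  shows "((\<lambda>x. of_real (mixture \<epsilon> e w n s t x - \<epsilon> x) * (y x)\<^sup>2) has_integral of_real r * t) {0..T}"
proof -
  have y2: "continuous_on {0..T} (\<lambda>x. (y x)\<^sup>2)" by (intro continuous_intros y)
  have h: "((\<lambda>x. of_real (f x - \<epsilon> x) * (y x)\<^sup>2) has_integral integral {0..T} (\<lambda>x. of_real (f x - \<epsilon> x) * (y x)\<^sup>2)) {0..T}" if "admissible n1 n2 f" for f
    by (rule integrable_integral[OF variation_integrable[OF adm(1) that y2]])
  have "((\<lambda>x. of_real (max (Re t) 0) * (of_real (e x - \<epsilon> x) * (y x)\<^sup>2) + of_real (max (- Re t) 0) * (of_real (w x - \<epsilon> x) * (y x)\<^sup>2)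
     + of_real (max (Im t) 0) * (of_real (n x - \<epsilon> x) * (y x)\<^sup>2) + of_real (max (- Im t) 0) * (of_real (s x - \<epsilon> x) * (y x)\<^sup>2))
     has_integral of_real (max (Re t) 0) * of_real r + of_real (max (- Re t) 0) * (- of_real r) + of_real (max (Im t) 0) * (\<i> * of_real r) + of_real (max (- Im t) 0) * (- \<i> * of_real r)) {0..T}"
    using h[OF adm(2)] h[OF adm(3)] h[OF adm(4)] h[OF adm(5)] unfolding I by (intro has_integral_add has_integral_mult_right)
  then show ?thesis
  proof (rule has_integral_eq_rhs[OF has_integral_eq[rotated]])
    show "of_real (max (Re t) 0) * (of_real (e x - \<epsilon> x) * (y x)\<^sup>2) + of_real (max (- Re t) 0) * (of_real (w x - \<epsilon> x) * (y x)\<^sup>2)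
     + of_real (max (Im t) 0) * (of_real (n x - \<epsilon> x) * (y x)\<^sup>2) + of_real (max (- Im t) 0) * (of_real (s x - \<epsilon> x) * (y x)\<^sup>2)
     = of_real (mixture \<epsilon> e w n s t x - \<epsilon> x) * (y x)\<^sup>2" for x
      unfolding mixture_def by (simp add: algebra_simps)
    show "of_real r * t = of_real (max (Re t) 0) * of_real r + of_real (max (- Re t) 0) * (- of_real r) + of_real (max (Im t) 0) * (\<i> * of_real r) + of_real (max (- Im t) 0) * (- \<i> * of_real r)"
      by (simp add: complex_eq_iff max_def)
  qed
qed

text \<open>If the first variations fill a disc, then four admissible directions span a family of coefficients
  whose effect on the boundary condition is a similarity up to a small error, and a zero of the
  perturbed condition exists by zero_of_near_similarity. How far k may be moved depends on the radius
  of the disc but not on the structure.\<close>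
theorem boundary_condition_restored:
  assumes n1: "0 < n1" and sp: "0 < sp" and K: "0 < K" and r: "0 < r"
  obtains \<delta> where "0 < \<delta>" "\<And>k k' \<epsilon> y v. cmod k = K \<Longrightarrow> cmod k' = K \<Longrightarrow> cmod (k' - k) < \<delta> \<Longrightarrow> admissible n1 n2 \<epsilon> \<Longrightarrow>
    wave k \<epsilon> 0 sp y v \<Longrightarrow> y 0 = 0 \<Longrightarrow> v 0 = 1 \<Longrightarrow> v sp = \<i> * k * of_real n1 * y sp \<Longrightarrow> y sp \<noteq> 0 \<Longrightarrow>
    ball 0 r \<subseteq> reachable_variations n1 n2 sp \<epsilon> y \<Longrightarrow>
    \<exists>\<epsilon>' y' v'. admissible n1 n2 \<epsilon>' \<and> wave k' \<epsilon>' 0 sp y' v' \<and> y' 0 = 0 \<and> v' 0 = 1 \<and> v' sp = \<i> * k' * of_real n1 * y' sp"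
proof -
  define B where "B = exp ((1 + K\<^sup>2 * n2\<^sup>2) * sp)"
  define C where "C = (1 + sp) * exp (2 * ((1 + K\<^sup>2 * n2\<^sup>2) * sp))"
  define L where "L = 4 * n2\<^sup>2"
  have pos: "0 < B" "0 < C" "0 \<le> L" using sp by (auto simp: B_def C_def L_def)
  \<comment> \<open>A1 bounds the effect of moving k, and A2 the quadratic error of the variation\<close>
  define A1 where "A1 = (2 * K * n2\<^sup>2 * B\<^sup>2 * sp + n1 * B\<^sup>2) / K\<^sup>2"
  define A2 where "A2 = L * B * C * sp * (2 * K * n2\<^sup>2 + K\<^sup>2 * L)"
  have A: "0 \<le> A1" "0 \<le> A2" unfolding A1_def A2_def using pos K sp n1 by auto
  define \<rho> where "\<rho> = min (1 / 2) (r / (8 * (A2 + 1)))"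
  have \<rho>: "0 < \<rho>" "\<rho> \<le> 1 / 2" "A2 * \<rho> \<le> r / 8"
  proof -
    show "0 < \<rho>" using r A by (auto simp: \<rho>_def)
    show "\<rho> \<le> 1 / 2" unfolding \<rho>_def by (rule min.cobounded1)
    have "A2 * \<rho> \<le> (A2 + 1) * (r / (8 * (A2 + 1)))" using A r \<open>0 < \<rho>\<close> by (intro mult_mono) (auto simp: \<rho>_def)
    also have "\<dots> = r / 8" using A by (simp add: divide_simps)
    finally show "A2 * \<rho> \<le> r / 8" .
  qed
  define \<delta> where "\<delta> = min \<rho> (r * \<rho> / (8 * (A1 + 1)))"
  have \<delta>: "0 < \<delta>" "\<delta> \<le> \<rho>" "A1 * \<delta> \<le> r * \<rho> / 8"
  proof -
    show "0 < \<delta>" "\<delta> \<le> \<rho>" using r A \<rho> by (auto simp: \<delta>_def)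
    have "A1 * \<delta> \<le> (A1 + 1) * (r * \<rho> / (8 * (A1 + 1)))" using A r \<rho> \<open>0 < \<delta>\<close> by (intro mult_mono) (auto simp: \<delta>_def)
    also have "\<dots> = r * \<rho> / 8" using A by (simp add: divide_simps)
    finally show "A1 * \<delta> \<le> r * \<rho> / 8" .
  qed
  show ?thesis
  proof (rule that[OF \<delta>(1)])
    fix k k' \<epsilon> y v
    assume k: "cmod k = K" "cmod k' = K" "cmod (k' - k) < \<delta>" and adm: "admissible n1 n2 \<epsilon>" and w: "wave k \<epsilon> 0 sp y v" "y 0 = 0" "v 0 = 1"
      and bc: "v sp = \<i> * k * of_real n1 * y sp" "y sp \<noteq> 0" and ball: "ball 0 r \<subseteq> reachable_variations n1 n2 sp \<epsilon> y"
    have kK: "cmod k \<le> K" "cmod k' \<le> K" using k by auto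
    have knz: "k \<noteq> 0" using k K by auto
    have pick: "\<exists>\<eta>. admissible n1 n2 \<eta> \<and> integral {0..sp} (\<lambda>s. of_real (\<eta> s - \<epsilon> s) * (y s)\<^sup>2) = z" if "cmod z = r / 2" for z
    proof -
      have "z \<in> ball 0 r" using that r by simp
      then show ?thesis using ball unfolding reachable_variations_def by auto
    qed
    obtain e where e: "admissible n1 n2 e" "integral {0..sp} (\<lambda>s. of_real (e s - \<epsilon> s) * (y s)\<^sup>2) = of_real (r / 2)"
      using pick[of "of_real (r / 2)"] r by auto
    obtain we where we: "admissible n1 n2 we" "integral {0..sp} (\<lambda>s. of_real (we s - \<epsilon> s) * (y s)\<^sup>2) = - of_real (r / 2)"
      using pick[of "- of_real (r / 2)"] r by auto
    obtain no where no: "admissible n1 n2 no" "integral {0..sp} (\<lambda>s. of_real (no s - \<epsilon> s) * (y s)\<^sup>2) = \<i> * of_real (r / 2)"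
      using pick[of "\<i> * of_real (r / 2)"] r by (auto simp: norm_mult)
    obtain so where so: "admissible n1 n2 so" "integral {0..sp} (\<lambda>s. of_real (so s - \<epsilon> s) * (y s)\<^sup>2) = - \<i> * of_real (r / 2)"
      using pick[of "- \<i> * of_real (r / 2)"] r by (auto simp: norm_mult)
    define E where "E = mixture \<epsilon> e we no so"
    have E0: "E 0 = \<epsilon>" by (simp add: E_def mixture_def fun_eq_iff)
    have Eadm: "admissible n1 n2 (E t)" if "cmod t \<le> \<rho>" for t
      unfolding E_def using mixture_admissible[OF adm e(1) we(1) no(1) so(1), of t] that \<rho> by simp
    have Elip: "\<bar>E t x - E t' x\<bar> \<le> L * cmod (t - t')" for t t' x
      unfolding E_def L_def by (rule mixture_lipschitz[OF adm e(1) we(1) no(1) so(1)])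
    have cy: "continuous_on {0..sp} y" using w(1) by (auto simp: wave_def intro: primitive_continuous)
    have Evar: "((\<lambda>x. of_real (E t x - \<epsilon> x) * (y x)\<^sup>2) has_integral of_real (r / 2) * t) {0..sp}" for t
      unfolding E_def by (rule mixture_variation[OF adm e(1) we(1) no(1) so(1) cy e(2) we(2) no(2) so(2)])
    have "\<forall>t\<in>cball 0 \<rho>. \<exists>yv. wave k' (E t) 0 sp (fst yv) (snd yv) \<and> fst yv 0 = 0 \<and> snd yv 0 = 1"
    proof
      fix t :: complex assume "t \<in> cball 0 \<rho>"
      then obtain y' v' where "wave k' (E t) 0 sp y' v'" "y' 0 = 0" "v' 0 = 1"
        using wave_exists[OF Eadm, of t sp k'] sp by auto
      then show "\<exists>yv. wave k' (E t) 0 sp (fst yv) (snd yv) \<and> fst yv 0 = 0 \<and> snd yv 0 = 1" by (intro exI[of _ "(y', v')"]) simp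
    qed
    then obtain YV where YV: "\<forall>t\<in>cball 0 \<rho>. wave k' (E t) 0 sp (fst (YV t)) (snd (YV t)) \<and> fst (YV t) 0 = 0 \<and> snd (YV t) 0 = 1"
      using bchoice by (metis (no_types, lifting))
    define Y where "Y = (\<lambda>t. fst (YV t))"
    define V where "V = (\<lambda>t. snd (YV t))"
    have W: "wave k' (E t) 0 sp (Y t) (V t)" "Y t 0 = 0" "V t 0 = 1" if "cmod t \<le> \<rho>" for t
      using YV that by (auto simp: Y_def V_def)
    have lipYV: "cmod (Y t sp - Y t' sp) \<le> K\<^sup>2 * L * C * cmod (t - t')" "cmod (V t sp - V t' sp) \<le> K\<^sup>2 * L * C * cmod (t - t')"
      if t: "cmod t \<le> \<rho>" "cmod t' \<le> \<rho>" for t t'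
    proof -
      have d: "cmod (k'\<^sup>2 * of_real (E t s) - k'\<^sup>2 * of_real (E t' s)) \<le> K\<^sup>2 * (L * cmod (t - t'))" for s
      proof -
        have "cmod (k'\<^sup>2 * of_real (E t s) - k'\<^sup>2 * of_real (E t' s)) = K\<^sup>2 * \<bar>E t s - E t' s\<bar>"
          using k(2) by (simp add: norm_mult norm_power flip: right_diff_distrib of_real_diff)
        also have "\<dots> \<le> K\<^sup>2 * (L * cmod (t - t'))" using Elip by (intro mult_left_mono) auto
        finally show ?thesis .
      qed
      note D = wave_continuous_dependence[OF W(1)[OF t(2)] W(1)[OF t(1)] Eadm[OF t(2)] Eadm[OF t(1)] W(2,3)[OF t(2)] W(2,3)[OF t(1)] kK(2) kK(2) d, of sp]
      show "cmod (Y t sp - Y t' sp) \<le> K\<^sup>2 * L * C * cmod (t - t')" "cmod (V t sp - V t' sp) \<le> K\<^sup>2 * L * C * cmod (t - t')"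
        using D sp unfolding C_def by (simp_all add: mult_ac)
    qed
    have LC: "0 \<le> K\<^sup>2 * L * C" using pos by simp
    have "(K\<^sup>2 * L * C)-lipschitz_on (cball 0 \<rho>) (\<lambda>t. Y t sp)" "(K\<^sup>2 * L * C)-lipschitz_on (cball 0 \<rho>) (\<lambda>t. V t sp)"
      using lipYV LC by (auto intro!: lipschitz_onI simp: dist_norm)
    then have cont: "continuous_on (cball 0 \<rho>) (\<lambda>t. Y t sp)" "continuous_on (cball 0 \<rho>) (\<lambda>t. V t sp)"
      by (auto intro: lipschitz_on_continuous_on)
    \<comment> \<open>the mismatch at the open end, scaled so that its linear part in t is r / 2 times the identity\<close>
    define R where "R = (\<lambda>t. - y sp * (V t sp - \<i> * k' * of_real n1 * Y t sp) / k\<^sup>2)"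
    have contR: "continuous_on (cball 0 \<rho>) R" unfolding R_def using knz by (intro continuous_intros cont) auto
    have near: "cmod (R t - of_real (r / 2) * t) \<le> r / 2 * \<rho>" if t: "cmod t \<le> \<rho>" for t
    proof -
      define D where "D = 2 * K * cmod (k' - k) * n2\<^sup>2 + K\<^sup>2 * (L * cmod t)"
      have D0: "0 \<le> D" using K pos by (simp add: D_def)
      have k2: "cmod (k'\<^sup>2 - k\<^sup>2) \<le> 2 * K * cmod (k' - k)"
      proof -
        have "k'\<^sup>2 - k\<^sup>2 = (k' + k) * (k' - k)" by (simp add: power2_eq_square algebra_simps)
        then show ?thesis using norm_triangle_ineq[of k' k] k by (simp add: norm_mult mult_right_mono)
      qed
      have d: "cmod (k'\<^sup>2 * of_real (E t s) - k\<^sup>2 * of_real (\<epsilon> s)) \<le> D" for s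
      proof -
        have "k'\<^sup>2 * of_real (E t s) - k\<^sup>2 * of_real (\<epsilon> s) = (k'\<^sup>2 - k\<^sup>2) * of_real (E t s) + k\<^sup>2 * of_real (E t s - E 0 s)"
          unfolding E0 by (simp add: algebra_simps)
        then have "cmod (k'\<^sup>2 * of_real (E t s) - k\<^sup>2 * of_real (\<epsilon> s)) \<le> cmod (k'\<^sup>2 - k\<^sup>2) * \<bar>E t s\<bar> + K\<^sup>2 * \<bar>E t s - E 0 s\<bar>"
          using norm_triangle_ineq[of "(k'\<^sup>2 - k\<^sup>2) * of_real (E t s)" "k\<^sup>2 * of_real (E t s - E 0 s)"] k(1)
          by (simp only: norm_mult norm_power norm_of_real)
        also have "\<dots> \<le> D"
          unfolding D_def using k2 admissible_bound[OF Eadm[OF t], of s] Elip[of t s 0] K by (intro add_mono mult_mono) auto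
        finally show ?thesis .
      qed
      have diff: "cmod (Y t s - y s) \<le> D * C" if "s \<in> {0..sp}" for s
        using wave_continuous_dependence(1)[OF w(1) W(1)[OF t] adm Eadm[OF t] w(2,3) W(2,3)[OF t] kK d, of s] that
        unfolding C_def by auto
      have yB: "cmod (y s) \<le> B" "cmod (Y t s) \<le> B" if "s \<in> {0..sp}" for s
        using wave_bound(1)[OF w(1) adm w(2,3) kK(1), of s] wave_bound(1)[OF W(1)[OF t] Eadm[OF t] W(2,3)[OF t] kK(2), of s] that
        unfolding B_def by auto
      have wr: "((\<lambda>s. (k'\<^sup>2 * of_real (E t s) - k\<^sup>2 * of_real (\<epsilon> s)) * (y s * Y t s) - k\<^sup>2 * (of_real (E t s - \<epsilon> s) * (y s)\<^sup>2)) has_integral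
          (Y t sp * v sp - y sp * V t sp) - k\<^sup>2 * (of_real (r / 2) * t)) {0..sp}"
        using sp by (intro has_integral_diff has_integral_mult_right wronskian_identity[OF w(1) W(1)[OF t] w(2) W(2)[OF t]] Evar) auto
      have ib: "cmod ((Y t sp * v sp - y sp * V t sp) - k\<^sup>2 * (of_real (r / 2) * t)) \<le> (2 * K * cmod (k' - k) * n2\<^sup>2 * B\<^sup>2 + K\<^sup>2 * (L * cmod t) * (B * (D * C))) * (sp - 0)"
      proof (rule has_integral_bound_Icc[OF _ wr])
        show "0 \<le> 2 * K * cmod (k' - k) * n2\<^sup>2 * B\<^sup>2 + K\<^sup>2 * (L * cmod t) * (B * (D * C))" using K pos D0 by simp
        fix s assume s: "s \<in> {0..sp}"
        have "(k'\<^sup>2 * of_real (E t s) - k\<^sup>2 * of_real (\<epsilon> s)) * (y s * Y t s) - k\<^sup>2 * (of_real (E t s - \<epsilon> s) * (y s)\<^sup>2)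
          = ((k'\<^sup>2 - k\<^sup>2) * of_real (E t s)) * (y s * Y t s) + (k\<^sup>2 * of_real (E t s - E 0 s)) * (y s * (Y t s - y s))"
          unfolding E0 by (simp add: algebra_simps power2_eq_square)
        then have "cmod ((k'\<^sup>2 * of_real (E t s) - k\<^sup>2 * of_real (\<epsilon> s)) * (y s * Y t s) - k\<^sup>2 * (of_real (E t s - \<epsilon> s) * (y s)\<^sup>2))
          \<le> (cmod (k'\<^sup>2 - k\<^sup>2) * \<bar>E t s\<bar>) * (cmod (y s) * cmod (Y t s)) + (K\<^sup>2 * \<bar>E t s - E 0 s\<bar>) * (cmod (y s) * cmod (Y t s - y s))"
          using norm_triangle_ineq[of "((k'\<^sup>2 - k\<^sup>2) * of_real (E t s)) * (y s * Y t s)" "(k\<^sup>2 * of_real (E t s - E 0 s)) * (y s * (Y t s - y s))"] k(1)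
          by (simp only: norm_mult norm_power norm_of_real)
        also have "\<dots> \<le> ((2 * K * cmod (k' - k)) * n2\<^sup>2) * (B * B) + (K\<^sup>2 * (L * cmod t)) * (B * (D * C))"
          using k2 admissible_bound[OF Eadm[OF t], of s] Elip[of t s 0] K yB[OF s] diff[OF s] pos by (intro add_mono mult_mono) auto
        also have "\<dots> = 2 * K * cmod (k' - k) * n2\<^sup>2 * B\<^sup>2 + K\<^sup>2 * (L * cmod t) * (B * (D * C))" by (simp add: power2_eq_square)
        finally show "cmod ((k'\<^sup>2 * of_real (E t s) - k\<^sup>2 * of_real (\<epsilon> s)) * (y s * Y t s) - k\<^sup>2 * (of_real (E t s - \<epsilon> s) * (y s)\<^sup>2))
          \<le> 2 * K * cmod (k' - k) * n2\<^sup>2 * B\<^sup>2 + K\<^sup>2 * (L * cmod t) * (B * (D * C))" .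
      qed (use sp in auto)
      have "k\<^sup>2 * (R t - of_real (r / 2) * t) = ((Y t sp * v sp - y sp * V t sp) - k\<^sup>2 * (of_real (r / 2) * t)) + \<i> * (k' - k) * of_real n1 * (y sp * Y t sp)"
        unfolding R_def bc(1) using knz by (simp add: field_simps)
      then have "K\<^sup>2 * cmod (R t - of_real (r / 2) * t) \<le> cmod ((Y t sp * v sp - y sp * V t sp) - k\<^sup>2 * (of_real (r / 2) * t)) + cmod (\<i> * (k' - k) * of_real n1 * (y sp * Y t sp))"
        using norm_triangle_ineq[of "(Y t sp * v sp - y sp * V t sp) - k\<^sup>2 * (of_real (r / 2) * t)" "\<i> * (k' - k) * of_real n1 * (y sp * Y t sp)"] k(1)
        by (metis norm_mult norm_power)
      also have "cmod (\<i> * (k' - k) * of_real n1 * (y sp * Y t sp)) \<le> cmod (k' - k) * n1 * (B * B)"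
        using yB[of sp] sp n1 pos unfolding norm_mult norm_of_real by (intro mult_mono) auto
      finally have "K\<^sup>2 * cmod (R t - of_real (r / 2) * t) \<le> (2 * K * cmod (k' - k) * n2\<^sup>2 * B\<^sup>2 + K\<^sup>2 * (L * cmod t) * (B * (D * C))) * sp + cmod (k' - k) * n1 * (B * B)"
        using ib by simp
      also have "\<dots> = K\<^sup>2 * (A1 * cmod (k' - k) + L * B * C * sp * D * cmod t)"
        unfolding A1_def using K by (simp add: field_simps power2_eq_square)
      finally have "cmod (R t - of_real (r / 2) * t) \<le> A1 * cmod (k' - k) + L * B * C * sp * D * cmod t"
        using K by (simp only: mult_le_cancel_left_pos zero_less_power)
      also have "\<dots> \<le> r * \<rho> / 8 + 2 * (r / 8) * \<rho>"
      proof (rule add_mono)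
        have "A1 * cmod (k' - k) \<le> A1 * \<delta>" using A k(3) by (intro mult_left_mono) auto
        then show "A1 * cmod (k' - k) \<le> r * \<rho> / 8" using \<delta>(3) by simp
        have "D \<le> (2 * K * n2\<^sup>2 + K\<^sup>2 * L) * \<rho>"
        proof -
          have "2 * K * cmod (k' - k) * n2\<^sup>2 \<le> 2 * K * \<rho> * n2\<^sup>2" using k(3) \<delta>(2) K by (intro mult_right_mono mult_left_mono) auto
          moreover have "K\<^sup>2 * (L * cmod t) \<le> K\<^sup>2 * (L * \<rho>)" using t pos by (intro mult_left_mono) auto
          ultimately show ?thesis unfolding D_def by (simp add: algebra_simps)
        qed
        then have "L * B * C * sp * D \<le> L * B * C * sp * ((2 * K * n2\<^sup>2 + K\<^sup>2 * L) * \<rho>)"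
          using pos sp by (intro mult_left_mono) auto
        also have "\<dots> = A2 * \<rho>" by (simp add: A2_def)
        also have "\<dots> \<le> 2 * (r / 8)" using \<rho>(3) r by simp
        finally have "L * B * C * sp * D \<le> 2 * (r / 8)" .
        then show "L * B * C * sp * D * cmod t \<le> 2 * (r / 8) * \<rho>" by (rule mult_mono[OF _ t]) (use r in auto)
      qed
      also have "\<dots> \<le> r / 2 * \<rho>" using r \<rho> by simp
      finally show ?thesis .
    qed
    have r2: "0 < r / 2" using r by simp
    obtain t where t: "cmod t \<le> \<rho>" "R t = 0" using zero_of_near_similarity[OF r2 \<rho>(1) contR near] by blast
    have "V t sp = \<i> * k' * of_real n1 * Y t sp" using t(2) bc(2) knz by (simp add: R_def)
    then show "\<exists>\<epsilon>' y' v'. admissible n1 n2 \<epsilon>' \<and> wave k' \<epsilon>' 0 sp y' v' \<and> y' 0 = 0 \<and> v' 0 = 1 \<and> v' sp = \<i> * k' * of_real n1 * y' sp"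
      using Eadm[OF t(1)] W[OF t(1)] by blast
  qed
qed

section \<open>Directions in which the coefficient pushes the trajectory\<close>

context mode begin

text \<open>While v dominates n2 k y the imaginary part of the flux decreases, so it can only return to 0 after
  the two have become comparable. This survives limits, where it separates crossings from the start.\<close>
lemma crossing_not_immediate:
  assumes "0 < t" "t \<le> T" "Im (flux t) = 0"
  obtains s where "0 \<le> s" "s \<le> t" "cmod (v s) \<le> n2 * (cmod k * cmod (y s))"
proof (rule ccontr)
  assume no: "\<not> thesis"
  have gt: "n2 * (cmod k * cmod (y s)) < cmod (v s)" if "0 \<le> s" "s \<le> t" for s
    using no that \<open>\<And>s. 0 \<le> s \<Longrightarrow> s \<le> t \<Longrightarrow> cmod (v s) \<le> n2 * (cmod k * cmod (y s)) \<Longrightarrow> thesis\<close> by (meson not_le)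
  have pos: "0 < - (\<alpha> * ((cmod k)\<^sup>2 * \<epsilon> s * (cmod (y s))\<^sup>2 - (cmod (v s))\<^sup>2))" if s: "s \<in> {0..t}" for s
  proof -
    have "(n2 * (cmod k * cmod (y s)))\<^sup>2 < (cmod (v s))\<^sup>2"
      using gt[of s] s n2 by (intro power_strict_mono) auto
    moreover have "(cmod k)\<^sup>2 * \<epsilon> s * (cmod (y s))\<^sup>2 \<le> (cmod k)\<^sup>2 * n2\<^sup>2 * (cmod (y s))\<^sup>2"
      using eps(2)[of s] by (intro mult_right_mono mult_left_mono) auto
    ultimately have "(cmod k)\<^sup>2 * \<epsilon> s * (cmod (y s))\<^sup>2 - (cmod (v s))\<^sup>2 < 0"
      by (simp add: power_mult_distrib mult_ac)
    then show ?thesis using \<alpha> by (simp add: mult_pos_neg)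
  qed
  have "negligible {s \<in> {0..t}. - (\<alpha> * ((cmod k)\<^sup>2 * \<epsilon> s * (cmod (y s))\<^sup>2 - (cmod (v s))\<^sup>2)) \<noteq> 0}"
  proof (rule primitive_zero_negligible[OF primitive_minus[OF primitive_subset[OF prim_Im_flux order_refl assms(2)]]])
    show "0 \<le> - (\<alpha> * ((cmod k)\<^sup>2 * \<epsilon> s * (cmod (y s))\<^sup>2 - (cmod (v s))\<^sup>2))" if "s \<in> {0..t}" for s
      using pos[OF that] by (rule less_imp_le)
    show "0 \<le> t" using assms(1) by simp
    show "- Im (flux t) \<le> - Im (flux 0)" by (simp add: assms(3) flux_0)
  qed
  moreover have "{s \<in> {0..t}. - (\<alpha> * ((cmod k)\<^sup>2 * \<epsilon> s * (cmod (y s))\<^sup>2 - (cmod (v s))\<^sup>2)) \<noteq> 0} = {0..t}"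
    using pos by (auto simp only: less_imp_neq[THEN not_sym])
  ultimately have "negligible (cbox 0 t)" by (simp only: cbox_interval)
  then show False using assms(1) unfolding negligible_interval by simp
qed

text \<open>A quantitative form of Re_flux_pos that survives limits.\<close>
lemma Re_flux_lower:
  assumes "0 \<le> t0" "\<And>u. 0 \<le> u \<Longrightarrow> u \<le> t0 \<Longrightarrow> u \<le> T \<Longrightarrow> 1 / 2 \<le> cmod (v u)" "0 \<le> s" "s \<le> T"
  shows "\<beta> / 4 * min s t0 \<le> Re (flux s)"
proof -
  define t where "t = min s t0"
  have t: "0 \<le> t" "t \<le> s" "t \<le> t0" using assms by (auto simp: t_def)
  have "\<beta> / 4 * t - \<beta> / 4 * 0 \<le> Re (flux t) - Re (flux 0)"
  proof (rule primitive_le[OF primitive_ident primitive_subset[OF prim_Re_flux order_refl] t(1)])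
    fix u assume u: "u \<in> {0..t}"
    have "(1 / 2)\<^sup>2 \<le> (cmod (v u))\<^sup>2" using assms(2)[of u] u t assms by (intro power_mono) auto
    moreover have "0 \<le> (cmod k)\<^sup>2 * \<epsilon> u * (cmod (y u))\<^sup>2" using eps(3)[of u] by simp
    ultimately have "1 / 4 \<le> (cmod (v u))\<^sup>2 + (cmod k)\<^sup>2 * \<epsilon> u * (cmod (y u))\<^sup>2" by (simp add: power_divide)
    from mult_left_mono[OF this, of \<beta>] \<beta>
    show "\<beta> / 4 \<le> \<beta> * ((cmod (v u))\<^sup>2 + (cmod k)\<^sup>2 * \<epsilon> u * (cmod (y u))\<^sup>2)" by simp
  qed (use t assms in auto)
  moreover have "Re (flux t) \<le> Re (flux s)"
  proof (rule primitive_mono[OF primitive_subset[OF prim_Re_flux t(1) assms(4)] t(2)])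
    fix u show "0 \<le> \<beta> * ((cmod (v u))\<^sup>2 + (cmod k)\<^sup>2 * \<epsilon> u * (cmod (y u))\<^sup>2)"
      using \<beta> eps(3)[of u] by simp
  qed
  ultimately show ?thesis by (simp add: flux_0 t_def)
qed

text \<open>A trajectory that met the real axis between 0 and the target has to be pushed on to larger
  impedances. This is impossible as long as the directions of all later pushes stay in the half-plane
  whose position is given by \<omega>.\<close>
lemma cone_obstruction:
  assumes t1: "0 < t1" "t1 \<le> e" "e \<le> T" "outgoing n1 e = 0" and cross: "Im (flux t1) = 0" "Re (refl n1 t1) < 0"
    and \<omega>: "\<beta> * sin \<omega> < \<alpha> * cos \<omega>"
    and cone: "\<And>t. t1 \<le> t \<Longrightarrow> t \<le> e \<Longrightarrow> 0 \<le> Im (exp (\<i> * of_real \<omega>) * (y t * cnj (y t1) * exp (\<i> * k * of_real n1 * of_real (t - t1))))"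
  shows False
proof -
  define A where "A = \<i> * k * y t1"
  have t1T: "t1 \<le> T" using t1 by simp
  have ynz: "y t1 \<noteq> 0" using y_nz t1 by simp
  have Anz: "A \<noteq> 0" using ynz k_nz by (simp add: A_def)
  define f where "f = Re (flux t1)"
  have fl: "v t1 * cnj A = of_real f" using cross(1) by (simp add: flux_def A_def f_def complex_eq_iff)
  have "v t1 * (cnj A * A) = of_real f * A" using fl by (metis mult.assoc)
  then have "v t1 * of_real ((cmod A)\<^sup>2) = of_real f * A" by (simp only: complex_norm_square mult.commute[of "cnj A"])
  then have vA: "v t1 = of_real (f / (cmod A)\<^sup>2) * A" using Anz by (simp add: field_simps)
  have fpos: "0 < f" using Re_flux_pos[OF t1(1) t1T] by (simp add: f_def)
  have A2: "(cmod k)\<^sup>2 * (cmod (y t1))\<^sup>2 = (cmod A)\<^sup>2" by (simp add: A_def norm_mult power_mult_distrib)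
  define m where "m = n1 - f / (cmod A)\<^sup>2"
  have "0 < m"
  proof -
    have "0 < (cmod (incoming n1 t1))\<^sup>2" using incoming_nz[of t1 n1] t1 t1T n1 by simp
    then have "(cmod (v t1))\<^sup>2 < (n1 * cmod A)\<^sup>2"
      using cross(2) unfolding Re_refl A2 by (simp add: divide_less_0_iff power_mult_distrib)
    then have "cmod (v t1) < n1 * cmod A" by (rule power2_less_imp_less) (use n1 in simp)
    moreover have "cmod (v t1) = \<bar>f / (cmod A)\<^sup>2\<bar> * cmod A" unfolding vA by (simp only: norm_mult norm_of_real)
    moreover have "\<bar>f / (cmod A)\<^sup>2\<bar> = f / (cmod A)\<^sup>2" using fpos by simp
    ultimately have "f / (cmod A)\<^sup>2 * cmod A < n1 * cmod A" by (simp only:)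
    then have "f / (cmod A)\<^sup>2 < n1" using Anz by (simp only: mult_less_cancel_right_pos zero_less_norm_iff not_False_eq_True)
    then show ?thesis by (simp add: m_def)
  qed
  have W: "outgoing n1 t1 = - of_real m * A" unfolding outgoing_alt m_def using vA by (simp add: A_def algebra_simps)
  let ?P = "\<lambda>t. y t * cnj (y t1) * exp (\<i> * k * of_real n1 * of_real (t - t1))"
  have "((\<lambda>t. (exp (\<i> * of_real \<omega>) * cnj (y t1) / k\<^sup>2) * (k\<^sup>2 * of_real (\<epsilon> t - n1\<^sup>2) * y t * exp (\<i> * k * of_real n1 * of_real (t - t1)))) has_integral
     (exp (\<i> * of_real \<omega>) * cnj (y t1) / k\<^sup>2) * outgoing n1 t1) {t1..e}"
    using outgoing_integral[OF _ t1(2,3,4)] t1(1) by (intro has_integral_mult_right) simp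
  then have "((\<lambda>t. of_real (\<epsilon> t - n1\<^sup>2) * (exp (\<i> * of_real \<omega>) * ?P t)) has_integral
     (exp (\<i> * of_real \<omega>) * cnj (y t1) / k\<^sup>2) * outgoing n1 t1) {t1..e}"
    by (rule has_integral_eq[rotated]) (use k_nz in \<open>simp add: mult_ac\<close>)
  from has_integral_linear[OF this bounded_linear_Im]
  have "((\<lambda>t. (\<epsilon> t - n1\<^sup>2) * Im (exp (\<i> * of_real \<omega>) * ?P t)) has_integral
     Im ((exp (\<i> * of_real \<omega>) * cnj (y t1) / k\<^sup>2) * outgoing n1 t1)) {t1..e}"
    by (simp add: o_def flip: of_real_diff)
  then have "0 \<le> Im ((exp (\<i> * of_real \<omega>) * cnj (y t1) / k\<^sup>2) * outgoing n1 t1)"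
    by (rule has_integral_nonneg) (use eps(1) cone in auto)
  moreover have "(exp (\<i> * of_real \<omega>) * cnj (y t1) / k\<^sup>2) * outgoing n1 t1 = of_real (m * (cmod (y t1))\<^sup>2 / (cmod k)\<^sup>2) * (exp (\<i> * of_real \<omega>) * (- \<i> * cnj k))"
  proof -
    have "cnj (y t1) * y t1 = of_real ((cmod (y t1))\<^sup>2)" by (simp only: complex_norm_square mult.commute)
    then have "(exp (\<i> * of_real \<omega>) * cnj (y t1) / k\<^sup>2) * outgoing n1 t1 = of_real (m * (cmod (y t1))\<^sup>2) * (exp (\<i> * of_real \<omega>) * (- \<i>)) / k"
      unfolding W A_def using k_nz by (simp add: power2_eq_square field_simps)
    also have "\<dots> = of_real (m * (cmod (y t1))\<^sup>2) * (exp (\<i> * of_real \<omega>) * (- \<i> * cnj k)) / (k * cnj k)"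
      using k_nz by simp
    also have "k * cnj k = of_real ((cmod k)\<^sup>2)" by (simp only: complex_norm_square)
    finally show ?thesis by simp
  qed
  moreover have "Im (exp (\<i> * of_real \<omega>) * (- \<i> * cnj k)) = \<beta> * sin \<omega> - \<alpha> * cos \<omega>"
    by (simp add: k Re_exp Im_exp algebra_simps)
  moreover have "0 < m * (cmod (y t1))\<^sup>2 / (cmod k)\<^sup>2" using \<open>0 < m\<close> ynz k_nz by simp
  moreover have "Im (of_real c * z) = c * Im z" for c z by simp
  ultimately have "0 \<le> m * (cmod (y t1))\<^sup>2 / (cmod k)\<^sup>2 * (\<beta> * sin \<omega> - \<alpha> * cos \<omega>)" by (simp only:)
  moreover have "m * (cmod (y t1))\<^sup>2 / (cmod k)\<^sup>2 * (\<beta> * sin \<omega> - \<alpha> * cos \<omega>) < 0"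
    by (rule mult_pos_neg[OF \<open>0 < m * (cmod (y t1))\<^sup>2 / (cmod k)\<^sup>2\<close>]) (use \<omega> in simp)
  ultimately show False by (meson not_less)
qed

end

section \<open>Limits of structures with degenerate variations\<close>

lemma primitive_closure:
  fixes f g :: "real \<Rightarrow> complex"
  assumes ab: "a \<le> b" and f: "continuous_on {a..b} f" and g: "continuous_on {a..b} g"
    and P: "\<And>c d. a < c \<Longrightarrow> c < d \<Longrightarrow> d < b \<Longrightarrow> primitive f g c d"
  shows "primitive f g a b"
  unfolding primitive_def
proof (intro conjI allI impI continuous_bounded_measurable[OF g])
  fix s t assume st: "a \<le> s" "s \<le> t" "t \<le> b"
  show "(g has_integral f t - f s) {s..t}"
  proof (rule fundamental_theorem_of_calculus_interior[OF st(2)])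
    show "continuous_on {s..t} f" by (rule continuous_on_subset[OF f]) (use st in auto)
    fix x assume x: "x \<in> {s<..<t}"
    define c where "c = (a + x) / 2" define d where "d = (x + b) / 2"
    have cd: "a < c" "c < x" "x < d" "d < b" using x st by (auto simp: c_def d_def)
    have "(f has_vector_derivative g x) (at x within {c..d})"
      by (rule primitive_has_vector_derivative[OF P continuous_on_subset[OF g]]) (use cd in auto)
    then show "(f has_vector_derivative g x) (at x)"
      using cd by (simp add: at_within_Icc_at)
  qed
qed

text \<open>The right-hand sides are continuous, so the equations in the interior extend to the closed interval.\<close>
lemma wave_closure:
  assumes "a \<le> b" "continuous_on {a..b} y" "continuous_on {a..b} v"
    and P: "\<And>c d. a < c \<Longrightarrow> c < d \<Longrightarrow> d < b \<Longrightarrow> wave k (\<lambda>_. n\<^sup>2) c d y v"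
  shows "wave k (\<lambda>_. n\<^sup>2) a b y v"
  unfolding wave_def
proof
  show "primitive y v a b" by (rule primitive_closure) (use assms in \<open>auto simp: wave_def\<close>)
  show "primitive v (\<lambda>s. - k\<^sup>2 * of_real (n\<^sup>2) * y s) a b"
    by (rule primitive_closure) (use assms in \<open>auto simp: wave_def intro!: continuous_intros\<close>)
qed

text \<open>In a homogeneous layer the two travelling amplitudes only change by exponential factors.\<close>
lemma homogeneous_amplitudes:
  assumes w: "wave k (\<lambda>_. n\<^sup>2) a b y v" and s: "a \<le> s" "s \<le> t" "t \<le> b"
  shows "v t - \<i> * k * of_real n * y t = exp (- (\<i> * k * of_real n) * of_real (t - s)) * (v s - \<i> * k * of_real n * y s)"
    "v t + \<i> * k * of_real n * y t = exp (\<i> * k * of_real n * of_real (t - s)) * (v s + \<i> * k * of_real n * y s)"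
proof -
  have amp: "v t + c * y t = exp (c * of_real (t - s)) * (v s + c * y s)" if c: "c\<^sup>2 = - k\<^sup>2 * of_real (n\<^sup>2)" for c
  proof -
    have P: "primitive (\<lambda>s. exp (- c * of_real s) * (v s + c * y s))
      (\<lambda>s. (- c * exp (- c * of_real s)) * (v s + c * y s) + exp (- c * of_real s) * (- k\<^sup>2 * of_real (n\<^sup>2) * y s + c * v s)) a b"
      using w unfolding wave_def by (intro primitive_mult primitive_exp_linear primitive_add primitive_cmult) auto
    have "(- c * exp (- c * of_real s)) * (v s + c * y s) + exp (- c * of_real s) * (- k\<^sup>2 * of_real (n\<^sup>2) * y s + c * v s) = 0" for s
      unfolding c[symmetric] by (simp add: power2_eq_square algebra_simps)
    then have "primitive (\<lambda>s. exp (- c * of_real s) * (v s + c * y s)) (\<lambda>_. 0) a b" using P by simp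
    from primitiveD(1)[OF this s]
    have "exp (- c * of_real t) * (v t + c * y t) = exp (- c * of_real s) * (v s + c * y s)"
      using has_integral_0 has_integral_unique by fastforce
    then have "(exp (c * of_real t) * exp (- c * of_real t)) * (v t + c * y t) = (exp (c * of_real t) * exp (- c * of_real s)) * (v s + c * y s)"
      by (simp only: mult.assoc)
    then show ?thesis by (simp add: right_diff_distrib flip: exp_add)
  qed
  have 1: "(\<i> * k * of_real n)\<^sup>2 = - k\<^sup>2 * of_real (n\<^sup>2)" "(- (\<i> * k * of_real n))\<^sup>2 = - k\<^sup>2 * of_real (n\<^sup>2)"
    by (simp_all add: power_mult_distrib)
  show "v t - \<i> * k * of_real n * y t = exp (- (\<i> * k * of_real n) * of_real (t - s)) * (v s - \<i> * k * of_real n * y s)"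
    using amp[OF 1(2)] by simp
  show "v t + \<i> * k * of_real n * y t = exp (\<i> * k * of_real n * of_real (t - s)) * (v s + \<i> * k * of_real n * y s)"
    using amp[OF 1(1)] .
qed

text \<open>The limit of a sequence of structures whose first variations degenerate in the direction N. Where
  the switching function Re (cnj N * Y^2) does not vanish the coefficient is extreme, and from the
  position es on the target is occupied. No equation is assumed where the switching function vanishes.\<close>
locale degenerate_limit =
  fixes n1 n2 sp es \<alpha> \<beta> :: real and k N :: complex and Y V :: "real \<Rightarrow> complex"
  assumes n1: "0 < n1" and n12: "n1 < n2" and \<alpha>: "0 < \<alpha>" and \<beta>: "0 < \<beta>" and k: "k = Complex \<alpha> (- \<beta>)"
    and ratio: "\<beta> * pi = \<alpha> * ln ((n2 + n1) / (n2 - n1))" and es: "0 < es" "es < sp"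
    and PY: "primitive Y V 0 sp" and cV: "continuous_on {0..sp} V" and Y0: "Y 0 = 0" and V0: "V 0 = 1"
    and Ynz: "\<And>s. 0 < s \<Longrightarrow> s \<le> sp \<Longrightarrow> Y s \<noteq> 0"
    and rest: "\<And>s. es \<le> s \<Longrightarrow> s \<le> sp \<Longrightarrow> V s = \<i> * k * of_real n1 * Y s"
    and N: "N \<noteq> 0"
    and high: "\<And>c d. 0 \<le> c \<Longrightarrow> c < d \<Longrightarrow> d \<le> sp \<Longrightarrow> (\<And>s. s \<in> {c..d} \<Longrightarrow> 0 < Re (cnj N * (Y s)\<^sup>2)) \<Longrightarrow> wave k (\<lambda>_. n2\<^sup>2) c d Y V"
    and low: "\<And>c d. 0 \<le> c \<Longrightarrow> c < d \<Longrightarrow> d \<le> sp \<Longrightarrow> (\<And>s. s \<in> {c..d} \<Longrightarrow> Re (cnj N * (Y s)\<^sup>2) < 0) \<Longrightarrow> wave k (\<lambda>_. n1\<^sup>2) c d Y V"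
begin

definition switch :: "real \<Rightarrow> real" where "switch s = Re (cnj N * (Y s)\<^sup>2)"
definition mismatch :: "real \<Rightarrow> complex" where "mismatch s = V s - \<i> * k * of_real n1 * Y s"
definition T0 :: real where "T0 = pi / (2 * n2 * \<alpha>)"

lemma n2: "0 < n2" using n1 n12 by simp
lemma knz: "k \<noteq> 0" using \<alpha> by (auto simp: k complex_eq_iff)
lemma T0_pos: "0 < T0" using n2 \<alpha> by (simp add: T0_def)

lemma cY: "continuous_on {0..sp} Y" by (rule primitive_continuous[OF PY])
lemma c_switch: "continuous_on {0..sp} switch" unfolding switch_def by (intro continuous_intros cY)
lemma c_mismatch: "continuous_on {0..sp} mismatch" unfolding mismatch_def by (intro continuous_intros cY cV)

lemma dY: "s \<in> {0..sp} \<Longrightarrow> (Y has_vector_derivative V s) (at s within {0..sp})"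
  by (rule primitive_has_vector_derivative[OF PY cV])

text \<open>The point s2 is the first one after which the target is never left.\<close>
lemma arrival:
  obtains s2 where "0 < s2" "s2 \<le> es" "\<And>s. s2 \<le> s \<Longrightarrow> s \<le> sp \<Longrightarrow> mismatch s = 0"
    "\<And>d. 0 < d \<Longrightarrow> \<exists>s. s2 - d < s \<and> s < s2 \<and> 0 \<le> s \<and> mismatch s \<noteq> 0"
proof -
  define S where "S = {s \<in> {0..sp}. mismatch s \<noteq> 0}"
  have S0: "0 \<in> S" using es by (simp add: S_def mismatch_def Y0 V0)
  have up: "s \<le> es" if "s \<in> S" for s using that rest[of s] unfolding S_def mismatch_def by force
  have bd: "bdd_above S" using up by (rule bdd_aboveI)
  define s2 where "s2 = Sup S"
  have le: "s2 \<le> es" unfolding s2_def using S0 up by (intro cSup_least) auto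
  have ge: "s \<le> s2" if "s \<in> S" for s unfolding s2_def using that bd by (rule cSup_upper)
  have s20: "0 \<le> s2" using ge[OF S0] .
  have after: "mismatch s = 0" if "s2 < s" "s \<le> sp" for s
    using ge[of s] that s20 unfolding S_def by force
  have at: "mismatch s2 = 0"
  proof (rule ccontr)
    assume nz: "mismatch s2 \<noteq> 0"
    have m: "s2 \<in> {0..sp}" using s20 le es by simp
    have "0 < cmod (mismatch s2)" using nz by simp
    then obtain d where d: "d > 0" "\<And>s. s \<in> {0..sp} \<Longrightarrow> dist s s2 < d \<Longrightarrow> dist (mismatch s) (mismatch s2) < cmod (mismatch s2)"
      using c_mismatch m unfolding continuous_on_iff by meson
    define s where "s = min sp (s2 + d / 2)"
    have "s2 < s" "s \<le> sp" "dist s s2 < d" using d le es by (auto simp: s_def dist_real_def)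
    then show False using d(2)[of s] after[of s] s20 by auto
  qed
  have "s2 \<noteq> 0" using at by (auto simp: mismatch_def Y0 V0)
  show ?thesis
  proof (rule that[of s2])
    show "0 < s2" using \<open>s2 \<noteq> 0\<close> s20 by simp
    show "mismatch s = 0" if "s2 \<le> s" "s \<le> sp" for s using at after[of s] that by (cases "s = s2") auto
    fix d :: real assume d: "0 < d"
    obtain s where s: "s \<in> S" "s2 - d < s" using less_cSupD[of S "s2 - d"] S0 d unfolding s2_def by auto
    then show "\<exists>s. s2 - d < s \<and> s < s2 \<and> 0 \<le> s \<and> mismatch s \<noteq> 0"
      using ge[of s] at unfolding S_def by (intro exI[of _ s]) (auto simp: less_le)
  qed (rule le)
qed

lemma rest_formula:
  assumes z: "\<forall>s. s2 \<le> s \<longrightarrow> s \<le> sp \<longrightarrow> mismatch s = 0" and s: "0 \<le> s2" "s2 \<le> s" "s \<le> sp"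
  shows "Y s = Y s2 * exp (\<i> * k * of_real n1 * of_real (s - s2))"
proof -
  let ?c = "\<i> * k * of_real n1"
  have P: "primitive (\<lambda>s. exp (- ?c * of_real s) * Y s) (\<lambda>s. (- ?c * exp (- ?c * of_real s)) * Y s + exp (- ?c * of_real s) * V s) s2 sp"
    using primitive_subset[OF PY s(1) order_refl] by (intro primitive_mult primitive_exp_linear)
  have "primitive (\<lambda>s. exp (- ?c * of_real s) * Y s) (\<lambda>_. 0) s2 sp"
    by (rule primitive_cong[OF P]) (use z in \<open>auto simp: mismatch_def\<close>)
  from primitiveD(1)[OF this order_refl s(2,3)]
  have "exp (- ?c * of_real s) * Y s = exp (- ?c * of_real s2) * Y s2"
    using has_integral_0 has_integral_unique by fastforce
  then have "exp (?c * of_real s) * (exp (- ?c * of_real s) * Y s) = exp (?c * of_real s) * (exp (- ?c * of_real s2) * Y s2)" by simp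
  then show ?thesis by (simp add: exp_minus exp_diff right_diff_distrib field_simps)
qed

text \<open>The wave in a layer of index n2 that ends in the target with the value 1, at the signed distance u
  from the end.\<close>
definition profile :: "real \<Rightarrow> complex" where
  "profile u = (of_real (n2 + n1) * exp (\<i> * k * of_real n2 * of_real u) + of_real (n2 - n1) * exp (- (\<i> * k * of_real n2) * of_real u)) / of_real (2 * n2)"

text \<open>At the critical ratio of decay and frequency the weights n2 + n1 and n2 - n1 are a shift of the
  hyperbolic argument by exactly the quarter wave T0.\<close>
lemma profile_hyperbolic:
  obtains D where "0 < D" "\<And>u. profile u = of_real D * Complex (cosh (\<beta> * n2 * (T0 + u)) * cos (\<alpha> * n2 * u)) (sinh (\<beta> * n2 * (T0 + u)) * sin (\<alpha> * n2 * u))"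
proof -
  define l where "l = \<beta> * n2 * T0"
  have "2 * l = ln ((n2 + n1) / (n2 - n1))"
    using ratio n2 \<alpha> unfolding l_def T0_def by (simp add: field_simps)
  then have e2: "exp (2 * l) = (n2 + n1) / (n2 - n1)" using n1 n12 by simp
  define D where "D = (n2 - n1) * exp l / n2"
  have D: "0 < D" using n12 n2 by (simp add: D_def)
  have m: "n2 - n1 = D * n2 * exp (- l)" using n2 by (simp add: D_def exp_minus)
  have p: "n2 + n1 = D * n2 * exp l"
  proof -
    have "n2 + n1 = (n2 - n1) * exp (2 * l)" using e2 n12 by simp
    also have "exp (2 * l) = exp l * exp l" by (simp flip: exp_add)
    finally show ?thesis using n2 by (simp add: D_def)
  qed
  show ?thesis
  proof (rule that[OF D])
    fix u
    define A where "A = \<beta> * n2 * (T0 + u)" define B where "B = \<alpha> * n2 * u"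
    have ik: "\<i> * k = Complex \<beta> \<alpha>" by (simp add: k complex_eq_iff)
    have "of_real l + \<i> * k * of_real n2 * of_real u = Complex A B"
      unfolding ik by (simp add: complex_eq_iff A_def B_def l_def algebra_simps)
    then have 1: "of_real (exp l) * exp (\<i> * k * of_real n2 * of_real u) = exp (Complex A B)"
      by (metis exp_add exp_of_real)
    have "of_real (- l) + (- (\<i> * k * of_real n2) * of_real u) = - Complex A B"
      using \<open>of_real l + \<i> * k * of_real n2 * of_real u = Complex A B\<close> by (simp add: algebra_simps flip: \<open>of_real l + _ = Complex A B\<close>)
    then have 2: "of_real (exp (- l)) * exp (- (\<i> * k * of_real n2) * of_real u) = exp (- Complex A B)"
      by (metis exp_add exp_of_real)
    have "profile u = of_real D * ((of_real (exp l) * exp (\<i> * k * of_real n2 * of_real u) + of_real (exp (- l)) * exp (- (\<i> * k * of_real n2) * of_real u)) / 2)"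
      unfolding profile_def p m using n2 by (simp add: field_simps)
    also have "(of_real (exp l) * exp (\<i> * k * of_real n2 * of_real u) + of_real (exp (- l)) * exp (- (\<i> * k * of_real n2) * of_real u)) / 2 = Complex (cosh A * cos B) (sinh A * sin B)"
      unfolding 1 2 by (simp add: complex_eq_iff Re_exp Im_exp cosh_def sinh_def field_simps)
    finally show "profile u = of_real D * Complex (cosh (\<beta> * n2 * (T0 + u)) * cos (\<alpha> * n2 * u)) (sinh (\<beta> * n2 * (T0 + u)) * sin (\<alpha> * n2 * u))"
      unfolding A_def B_def .
  qed
qed

lemma profile_zero: "profile (- T0) = 0"
proof -
  obtain D where D: "0 < D" "\<And>u. profile u = of_real D * Complex (cosh (\<beta> * n2 * (T0 + u)) * cos (\<alpha> * n2 * u)) (sinh (\<beta> * n2 * (T0 + u)) * sin (\<alpha> * n2 * u))"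
    using profile_hyperbolic by blast
  have "\<alpha> * n2 * T0 = pi / 2" using \<alpha> n2 by (simp add: T0_def)
  then have "cos (\<alpha> * n2 * T0) = 0" by (simp only: cos_pi_half)
  then show ?thesis unfolding D(2) by (simp add: complex_eq_iff)
qed

lemma profile_square:
  assumes "- T0 < u" "u < 0" shows "Im ((profile u)\<^sup>2) < 0"
proof -
  obtain D where D: "0 < D" "\<And>u. profile u = of_real D * Complex (cosh (\<beta> * n2 * (T0 + u)) * cos (\<alpha> * n2 * u)) (sinh (\<beta> * n2 * (T0 + u)) * sin (\<alpha> * n2 * u))"
    using profile_hyperbolic by blast
  define A where "A = \<beta> * n2 * (T0 + u)" define B where "B = \<alpha> * n2 * u"
  have A: "0 < sinh A" using assms \<beta> n2 by (simp add: A_def)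
  have "- (pi / 2) < B"
  proof -
    have "\<alpha> * n2 * (- T0) < \<alpha> * n2 * u" using assms \<alpha> n2 by (intro mult_strict_left_mono) auto
    moreover have "\<alpha> * n2 * (- T0) = - (pi / 2)" using \<alpha> n2 by (simp add: T0_def)
    ultimately show ?thesis by (simp add: B_def)
  qed
  moreover have "B < 0" using assms \<alpha> n2 by (simp add: B_def mult_pos_neg)
  ultimately have "0 < cos B" "sin B < 0"
    using sin_gt_zero[of "- B"] by (auto intro: cos_gt_zero_pi)
  have "Im ((profile u)\<^sup>2) = D\<^sup>2 * (2 * (cosh A * cos B) * (sinh A * sin B))"
    unfolding D(2) A_def B_def by (simp add: power_mult_distrib power2_eq_square)
  also have "\<dots> < 0"
    using D(1) A \<open>0 < cos B\<close> \<open>sin B < 0\<close> cosh_real_pos[of A] by (simp add: mult_pos_neg)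
  finally show ?thesis .
qed

lemma layer_profile:
  assumes w: "wave k (\<lambda>_. n2\<^sup>2) a b Y V" and z: "mismatch b = 0" and s: "a \<le> s" "s \<le> b"
  shows "Y s = Y b * profile (s - b)"
proof -
  let ?c = "\<i> * k * of_real n2"
  have cnz: "?c \<noteq> 0" using knz n2 by simp
  have Vb: "V b = \<i> * k * of_real n1 * Y b" using z by (simp add: mismatch_def)
  note h = homogeneous_amplitudes[OF w s order_refl]
  have 1: "V s - ?c * Y s = exp (?c * of_real (b - s)) * (V b - ?c * Y b)" unfolding h(1) by (simp add: exp_minus)
  have 2: "V s + ?c * Y s = exp (- ?c * of_real (b - s)) * (V b + ?c * Y b)" unfolding h(2) by (simp add: exp_minus)
  have "2 * ?c * Y s = exp (- ?c * of_real (b - s)) * (V b + ?c * Y b) - exp (?c * of_real (b - s)) * (V b - ?c * Y b)"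
    unfolding 1[symmetric] 2[symmetric] by simp
  also have "V b + ?c * Y b = \<i> * k * of_real (n2 + n1) * Y b" unfolding Vb by (simp add: algebra_simps)
  also have "V b - ?c * Y b = - (\<i> * k * of_real (n2 - n1) * Y b)" unfolding Vb by (simp add: algebra_simps)
  also have "- ?c * of_real (b - s) = ?c * of_real (s - b)" by (simp add: algebra_simps)
  also have "?c * of_real (b - s) = - ?c * of_real (s - b)" by (simp add: algebra_simps)
  finally have "2 * ?c * Y s = \<i> * k * (of_real (n2 + n1) * exp (?c * of_real (s - b)) + of_real (n2 - n1) * exp (- ?c * of_real (s - b))) * Y b"
    by (simp add: algebra_simps)
  also have "\<dots> = 2 * ?c * (Y b * profile (s - b))"
    unfolding profile_def using n2 by (simp add: field_simps)
  finally show ?thesis using cnz by simp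
qed

end

lemma positive_interval:
  fixes h :: "real \<Rightarrow> real"
  assumes h: "continuous_on {a..b} h" and s: "s \<in> {a..b}" "0 < h s" and ab: "a < b"
  obtains c d where "a \<le> c" "c < d" "d \<le> b" "s \<in> {c..d}" "\<And>t. t \<in> {c..d} \<Longrightarrow> 0 < h t"
proof -
  obtain r where r: "r > 0" "\<And>t. t \<in> {a..b} \<Longrightarrow> dist t s < r \<Longrightarrow> dist (h t) (h s) < h s"
    using h s unfolding continuous_on_iff by meson
  define c where "c = max a (s - r / 2)" define d where "d = min b (s + r / 2)"
  show ?thesis
  proof (rule that[of c d])
    show "a \<le> c" "d \<le> b" "s \<in> {c..d}" "c < d" using r(1) s ab by (auto simp: c_def d_def)
    fix t assume "t \<in> {c..d}"
    then have "t \<in> {a..b}" "dist t s < r" using r(1) by (auto simp: c_def d_def dist_real_def)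
    from r(2)[OF this] show "0 < h t" by (simp add: dist_real_def abs_if split: if_splits)
  qed
qed

context degenerate_limit begin

text \<open>Where the switching function is positive the medium is n2, but a state at rest in the target
  requires the medium n1.\<close>
lemma switch_nonpos_at_rest:
  assumes zz: "\<forall>s. s2 \<le> s \<longrightarrow> s \<le> sp \<longrightarrow> mismatch s = 0" and s2: "0 < s2" "s2 < sp" and s: "s2 \<le> s" "s \<le> sp"
  shows "switch s \<le> 0"
proof (rule ccontr)
  assume "\<not> switch s \<le> 0"
  then have pos: "0 < switch s" by simp
  have cs: "continuous_on {s2..sp} switch" by (rule continuous_on_subset[OF c_switch]) (use s2 in auto)
  obtain c d where cd: "s2 \<le> c" "c < d" "d \<le> sp" "\<And>t. t \<in> {c..d} \<Longrightarrow> 0 < switch t"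
    by (rule positive_interval[OF cs _ pos s2(2)]) (use s in auto)
  have w: "wave k (\<lambda>_. n2\<^sup>2) c d Y V"
    by (rule high) (use cd s2 in \<open>auto simp: switch_def\<close>)
  have c: "continuous_on {c..d} Y" "continuous_on {c..d} V"
    using cY cV cd s2 by (auto intro: continuous_on_subset)
  have V: "V t = (\<i> * k * of_real n1) * Y t" if "t \<in> {c..d}" for t
    using zz[rule_format, of t] that cd by (simp add: mismatch_def)
  have "(V has_vector_derivative (- k\<^sup>2 * of_real (n2\<^sup>2) * Y c)) (at c within {c..d})"
    by (rule primitive_has_vector_derivative) (use w c cd in \<open>auto simp: wave_def intro!: continuous_intros\<close>)
  moreover have "((\<lambda>t. (\<i> * k * of_real n1) * Y t) has_vector_derivative ((\<i> * k * of_real n1) * V c)) (at c within {c..d})"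
    by (rule primitive_has_vector_derivative[OF primitive_cmult]) (use w c cd in \<open>auto simp: wave_def intro!: continuous_intros\<close>)
  then have "(V has_vector_derivative ((\<i> * k * of_real n1) * V c)) (at c within {c..d})"
    by (rule has_vector_derivative_transform[rotated 2]) (use V cd in auto)
  ultimately have "- k\<^sup>2 * of_real (n2\<^sup>2) * Y c = (\<i> * k * of_real n1) * V c"
    by (rule vector_derivative_unique_within_closed_interval[of c d c, rotated 2, unfolded cbox_interval]) (use cd in auto)
  also have "\<dots> = - k\<^sup>2 * of_real (n1\<^sup>2) * Y c"
    using V[of c] cd(2) by (simp add: power2_eq_square mult_ac)
  finally have "complex_of_real (n2\<^sup>2) = of_real (n1\<^sup>2)" using knz Ynz[rule_format, of c] cd s2 by simp
  then have "n2\<^sup>2 = n1\<^sup>2" by (simp only: of_real_eq_iff)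
  then show False using n1 n12 by simp
qed

text \<open>Were it negative, the medium before arrival would be n1, where the mismatch only changes by a
  nonzero factor and cannot become zero.\<close>
lemma switch_zero_at_arrival:
  assumes zz: "\<forall>s. s2 \<le> s \<longrightarrow> s \<le> sp \<longrightarrow> mismatch s = 0" and s2: "0 < s2" "s2 < sp"
    and arr: "\<And>d. 0 < d \<Longrightarrow> \<exists>s. s2 - d < s \<and> s < s2 \<and> 0 \<le> s \<and> mismatch s \<noteq> 0"
  shows "switch s2 = 0"
proof (rule ccontr)
  assume "switch s2 \<noteq> 0"
  then have neg: "0 < - switch s2" using switch_nonpos_at_rest[OF zz s2 order_refl] s2 by simp
  have cs: "continuous_on {0..s2} (\<lambda>s. - switch s)"
    by (intro continuous_intros continuous_on_subset[OF c_switch]) (use s2 in auto)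
  obtain c d where cd: "0 \<le> c" "c < d" "d \<le> s2" "s2 \<in> {c..d}" "\<And>t. t \<in> {c..d} \<Longrightarrow> 0 < - switch t"
    by (rule positive_interval[OF cs _ neg s2(1)]) (use s2 in auto)
  have d: "d = s2" using cd by simp
  have "switch t < 0" if "t \<in> {c..s2}" for t using cd(5)[of t] that d by simp
  then have w: "wave k (\<lambda>_. n1\<^sup>2) c s2 Y V"
    unfolding switch_def by (intro low) (use cd s2 in auto)
  obtain s where s: "s2 - (s2 - c) < s" "s < s2" "mismatch s \<noteq> 0" using arr[of "s2 - c"] cd d by auto
  have "mismatch s2 = exp (- (\<i> * k * of_real n1) * of_real (s2 - s)) * mismatch s"
    unfolding mismatch_def by (rule homogeneous_amplitudes(1)[OF w]) (use s in auto)
  then show False using zz[rule_format, of s2] s2 s(3) by simp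
qed

text \<open>After arrival the switching function is a negative multiple of an amplified sine. As it stays
  nonpositive, at most half a period fits behind the arrival point.\<close>
lemma rest_is_short:
  assumes zz: "\<forall>s. s2 \<le> s \<longrightarrow> s \<le> sp \<longrightarrow> mismatch s = 0" and s2: "0 < s2" "s2 < sp" and sw: "switch s2 = 0"
  shows "0 < Im (cnj N * (Y s2)\<^sup>2)" "2 * \<alpha> * n1 * (sp - s2) \<le> pi"
proof -
  define \<tau> where "\<tau> = Im (cnj N * (Y s2)\<^sup>2)"
  have i\<tau>: "cnj N * (Y s2)\<^sup>2 = \<i> * of_real \<tau>" using sw by (simp add: switch_def \<tau>_def complex_eq_iff)
  have ik: "\<i> * k = Complex \<beta> \<alpha>" by (simp add: k complex_eq_iff)
  have sgn: "0 \<le> \<tau> * sin (2 * \<alpha> * n1 * u)" if u: "0 \<le> u" "u \<le> sp - s2" for u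
  proof -
    have "Y (s2 + u) = Y s2 * exp (\<i> * k * of_real n1 * of_real u)"
      using rest_formula[OF zz, of "s2 + u"] s2 u by simp
    then have "cnj N * (Y (s2 + u))\<^sup>2 = \<i> * of_real \<tau> * (exp (\<i> * k * of_real n1 * of_real u))\<^sup>2"
      unfolding i\<tau>[symmetric] by (simp add: power_mult_distrib)
    also have "(exp (\<i> * k * of_real n1 * of_real u))\<^sup>2 = exp (Complex (2 * \<beta> * n1 * u) (2 * \<alpha> * n1 * u))"
      unfolding exp_double[symmetric] ik by (rule arg_cong[where f=exp]) (simp add: complex_eq_iff)
    finally have "switch (s2 + u) = - (exp (2 * \<beta> * n1 * u) * (\<tau> * sin (2 * \<alpha> * n1 * u)))"
      by (simp add: switch_def Im_exp)
    then have "0 \<le> exp (2 * \<beta> * n1 * u) * (\<tau> * sin (2 * \<alpha> * n1 * u))"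
      using switch_nonpos_at_rest[OF zz s2, of "s2 + u"] u by simp
    then show ?thesis by (simp only: zero_le_mult_iff exp_ge_zero not_exp_le_zero) simp
  qed
  define L where "L = 2 * \<alpha> * n1 * (sp - s2)"
  have p: "0 < 2 * \<alpha> * n1" using \<alpha> n1 by simp
  have L: "0 < L" using p s2 by (simp add: L_def)
  have sgn': "0 \<le> \<tau> * sin x" if "0 \<le> x" "x \<le> L" for x
  proof -
    have "x / (2 * \<alpha> * n1) \<le> sp - s2" using that p by (simp add: L_def divide_le_eq mult.commute)
    moreover have "2 * \<alpha> * n1 * (x / (2 * \<alpha> * n1)) = x"
      using p by (metis less_irrefl nonzero_mult_div_cancel_left times_divide_eq_right)
    ultimately show ?thesis using sgn[of "x / (2 * \<alpha> * n1)"] that p by simp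
  qed
  have "\<tau> \<noteq> 0" using i\<tau> N Ynz[rule_format, of s2] s2 by auto
  moreover have "0 \<le> \<tau> * sin (min L 1)" using L by (intro sgn') auto
  moreover have "0 < sin (min L 1)" using L pi_gt3 by (intro sin_gt_zero) auto
  ultimately show "0 < Im (cnj N * (Y s2)\<^sup>2)" unfolding \<tau>_def[symmetric] by (simp add: zero_le_mult_iff)
  then have "0 < \<tau>" by (simp add: \<tau>_def)
  show "2 * \<alpha> * n1 * (sp - s2) \<le> pi"
  proof (rule ccontr)
    assume "\<not> ?thesis"
    then have l: "pi < L" by (simp add: L_def)
    define x where "x = min L (4 * pi / 3)"
    have "4 * pi / 3 < 2 * pi" "pi < 4 * pi / 3" using pi_gt_zero by linarith+
    then have x: "pi < x" "x < 2 * pi" "x \<le> L" using l unfolding x_def by linarith+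
    have "sin x < 0" using x by (intro sin_lt_zero) auto
    then show False using sgn'[of x] x pi_gt_zero \<open>0 < \<tau>\<close> by (simp add: zero_le_mult_iff)
  qed
qed

text \<open>The derivative of the switching function at arrival is negative, so it is positive just before. Up
  to its last zero before arrival the medium is n2, and there the explicit profile would give it a
  positive value.\<close>
lemma switch_positive_before:
  assumes zz: "\<forall>s. s2 \<le> s \<longrightarrow> s \<le> sp \<longrightarrow> mismatch s = 0" and s2: "0 < s2" "s2 < sp" and sw: "switch s2 = 0"
    and s: "0 \<le> s" "s2 - T0 < s" "s < s2"
  shows "0 < switch s"
proof (rule ccontr)
  assume neg: "\<not> 0 < switch s"
  define \<tau> where "\<tau> = Im (cnj N * (Y s2)\<^sup>2)"
  have \<tau>: "0 < \<tau>" unfolding \<tau>_def by (rule rest_is_short(1)[OF zz s2 sw])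
  have i\<tau>: "cnj N * (Y s2)\<^sup>2 = \<i> * of_real \<tau>" using sw by (simp add: switch_def \<tau>_def complex_eq_iff)
  have V2: "V s2 = \<i> * k * of_real n1 * Y s2" using zz[rule_format, of s2] s2 by (simp add: mismatch_def)
  have "((\<lambda>s. cnj N * (Y s * Y s)) has_vector_derivative (cnj N * (Y s2 * V s2 + V s2 * Y s2))) (at s2 within {0..sp})"
    by (rule has_vector_derivative_mult_right[OF has_vector_derivative_mult[OF dY dY]]) (use s2 in auto)
  from bounded_linear.has_vector_derivative[OF bounded_linear_Re this]
  have dS: "(switch has_vector_derivative Re (cnj N * (Y s2 * V s2 + V s2 * Y s2))) (at s2 within {0..sp})"
    unfolding switch_def power2_eq_square .
  have "cnj N * (Y s2 * V s2 + V s2 * Y s2) = (cnj N * (Y s2)\<^sup>2) * (2 * \<i> * k * of_real n1)"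
    by (simp add: V2 power2_eq_square algebra_simps)
  then have "Re (cnj N * (Y s2 * V s2 + V s2 * Y s2)) = Re ((\<i> * of_real \<tau>) * (2 * \<i> * k * of_real n1))"
    by (simp only: i\<tau>)
  moreover have "Re ((\<i> * of_real \<tau>) * (2 * \<i> * k * of_real n1)) = - 2 * \<tau> * \<alpha> * n1" by (simp add: k)
  ultimately have "Re (cnj N * (Y s2 * V s2 + V s2 * Y s2)) = - 2 * \<tau> * \<alpha> * n1" by (rule trans)
  from dS[unfolded this] have "(switch has_real_derivative (- 2 * \<tau> * \<alpha> * n1)) (at s2 within {0..sp})"
    by (simp only: has_real_derivative_iff_has_vector_derivative)
  moreover have "- 2 * \<tau> * \<alpha> * n1 < 0" using \<tau> \<alpha> n1 by simp
  ultimately obtain d where d: "d > 0" "\<And>h. h > 0 \<Longrightarrow> s2 - h \<in> {0..sp} \<Longrightarrow> h < d \<Longrightarrow> switch s2 < switch (s2 - h)"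
    using has_real_derivative_neg_dec_left by blast
  have near: "0 < switch t" if "0 \<le> t" "s2 - d < t" "t < s2" for t
    using d(2)[of "s2 - t"] that s2 sw by simp
  define s' where "s' = s2 - min (d / 2) ((s2 - s) / 2)"
  have s': "s < s'" "s' < s2" "s2 - d < s'" using d(1) s by (auto simp: s'_def min_def field_simps)
  define S where "S = {s..s'} \<inter> switch -` {..0}"
  have cS: "continuous_on {s..s'} switch" by (rule continuous_on_subset[OF c_switch]) (use s s' s2 in auto)
  have "closed S" unfolding S_def by (rule continuous_closed_preimage[OF cS]) auto
  moreover have "bounded S" by (rule bounded_subset[OF bounded_closed_interval[of s s']]) (auto simp: S_def)
  ultimately have "compact S" by (simp add: compact_eq_bounded_closed)
  moreover have "s \<in> S" using neg s' by (simp add: S_def)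
  then have "S \<noteq> {}" by blast
  ultimately obtain s3 where s3: "s3 \<in> S" "\<And>t. t \<in> S \<Longrightarrow> t \<le> s3" using compact_attains_sup by meson
  have m3: "s \<le> s3" "s3 \<le> s'" "switch s3 \<le> 0" using s3(1) by (auto simp: S_def)
  have pos: "0 < switch t" if t: "s3 < t" "t < s2" for t
  proof (cases "t \<le> s'")
    case True
    have "t \<notin> S" using s3(2)[of t] t by auto
    then show ?thesis using True t m3 by (simp add: S_def)
  next
    case False
    then show ?thesis using near[of t] t m3 s s' by simp
  qed
  have "wave k (\<lambda>_. n2\<^sup>2) s3 s2 Y V"
  proof (rule wave_closure)
    show "continuous_on {s3..s2} Y" "continuous_on {s3..s2} V"
      using cY cV m3 s s2 by (auto intro: continuous_on_subset)
    fix a b assume ab: "s3 < a" "a < b" "b < s2"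
    show "wave k (\<lambda>_. n2\<^sup>2) a b Y V" by (rule high) (use ab pos m3 s s2 in \<open>auto simp: switch_def\<close>)
  qed (use m3 s' in simp)
  from layer_profile[OF this, of s3] zz[rule_format, of s2] s2 m3 s'
  have "Y s3 = Y s2 * profile (s3 - s2)" by simp
  then have "cnj N * (Y s3)\<^sup>2 = \<i> * of_real \<tau> * (profile (s3 - s2))\<^sup>2"
    unfolding i\<tau>[symmetric] by (simp add: power_mult_distrib)
  then have "switch s3 = - (\<tau> * Im ((profile (s3 - s2))\<^sup>2))" by (simp add: switch_def)
  moreover have "Im ((profile (s3 - s2))\<^sup>2) < 0" by (rule profile_square) (use m3 s s' in auto)
  then have "\<tau> * Im ((profile (s3 - s2))\<^sup>2) < 0" by (rule mult_pos_neg[OF \<tau>])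
  ultimately show False using m3 by simp
qed

text \<open>The layer of medium n2 before arrival cannot be longer than T0, since the profile vanishes at the
  distance T0 and Y has no zeros; it cannot be shorter, since Y vanishes at the start and the profile
  does not. So the limit is the quarter-wave layer, followed by a short stretch of the medium n1.\<close>
lemma quarter_wave_limit:
  shows "T0 \<le> es" "2 * \<alpha> * n1 * (sp - T0) \<le> pi" "wave k (\<lambda>_. n2\<^sup>2) 0 T0 Y V"
    "\<forall>s. T0 \<le> s \<longrightarrow> s \<le> sp \<longrightarrow> Y s = Y T0 * exp (\<i> * k * of_real n1 * of_real (s - T0))"
proof -
  obtain s2 where s2: "0 < s2" "s2 \<le> es" and z: "\<And>s. s2 \<le> s \<Longrightarrow> s \<le> sp \<Longrightarrow> mismatch s = 0"
    and arr: "\<And>d. 0 < d \<Longrightarrow> \<exists>s. s2 - d < s \<and> s < s2 \<and> 0 \<le> s \<and> mismatch s \<noteq> 0"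
    using arrival by blast
  have zz: "\<forall>s. s2 \<le> s \<longrightarrow> s \<le> sp \<longrightarrow> mismatch s = 0" using z by blast
  have lt: "s2 < sp" using s2 es by simp
  have sw: "switch s2 = 0" by (rule switch_zero_at_arrival[OF zz s2(1) lt arr])
  define a where "a = max 0 (s2 - T0)"
  have a: "0 \<le> a" "a < s2" "s2 - T0 \<le> a" using s2 T0_pos by (auto simp: a_def)
  have w: "wave k (\<lambda>_. n2\<^sup>2) a s2 Y V"
  proof (rule wave_closure)
    show "continuous_on {a..s2} Y" "continuous_on {a..s2} V"
      using cY cV a lt by (auto intro: continuous_on_subset)
    fix c d assume cd: "a < c" "c < d" "d < s2"
    have "0 < switch s" if "s \<in> {c..d}" for s
      by (rule switch_positive_before[OF zz s2(1) lt sw]) (use that cd a in auto)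
    then show "wave k (\<lambda>_. n2\<^sup>2) c d Y V" by (intro high) (use cd a lt in \<open>auto simp: switch_def\<close>)
  qed (use a in simp)
  have Ya: "Y a = Y s2 * profile (a - s2)"
    by (rule layer_profile[OF w]) (use zz lt a in auto)
  have Y2: "Y s2 \<noteq> 0" using Ynz[rule_format, of s2] s2 lt by simp
  have "s2 = T0"
  proof (rule linorder_cases[of s2 T0])
    assume l: "s2 < T0"
    then have "a = 0" by (simp add: a_def)
    then have "profile (- s2) = 0" using Ya Y0 Y2 by simp
    then show ?thesis using profile_square[of "- s2"] l s2 by simp
  next
    assume l: "T0 < s2"
    then have "a = s2 - T0" "0 < a" by (auto simp: a_def)
    then have "Y a = 0" using Ya profile_zero by simp
    then show ?thesis using Ynz[rule_format, of a] \<open>0 < a\<close> a lt by simp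
  qed
  then have a0: "a = 0" by (simp add: a_def)
  show "T0 \<le> es" using s2 \<open>s2 = T0\<close> by simp
  show "2 * \<alpha> * n1 * (sp - T0) \<le> pi" using rest_is_short(2)[OF zz s2(1) lt sw] \<open>s2 = T0\<close> by simp
  show "wave k (\<lambda>_. n2\<^sup>2) 0 T0 Y V" using w by (simp only: a0 \<open>s2 = T0\<close>)
  show "\<forall>s. T0 \<le> s \<longrightarrow> s \<le> sp \<longrightarrow> Y s = Y T0 * exp (\<i> * k * of_real n1 * of_real (s - T0))"
    using rest_formula[OF zz] s2(1) unfolding \<open>s2 = T0\<close> by (meson less_imp_le)
qed

text \<open>Relative to n2 the reflection coefficient of the layer turns at a constant rate, and completes the
  half-turn to the real axis only at T0.\<close>
lemma limit_flux_negative: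
  assumes "0 < s" "s < T0" shows "Im (V s * cnj (\<i> * k * Y s)) < 0"
proof -
  let ?c = "\<i> * k * of_real n2"
  define A where "A = V s - ?c * Y s" define B where "B = V s + ?c * Y s"
  note h = homogeneous_amplitudes[OF quarter_wave_limit(3), of 0 s]
  have "A = exp (- ?c * of_real (s - 0)) * (V 0 - ?c * Y 0)" unfolding A_def by (rule h(1)) (use assms in auto)
  then have A: "A = exp (- ?c * of_real s)" by (simp only: Y0 V0 mult_zero_right diff_zero mult_1_right)
  have "B = exp (?c * of_real (s - 0)) * (V 0 + ?c * Y 0)" unfolding B_def by (rule h(2)) (use assms in auto)
  then have B: "B = exp (?c * of_real s)" by (simp only: Y0 V0 mult_zero_right diff_zero add_0_right mult_1_right)
  have AB: "A + B = 2 * V s" "B - A = 2 * (?c * Y s)" by (simp_all add: A_def B_def)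
  have "(A + B) * cnj (B - A) = of_real (4 * n2) * (V s * cnj (\<i> * k * Y s))"
    unfolding AB by (simp add: mult_ac)
  moreover have "Im (of_real a * z) = a * Im z" for a z by simp
  ultimately have 1: "Im ((A + B) * cnj (B - A)) = 4 * n2 * Im (V s * cnj (\<i> * k * Y s))"
    by (simp only:)
  have 2: "Im ((A + B) * cnj (B - A)) = 2 * Im (A * cnj B)"
    by (simp add: algebra_simps)
  have "A * cnj B = exp (Complex 0 (- (2 * \<alpha> * n2 * s)))"
    unfolding A B exp_cnj exp_add[symmetric]
    by (rule arg_cong[where f=exp]) (simp add: complex_eq_iff k)
  then have "Im (A * cnj B) = - sin (2 * \<alpha> * n2 * s)" by (simp only: Im_exp complex.sel exp_zero mult_1 sin_minus)
  then have eq: "4 * n2 * Im (V s * cnj (\<i> * k * Y s)) = - 2 * sin (2 * \<alpha> * n2 * s)"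
    using 1 2 by linarith
  have "2 * \<alpha> * n2 * s < 2 * \<alpha> * n2 * T0" using assms \<alpha> n2 by simp
  also have "\<dots> = pi" using \<alpha> n2 by (simp add: T0_def)
  finally have "0 < sin (2 * \<alpha> * n2 * s)" using assms \<alpha> n2 by (intro sin_gt_zero) auto
  then have "4 * n2 * Im (V s * cnj (\<i> * k * Y s)) < 0" unfolding eq by linarith
  then show ?thesis using n2 by (simp only: mult_less_0_iff) linarith
qed

end

section \<open>Uniform openness of the variations\<close>

lemma uniform_limit_along:
  fixes f :: "nat \<Rightarrow> real \<Rightarrow> complex"
  assumes u: "uniform_limit {a..b} f F sequentially" and F: "continuous_on {a..b} F"
    and s: "\<And>n. s n \<in> {a..b}" "s \<longlonglongrightarrow> l"
  shows "(\<lambda>n. f n (s n)) \<longlonglongrightarrow> F l"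
proof -
  have l: "l \<in> {a..b}" using closed_sequentially[OF closed_atLeastAtMost] s by blast
  have 1: "(\<lambda>n. F (s n)) \<longlonglongrightarrow> F l"
    by (rule continuous_on_tendsto_compose[OF F s(2) l]) (use s(1) in simp)
  have "(\<lambda>n. f n (s n) - F (s n)) \<longlonglongrightarrow> 0"
  proof (rule tendstoI)
    fix e :: real assume "0 < e"
    from uniform_limitD[OF u this] show "\<forall>\<^sub>F n in sequentially. dist (f n (s n) - F (s n)) 0 < e"
      by eventually_elim (use s(1) in \<open>simp add: dist_norm\<close>)
  qed
  from tendsto_add[OF this 1] show ?thesis by simp
qed

text \<open>Waves with bounded spectral parameters and arbitrary admissible coefficients are equicontinuous. The
  coefficients need not converge, so only the first of the two equations is claimed for the limit.\<close>
lemma wave_compactness: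
  fixes y v :: "nat \<Rightarrow> real \<Rightarrow> complex"
  assumes w: "\<And>n. wave (k n) (\<epsilon> n) 0 T (y n) (v n)" and adm: "\<And>n. admissible n1 n2 (\<epsilon> n)"
    and z: "\<And>n. y n 0 = 0" "\<And>n. v n 0 = 1" and K: "\<And>n. cmod (k n) \<le> K" and T: "0 < T"
  obtains r Y V where "strict_mono (r :: nat \<Rightarrow> nat)" "uniform_limit {0..T} (\<lambda>n. y (r n)) Y sequentially"
    "uniform_limit {0..T} (\<lambda>n. v (r n)) V sequentially" "continuous_on {0..T} Y" "continuous_on {0..T} V" "primitive Y V 0 T"
proof -
  define B where "B = exp ((1 + K\<^sup>2 * n2\<^sup>2) * T)"
  define C where "C = K\<^sup>2 * n2\<^sup>2 * B"
  have B: "0 < B" by (simp add: B_def)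
  have C: "0 \<le> C" using B by (simp add: C_def)
  have yb: "cmod (y n s) \<le> B" and vb: "cmod (v n s) \<le> B" if "s \<in> {0..T}" for n s
    unfolding B_def using wave_bound[OF w adm z K, of s n] that by auto
  have py: "primitive (y n) (v n) 0 T" and pv: "primitive (v n) (\<lambda>s. - (k n)\<^sup>2 * of_real (\<epsilon> n s) * y n s) 0 T" for n
    using w[of n] by (auto simp: wave_def)
  have lip: "cmod (y n t - y n s) \<le> B * (t - s) \<and> cmod (v n t - v n s) \<le> C * (t - s)" if st: "0 \<le> s" "s \<le> t" "t \<le> T" for n s t
  proof
    show "cmod (y n t - y n s) \<le> B * (t - s)"
      by (rule primitive_lipschitz_le[OF py st]) (use B vb st in auto)
    show "cmod (v n t - v n s) \<le> C * (t - s)"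
    proof (rule primitive_lipschitz_le[OF pv st C])
      fix r assume r: "r \<in> {s..t}"
      have "(cmod (k n))\<^sup>2 * \<bar>\<epsilon> n r\<bar> \<le> K\<^sup>2 * n2\<^sup>2"
        using admissible_bound[OF adm, of n r] K[of n] by (intro mult_mono power_mono) auto
      then have "(cmod (k n))\<^sup>2 * \<bar>\<epsilon> n r\<bar> * cmod (y n r) \<le> K\<^sup>2 * n2\<^sup>2 * B"
        by (rule mult_mono) (use yb[of r n] r st in auto)
      then show "cmod (- (k n)\<^sup>2 * of_real (\<epsilon> n r) * y n r) \<le> C" by (simp add: norm_mult norm_power C_def)
    qed
  qed
  define F where "F = (\<lambda>n s. (y n s, v n s))"
  have pair: "norm (F n t - F n s) \<le> cmod (y n t - y n s) + cmod (v n t - v n s)" for n s t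
    unfolding F_def using norm_Pair_le[of "y n t - y n s" "v n t - v n s"] by simp
  have lipF: "norm (F n s - F n t) \<le> (B + C) * \<bar>t - s\<bar>" if "s \<in> {0..T}" "t \<in> {0..T}" for n s t
  proof (cases "s \<le> t")
    case True
    have "norm (F n s - F n t) \<le> cmod (y n t - y n s) + cmod (v n t - v n s)" using pair[of n t s] by (simp add: norm_minus_commute)
    also have "\<dots> \<le> B * (t - s) + C * (t - s)" using lip[of s t n] True that by (intro add_mono) auto
    finally show ?thesis using True by (simp add: distrib_right)
  next
    case False
    have "norm (F n s - F n t) \<le> cmod (y n s - y n t) + cmod (v n s - v n t)" using pair[of n s t] by simp
    also have "\<dots> \<le> B * (s - t) + C * (s - t)" using lip[of t s n] False that by (intro add_mono) auto
    finally show ?thesis using False by (simp add: distrib_right)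
  qed
  obtain G r where G: "continuous_on {0..T} G" "strict_mono (r :: nat \<Rightarrow> nat)"
    and lim: "\<And>e. 0 < e \<Longrightarrow> \<exists>N. \<forall>n x. n \<ge> N \<and> x \<in> {0..T} \<longrightarrow> norm (F (r n) x - G x) < e"
  proof (rule Arzela_Ascoli[of "{0..T}" F "B + B"])
    show "norm (F n x) \<le> B + B" if "x \<in> {0..T}" for n x
      using norm_Pair_le[of "y n x" "v n x"] yb[OF that, of n] vb[OF that, of n] by (simp add: F_def)
    fix x e :: real assume x: "x \<in> {0..T}" and e: "0 < e"
    have p: "0 < B + C + 1" using B C by simp
    show "\<exists>d>0. \<forall>n y. y \<in> {0..T} \<and> norm (x - y) < d \<longrightarrow> norm (F n x - F n y) < e"
    proof (intro exI[of _ "e / (B + C + 1)"] conjI allI impI)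
      show "0 < e / (B + C + 1)" using e p by simp
      fix n t assume t: "t \<in> {0..T} \<and> norm (x - t) < e / (B + C + 1)"
      have "norm (F n x - F n t) \<le> (B + C) * \<bar>t - x\<bar>" using lipF x t by blast
      also have "\<dots> \<le> (B + C + 1) * \<bar>t - x\<bar>" by (intro mult_right_mono) auto
      also have "\<bar>t - x\<bar> < e / (B + C + 1)" using t by (simp add: abs_minus_commute)
      then have "(B + C + 1) * \<bar>t - x\<bar> < (B + C + 1) * (e / (B + C + 1))" using p by (rule mult_strict_left_mono)
      also have "\<dots> = e" using p by simp
      finally show "norm (F n x - F n t) < e" .
    qed
  qed (auto intro: that)
  have ul: "uniform_limit {0..T} (\<lambda>n. y (r n)) (\<lambda>s. fst (G s)) sequentially \<and> uniform_limit {0..T} (\<lambda>n. v (r n)) (\<lambda>s. snd (G s)) sequentially"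
    unfolding uniform_limit_sequentially_iff
  proof (intro conjI allI impI)
    fix e :: real assume "0 < e"
    from lim[OF this] obtain N where N: "\<And>n x. n \<ge> N \<Longrightarrow> x \<in> {0..T} \<Longrightarrow> norm (F (r n) x - G x) < e" by blast
    have "dist (y (r n) x) (fst (G x)) < e \<and> dist (v (r n) x) (snd (G x)) < e" if "n \<ge> N" "x \<in> {0..T}" for n x
      using N[OF that] norm_fst_le[of "fst (F (r n) x - G x)" "snd (F (r n) x - G x)"]
        norm_snd_le[where x="fst (F (r n) x - G x)" and y="snd (F (r n) x - G x)"]
      unfolding prod.collapse by (simp add: F_def dist_norm)
    then show "\<exists>N. \<forall>n\<ge>N. \<forall>x\<in>{0..T}. dist (y (r n) x) (fst (G x)) < e" "\<exists>N. \<forall>n\<ge>N. \<forall>x\<in>{0..T}. dist (v (r n) x) (snd (G x)) < e"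
      by blast+
  qed
  show ?thesis
  proof (rule that[OF G(2)])
    show "uniform_limit {0..T} (\<lambda>n. y (r n)) (\<lambda>s. fst (G s)) sequentially"
      "uniform_limit {0..T} (\<lambda>n. v (r n)) (\<lambda>s. snd (G s)) sequentially" using ul by auto
    show "continuous_on {0..T} (\<lambda>s. fst (G s))" "continuous_on {0..T} (\<lambda>s. snd (G s))"
      by (intro continuous_intros G(1))+
    show "primitive (\<lambda>s. fst (G s)) (\<lambda>s. snd (G s)) 0 T"
      by (rule primitive_uniform_limit[OF py tendsto_uniform_limitI[OF conjunct1[OF ul]] conjunct2[OF ul]])
  qed
qed

lemma convex_reachable_variations:
  assumes adm: "admissible n1 n2 \<epsilon>" and y: "continuous_on {0..sp} y"
  shows "convex (reachable_variations n1 n2 sp \<epsilon> y)"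
proof (rule convexI)
  fix p q and u t :: real
  assume p: "p \<in> reachable_variations n1 n2 sp \<epsilon> y" and q: "q \<in> reachable_variations n1 n2 sp \<epsilon> y"
    and ut: "0 \<le> u" "0 \<le> t" "u + t = 1"
  obtain f g where f: "admissible n1 n2 f" "p = integral {0..sp} (\<lambda>s. of_real (f s - \<epsilon> s) * (y s)\<^sup>2)"
    and g: "admissible n1 n2 g" "q = integral {0..sp} (\<lambda>s. of_real (g s - \<epsilon> s) * (y s)\<^sup>2)"
    using p q unfolding reachable_variations_def by auto
  define h where "h = (\<lambda>s. u * f s + t * g s)"
  have h: "admissible n1 n2 h"
    unfolding admissible_def
  proof (intro conjI allI)
    show "h \<in> borel_measurable borel" using f(1) g(1) unfolding h_def admissible_def
      by (intro borel_measurable_add borel_measurable_times borel_measurable_const) auto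
    fix s
    have "u * n1\<^sup>2 + t * n1\<^sup>2 \<le> h s" "h s \<le> u * n2\<^sup>2 + t * n2\<^sup>2"
      unfolding h_def using f(1) g(1) ut unfolding admissible_def by (auto intro!: add_mono mult_left_mono)
    then show "n1\<^sup>2 \<le> h s" "h s \<le> n2\<^sup>2" using ut by (simp_all flip: distrib_right)
  qed
  have c: "continuous_on {0..sp} (\<lambda>s. (y s)\<^sup>2)" by (intro continuous_intros y)
  note int = variation_integrable[OF adm f(1) c] variation_integrable[OF adm g(1) c]
  have "((\<lambda>s. u *\<^sub>R (of_real (f s - \<epsilon> s) * (y s)\<^sup>2) + t *\<^sub>R (of_real (g s - \<epsilon> s) * (y s)\<^sup>2)) has_integral u *\<^sub>R p + t *\<^sub>R q) {0..sp}"
    unfolding f(2) g(2) by (intro has_integral_add has_integral_cmul integrable_integral int)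
  moreover have "u *\<^sub>R (of_real (f s - \<epsilon> s) * (y s)\<^sup>2) + t *\<^sub>R (of_real (g s - \<epsilon> s) * (y s)\<^sup>2) = of_real (h s - \<epsilon> s) * (y s)\<^sup>2" for s
  proof -
    have "h s - \<epsilon> s = u * (f s - \<epsilon> s) + t * (g s - \<epsilon> s) + (u + t - 1) * \<epsilon> s" by (simp add: h_def algebra_simps)
    then have "h s - \<epsilon> s = u * (f s - \<epsilon> s) + t * (g s - \<epsilon> s)" using ut by simp
    then show ?thesis by (simp only: of_real_add of_real_mult scaleR_conv_of_real distrib_right mult.assoc)
  qed
  ultimately have "integral {0..sp} (\<lambda>s. of_real (h s - \<epsilon> s) * (y s)\<^sup>2) = u *\<^sub>R p + t *\<^sub>R q" by (simp add: integral_unique)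
  then have "u *\<^sub>R p + t *\<^sub>R q = integral {0..sp} (\<lambda>s. of_real (h s - \<epsilon> s) * (y s)\<^sup>2) \<and> admissible n1 n2 h"
    using h by (simp only:)
  then show "u *\<^sub>R p + t *\<^sub>R q \<in> reachable_variations n1 n2 sp \<epsilon> y"
    unfolding reachable_variations_def by blast
qed

text \<open>A line separates the missed point from the convex set of variations.\<close>
lemma missed_direction:
  assumes adm: "admissible n1 n2 \<epsilon>" and y: "continuous_on {0..sp} y" and w: "w \<notin> reachable_variations n1 n2 sp \<epsilon> y"
  obtains N where "cmod N = 1"
    "\<And>\<eta>. admissible n1 n2 \<eta> \<Longrightarrow> Re (cnj N * integral {0..sp} (\<lambda>s. of_real (\<eta> s - \<epsilon> s) * (y s)\<^sup>2)) \<le> cmod w"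
proof -
  have "convex ((\<lambda>x. w + x) ` (uminus ` reachable_variations n1 n2 sp \<epsilon> y))"
    by (intro convex_translation convex_negations convex_reachable_variations[OF adm y])
  then have cv: "convex ((\<lambda>z. w - z) ` reachable_variations n1 n2 sp \<epsilon> y)" by (simp add: image_image)
  have nz: "0 \<notin> (\<lambda>z. w - z) ` reachable_variations n1 n2 sp \<epsilon> y" using w by auto
  obtain a where a0: "a \<noteq> 0" and a1: "\<forall>x\<in>(\<lambda>z. w - z) ` reachable_variations n1 n2 sp \<epsilon> y. 0 \<le> inner a x"
    using separating_hyperplane_set_0[OF cv nz] by (elim exE conjE) blast
  have a: "0 \<le> inner a (w - z)" if "z \<in> reachable_variations n1 n2 sp \<epsilon> y" for z
    using a1 that by (simp only: ball_simps)
  define N where "N = a / of_real (cmod a)"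
  have inn: "Re (cnj N * z) = inner a z / cmod a" for z
    by (simp add: N_def inner_complex_def add_divide_distrib)
  have N: "cmod N = 1" using a0 by (simp add: N_def norm_divide)
  show ?thesis
  proof (rule that[OF N])
    fix \<eta> assume "admissible n1 n2 \<eta>"
    then have "integral {0..sp} (\<lambda>s. of_real (\<eta> s - \<epsilon> s) * (y s)\<^sup>2) \<in> reachable_variations n1 n2 sp \<epsilon> y" (is "?I \<in> _")
      unfolding reachable_variations_def by blast
    from a[OF this] have "inner a ?I \<le> inner a w" by (simp add: inner_diff_right)
    then have "Re (cnj N * ?I) \<le> Re (cnj N * w)" unfolding inn by (rule divide_right_mono) simp
    also have "\<dots> \<le> cmod (cnj N * w)" by (rule complex_Re_le_cmod)
    finally show "Re (cnj N * ?I) \<le> cmod w" by (simp add: norm_mult N)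
  qed
qed

text \<open>Data of a sequence of structures with arguments strictly above the critical ray, all of them at rest
  in the target from the position es on, whose first variations are bounded in the direction Ns n by
  ds n, which tends to 0.\<close>
locale degenerating =
  fixes n1 n2 sp es \<alpha> \<beta> :: real and k N :: complex and Y V :: "real \<Rightarrow> complex"
    and ks Ns :: "nat \<Rightarrow> complex" and eps :: "nat \<Rightarrow> real \<Rightarrow> real" and ys vs :: "nat \<Rightarrow> real \<Rightarrow> complex" and ds :: "nat \<Rightarrow> real"
  assumes n1: "0 < n1" and n12: "n1 < n2" and \<alpha>: "0 < \<alpha>" and \<beta>: "0 < \<beta>" and k: "k = Complex \<alpha> (- \<beta>)"
    and ratio: "\<beta> * pi = \<alpha> * ln ((n2 + n1) / (n2 - n1))" and es: "0 < es" "es < sp"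
    and ks: "ks \<longlonglongrightarrow> k" and Ns: "Ns \<longlonglongrightarrow> N" "N \<noteq> 0" and ds: "ds \<longlonglongrightarrow> 0"
    and lower: "\<And>n. 0 < Re (ks n)" "\<And>n. Im (ks n) < 0"
    and steep: "\<And>n. - Im (ks n) * pi < Re (ks n) * ln ((n2 + n1) / (n2 - n1))"
    and adm: "\<And>n. admissible n1 n2 (eps n)" and w: "\<And>n. wave (ks n) (eps n) 0 sp (ys n) (vs n)"
    and z: "\<And>n. ys n 0 = 0" "\<And>n. vs n 0 = 1"
    and rest: "\<And>n s. es \<le> s \<Longrightarrow> s \<le> sp \<Longrightarrow> vs n s = \<i> * ks n * of_real n1 * ys n s"
    and sep: "\<And>n \<eta>. admissible n1 n2 \<eta> \<Longrightarrow> Re (cnj (Ns n) * integral {0..sp} (\<lambda>s. of_real (\<eta> s - eps n s) * (ys n s)\<^sup>2)) \<le> ds n"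
    and ul: "uniform_limit {0..sp} ys Y sequentially" "uniform_limit {0..sp} vs V sequentially"
    and cY: "continuous_on {0..sp} Y" and cV: "continuous_on {0..sp} V" and PY: "primitive Y V 0 sp"
begin

lemma sp: "0 < sp" using es by simp

lemma is_mode: "mode n1 n2 (Re (ks n)) (- Im (ks n)) sp (ks n) (eps n) (ys n) (vs n)"
  by (rule mode_of_wave[OF n1 n12 lower sp adm w]) (auto simp: z)

lemma lim_y: "s \<in> {0..sp} \<Longrightarrow> (\<lambda>n. ys n s) \<longlonglongrightarrow> Y s" by (rule tendsto_uniform_limitI[OF ul(1)])
lemma lim_v: "s \<in> {0..sp} \<Longrightarrow> (\<lambda>n. vs n s) \<longlonglongrightarrow> V s" by (rule tendsto_uniform_limitI[OF ul(2)])

lemma limit_start: "Y 0 = 0" "V 0 = 1"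
  using lim_y[of 0] lim_v[of 0] sp by (auto simp: z LIMSEQ_const_iff)

lemma limit_rest:
  assumes "es \<le> s" "s \<le> sp" shows "V s = \<i> * k * of_real n1 * Y s"
proof -
  have s: "s \<in> {0..sp}" using assms es by auto
  have "(\<lambda>n. \<i> * ks n * of_real n1 * ys n s) \<longlonglongrightarrow> \<i> * k * of_real n1 * Y s"
    by (intro tendsto_intros ks lim_y[OF s])
  moreover have "(\<lambda>n. vs n s) = (\<lambda>n. \<i> * ks n * of_real n1 * ys n s)" using rest assms by auto
  ultimately show ?thesis using lim_v[OF s] by (metis LIMSEQ_unique)
qed

text \<open>The lower bound for the real part of the flux passes to the limit.\<close>
lemma limit_nonzero:
  assumes s: "0 < s" "s \<le> sp" shows "Y s \<noteq> 0"
proof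
  assume Y: "Y s = 0"
  obtain d where d: "d > 0" "\<And>u. u \<in> {0..sp} \<Longrightarrow> dist u 0 < d \<Longrightarrow> dist (V u) (V 0) < 1 / 4"
    using cV[unfolded continuous_on_iff, rule_format, of 0 "1 / 4"] sp by auto
  define t0 where "t0 = min sp (d / 2)"
  have t0: "0 < t0" "t0 \<le> sp" "t0 < d" using d sp by (auto simp: t0_def)
  have "\<forall>\<^sub>F n in sequentially. \<beta> / 2 < - Im (ks n)"
    using order_tendstoD(1)[OF tendsto_minus[OF tendsto_Im[OF ks]], of "\<beta> / 2"] \<beta> by (simp add: k)
  then have "\<forall>\<^sub>F n in sequentially. \<beta> / 8 * min s t0 \<le> Re (vs n s * cnj (\<i> * ks n * ys n s))"
    using uniform_limitD[OF ul(2), of "1 / 4", simplified]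
  proof eventually_elim
    case (elim n)
    interpret mode n1 n2 "Re (ks n)" "- Im (ks n)" sp "ks n" "eps n" "ys n" "vs n" by (rule is_mode)
    have "1 / 2 \<le> cmod (vs n u)" if u: "0 \<le> u" "u \<le> t0" "u \<le> sp" for u
    proof -
      have "dist (vs n u) (V u) < 1 / 4" using elim(2) u by auto
      moreover have "dist (V u) 1 < 1 / 4" using d(2)[of u] u t0 limit_start by simp
      ultimately have "dist (vs n u) 1 < 1 / 2" using dist_triangle[of "vs n u" 1 "V u"] by simp
      then show ?thesis using norm_triangle_ineq2[of 1 "1 - vs n u"] by (simp add: dist_norm norm_minus_commute)
    qed
    then have "- Im (ks n) / 4 * min s t0 \<le> Re (flux s)"
      using s t0 by (intro Re_flux_lower) auto
    moreover have "\<beta> / 8 * min s t0 \<le> - Im (ks n) / 4 * min s t0"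
      using elim(1) s t0 by (intro mult_right_mono) auto
    ultimately show ?case by (simp add: flux_def)
  qed
  moreover have "(\<lambda>n. Re (vs n s * cnj (\<i> * ks n * ys n s))) \<longlonglongrightarrow> Re (V s * cnj (\<i> * k * Y s))"
    by (intro tendsto_intros ks lim_y lim_v) (use s in auto)
  ultimately have "\<beta> / 8 * min s t0 \<le> Re (V s * cnj (\<i> * k * Y s))"
    using tendsto_lowerbound by (metis trivial_limit_sequentially)
  moreover have "0 < \<beta> / 8 * min s t0" using \<beta> s t0 by simp
  ultimately show False using Y by simp
qed

lemma uniform_bounds:
  obtains B K where "0 < B" "0 < K" "\<And>n s. s \<in> {0..sp} \<Longrightarrow> cmod (ys n s) \<le> B" "\<And>n. cmod (ks n) \<le> K"
proof -
  obtain K where K: "K > 0" "\<And>n. cmod (ks n) \<le> K"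
    using convergent_imp_Bseq[of ks] ks by (auto simp: convergent_def Bseq_def)
  show ?thesis
    by (rule that[of "exp ((1 + K\<^sup>2 * n2\<^sup>2) * sp)" K]) (use K wave_bound(1)[OF w adm z K(2)] in auto)
qed

lemma py: "primitive (ys n) (vs n) 0 sp" and pv: "primitive (vs n) (\<lambda>s. - (ks n)\<^sup>2 * of_real (eps n s) * ys n s) 0 sp"
  using w[of n] by (auto simp: wave_def)

text \<open>Where the limiting switching function keeps one sign, replacing the coefficient by the extreme value
  m is an admissible change whose effect is small; hence the coefficient converges to that value in
  mean.\<close>
lemma saturation:
  fixes e m :: real
  assumes cd: "0 \<le> c" "c < d" "d \<le> sp" and e: "\<bar>e\<bar> = 1" and m: "n1\<^sup>2 \<le> m\<^sup>2" "m\<^sup>2 \<le> n2\<^sup>2"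
    and side: "\<And>n s. 0 \<le> e * (m\<^sup>2 - eps n s)"
    and pos: "\<forall>s\<in>{c..d}. 0 < e * Re (cnj N * (Y s)\<^sup>2)"
  obtains C where "0 < C" "\<forall>\<^sub>F n in sequentially. integral {c..d} (\<lambda>s. e * (m\<^sup>2 - eps n s)) \<le> C * ds n"
proof -
  let ?\<sigma> = "\<lambda>s. e * Re (cnj N * (Y s)\<^sup>2)"
  have sub: "{c..d} \<subseteq> {0..sp}" using cd by auto
  have "continuous_on {c..d} ?\<sigma>" by (intro continuous_intros continuous_on_subset[OF cY sub])
  then obtain s0 where s0: "s0 \<in> {c..d}" "\<And>s. s \<in> {c..d} \<Longrightarrow> ?\<sigma> s0 \<le> ?\<sigma> s"
    using continuous_attains_inf[of "{c..d}" ?\<sigma>] cd by auto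
  define \<delta> where "\<delta> = ?\<sigma> s0 / 2"
  have \<delta>: "0 < \<delta>" using pos s0 by (simp add: \<delta>_def)
  have bY: "bounded (Y ` {c..d})"
    by (intro compact_imp_bounded compact_continuous_image continuous_on_subset[OF cY sub]) auto
  have "uniform_limit {c..d} (\<lambda>n s. cnj (Ns n) * (ys n s * ys n s)) (\<lambda>s. cnj N * (Y s * Y s)) sequentially"
  proof (intro uniform_lim_mult)
    show "uniform_limit {c..d} (\<lambda>n s. cnj (Ns n)) (\<lambda>s. cnj N) sequentially"
      using tendsto_cnj[OF Ns(1)] by (simp add: uniform_limit_sequentially_iff tendsto_iff eventually_sequentially) blast
    show u: "uniform_limit {c..d} ys Y sequentially" by (rule uniform_limit_on_subset[OF ul(1) sub])
    then show "uniform_limit {c..d} ys Y sequentially" .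
    show "bounded ((\<lambda>s. cnj N) ` {c..d})" by (rule bounded_subset[of "{cnj N}"]) auto
    show "bounded ((\<lambda>s. Y s * Y s) ` {c..d})"
      by (intro compact_imp_bounded compact_continuous_image continuous_intros continuous_on_subset[OF cY sub]) auto
  qed (rule bY)+
  from uniform_limitD[OF this \<delta>]
  have "\<forall>\<^sub>F n in sequentially. integral {c..d} (\<lambda>s. e * (m\<^sup>2 - eps n s)) \<le> (1 / \<delta>) * ds n"
  proof eventually_elim
    case (elim n)
    have low: "\<delta> \<le> e * Re (cnj (Ns n) * (ys n s)\<^sup>2)" if s: "s \<in> {c..d}" for s
    proof -
      define R where "R = Re (cnj (Ns n) * (ys n s)\<^sup>2)"
      define R' where "R' = Re (cnj N * (Y s)\<^sup>2)"
      have "cmod (cnj (Ns n) * (ys n s)\<^sup>2 - cnj N * (Y s)\<^sup>2) < \<delta>"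
        using bspec[OF elim s] by (simp only: dist_norm power2_eq_square)
      then have "\<bar>Re (cnj (Ns n) * (ys n s)\<^sup>2 - cnj N * (Y s)\<^sup>2)\<bar> < \<delta>"
        by (rule le_less_trans[OF abs_Re_le_cmod])
      then have "\<bar>R - R'\<bar> < \<delta>" by (simp only: minus_complex.sel R_def R'_def)
      then have "\<bar>e * R - e * R'\<bar> < \<delta>" by (simp only: right_diff_distrib[symmetric] abs_mult e mult_1)
      moreover have "2 * \<delta> \<le> e * R'" using s0(2)[OF s] by (simp add: \<delta>_def R'_def)
      ultimately show ?thesis unfolding R_def[symmetric] by linarith
    qed
    \<comment> \<open>the change is confined to the interval, so the sign of the switching function elsewhere does not matter\<close>
    define \<eta> where "\<eta> = (\<lambda>s. if s \<in> {c..d} then m\<^sup>2 else eps n s)"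
    have \<eta>: "admissible n1 n2 \<eta>"
      unfolding admissible_def \<eta>_def
    proof (intro conjI allI)
      show "(\<lambda>s. if s \<in> {c..d} then m\<^sup>2 else eps n s) \<in> borel_measurable borel"
        using adm[of n] by (intro measurable_If) (auto simp: admissible_def)
    qed (use m adm[of n] in \<open>auto simp: admissible_def\<close>)
    have cy: "continuous_on {c..d} (\<lambda>s. (ys n s)\<^sup>2)"
      by (intro continuous_intros continuous_on_subset[OF primitive_continuous[OF py] sub])
    have cm: "admissible n1 n2 (\<lambda>_. m\<^sup>2)" using m by (simp add: admissible_def)
    have "integral {0..sp} (\<lambda>s. of_real (\<eta> s - eps n s) * (ys n s)\<^sup>2)
      = integral {0..sp} (\<lambda>s. if s \<in> {c..d} then of_real (m\<^sup>2 - eps n s) * (ys n s)\<^sup>2 else 0)"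
      by (intro arg_cong[where f="integral _"]) (auto simp: \<eta>_def fun_eq_iff)
    also have "\<dots> = integral {c..d} (\<lambda>s. of_real (m\<^sup>2 - eps n s) * (ys n s)\<^sup>2)"
      unfolding integral_restrict_Int using sub by (simp only: Int_absorb2)
    finally have h1: "Re (cnj (Ns n) * integral {c..d} (\<lambda>s. of_real (m\<^sup>2 - eps n s) * (ys n s)\<^sup>2)) \<le> ds n"
      using sep[OF \<eta>, of n] by simp
    have h2: "((\<lambda>s. Re (cnj (Ns n) * (of_real (m\<^sup>2 - eps n s) * (ys n s)\<^sup>2))) has_integral
        Re (cnj (Ns n) * integral {c..d} (\<lambda>s. of_real (m\<^sup>2 - eps n s) * (ys n s)\<^sup>2))) {c..d}"
      by (intro has_integral_Re has_integral_mult_right integrable_integral variation_integrable[OF adm cm cy])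
    have i1: "(\<lambda>s. e * (m\<^sup>2 - eps n s)) integrable_on {c..d}"
      using integrable_linear[OF variation_integrable[OF adm[of n] cm continuous_on_const[of _ 1]] bounded_linear_Re, of c d]
      by (intro integrable_on_mult_right) (simp add: o_def)
    then have h3: "((\<lambda>s. \<delta> * (e * (m\<^sup>2 - eps n s))) has_integral \<delta> * integral {c..d} (\<lambda>s. e * (m\<^sup>2 - eps n s))) {c..d}"
      by (intro has_integral_mult_right integrable_integral)
    have re: "Re (of_real a * z) = a * Re z" for a z by simp
    have "\<delta> * integral {c..d} (\<lambda>s. e * (m\<^sup>2 - eps n s)) \<le> Re (cnj (Ns n) * integral {c..d} (\<lambda>s. of_real (m\<^sup>2 - eps n s) * (ys n s)\<^sup>2))"
    proof (rule has_integral_le[OF h3 h2])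
      fix s assume s: "s \<in> {c..d}"
      have "(e * (m\<^sup>2 - eps n s)) * \<delta> \<le> (e * (m\<^sup>2 - eps n s)) * (e * Re (cnj (Ns n) * (ys n s)\<^sup>2))"
        by (rule mult_left_mono[OF low[OF s] side])
      also have "\<dots> = (e * e) * ((m\<^sup>2 - eps n s) * Re (cnj (Ns n) * (ys n s)\<^sup>2))" by (simp only: mult_ac)
      also have "e * e = 1" using e by (auto simp: abs_if split: if_splits)
      also have "1 * ((m\<^sup>2 - eps n s) * Re (cnj (Ns n) * (ys n s)\<^sup>2)) = Re (of_real (m\<^sup>2 - eps n s) * (cnj (Ns n) * (ys n s)\<^sup>2))"
        by (simp only: re mult_1)
      also have "of_real (m\<^sup>2 - eps n s) * (cnj (Ns n) * (ys n s)\<^sup>2) = cnj (Ns n) * (of_real (m\<^sup>2 - eps n s) * (ys n s)\<^sup>2)" by (simp only: mult_ac)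
      finally show "\<delta> * (e * (m\<^sup>2 - eps n s)) \<le> Re (cnj (Ns n) * (of_real (m\<^sup>2 - eps n s) * (ys n s)\<^sup>2))"
        by (simp only: mult.commute)
    qed
    from order_trans[OF this h1] show ?case using \<delta> by (simp add: pos_le_divide_eq mult.commute)
  qed
  then show ?thesis using that[of "1 / \<delta>"] \<delta> by simp
qed

lemma saturated_wave:
  fixes e m :: real
  assumes cd: "0 \<le> c" "c < d" "d \<le> sp" and e: "\<bar>e\<bar> = 1" and m: "n1\<^sup>2 \<le> m\<^sup>2" "m\<^sup>2 \<le> n2\<^sup>2"
    and side: "\<And>n s. 0 \<le> e * (m\<^sup>2 - eps n s)"
    and pos: "\<forall>s\<in>{c..d}. 0 < e * Re (cnj N * (Y s)\<^sup>2)"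
  shows "wave k (\<lambda>_. m\<^sup>2) c d Y V"
proof -
  obtain C where C: "0 < C" "\<forall>\<^sub>F n in sequentially. integral {c..d} (\<lambda>s. e * (m\<^sup>2 - eps n s)) \<le> C * ds n"
    using saturation[OF cd e m side pos] by blast
  obtain B K where BK: "0 < B" "0 < K" "\<And>n s. s \<in> {0..sp} \<Longrightarrow> cmod (ys n s) \<le> B" "\<And>n. cmod (ks n) \<le> K"
    using uniform_bounds by blast
  have cm: "admissible n1 n2 (\<lambda>_. m\<^sup>2)" using m by (simp add: admissible_def)
  have i1: "(\<lambda>s. e * (m\<^sup>2 - eps n s)) integrable_on {s..t}" for n s t
    using integrable_linear[OF variation_integrable[OF adm[of n] cm continuous_on_const[of _ 1]] bounded_linear_Re, of s t]
    by (intro integrable_on_mult_right) (simp add: o_def)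
  have inc: "((\<lambda>r. - k\<^sup>2 * of_real (m\<^sup>2) * Y r) has_integral V t - V s) {s..t}" if st: "c \<le> s" "s \<le> t" "t \<le> d" for s t
  proof -
    have sub: "{s..t} \<subseteq> {0..sp}" using st cd by auto
    have cy: "continuous_on {s..t} (ys n)" for n by (rule continuous_on_subset[OF primitive_continuous[OF py] sub])
    obtain I J where I: "\<And>n. (ys n has_integral I n) {s..t}" and J: "(Y has_integral J) {s..t}" and IJ: "I \<longlonglongrightarrow> J"
      using uniform_limit_integral[OF uniform_limit_on_subset[OF ul(1) sub] cy trivial_limit_sequentially] by blast
    have diff: "cmod (vs n t - vs n s - (- (ks n)\<^sup>2 * of_real (m\<^sup>2) * I n)) \<le> K\<^sup>2 * B * integral {c..d} (\<lambda>s. e * (m\<^sup>2 - eps n s))" for n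
    proof -
      have h: "((\<lambda>r. - (ks n)\<^sup>2 * of_real (eps n r) * ys n r - (- (ks n)\<^sup>2 * of_real (m\<^sup>2) * ys n r)) has_integral
          vs n t - vs n s - (- (ks n)\<^sup>2 * of_real (m\<^sup>2) * I n)) {s..t}"
        by (intro has_integral_diff has_integral_mult_right I primitiveD(1)[OF pv]) (use st cd in auto)
      have "cmod (integral {s..t} (\<lambda>r. - (ks n)\<^sup>2 * of_real (eps n r) * ys n r - (- (ks n)\<^sup>2 * of_real (m\<^sup>2) * ys n r)))
         \<le> integral {s..t} (\<lambda>r. K\<^sup>2 * B * (e * (m\<^sup>2 - eps n r)))"
      proof (rule integral_norm_bound_integral)
        show "(\<lambda>r. K\<^sup>2 * B * (e * (m\<^sup>2 - eps n r))) integrable_on {s..t}" by (intro integrable_on_mult_right i1)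
        fix r assume r: "r \<in> {s..t}"
        have "\<bar>m\<^sup>2 - eps n r\<bar> = e * (m\<^sup>2 - eps n r)" using side[of n r] e by (metis abs_mult abs_of_nonneg mult_1)
        moreover have "- (ks n)\<^sup>2 * of_real (eps n r) * ys n r - (- (ks n)\<^sup>2 * of_real (m\<^sup>2) * ys n r) = (ks n)\<^sup>2 * ys n r * of_real (m\<^sup>2 - eps n r)"
          by (simp add: algebra_simps)
        ultimately have "cmod (- (ks n)\<^sup>2 * of_real (eps n r) * ys n r - (- (ks n)\<^sup>2 * of_real (m\<^sup>2) * ys n r)) = ((cmod (ks n))\<^sup>2 * cmod (ys n r)) * (e * (m\<^sup>2 - eps n r))"
          by (simp only: norm_mult norm_power norm_of_real)
        also have "\<dots> \<le> (K\<^sup>2 * B) * (e * (m\<^sup>2 - eps n r))"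
          using BK(3)[of r n] BK(4)[of n] r sub by (intro mult_right_mono mult_mono power_mono side) auto
        finally show "cmod (- (ks n)\<^sup>2 * of_real (eps n r) * ys n r - (- (ks n)\<^sup>2 * of_real (m\<^sup>2) * ys n r)) \<le> K\<^sup>2 * B * (e * (m\<^sup>2 - eps n r))" .
      qed (use h in blast)
      also have "\<dots> = K\<^sup>2 * B * integral {s..t} (\<lambda>r. e * (m\<^sup>2 - eps n r))" by (rule integral_mult_right)
      also have "\<dots> \<le> K\<^sup>2 * B * integral {c..d} (\<lambda>r. e * (m\<^sup>2 - eps n r))"
        using BK st by (intro mult_left_mono integral_subset_le i1) (auto intro: side)
      finally show ?thesis by (simp only: integral_unique[OF h])
    qed
    have "(\<lambda>n. vs n t - vs n s - (- (ks n)\<^sup>2 * of_real (m\<^sup>2) * I n)) \<longlonglongrightarrow> 0"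
    proof (rule Lim_null_comparison)
      show "\<forall>\<^sub>F n in sequentially. cmod (vs n t - vs n s - (- (ks n)\<^sup>2 * of_real (m\<^sup>2) * I n)) \<le> K\<^sup>2 * B * (C * ds n)"
        using C(2)
      proof eventually_elim
        case (elim n)
        then have "K\<^sup>2 * B * integral {c..d} (\<lambda>s. e * (m\<^sup>2 - eps n s)) \<le> K\<^sup>2 * B * (C * ds n)"
          using BK by (intro mult_left_mono) auto
        then show ?case using diff[of n] by linarith
      qed
      have "(\<lambda>n. K\<^sup>2 * B * (C * ds n)) \<longlonglongrightarrow> K\<^sup>2 * B * (C * 0)" by (intro tendsto_intros ds)
      then show "(\<lambda>n. K\<^sup>2 * B * (C * ds n)) \<longlonglongrightarrow> 0" by simp
    qed
    moreover have "(\<lambda>n. vs n t - vs n s - (- (ks n)\<^sup>2 * of_real (m\<^sup>2) * I n)) \<longlonglongrightarrow> V t - V s - (- k\<^sup>2 * of_real (m\<^sup>2) * J)"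
      by (intro tendsto_intros ks IJ lim_v) (use st cd in auto)
    ultimately have "V t - V s - (- k\<^sup>2 * of_real (m\<^sup>2) * J) = 0" by (rule LIMSEQ_unique[symmetric])
    then have "V t - V s = - k\<^sup>2 * of_real (m\<^sup>2) * J" by (simp only: right_minus_eq)
    then show ?thesis using has_integral_mult_right[OF J] by (simp only:)
  qed
  have c: "continuous_on {c..d} (\<lambda>s. - k\<^sup>2 * of_real (m\<^sup>2) * Y s)"
    by (intro continuous_intros continuous_on_subset[OF cY]) (use cd in auto)
  show ?thesis
    unfolding wave_def
  proof
    show "primitive Y V c d" by (rule primitive_subset[OF PY]) (use cd in auto)
    show "primitive V (\<lambda>s. - k\<^sup>2 * of_real (m\<^sup>2) * Y s) c d"
      unfolding primitive_def using inc continuous_bounded_measurable[OF c] by auto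
  qed
qed

sublocale limit: degenerate_limit n1 n2 sp es \<alpha> \<beta> k N Y V
proof unfold_locales
  have nn: "n1\<^sup>2 \<le> n2\<^sup>2" using n1 n12 by (intro power_mono) auto
  fix c d assume cd: "0 \<le> c" "c < d" "d \<le> sp"
  show "wave k (\<lambda>_. n2\<^sup>2) c d Y V" if "\<And>s. s \<in> {c..d} \<Longrightarrow> 0 < Re (cnj N * (Y s)\<^sup>2)"
    by (rule saturated_wave[OF cd, of 1]) (use nn adm that in \<open>auto simp: admissible_def\<close>)
  show "wave k (\<lambda>_. n1\<^sup>2) c d Y V" if "\<And>s. s \<in> {c..d} \<Longrightarrow> Re (cnj N * (Y s)\<^sup>2) < 0"
  proof (rule saturated_wave[OF cd, of "- 1"])
    show "\<forall>s\<in>{c..d}. 0 < - 1 * Re (cnj N * (Y s)\<^sup>2)"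
      using that by (simp only: mult_minus1 neg_0_less_iff_less) blast
  qed (use nn adm in \<open>auto simp: admissible_def\<close>)
qed (use n1 n12 \<alpha> \<beta> k ratio es PY cV limit_start limit_nonzero limit_rest Ns in auto)

end

context degenerating begin

text \<open>An angle for cone_obstruction that is smaller than the angle by which the pushes turn on the final
  piece.\<close>
lemma phase_choice:
  obtains \<omega> where "0 < \<omega>" "\<omega> \<le> \<alpha> * n1 * (sp - es)" "\<beta> * sin \<omega> < \<alpha> * cos \<omega>" "0 < sin \<omega>"
proof -
  define a where "a = arctan (\<alpha> / \<beta>)"
  have a: "0 < a" "a < pi / 2" using \<alpha> \<beta> arctan_bounded[of "\<alpha> / \<beta>"] by (auto simp: a_def zero_less_arctan_iff)
  have m: "0 < \<alpha> * n1 * (sp - es)" using \<alpha> n1 es by simp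
  define \<omega> where "\<omega> = min (a / 2) (\<alpha> * n1 * (sp - es))"
  have \<omega>: "0 < \<omega>" "\<omega> < a" using a m by (auto simp: \<omega>_def)
  have c: "0 < cos \<omega>" using \<omega> a by (intro cos_gt_zero) auto
  have "tan \<omega> < tan a" using \<omega> a by (intro tan_monotone) auto
  then have "sin \<omega> / cos \<omega> < \<alpha> / \<beta>" unfolding a_def tan_arctan by (simp only: tan_def)
  then have "\<beta> * sin \<omega> < \<alpha> * cos \<omega>" using c \<beta> by (simp add: divide_less_eq less_divide_eq mult.commute)
  moreover have "0 < sin \<omega>" using \<omega> a pi_gt_zero by (intro sin_gt_zero) auto
  ultimately show ?thesis using that[of \<omega>] \<omega> by (simp add: \<omega>_def)
qed

text \<open>Less decay than on the critical ray lets each structure cross the real axis between 0 and the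
  target, hence its later pushes do not all lie strictly inside the half-plane of cone_obstruction.\<close>
lemma spread_pushes:
  assumes \<omega>: "\<beta> * sin \<omega> < \<alpha> * cos \<omega>" "0 < sin \<omega>"
  obtains t \<tau> where "0 < t" "t \<le> \<tau>" "\<tau> \<le> es" "Im (vs n t * cnj (\<i> * ks n * ys n t)) = 0"
    "Im (exp (\<i> * of_real \<omega>) * (ys n \<tau> * cnj (ys n t) * exp (\<i> * ks n * of_real n1 * of_real (\<tau> - t)))) \<le> 0"
    "\<exists>s. 0 \<le> s \<and> s \<le> t \<and> cmod (vs n s) \<le> n2 * (cmod (ks n) * cmod (ys n s))"
proof -
  note pos = \<alpha> \<beta>
  define a where "a = Re (ks n)" define b where "b = - Im (ks n)"
  interpret mode n1 n2 a b sp "ks n" "eps n" "ys n" "vs n" unfolding a_def b_def by (rule is_mode)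
  have ab: "0 < a" "0 < b" "b * pi < a * ln ((n2 + n1) / (n2 - n1))" using lower[of n] steep[of n] by (auto simp: a_def b_def)
  have o: "outgoing n1 es = 0" using rest[of es n] es by (simp add: outgoing_def)
  obtain e where e: "0 \<le> e" "e \<le> es" "outgoing n1 e = 0"
    by (rule first_zero[OF cont_outgoing[of n1] _ _ o]) (use es in auto)
  have "outgoing n1 0 \<noteq> 0" by (simp add: outgoing_def z)
  then have e0: "0 < e" "e \<le> sp" using e es by (auto simp: less_le)
  have "refl n1 e = 0" using refl_zero_iff[of e n1] e0 e n1 by simp
  then have fe: "Im (flux e) = 0" using Im_flux_sign(2)[of e n1] e0 n1 by simp
  obtain t where t: "0 < t" "t \<le> e" "Im (flux t) = 0" "\<And>s. 0 < s \<Longrightarrow> s < t \<Longrightarrow> Im (flux s) < 0"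
    by (rule first_crossing_exists[OF e0 fe]) (rule that)
  have tsp: "t \<le> sp" using t(2) e0 by simp
  have re: "Re (refl n1 t) < 0"
  proof (rule ccontr)
    assume "\<not> Re (refl n1 t) < 0"
    then have nn: "0 \<le> Re (refl n1 t)" by simp
    obtain p where p: "refl n2 t = - of_real (exp (- p))" "a * p \<le> b * pi"
      by (rule first_crossing[OF t(1) tsp t(4) t(3)])
    have "ln ((n2 + n1) / (n2 - n1)) \<le> p" by (rule real_impedance_refl[OF t(1) tsp t(3) p(1) nn])
    then have "a * ln ((n2 + n1) / (n2 - n1)) \<le> a * p" using ab by simp
    then show False using p ab by linarith
  qed
  have \<omega>n: "b * sin \<omega> < a * cos \<omega>"
  proof -
    have "(b * pi) * \<alpha> < (a * ln ((n2 + n1) / (n2 - n1))) * \<alpha>" using ab pos by (intro mult_strict_right_mono)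
    also have "\<dots> = a * (\<alpha> * ln ((n2 + n1) / (n2 - n1)))" by simp
    also have "\<dots> = a * (\<beta> * pi)" using ratio by simp
    finally have "pi * (b * \<alpha>) < pi * (a * \<beta>)" by (simp add: mult_ac)
    then have "b * \<alpha> < a * \<beta>" using pi_gt_zero by (simp only: mult_less_cancel_left_pos)
    then have "(b * \<alpha>) * sin \<omega> < (a * \<beta>) * sin \<omega>" using \<omega> by (intro mult_strict_right_mono)
    also have "\<dots> = a * (\<beta> * sin \<omega>)" by simp
    also have "\<dots> \<le> a * (\<alpha> * cos \<omega>)" using ab \<omega> by (intro mult_left_mono) auto
    finally have "\<alpha> * (b * sin \<omega>) < \<alpha> * (a * cos \<omega>)" by (simp add: mult_ac)
    then show ?thesis using pos by (simp only: mult_less_cancel_left_pos)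
  qed
  define J where "J = (\<lambda>\<tau>. Im (exp (\<i> * of_real \<omega>) * (ys n \<tau> * cnj (ys n t) * exp (\<i> * ks n * of_real n1 * of_real (\<tau> - t)))))"
  have "\<exists>\<tau>. t \<le> \<tau> \<and> \<tau> \<le> e \<and> J \<tau> \<le> 0"
  proof (rule ccontr)
    assume no: "\<not> ?thesis"
    show False
    proof (rule cone_obstruction[OF t(1,2) e0(2) e(3) t(3) re \<omega>n])
      fix \<tau> assume "t \<le> \<tau>" "\<tau> \<le> e"
      then have "\<not> J \<tau> \<le> 0" using no by blast
      then have "0 \<le> J \<tau>" by simp
      then show "0 \<le> Im (exp (\<i> * of_real \<omega>) * (ys n \<tau> * cnj (ys n t) * exp (\<i> * ks n * of_real n1 * of_real (\<tau> - t))))"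
        unfolding J_def .
    qed
  qed
  then obtain \<tau> where \<tau>: "t \<le> \<tau>" "\<tau> \<le> e" "J \<tau> \<le> 0" by blast
  obtain s where s: "0 \<le> s" "s \<le> t" "cmod (vs n s) \<le> n2 * (cmod (ks n) * cmod (ys n s))"
    by (rule crossing_not_immediate[OF t(1) tsp t(3)])
  show ?thesis
  proof (rule that[OF t(1) \<tau>(1)])
    show "\<tau> \<le> es" using \<tau>(2) e(2) by simp
    show "Im (vs n t * cnj (\<i> * ks n * ys n t)) = 0" using t(3) unfolding flux_def .
    show "Im (exp (\<i> * of_real \<omega>) * (ys n \<tau> * cnj (ys n t) * exp (\<i> * ks n * of_real n1 * of_real (\<tau> - t)))) \<le> 0"
      using \<tau>(3) unfolding J_def .
    show "\<exists>s. 0 \<le> s \<and> s \<le> t \<and> cmod (vs n s) \<le> n2 * (cmod (ks n) * cmod (ys n s))" using s by blast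
  qed
qed

text \<open>In the limit the crossing takes place at T0 or later: not at the start by crossing_not_immediate,
  and not in the layer by limit_flux_negative. After T0 the pushes turn by the angle 2 \<alpha> n1
  (\<tau> - s), which by quarter_wave_limit and the choice of \<omega> leaves them strictly inside the
  half-plane, against spread_pushes.\<close>
lemma no_degeneration: False
proof -
  obtain \<omega> where \<omega>: "0 < \<omega>" "\<omega> \<le> \<alpha> * n1 * (sp - es)" "\<beta> * sin \<omega> < \<alpha> * cos \<omega>" "0 < sin \<omega>"
    using phase_choice by blast
  define P where "P = (\<lambda>n q. 0 < fst q \<and> fst q \<le> snd q \<and> snd q \<le> es \<and> Im (vs n (fst q) * cnj (\<i> * ks n * ys n (fst q))) = 0 \<and>
    Im (exp (\<i> * of_real \<omega>) * (ys n (snd q) * cnj (ys n (fst q)) * exp (\<i> * ks n * of_real n1 * of_real (snd q - fst q)))) \<le> 0 \<and>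
    (\<exists>s. 0 \<le> s \<and> s \<le> fst q \<and> cmod (vs n s) \<le> n2 * (cmod (ks n) * cmod (ys n s))))"
  have "\<forall>n. \<exists>q. P n q"
  proof
    fix n
    show "\<exists>q. P n q"
    proof (rule spread_pushes[OF \<omega>(3,4), of n])
      fix t \<tau> assume "0 < t" "t \<le> \<tau>" "\<tau> \<le> es" "Im (vs n t * cnj (\<i> * ks n * ys n t)) = 0"
        "Im (exp (\<i> * of_real \<omega>) * (ys n \<tau> * cnj (ys n t) * exp (\<i> * ks n * of_real n1 * of_real (\<tau> - t)))) \<le> 0"
        "\<exists>s. 0 \<le> s \<and> s \<le> t \<and> cmod (vs n s) \<le> n2 * (cmod (ks n) * cmod (ys n s))"
      then have "P n (t, \<tau>)" unfolding P_def fst_conv snd_conv by blast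
      then show ?thesis by blast
    qed
  qed
  then obtain q where q: "\<And>n. P n (q n)" using choice[of P] by blast
  have mem: "\<forall>n. q n \<in> {0..es} \<times> {0..es}"
  proof
    fix n show "q n \<in> {0..es} \<times> {0..es}" using q[of n] unfolding P_def by (cases "q n") auto
  qed
  have "compact ({0..es} \<times> {0..es})" by (intro compact_Times compact_Icc)
  then obtain l r where l: "l \<in> {0..es} \<times> {0..es}" "strict_mono (r :: nat \<Rightarrow> nat)" "(q \<circ> r) \<longlonglongrightarrow> l"
    using mem unfolding compact_def by blast
  define s where "s = fst l" define \<tau> where "\<tau> = snd l"
  define a where "a = (\<lambda>n. fst (q (r n)))" define b where "b = (\<lambda>n. snd (q (r n)))"
  have ab: "a \<longlonglongrightarrow> s" "b \<longlonglongrightarrow> \<tau>"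
    using tendsto_fst[OF l(3)] tendsto_snd[OF l(3)] by (simp_all add: a_def b_def s_def \<tau>_def o_def)
  have q1: "0 < a n" "a n \<le> b n" "b n \<le> es" "Im (vs (r n) (a n) * cnj (\<i> * ks (r n) * ys (r n) (a n))) = 0"
    "Im (exp (\<i> * of_real \<omega>) * (ys (r n) (b n) * cnj (ys (r n) (a n)) * exp (\<i> * ks (r n) * of_real n1 * of_real (b n - a n)))) \<le> 0"
    "\<exists>s. 0 \<le> s \<and> s \<le> a n \<and> cmod (vs (r n) s) \<le> n2 * (cmod (ks (r n)) * cmod (ys (r n) s))" for n
    using q[of "r n"] unfolding P_def a_def b_def by blast+
  have abm: "a n \<in> {0..sp}" "b n \<in> {0..sp}" for n using q1(1,2,3)[of n] es by auto
  have s\<tau>: "s \<le> \<tau>" by (rule LIMSEQ_le[OF ab]) (use q1(2) in auto)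
  have \<tau>es: "\<tau> \<le> es" by (rule LIMSEQ_le_const2[OF ab(2)]) (use q1(3) in auto)
  have s0: "0 \<le> s" using l(1) by (auto simp: s_def)
  note ys = uniform_limit_along[OF filterlim_compose[OF ul(1) filterlim_subseq[OF l(2)]] cY]
  note vs = uniform_limit_along[OF filterlim_compose[OF ul(2) filterlim_subseq[OF l(2)]] cV]
  have kr: "(\<lambda>n. ks (r n)) \<longlonglongrightarrow> k" using filterlim_compose[OF ks filterlim_subseq[OF l(2)]] .
  have "s \<noteq> 0"
  proof
    assume "s = 0"
    obtain c where c: "\<And>n. 0 \<le> c n" "\<And>n. c n \<le> a n" "\<And>n. cmod (vs (r n) (c n)) \<le> n2 * (cmod (ks (r n)) * cmod (ys (r n) (c n)))"
      using q1(6) by metis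
    have cm: "c n \<in> {0..sp}" for n using c(1,2)[of n] abm(1)[of n] by auto
    have "c \<longlonglongrightarrow> 0"
      by (rule tendsto_sandwich[OF _ _ tendsto_const ab(1)[unfolded \<open>s = 0\<close>]]) (use c in auto)
    then have "(\<lambda>n. cmod (vs (r n) (c n))) \<longlonglongrightarrow> cmod (V 0)" "(\<lambda>n. n2 * (cmod (ks (r n)) * cmod (ys (r n) (c n)))) \<longlonglongrightarrow> n2 * (cmod k * cmod (Y 0))"
      by (intro tendsto_intros kr vs ys cm; assumption)+
    then have "cmod (V 0) \<le> n2 * (cmod k * cmod (Y 0))"
      by (rule LIMSEQ_le) (use c(3) in auto)
    then show False by (simp add: limit_start)
  qed
  then have sp0: "0 < s" using s0 by simp
  have "(\<lambda>n. Im (vs (r n) (a n) * cnj (\<i> * ks (r n) * ys (r n) (a n)))) \<longlonglongrightarrow> Im (V s * cnj (\<i> * k * Y s))"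
    by (intro tendsto_intros kr vs ys abm ab)
  then have "Im (V s * cnj (\<i> * k * Y s)) = 0" unfolding q1(4) by (simp only: LIMSEQ_const_iff)
  then have "\<not> s < limit.T0" using limit.limit_flux_negative[OF sp0] by (metis less_irrefl)
  then have T: "limit.T0 \<le> s" by simp
  have "(\<lambda>n. Im (exp (\<i> * of_real \<omega>) * (ys (r n) (b n) * cnj (ys (r n) (a n)) * exp (\<i> * ks (r n) * of_real n1 * of_real (b n - a n)))))
     \<longlonglongrightarrow> Im (exp (\<i> * of_real \<omega>) * (Y \<tau> * cnj (Y s) * exp (\<i> * k * of_real n1 * of_real (\<tau> - s))))"
    by (intro tendsto_intros kr vs ys abm ab)
  then have le: "Im (exp (\<i> * of_real \<omega>) * (Y \<tau> * cnj (Y s) * exp (\<i> * k * of_real n1 * of_real (\<tau> - s)))) \<le> 0"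
    by (rule LIMSEQ_le_const2) (use q1(5) in auto)
  define A where "A = s - limit.T0" define D where "D = \<tau> - s"
  define c where "c = \<i> * k * of_real n1"
  have cc: "c = Complex (\<beta> * n1) (\<alpha> * n1)" by (simp add: c_def k complex_eq_iff)
  have Ys: "Y s = Y limit.T0 * exp (c * of_real A)" and Y\<tau>: "Y \<tau> = Y limit.T0 * exp (c * of_real (A + D))"
  proof -
    have 1: "s \<le> sp" "limit.T0 \<le> \<tau>" "\<tau> \<le> sp" using T s\<tau> \<tau>es es by auto
    show "Y s = Y limit.T0 * exp (c * of_real A)"
      using limit.quarter_wave_limit(4)[rule_format, OF T 1(1)] by (simp only: c_def A_def)
    have "A + D = \<tau> - limit.T0" by (simp add: A_def D_def)
    then show "Y \<tau> = Y limit.T0 * exp (c * of_real (A + D))"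
      using limit.quarter_wave_limit(4)[rule_format, OF 1(2,3)] by (simp only: c_def)
  qed
  have "exp (c * of_real (A + D)) * cnj (exp (c * of_real A)) * exp (c * of_real D)
      = exp (Complex (2 * \<beta> * n1 * (A + D)) (2 * \<alpha> * n1 * D))"
    unfolding exp_cnj exp_add[symmetric] by (rule arg_cong[where f=exp]) (simp add: cc complex_eq_iff algebra_simps)
  then have "Y \<tau> * cnj (Y s) * exp (c * of_real D) = (Y limit.T0 * cnj (Y limit.T0)) * exp (Complex (2 * \<beta> * n1 * (A + D)) (2 * \<alpha> * n1 * D))"
    unfolding Ys Y\<tau> by (simp add: mult_ac)
  also have "Y limit.T0 * cnj (Y limit.T0) = of_real ((cmod (Y limit.T0))\<^sup>2)" by (simp only: complex_norm_square)
  finally have "exp (\<i> * of_real \<omega>) * (Y \<tau> * cnj (Y s) * exp (c * of_real D))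
     = of_real ((cmod (Y limit.T0))\<^sup>2) * (exp (\<i> * of_real \<omega>) * exp (Complex (2 * \<beta> * n1 * (A + D)) (2 * \<alpha> * n1 * D)))"
    by (simp only: mult_ac)
  also have "exp (\<i> * of_real \<omega>) * exp (Complex (2 * \<beta> * n1 * (A + D)) (2 * \<alpha> * n1 * D)) = exp (Complex (2 * \<beta> * n1 * (A + D)) (\<omega> + 2 * \<alpha> * n1 * D))"
    unfolding exp_add[symmetric] by (rule arg_cong[where f=exp]) (simp add: complex_eq_iff)
  finally have "Im (exp (\<i> * of_real \<omega>) * (Y \<tau> * cnj (Y s) * exp (c * of_real D)))
     = (cmod (Y limit.T0))\<^sup>2 * (exp (2 * \<beta> * n1 * (A + D)) * sin (\<omega> + 2 * \<alpha> * n1 * D))"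
    by (simp add: Im_exp)
  moreover have "0 < sin (\<omega> + 2 * \<alpha> * n1 * D)"
  proof (rule sin_gt_zero)
    have p: "0 < \<alpha> * n1" using \<alpha> n1 by simp
    have "(\<alpha> * n1) * D \<le> (\<alpha> * n1) * (es - limit.T0)" using p T \<tau>es by (intro mult_left_mono) (auto simp: D_def)
    moreover have "2 * ((\<alpha> * n1) * (sp - limit.T0)) \<le> pi" using limit.quarter_wave_limit(2) by (simp add: mult_ac)
    moreover have "(\<alpha> * n1) * (sp - limit.T0) = (\<alpha> * n1) * (es - limit.T0) + (\<alpha> * n1) * (sp - es)" by (simp add: algebra_simps)
    moreover have "2 * \<alpha> * n1 * D = 2 * ((\<alpha> * n1) * D)" by simp
    moreover have "0 \<le> (\<alpha> * n1) * D" using p s\<tau> by (simp add: D_def)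
    ultimately show "0 < \<omega> + 2 * \<alpha> * n1 * D" "\<omega> + 2 * \<alpha> * n1 * D < pi" using \<omega>(1,2) by linarith+
  qed
  moreover have "Y limit.T0 \<noteq> 0" using limit_nonzero[of limit.T0] limit.T0_pos limit.quarter_wave_limit(1) es by simp
  ultimately have "0 < Im (exp (\<i> * of_real \<omega>) * (Y \<tau> * cnj (Y s) * exp (c * of_real D)))" by simp
  then show False using le by (simp add: c_def D_def)
qed

end

context resonator begin

lemma ray_coordinates: "of_real K * exp (\<i> * of_real \<gamma>) = Complex (K * cos \<gamma>) (- (K * - sin \<gamma>))"
  by (simp add: complex_eq_iff Re_exp Im_exp)

lemma sin_\<gamma>0: "0 < - sin \<gamma>0" using sin_gt_zero[of "- \<gamma>0"] \<gamma>0_range by simp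

lemma critical_ratio: "(K * - sin \<gamma>0) * pi = (K * cos \<gamma>0) * ln ((n2 + n1) / (n2 - n1))"
proof -
  have "sin \<gamma>0 / cos \<gamma>0 = - (L0 / pi)" using tan_\<gamma>0 by (simp add: tan_def)
  then have "- sin \<gamma>0 * pi = cos \<gamma>0 * L0" using cos_\<gamma>0 pi_gt_zero by (simp add: field_simps)
  then have "K * (- sin \<gamma>0 * pi) = K * (cos \<gamma>0 * L0)" by simp
  then show ?thesis by (simp only: L0_def mult.assoc)
qed

lemma Arg_ray: "0 < K \<Longrightarrow> \<gamma>0 < \<gamma> \<Longrightarrow> \<gamma> < 0 \<Longrightarrow> Arg (of_real K * exp (\<i> * of_real \<gamma>)) = \<gamma>"
  using \<gamma>0_range by (intro Arg_unique) auto

text \<open>Near the critical ray, every structure at rest in the target on the whole of the last piece has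
  variations in all directions, with a bound that is common to all of them: otherwise missed
  directions and wave_compactness would produce a degenerating sequence.\<close>
lemma uniformly_open_variations:
  assumes K: "0 < K" and es: "0 < es" "es < sp"
  obtains r d where "0 < r" "0 < d" "d \<le> - \<gamma>0"
    "\<forall>\<gamma> \<epsilon> y v. \<gamma>0 < \<gamma> \<longrightarrow> \<gamma> < \<gamma>0 + d \<longrightarrow> admissible n1 n2 \<epsilon> \<longrightarrow> wave (of_real K * exp (\<i> * of_real \<gamma>)) \<epsilon> 0 sp y v \<longrightarrow>
      y 0 = 0 \<longrightarrow> v 0 = 1 \<longrightarrow> (\<forall>s. es \<le> s \<longrightarrow> s \<le> sp \<longrightarrow> v s = \<i> * (of_real K * exp (\<i> * of_real \<gamma>)) * of_real n1 * y s) \<longrightarrow>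
      ball 0 r \<subseteq> reachable_variations n1 n2 sp \<epsilon> y"
proof (rule ccontr)
  assume no: "\<not> thesis"
  define kk where "kk = (\<lambda>\<gamma>::real. of_real K * exp (\<i> * of_real \<gamma>))"
  define P where "P = (\<lambda>n q. case q of (\<gamma>, \<epsilon>, y, v, w) \<Rightarrow> \<gamma>0 < \<gamma> \<and> \<gamma> < \<gamma>0 + (- \<gamma>0) * inverse (real (Suc n)) \<and> admissible n1 n2 \<epsilon> \<and> wave (kk \<gamma>) \<epsilon> 0 sp y v \<and>
      y 0 = 0 \<and> v 0 = 1 \<and> (\<forall>s. es \<le> s \<longrightarrow> s \<le> sp \<longrightarrow> v s = \<i> * kk \<gamma> * of_real n1 * y s) \<and>
      cmod w < inverse (real (Suc n)) \<and> w \<notin> reachable_variations n1 n2 sp \<epsilon> y)"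
  have "\<forall>n. \<exists>q. P n q"
  proof (rule allI, rule ccontr)
    fix n assume none: "\<not> (\<exists>q. P n q)"
    have i: "0 < inverse (real (Suc n))" "inverse (real (Suc n)) \<le> 1" by (simp_all add: inverse_le_1_iff)
    show False
    proof (rule notE[OF no], rule that[of "inverse (real (Suc n))" "(- \<gamma>0) * inverse (real (Suc n))"])
      show "0 < (- \<gamma>0) * inverse (real (Suc n))" using \<gamma>0_range i by (intro mult_pos_pos) auto
      show "(- \<gamma>0) * inverse (real (Suc n)) \<le> - \<gamma>0" using \<gamma>0_range i by (intro mult_left_le) auto
      show "\<forall>\<gamma> \<epsilon> y v. \<gamma>0 < \<gamma> \<longrightarrow> \<gamma> < \<gamma>0 + (- \<gamma>0) * inverse (real (Suc n)) \<longrightarrow> admissible n1 n2 \<epsilon> \<longrightarrow> wave (of_real K * exp (\<i> * of_real \<gamma>)) \<epsilon> 0 sp y v \<longrightarrow>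
        y 0 = 0 \<longrightarrow> v 0 = 1 \<longrightarrow> (\<forall>s. es \<le> s \<longrightarrow> s \<le> sp \<longrightarrow> v s = \<i> * (of_real K * exp (\<i> * of_real \<gamma>)) * of_real n1 * y s) \<longrightarrow>
        ball 0 (inverse (real (Suc n))) \<subseteq> reachable_variations n1 n2 sp \<epsilon> y"
      proof (intro allI impI subsetI)
        fix \<gamma> \<epsilon> y v and w :: complex
        assume a: "\<gamma>0 < \<gamma>" "\<gamma> < \<gamma>0 + (- \<gamma>0) * inverse (real (Suc n))" "admissible n1 n2 \<epsilon>" "wave (of_real K * exp (\<i> * of_real \<gamma>)) \<epsilon> 0 sp y v"
          "y 0 = 0" "v 0 = 1" "\<forall>s. es \<le> s \<longrightarrow> s \<le> sp \<longrightarrow> v s = \<i> * (of_real K * exp (\<i> * of_real \<gamma>)) * of_real n1 * y s"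
          and w: "w \<in> ball 0 (inverse (real (Suc n)))"
        show "w \<in> reachable_variations n1 n2 sp \<epsilon> y"
        proof (rule ccontr)
          assume "w \<notin> reachable_variations n1 n2 sp \<epsilon> y"
          moreover have "cmod w < inverse (real (Suc n))" using w by (simp only: mem_ball_0)
          ultimately have "P n (\<gamma>, \<epsilon>, y, v, w)" unfolding P_def prod.case kk_def using a by (intro conjI)
          then show False using none by blast
        qed
      qed
    qed (rule i)
  qed
  then obtain q where q: "\<forall>n. P n (q n)" using choice[of P] by blast
  define g where "g = (\<lambda>n. fst (q n))"
  define ee where "ee = (\<lambda>n. fst (snd (q n)))"
  define ys where "ys = (\<lambda>n. fst (snd (snd (q n))))"
  define vs where "vs = (\<lambda>n. fst (snd (snd (snd (q n)))))"
  define ws where "ws = (\<lambda>n. snd (snd (snd (snd (q n)))))"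
  have Q: "\<gamma>0 < g n \<and> g n < \<gamma>0 + (- \<gamma>0) * inverse (real (Suc n)) \<and> admissible n1 n2 (ee n) \<and> wave (kk (g n)) (ee n) 0 sp (ys n) (vs n) \<and>
      ys n 0 = 0 \<and> vs n 0 = 1 \<and> (\<forall>s. es \<le> s \<longrightarrow> s \<le> sp \<longrightarrow> vs n s = \<i> * kk (g n) * of_real n1 * ys n s) \<and>
      cmod (ws n) < inverse (real (Suc n)) \<and> ws n \<notin> reachable_variations n1 n2 sp (ee n) (ys n)" for n
    using spec[OF q, of n] unfolding P_def g_def ee_def ys_def vs_def ws_def split_beta .
  have g1: "\<gamma>0 < g n" and g2: "g n < \<gamma>0 + (- \<gamma>0) * inverse (real (Suc n))" and adm: "admissible n1 n2 (ee n)"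
    and w: "wave (kk (g n)) (ee n) 0 sp (ys n) (vs n)" and z1: "ys n 0 = 0" and z2: "vs n 0 = 1"
    and rest: "\<forall>s. es \<le> s \<longrightarrow> s \<le> sp \<longrightarrow> vs n s = \<i> * kk (g n) * of_real n1 * ys n s"
    and small: "cmod (ws n) < inverse (real (Suc n))" and miss: "ws n \<notin> reachable_variations n1 n2 sp (ee n) (ys n)" for n
    using Q[of n] by - (elim conjE, assumption)+
  have g0: "g n < 0" for n
  proof -
    have "(- \<gamma>0) * inverse (real (Suc n)) \<le> - \<gamma>0" using \<gamma>0_range by (intro mult_left_le) (auto simp: inverse_le_1_iff)
    then show ?thesis using g2[of n] by linarith
  qed
  have cK: "cmod (kk \<gamma>) \<le> K" for \<gamma> using K by (simp add: kk_def norm_mult)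
  have cy: "continuous_on {0..sp} (ys n)" for n using w[of n] unfolding wave_def by (blast intro: primitive_continuous)
  have "\<forall>n. \<exists>N. cmod N = 1 \<and> (\<forall>\<eta>. admissible n1 n2 \<eta> \<longrightarrow> Re (cnj N * integral {0..sp} (\<lambda>s. of_real (\<eta> s - ee n s) * (ys n s)\<^sup>2)) \<le> cmod (ws n))"
  proof
    fix n
    show "\<exists>N. cmod N = 1 \<and> (\<forall>\<eta>. admissible n1 n2 \<eta> \<longrightarrow> Re (cnj N * integral {0..sp} (\<lambda>s. of_real (\<eta> s - ee n s) * (ys n s)\<^sup>2)) \<le> cmod (ws n))"
      by (rule missed_direction[OF adm cy miss, of n]) blast
  qed
  then obtain Nn where N1: "\<And>n. cmod (Nn n) = 1"
    and N2: "\<And>n \<eta>. admissible n1 n2 \<eta> \<Longrightarrow> Re (cnj (Nn n) * integral {0..sp} (\<lambda>s. of_real (\<eta> s - ee n s) * (ys n s)\<^sup>2)) \<le> cmod (ws n)"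
    by metis
  obtain r1 Y V where r1: "strict_mono (r1 :: nat \<Rightarrow> nat)" and u1: "uniform_limit {0..sp} (\<lambda>n. ys (r1 n)) Y sequentially"
    and u2: "uniform_limit {0..sp} (\<lambda>n. vs (r1 n)) V sequentially" and cY: "continuous_on {0..sp} Y" and cV: "continuous_on {0..sp} V" and PY: "primitive Y V 0 sp"
    by (rule wave_compactness[OF w adm z1 z2 cK sp])
  have "compact (sphere (0::complex) 1)" by (rule compact_sphere)
  moreover have "\<forall>n. (Nn \<circ> r1) n \<in> sphere 0 1" using N1 by simp
  ultimately obtain N r2 where N: "N \<in> sphere 0 1" "strict_mono (r2 :: nat \<Rightarrow> nat)" "((Nn \<circ> r1) \<circ> r2) \<longlonglongrightarrow> N"
    unfolding compact_def by blast
  define r where "r = (\<lambda>n. r1 (r2 n))"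
  have r: "strict_mono r" using strict_mono_o[OF r1 N(2)] by (simp add: r_def o_def)
  have inv: "(\<lambda>n. inverse (real (Suc n))) \<longlonglongrightarrow> 0" by (rule LIMSEQ_inverse_real_of_nat)
  have "(\<lambda>n. \<gamma>0 + (- \<gamma>0) * inverse (real (Suc n))) \<longlonglongrightarrow> \<gamma>0 + (- \<gamma>0) * 0" by (intro tendsto_intros inv)
  then have up: "(\<lambda>n. \<gamma>0 + (- \<gamma>0) * inverse (real (Suc n))) \<longlonglongrightarrow> \<gamma>0" by simp
  have g: "g \<longlonglongrightarrow> \<gamma>0"
    by (rule tendsto_sandwich[OF _ _ tendsto_const up]) (intro always_eventually allI less_imp_le g1 g2)+
  have gr: "(\<lambda>n. g (r n)) \<longlonglongrightarrow> \<gamma>0" by (rule filterlim_compose[OF g filterlim_subseq[OF r]])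
  have w0: "(\<lambda>n. cmod (ws n)) \<longlonglongrightarrow> 0"
    by (rule tendsto_sandwich[OF _ _ tendsto_const inv]) (intro always_eventually allI less_imp_le small norm_ge_zero)+
  have "degenerating n1 n2 sp es (K * cos \<gamma>0) (K * - sin \<gamma>0) (kk \<gamma>0) N Y V (\<lambda>n. kk (g (r n))) (\<lambda>n. Nn (r n)) (\<lambda>n. ee (r n)) (\<lambda>n. ys (r n)) (\<lambda>n. vs (r n)) (\<lambda>n. cmod (ws (r n)))"
  proof
    show "0 < n1" "n1 < n2" "0 < es" "es < sp" by (rule n1 n12 es)+
    show "0 < K * cos \<gamma>0" "0 < K * - sin \<gamma>0" using K cos_\<gamma>0 sin_\<gamma>0 by (intro mult_pos_pos; simp)+
    show "kk \<gamma>0 = Complex (K * cos \<gamma>0) (- (K * - sin \<gamma>0))" unfolding kk_def by (rule ray_coordinates)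
    show "(K * - sin \<gamma>0) * pi = (K * cos \<gamma>0) * ln ((n2 + n1) / (n2 - n1))" by (rule critical_ratio)
    show "(\<lambda>n. kk (g (r n))) \<longlonglongrightarrow> kk \<gamma>0" unfolding kk_def by (intro tendsto_intros gr)
    show "(\<lambda>n. Nn (r n)) \<longlonglongrightarrow> N" using N(3) by (simp add: o_def r_def)
    show "N \<noteq> 0" using N(1) by auto
    show "(\<lambda>n. cmod (ws (r n))) \<longlonglongrightarrow> 0" by (rule filterlim_compose[OF w0 filterlim_subseq[OF r]])
    fix n
    have c: "0 < cos (g (r n))" using g1[of "r n"] g0[of "r n"] \<gamma>0_range by (intro cos_gt_zero_pi) auto
    have s: "0 < - sin (g (r n))" using sin_gt_zero[of "- g (r n)"] g1[of "r n"] g0[of "r n"] \<gamma>0_range by simp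
    have Rk: "Re (kk (g (r n))) = K * cos (g (r n))" "Im (kk (g (r n))) = - (K * - sin (g (r n)))"
      unfolding kk_def ray_coordinates by (simp_all only: complex.sel)
    show 1: "0 < Re (kk (g (r n)))" unfolding Rk using K c by (rule mult_pos_pos)
    show "Im (kk (g (r n))) < 0" unfolding Rk using mult_pos_pos[OF K s] by linarith
    show "- Im (kk (g (r n))) * pi < Re (kk (g (r n))) * ln ((n2 + n1) / (n2 - n1))"
      unfolding L0_def[symmetric]
    proof (rule steeper_argument[OF 1])
      show "\<gamma>0 < Arg (kk (g (r n)))" unfolding kk_def Arg_ray[OF K g1 g0] by (rule g1)
    qed
    show "admissible n1 n2 (ee (r n))" by (rule adm)
    show "wave (kk (g (r n))) (ee (r n)) 0 sp (ys (r n)) (vs (r n))" by (rule w)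
    show "ys (r n) 0 = 0" "vs (r n) 0 = 1" by (rule z1 z2)+
    show "vs (r n) s = \<i> * kk (g (r n)) * of_real n1 * ys (r n) s" if "es \<le> s" "s \<le> sp" for s
      using rest[of "r n", rule_format, OF that] .
    show "Re (cnj (Nn (r n)) * integral {0..sp} (\<lambda>s. of_real (\<eta> s - ee (r n) s) * (ys (r n) s)\<^sup>2)) \<le> cmod (ws (r n))" if "admissible n1 n2 \<eta>" for \<eta>
      by (rule N2[OF that])
    show "uniform_limit {0..sp} (\<lambda>n. ys (r n)) Y sequentially" unfolding r_def by (rule filterlim_compose[OF u1 filterlim_subseq[OF N(2)]])
    show "uniform_limit {0..sp} (\<lambda>n. vs (r n)) V sequentially" unfolding r_def by (rule filterlim_compose[OF u2 filterlim_subseq[OF N(2)]])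
  qed (rule cY cV PY)+
  then show False by (rule degenerating.no_degeneration)
qed

end

section \<open>The right limit of the minimal modulus\<close>

lemma admissible_resonator:
  assumes "admissible n1 n2 \<epsilon>" shows "\<epsilon> \<in> resonator_family n1 n2 sp"
proof -
  have "AE s in lebesgue_on {0<..<sp}. n1\<^sup>2 \<le> \<epsilon> s \<and> \<epsilon> s \<le> n2\<^sup>2"
    by (rule AE_I2) (use assms in \<open>simp add: admissible_def\<close>)
  then show ?thesis
    unfolding resonator_family_def feasible_on_def using admissible_measurable(1)[OF assms] by blast
qed

context resonator begin

text \<open>Shrinking the structure of an eigenvalue of modulus below \<rho> to modulus K leaves room for a
  stretch of the medium n1. Its variations are then uniformly open, so the boundary condition can be
  restored at modulus K on all neighbouring rays.\<close>
lemma pencil_filled: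
  assumes \<rho>: "0 < \<rho>" "\<rho> < K" and freq: "\<exists>\<^sub>F \<gamma> in at_right \<gamma>0. rho_min n1 n2 sp \<gamma> < ereal \<rho>"
  shows "\<forall>\<^sub>F \<gamma> in at_right \<gamma>0. rho_min n1 n2 sp \<gamma> \<le> ereal K"
proof -
  have K: "0 < K" using \<rho> by simp
  define kk where "kk = (\<lambda>\<gamma>::real. of_real K * exp (\<i> * of_real \<gamma>))"
  \<comment> \<open>the rescaled structures end before es, whatever the eigenvalue of modulus below \<rho> they come from\<close>
  define es where "es = sp * \<rho> / K"
  have es: "0 < es" "es < sp" using \<rho> K sp by (simp_all add: es_def divide_less_eq)
  obtain r d where r: "0 < r" and d: "0 < d" "d \<le> - \<gamma>0"
    and opn: "\<forall>\<gamma> \<epsilon> y v. \<gamma>0 < \<gamma> \<longrightarrow> \<gamma> < \<gamma>0 + d \<longrightarrow> admissible n1 n2 \<epsilon> \<longrightarrow> wave (of_real K * exp (\<i> * of_real \<gamma>)) \<epsilon> 0 sp y v \<longrightarrow>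
      y 0 = 0 \<longrightarrow> v 0 = 1 \<longrightarrow> (\<forall>s. es \<le> s \<longrightarrow> s \<le> sp \<longrightarrow> v s = \<i> * (of_real K * exp (\<i> * of_real \<gamma>)) * of_real n1 * y s) \<longrightarrow>
      ball 0 r \<subseteq> reachable_variations n1 n2 sp \<epsilon> y"
    by (rule uniformly_open_variations[OF K es])
  obtain \<delta> where \<delta>: "0 < \<delta>" and bcr: "\<And>k k' \<epsilon> y v. cmod k = K \<Longrightarrow> cmod k' = K \<Longrightarrow> cmod (k' - k) < \<delta> \<Longrightarrow> admissible n1 n2 \<epsilon> \<Longrightarrow>
    wave k \<epsilon> 0 sp y v \<Longrightarrow> y 0 = 0 \<Longrightarrow> v 0 = 1 \<Longrightarrow> v sp = \<i> * k * of_real n1 * y sp \<Longrightarrow> y sp \<noteq> 0 \<Longrightarrow>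
    ball 0 r \<subseteq> reachable_variations n1 n2 sp \<epsilon> y \<Longrightarrow>
    \<exists>\<epsilon>' y' v'. admissible n1 n2 \<epsilon>' \<and> wave k' \<epsilon>' 0 sp y' v' \<and> y' 0 = 0 \<and> v' 0 = 1 \<and> v' sp = \<i> * k' * of_real n1 * y' sp"
    by (rule boundary_condition_restored[OF n1 sp K r, where ?n2.0=n2]) (rule that)
  have ck: "cmod (kk \<gamma>) = K" for \<gamma> using K by (simp add: kk_def norm_mult)
  have "isCont kk \<gamma>0" unfolding kk_def by (intro continuous_intros)
  then obtain d2 where d2: "0 < d2" "\<And>\<gamma>. \<bar>\<gamma> - \<gamma>0\<bar> < d2 \<Longrightarrow> cmod (kk \<gamma> - kk \<gamma>0) < \<delta> / 2"
    unfolding continuous_at_eps_delta dist_norm real_norm_def using half_gt_zero[OF \<delta>] by blast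
  define d3 where "d3 = min d d2"
  have d3: "0 < d3" using d d2 by (simp add: d3_def)
  have near: "\<forall>\<^sub>F \<gamma> in at_right \<gamma>0. \<gamma>0 < \<gamma> \<and> \<gamma> < \<gamma>0 + d3"
    unfolding eventually_at_right_field using d3 by (intro exI[of _ "\<gamma>0 + d3"]) auto
  from frequently_eventually_conj[OF freq near]
  obtain \<gamma> where \<gamma>: "rho_min n1 n2 sp \<gamma> < ereal \<rho>" "\<gamma>0 < \<gamma>" "\<gamma> < \<gamma>0 + d3"
    using frequently_ex by blast
  then obtain k where k: "k \<in> eigenvalue_set n1 n2 sp" "Arg k = \<gamma>" "cmod k < \<rho>"
    unfolding rho_min_def INF_less_iff by auto
  obtain \<epsilon> where e: "\<epsilon> \<in> resonator_family n1 n2 sp" "generates_eigenvalue n1 sp \<epsilon> k"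
    using k(1) by (auto simp: eigenvalue_set_def)
  obtain \<epsilon>' N y v where a: "admissible n1 n2 \<epsilon>'" and w: "wave k \<epsilon>' 0 sp y v" and bc: "y 0 = 0" "v 0 = 1" "v sp = \<i> * k * of_real n1 * y sp" "y sp \<noteq> 0" "k \<noteq> 0"
    by (rule generated_wave[OF n1 n12 sp e]) (rule that)
  define c where "c = K / cmod k"
  have ck0: "0 < cmod k" using bc by simp
  have c: "1 < c" using k(3) \<rho> ck0 by (simp add: c_def less_divide_eq)
  have kc: "of_real c * k = kk \<gamma>"
  proof -
    have "k = of_real (cmod k) * exp (\<i> * of_real \<gamma>)" using k(2) rcis_cmod_Arg[of k] by (simp add: rcis_def cis_conv_exp)
    then have "of_real c * k = of_real (c * cmod k) * exp (\<i> * of_real \<gamma>)" by (metis mult.assoc of_real_mult)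
    moreover have "c * cmod k = K" using ck0 by (simp add: c_def)
    ultimately show ?thesis by (simp add: kk_def)
  qed
  have ws: "wave (kk \<gamma>) (\<lambda>s. \<epsilon>' (c * s)) 0 (sp / c) (\<lambda>s. y (c * s) / of_real c) (\<lambda>s. v (c * s))"
    unfolding kc[symmetric] by (rule wave_scale[OF w]) (use c in simp)
  have as: "admissible n1 n2 (\<lambda>s. \<epsilon>' (c * s))"
  proof -
    have "\<epsilon>' \<in> borel_measurable borel" using a by (simp add: admissible_def)
    then have "(\<lambda>s. \<epsilon>' (c * s)) \<in> borel_measurable borel" by measurable
    then show ?thesis using a by (simp add: admissible_def)
  qed
  have T: "0 < sp / c" "sp / c \<le> sp" "sp / c \<le> es"
  proof -
    show "0 < sp / c" "sp / c \<le> sp" using sp c by (simp_all add: divide_le_eq)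
    have "sp / c = sp * cmod k / K" by (simp add: c_def)
    also have "\<dots> \<le> es" unfolding es_def using k(3) sp K by (intro divide_right_mono mult_left_mono) auto
    finally show "sp / c \<le> es" .
  qed
  have knz: "kk \<gamma> \<noteq> 0" using ck[of \<gamma>] K by auto
  have c0: "c \<noteq> 0" using c by simp
  have bcs: "v (c * (sp / c)) = \<i> * kk \<gamma> * of_real n1 * (y (c * (sp / c)) / of_real c)"
    using bc(3) c0 unfolding kc[symmetric] by simp
  obtain y' v' where w': "wave (kk \<gamma>) (\<lambda>s. if s < sp / c then \<epsilon>' (c * s) else n1\<^sup>2) 0 sp y' v'"
    and in1: "\<forall>s\<le>sp / c. y' s = y (c * s) / of_real c \<and> v' s = v (c * s)"
    and in2: "\<forall>s\<ge>sp / c. y' s = y (c * (sp / c)) / of_real c * exp (\<i> * kk \<gamma> * of_real n1 * of_real (s - sp / c)) \<and> v' s = \<i> * kk \<gamma> * of_real n1 * y' s"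
    and a': "admissible n1 n2 (\<lambda>s. if s < sp / c then \<epsilon>' (c * s) else n1\<^sup>2)"
    by (rule wave_extend[OF ws as n1 n12 T(1,2) knz bcs])
  have z': "y' 0 = 0" "v' 0 = 1" using in1 T(1) bc by auto
  have rest': "\<forall>s. es \<le> s \<longrightarrow> s \<le> sp \<longrightarrow> v' s = \<i> * kk \<gamma> * of_real n1 * y' s"
    using in2 order_trans[OF T(3)] by simp
  have b: "ball 0 r \<subseteq> reachable_variations n1 n2 sp (\<lambda>s. if s < sp / c then \<epsilon>' (c * s) else n1\<^sup>2) y'"
    using opn[rule_format, OF \<gamma>(2) _ a' w'[unfolded kk_def] z' rest'[unfolded kk_def, rule_format]] \<gamma>(3) by (simp add: d3_def)
  have e': "v' sp = \<i> * kk \<gamma> * of_real n1 * y' sp" "y' sp \<noteq> 0"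
    using in2[rule_format, OF T(2)] bc(4) c0 by auto
  from near show ?thesis
  proof eventually_elim
    case (elim \<gamma>')
    have g: "\<gamma>0 < \<gamma>'" "\<gamma>' < 0" using elim d by (auto simp: d3_def)
    have "cmod (kk \<gamma>' - kk \<gamma>0) < \<delta> / 2" "cmod (kk \<gamma> - kk \<gamma>0) < \<delta> / 2"
      using d2(2)[of \<gamma>'] d2(2)[of \<gamma>] elim \<gamma> by (auto simp: d3_def)
    then have "cmod (kk \<gamma>' - kk \<gamma>) < \<delta>"
      using norm_triangle_ineq4[of "kk \<gamma>' - kk \<gamma>0" "kk \<gamma> - kk \<gamma>0"] by simp
    from bcr[OF ck ck this a' w' z' e' b]
    obtain e2 y2 v2 where 2: "admissible n1 n2 e2" "wave (kk \<gamma>') e2 0 sp y2 v2" "y2 0 = 0" "v2 0 = 1" "v2 sp = \<i> * kk \<gamma>' * of_real n1 * y2 sp"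
      by blast
    have cs: "0 < cos \<gamma>'" using g \<gamma>0_range by (intro cos_gt_zero_pi) auto
    have sn: "sin \<gamma>' < 0" using sin_gt_zero[of "- \<gamma>'"] g \<gamma>0_range by simp
    have Rk: "0 < Re (kk \<gamma>')" "Im (kk \<gamma>') < 0" using K cs sn unfolding kk_def ray_coordinates by (simp_all add: mult_pos_neg)
    have "v2 0 \<noteq> 0" using 2(4) by simp
    then interpret mode n1 n2 "Re (kk \<gamma>')" "- Im (kk \<gamma>')" sp "kk \<gamma>'" e2 y2 v2
      by (rule mode_of_wave[OF n1 n12 Rk sp 2(1-3)])
    have "y2 sp \<noteq> 0" by (rule y_nz) (use T in auto)
    then have "generates_eigenvalue n1 sp e2 (kk \<gamma>')"
      using wave_generates[OF sp k_nz 2(2,3) _ 2(5), of "{}" e2] by simp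
    then have "kk \<gamma>' \<in> eigenvalue_set n1 n2 sp"
      unfolding eigenvalue_set_def using admissible_resonator[OF 2(1)] by blast
    moreover have "Arg (kk \<gamma>') = \<gamma>'" unfolding kk_def by (rule Arg_ray[OF K g])
    ultimately have "rho_min n1 n2 sp \<gamma>' \<le> ereal (cmod (kk \<gamma>'))"
      unfolding rho_min_def by (intro INF_lower) simp
    then show ?case by (simp only: ck)
  qed
qed

text \<open>By pencil_filled the upper limit does not exceed the lower limit, and by rho_min_right both stay
  above the modulus of \<kappa>0.\<close>
theorem rho_min_right_limit: "\<exists>L. (rho_min n1 n2 sp \<longlongrightarrow> L) (at_right \<gamma>0) \<and> ereal (cmod \<kappa>0) < L"
proof -
  define L where "L = Liminf (at_right \<gamma>0) (rho_min n1 n2 sp)"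
  obtain m where m: "cmod \<kappa>0 < m" "m < escape / cos \<gamma>0" using dense[OF cmod_\<kappa>0_less] by blast
  have "isCont (\<lambda>\<gamma>. escape / cos \<gamma>) \<gamma>0" using cos_\<gamma>0 by (intro continuous_intros) auto
  then have "((\<lambda>\<gamma>. escape / cos \<gamma>) \<longlongrightarrow> escape / cos \<gamma>0) (at_right \<gamma>0)"
    unfolding isCont_def by (rule filterlim_mono) (simp_all add: at_le)
  then have "\<forall>\<^sub>F \<gamma> in at_right \<gamma>0. m < escape / cos \<gamma>" using m(2) by (rule order_tendstoD)
  moreover have "\<forall>\<^sub>F \<gamma> in at_right \<gamma>0. \<gamma> \<in> {\<gamma>0<..<0}" by (rule eventually_at_right_real) (rule \<gamma>0_range)
  ultimately have "\<forall>\<^sub>F \<gamma> in at_right \<gamma>0. ereal m \<le> rho_min n1 n2 sp \<gamma>"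
  proof eventually_elim
    case (elim \<gamma>)
    have "ereal m \<le> ereal (escape / cos \<gamma>)" using elim(1) by simp
    also have "\<dots> \<le> rho_min n1 n2 sp \<gamma>" by (rule rho_min_right) (use elim in auto)
    finally show ?case .
  qed
  then have mL: "ereal m \<le> L" unfolding L_def by (rule Liminf_bounded)
  have "Limsup (at_right \<gamma>0) (rho_min n1 n2 sp) \<le> L"
  proof (rule dense_ge)
    fix x assume "L < x"
    then obtain K where K: "L < ereal K" "ereal K < x" using ereal_dense2 by blast
    obtain \<rho> where \<rho>: "L < ereal \<rho>" "ereal \<rho> < ereal K" using ereal_dense2[OF K(1)] by blast
    have "ereal m < ereal \<rho>" using mL \<rho>(1) by (rule le_less_trans)
    then have "m < \<rho>" by simp
    then have pos: "0 < \<rho>" using m(1) norm_ge_zero[of \<kappa>0] by linarith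
    have "\<exists>\<^sub>F \<gamma> in at_right \<gamma>0. rho_min n1 n2 sp \<gamma> < ereal \<rho>"
    proof (rule ccontr)
      assume "\<not> ?thesis"
      then have "\<forall>\<^sub>F \<gamma> in at_right \<gamma>0. ereal \<rho> \<le> rho_min n1 n2 sp \<gamma>" by (simp add: frequently_def not_less)
      then have "ereal \<rho> \<le> L" unfolding L_def by (rule Liminf_bounded)
      then show False using \<rho>(1) by simp
    qed
    then have "\<forall>\<^sub>F \<gamma> in at_right \<gamma>0. rho_min n1 n2 sp \<gamma> \<le> ereal K" using \<rho>(2) by (intro pencil_filled[OF pos]) simp_all
    then have "Limsup (at_right \<gamma>0) (rho_min n1 n2 sp) \<le> ereal K" by (rule Limsup_bounded)
    then show "Limsup (at_right \<gamma>0) (rho_min n1 n2 sp) \<le> x" using K(2) by simp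
  qed
  moreover have "L \<le> Limsup (at_right \<gamma>0) (rho_min n1 n2 sp)" unfolding L_def by (rule Liminf_le_Limsup) simp
  ultimately have "(rho_min n1 n2 sp \<longlongrightarrow> L) (at_right \<gamma>0)"
    by (subst tendsto_iff_Liminf_eq_Limsup) (auto simp: L_def)
  moreover have "ereal (cmod \<kappa>0) < L" using m(1) mL by (meson ereal_less_eq(3) less_le_trans less_ereal.simps(1))
  ultimately show ?thesis by blast
qed

end

section \<open>Minimal decay and minimal modulus\<close>

theorem theorem9p4:
  fixes n1 n2 sp \<alpha>0 \<gamma>0 :: real and \<kappa>0 :: complex and \<rho>0 \<rho>1 :: ereal
  assumes n1_pos: "0 < n1" and n1_less_n2: "n1 < n2" and sp_pos: "0 < sp"
    and \<kappa>0: "\<kappa>0 = - (\<i> / of_real (2 * sp * n2)) * of_real (ln ((n2 + n1) / (n2 - n1)))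
                   + of_real (pi / (2 * sp * n2))"
    and \<gamma>0: "\<gamma>0 = Arg \<kappa>0"
    and \<alpha>0: "\<alpha>0 = pi / (2 * sp * n2)"
    and \<rho>0: "\<rho>0 = rho_min n1 n2 sp \<gamma>0"
    and \<rho>1: "\<rho>1 = (INF \<gamma>\<in>{\<gamma>0<..<0}. rho_min n1 n2 sp \<gamma> * ereal (cos \<gamma>) / ereal (cos \<gamma>0))"
  shows "(rho_min n1 n2 sp \<longlongrightarrow> \<rho>0) (at_left \<gamma>0) \<and> \<rho>0 = ereal (cmod \<kappa>0) \<and> ereal (cmod \<kappa>0) < \<rho>1 \<and>
    (\<exists>L. (rho_min n1 n2 sp \<longlongrightarrow> L) (at_right \<gamma>0) \<and> \<rho>0 < L) \<and>
    \<comment> \<open>(i)\<close>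
    (is_min_decay_eigenvalue n1 n2 sp \<alpha>0 \<kappa>0 \<and> is_min_modulus_eigenvalue n1 n2 sp \<gamma>0 \<kappa>0 \<and>
     (\<lambda>s. n2\<^sup>2) \<in> resonator_family n1 n2 sp \<and> generates_eigenvalue n1 sp (\<lambda>s. n2\<^sup>2) \<kappa>0 \<and>
     (\<forall>\<epsilon>\<in>resonator_family n1 n2 sp. generates_eigenvalue n1 sp \<epsilon> \<kappa>0 \<longrightarrow>
        (AE s in lebesgue_on {0<..<sp}. \<epsilon> s = n2\<^sup>2))) \<and>
    \<comment> \<open>(ii)\<close>
    (\<forall>\<rho>::real. \<forall>\<kappa>. \<rho>0 \<le> ereal \<rho> \<and> ereal \<rho> < \<rho>1 \<and> \<kappa> = of_real \<rho> * exp (\<i> * of_real \<gamma>0) \<longrightarrow>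
       is_min_decay_eigenvalue n1 n2 sp (\<rho> * cos \<gamma>0) \<kappa> \<and>
       (\<exists>T. T_min n1 n2 \<kappa> Infty (Fin (of_real n1)) = ereal T \<and> T \<le> sp \<and>
          (\<exists>\<epsilon>. is_min_time_control n1 n2 \<kappa> Infty (Fin (of_real n1)) \<epsilon>) \<and>
          (\<forall>\<epsilon>. is_min_time_control n1 n2 \<kappa> Infty (Fin (of_real n1)) \<epsilon> \<longrightarrow>
             is_min_decay_resonator n1 n2 sp (\<rho> * cos \<gamma>0) (\<lambda>s. if s < T then \<epsilon> s else n1\<^sup>2))))"
proof -
  interpret R: resonator n1 n2 sp by unfold_locales (rule n1_pos n1_less_n2 sp_pos)+
  have k0: "\<kappa>0 = R.\<kappa>0"
    unfolding \<kappa>0 R.\<kappa>0_def R.\<alpha>0_def R.\<beta>0_def R.L0_def by (simp add: complex_eq_iff)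
  have g0: "\<gamma>0 = R.\<gamma>0" unfolding \<gamma>0 R.\<gamma>0_def k0 ..
  have a0: "\<alpha>0 = R.\<alpha>0" unfolding \<alpha>0 R.\<alpha>0_def ..
  have r0: "\<rho>0 = ereal (cmod R.\<kappa>0)" unfolding \<rho>0 g0 by (rule R.rho_min_\<gamma>0)
  have "ereal (cmod R.\<kappa>0) < ereal (R.escape / cos R.\<gamma>0)" using R.cmod_\<kappa>0_less by simp
  also have "\<dots> \<le> \<rho>1" unfolding \<rho>1 g0 by (rule R.rho1_bound)
  finally have r1: "ereal (cmod R.\<kappa>0) < \<rho>1" .
  have ii: "is_min_decay_eigenvalue n1 n2 sp (\<rho> * cos R.\<gamma>0) \<kappa> \<and>
       (\<exists>T. T_min n1 n2 \<kappa> Infty (Fin (of_real n1)) = ereal T \<and> T \<le> sp \<and>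
          (\<exists>\<epsilon>. is_min_time_control n1 n2 \<kappa> Infty (Fin (of_real n1)) \<epsilon>) \<and>
          (\<forall>\<epsilon>. is_min_time_control n1 n2 \<kappa> Infty (Fin (of_real n1)) \<epsilon> \<longrightarrow>
             is_min_decay_resonator n1 n2 sp (\<rho> * cos R.\<gamma>0) (\<lambda>s. if s < T then \<epsilon> s else n1\<^sup>2)))"
    if "\<rho>0 \<le> ereal \<rho> \<and> ereal \<rho> < \<rho>1 \<and> \<kappa> = of_real \<rho> * exp (\<i> * of_real \<gamma>0)" for \<rho> \<kappa>
    using that unfolding r0 \<rho>1 g0 by (intro R.ray_resonators) blast+
  show ?thesis
    unfolding r0 k0 g0 a0
  proof (intro conjI allI impI)
    show "(rho_min n1 n2 sp \<longlongrightarrow> ereal (cmod R.\<kappa>0)) (at_left R.\<gamma>0)" by (rule R.rho_min_left_limit)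
    show "\<exists>L. (rho_min n1 n2 sp \<longlongrightarrow> L) (at_right R.\<gamma>0) \<and> ereal (cmod R.\<kappa>0) < L" by (rule R.rho_min_right_limit)
    show "is_min_decay_eigenvalue n1 n2 sp R.\<alpha>0 R.\<kappa>0" by (rule R.\<kappa>0_min_decay)
    show "is_min_modulus_eigenvalue n1 n2 sp R.\<gamma>0 R.\<kappa>0" by (rule R.\<kappa>0_min_modulus)
    show "\<forall>\<epsilon>\<in>resonator_family n1 n2 sp. generates_eigenvalue n1 sp \<epsilon> R.\<kappa>0 \<longrightarrow> (AE s in lebesgue_on {0<..<sp}. \<epsilon> s = n2\<^sup>2)"
      using R.\<kappa>0_unique by blast
  qed (use r1 ii r0 g0 R.\<kappa>0_eigenvalue in simp_all)
qed

end
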